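(* Let $f\in L^2(\Omega)$, let $u\in H_0^1(\Omega)$ be the solution of $(\nabla u,\nabla v)=(f,v)$ for all $v\in H_0^1(\Omega)$, and let $u_h\in V_h^c$ be the solution of $(\nabla u_h,\nabla v_h)=(f,v_h)$ for all $v_h\in V_h^c$. Then $$|u-u_h|_{H^1(\Omega)}\le \mathfrak E_h(f)\le M_h\|f\|_{L^2(\Omega)},$$ where $$\mathfrak E_h(f):=C_{0,h}\|f-\Pi_h^0f\|_{L^2(\Omega)}+\kappa_{M,h}\|\Pi_h^0f\|_{L^2(\Omega)},\qquad M_h:=\sqrt{C_{0,h}^2+\kappa_{M,h}^2}.$$ (No convexity of $\Omega$ and no global $H^2$-regularity are assumed.)
   Context: Let $d\in\{2,3\}$, let $\Omega\subset\mathbb R^d$ be a bounded polyhedral Lipschitz domain, and let $\mathbb T_h$ be a finite conforming triangulation of $\overline\Omega$ into non-degenerate closed $d$-simplices (the intersection of two distinct elements is empty or a common subsimplex); no shape regularity is assumed. $(\cdot,\cdot)$ is the $L^2(\Omega)$ inner product (scalar or vector valued), $|v|_{H^1(\Omega)}:=\|\nabla v\|_{L^2(\Omega)^d}$, and $\nabla_h$ is the elementwise (broken) gradient. $X_h$ is the space of functions constant on each $T\in\mathbb T_h$, and $\Pi_h^0:L^2(\Omega)\to X_h$ is the $L^2$-orthogonal projection (elementwise mean). $V_h^c:=\{v\in H_0^1(\Omega): v|_T \text{ affine } \forall T\in\mathbb T_h\}$. The Crouzeix--Raviart space $V_{h,0}^{\mathrm{CR}}$ consists of the elementwise affine functions $v$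 such that $\int_F[\![v]\!]\,ds=0$ for all faces $F$, where $[\![v]\!]$ is the jump across an interior face and the trace of $v$ on a boundary face. For $g_h\in X_h$: $z_h^c(g_h)\in V_h^c$ is the unique solution of $(\nabla z_h^c(g_h),\nabla v_h)=(g_h,v_h)$ for all $v_h\in V_h^c$; $z_h^{\mathrm{CR}}(g_h)\in V_{h,0}^{\mathrm{CR}}$ is the unique solution of $(\nabla_h z_h^{\mathrm{CR}}(g_h),\nabla_h v_h)=(g_h,v_h)$ for all $v_h\in V_{h,0}^{\mathrm{CR}}$; the Marini flux is $\bm\sigma_h^M(g_h)|_T:=\nabla_h z_h^{\mathrm{CR}}(g_h)|_T-\frac{g_h|_T}{d}(\bm x-\bm x_T)$, with $\bm x_T$ the barycentre of $T$; and $$\kappa_{M,h}:=\sup_{0\ne g_h\in X_h}\frac{\|\bm\sigma_h^M(g_h)-\nabla z_h^c(g_h)\|_{L^2(\Omega)^d}}{\|g_h\|_{L^2(\Omega)}}.$$ The optimal Poincaré constants are $C_0(T):=\sup\{\|v\|_{L^2(T)}/\|\nabla v\|_{L^2(T)^d}: 0\ne v\in H^1(T),\ \int_Tv\,dx=0\}$ and $C_{0,h}:=\max_{T\in\mathbb T_h}C_0(T)$. *)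

theory Defs
  imports "HOL-Analysis.Analysis"
begin

section \<open>Domains and triangulations\<close>

text \<open>Near each boundary point, \<open>\<Omega>\<close> lies strictly above a Lipschitz graph over the hyperplane
  orthogonal to a unit vector \<open>n\<close>; only the values of \<open>\<gamma>\<close> on that hyperplane matter.\<close>

definition lipschitz_boundary :: "'a::euclidean_space set \<Rightarrow> bool" where
  "lipschitz_boundary \<Omega> \<longleftrightarrow>
     (\<forall>x \<in> frontier \<Omega>. \<exists>r > 0. \<exists>n. norm n = 1 \<and>
        (\<exists>(\<gamma> :: 'a \<Rightarrow> real) L. L-lipschitz_on UNIV \<gamma> \<and>
           (\<forall>y \<in> ball x r. y \<in> \<Omega> \<longleftrightarrow> y \<bullet> n > \<gamma> (y - (y \<bullet> n) *\<^sub>R n))))"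

definition polyhedral_boundary :: "'a::euclidean_space set \<Rightarrow> bool" where
  "polyhedral_boundary \<Omega> \<longleftrightarrow>
     (\<exists>\<P>. finite \<P> \<and> (\<forall>P \<in> \<P>. polytope P \<and> aff_dim P = int DIM('a) - 1) \<and> frontier \<Omega> = \<Union>\<P>)"

definition polyhedral_lipschitz_domain :: "'a::euclidean_space set \<Rightarrow> bool" where
  "polyhedral_lipschitz_domain \<Omega> \<longleftrightarrow>
     open \<Omega> \<and> connected \<Omega> \<and> \<Omega> \<noteq> {} \<and> bounded \<Omega> \<and> polyhedral_boundary \<Omega> \<and> lipschitz_boundary \<Omega>"

definition conforming_triangulation :: "'a::euclidean_space set \<Rightarrow> 'a set set \<Rightarrow> bool" where
  "conforming_triangulation \<Omega> \<T> \<longleftrightarrow>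
     triangulation \<T> \<and> (\<forall>T \<in> \<T>. int DIM('a) simplex T) \<and> \<Union>\<T> = closure \<Omega>"

definition barycentre :: "'a::euclidean_space set \<Rightarrow> 'a" where
  "barycentre T = (\<Sum>p | p extreme_point_of T. p) /\<^sub>R real (DIM('a) + 1)"

section \<open>Lebesgue and Sobolev spaces\<close>

text \<open>Elements of function spaces are represented by functions on the whole space; only their
  values on \<open>\<Omega>\<close>, up to null sets, are relevant.\<close>

definition L2 :: "'a::euclidean_space set \<Rightarrow> ('a \<Rightarrow> 'b::euclidean_space) set" where
  "L2 \<Omega> = {f. f \<in> borel_measurable (lebesgue_on \<Omega>) \<and>
              integrable (lebesgue_on \<Omega>) (\<lambda>x. (norm (f x))\<^sup>2)}"

definition l2_inner ::
    "'a::euclidean_space set \<Rightarrow> ('a \<Rightarrow> 'b::euclidean_space) \<Rightarrow> ('a \<Rightarrow> 'b) \<Rightarrow> real" where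
  "l2_inner \<Omega> f g = (LINT x|lebesgue_on \<Omega>. f x \<bullet> g x)"

definition l2_norm :: "'a::euclidean_space set \<Rightarrow> ('a \<Rightarrow> 'b::euclidean_space) \<Rightarrow> real" where
  "l2_norm \<Omega> f = sqrt (l2_inner \<Omega> f f)"

text \<open>The classical gradient, meaningful where \<open>f\<close> is differentiable.\<close>

definition grad :: "('a::euclidean_space \<Rightarrow> real) \<Rightarrow> 'a \<Rightarrow> 'a" where
  "grad f x = (\<Sum>i \<in> Basis. frechet_derivative f (at x) i *\<^sub>R i)"

primrec times_cont_diff :: "nat \<Rightarrow> ('a::euclidean_space \<Rightarrow> real) \<Rightarrow> bool" where
  "times_cont_diff 0 f \<longleftrightarrow> continuous_on UNIV f"
| "times_cont_diff (Suc k) f \<longleftrightarrow>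
     (\<forall>x. f differentiable (at x)) \<and>
     (\<forall>i \<in> Basis. times_cont_diff k (\<lambda>x. frechet_derivative f (at x) i))"

definition test_functions :: "'a::euclidean_space set \<Rightarrow> ('a \<Rightarrow> real) set" where
  "test_functions \<Omega> = {\<phi>. (\<forall>k. times_cont_diff k \<phi>) \<and>
     compact (closure {x. \<phi> x \<noteq> 0}) \<and> closure {x. \<phi> x \<noteq> 0} \<subseteq> \<Omega>}"

definition is_weak_grad ::
    "'a::euclidean_space set \<Rightarrow> ('a \<Rightarrow> real) \<Rightarrow> ('a \<Rightarrow> 'a) \<Rightarrow> bool" where
  "is_weak_grad \<Omega> v G \<longleftrightarrow> G \<in> L2 \<Omega> \<and>
     (\<forall>\<phi> \<in> test_functions \<Omega>.
        (LINT x|lebesgue_on \<Omega>. v x *\<^sub>R grad \<phi> x) = - (LINT x|lebesgue_on \<Omega>. \<phi> x *\<^sub>R G x))"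

text \<open>The weak gradient is unique up to null sets; \<open>weak_grad\<close> picks a representative.\<close>

definition weak_grad :: "'a::euclidean_space set \<Rightarrow> ('a \<Rightarrow> real) \<Rightarrow> 'a \<Rightarrow> 'a" where
  "weak_grad \<Omega> v = (SOME G. is_weak_grad \<Omega> v G)"

definition H1 :: "'a::euclidean_space set \<Rightarrow> ('a \<Rightarrow> real) set" where
  "H1 \<Omega> = {v \<in> L2 \<Omega>. \<exists>G. is_weak_grad \<Omega> v G}"

definition H1_seminorm :: "'a::euclidean_space set \<Rightarrow> ('a \<Rightarrow> real) \<Rightarrow> real" where
  "H1_seminorm \<Omega> v = l2_norm \<Omega> (weak_grad \<Omega> v)"

definition H1_norm :: "'a::euclidean_space set \<Rightarrow> ('a \<Rightarrow> real) \<Rightarrow> real" where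
  "H1_norm \<Omega> v = sqrt ((l2_norm \<Omega> v)\<^sup>2 + (H1_seminorm \<Omega> v)\<^sup>2)"

definition H01 :: "'a::euclidean_space set \<Rightarrow> ('a \<Rightarrow> real) set" where
  "H01 \<Omega> = {v \<in> H1 \<Omega>. \<forall>\<epsilon> > 0. \<exists>\<phi> \<in> test_functions \<Omega>. H1_norm \<Omega> (\<lambda>x. v x - \<phi> x) < \<epsilon>}"

text \<open>A weak solution of the Poisson problem in a subspace \<open>V\<close> of \<open>H\<^sup>1\<^sub>0(\<Omega>)\<close>: the exact solution
  for \<open>V = H\<^sup>1\<^sub>0(\<Omega>)\<close>, the Galerkin solution for a discrete \<open>V\<close>.\<close>

definition poisson_solution ::
    "'a::euclidean_space set \<Rightarrow> ('a \<Rightarrow> real) set \<Rightarrow> ('a \<Rightarrow> real) \<Rightarrow> ('a \<Rightarrow> real) \<Rightarrow> bool" where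
  "poisson_solution \<Omega> V f u \<longleftrightarrow> u \<in> V \<and>
     (\<forall>v \<in> V. l2_inner \<Omega> (weak_grad \<Omega> u) (weak_grad \<Omega> v) = l2_inner \<Omega> f v)"

section \<open>Discrete spaces\<close>

text \<open>Elementwise conditions are imposed on the interiors of the (closed) elements, so that
  discontinuous functions may be described by single-valued ones: their values on the skeleton,
  a null set, are arbitrary.\<close>

definition piecewise_constant :: "'a::euclidean_space set set \<Rightarrow> ('a \<Rightarrow> real) set" where
  "piecewise_constant \<T> = {g. \<forall>T \<in> \<T>. g constant_on interior T}"

definition piecewise_affine :: "'a::euclidean_space set set \<Rightarrow> ('a \<Rightarrow> real) set" where
  "piecewise_affine \<T> = {v. \<forall>T \<in> \<T>. \<exists>a b. \<forall>x \<in> interior T. v x = a \<bullet> x + b}"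

definition l2_proj ::
    "'a::euclidean_space set \<Rightarrow> 'a set set \<Rightarrow> ('a \<Rightarrow> real) \<Rightarrow> 'a \<Rightarrow> real" where
  "l2_proj \<Omega> \<T> f = (SOME p. p \<in> piecewise_constant \<T> \<and>
     (\<forall>q \<in> piecewise_constant \<T>. l2_inner \<Omega> (\<lambda>x. f x - p x) q = 0))"

definition conforming_space :: "'a::euclidean_space set \<Rightarrow> 'a set set \<Rightarrow> ('a \<Rightarrow> real) set" where
  "conforming_space \<Omega> \<T> = H01 \<Omega> \<inter> piecewise_affine \<T>"

definition broken_grad :: "'a::euclidean_space set set \<Rightarrow> ('a \<Rightarrow> real) \<Rightarrow> 'a \<Rightarrow> 'a" where
  "broken_grad \<T> v x = (if x \<in> (\<Union>T \<in> \<T>. interior T) then grad v x else 0)"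

text \<open>Surface measure on a facet \<open>F\<close>: the measure of a subset is the Lebesgue measure of the right
  prism of height one over it. The choice between the two unit normals is immaterial.\<close>

definition unit_normal :: "'a::euclidean_space set \<Rightarrow> 'a" where
  "unit_normal F = (SOME n. norm n = 1 \<and> (\<forall>x \<in> F. \<forall>y \<in> F. n \<bullet> (x - y) = 0))"

definition prism :: "'a::euclidean_space set \<Rightarrow> 'a set" where
  "prism F = {x + t *\<^sub>R unit_normal F | x t. x \<in> F \<and> t \<in> {0..1}}"

definition facet_measure :: "'a::euclidean_space set \<Rightarrow> 'a measure" where
  "facet_measure F = distr (lebesgue_on (prism F)) borel (closest_point (affine hull F))"

text \<open>The trace on \<open>\<partial>T\<close> of the restriction of \<open>v\<close> to \<open>T\<close>, as its continuous extension.\<close>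

definition trace :: "'a::euclidean_space set \<Rightarrow> ('a \<Rightarrow> real) \<Rightarrow> 'a \<Rightarrow> real" where
  "trace T v x = Lim (at x within interior T) v"

definition crouzeix_raviart :: "'a::euclidean_space set \<Rightarrow> 'a set set \<Rightarrow> ('a \<Rightarrow> real) set" where
  "crouzeix_raviart \<Omega> \<T> = {v \<in> piecewise_affine \<T>.
     (\<forall>T \<in> \<T>. \<forall>T' \<in> \<T>. \<forall>F. T \<noteq> T' \<and> F facet_of T \<and> F facet_of T' \<longrightarrow>
        (LINT x:F|facet_measure F. trace T v x - trace T' v x) = 0) \<and>
     (\<forall>T \<in> \<T>. \<forall>F. F facet_of T \<and> F \<subseteq> frontier \<Omega> \<longrightarrow>
        (LINT x:F|facet_measure F. trace T v x) = 0)}"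

section \<open>Discrete solutions, Marini flux and constants\<close>

text \<open>The discrete solutions are unique as elements of \<open>L\<^sup>2(\<Omega>)\<close>; representatives are chosen.\<close>

definition z_c :: "'a::euclidean_space set \<Rightarrow> 'a set set \<Rightarrow> ('a \<Rightarrow> real) \<Rightarrow> 'a \<Rightarrow> real" where
  "z_c \<Omega> \<T> g = (SOME z. poisson_solution \<Omega> (conforming_space \<Omega> \<T>) g z)"

definition z_CR :: "'a::euclidean_space set \<Rightarrow> 'a set set \<Rightarrow> ('a \<Rightarrow> real) \<Rightarrow> 'a \<Rightarrow> real" where
  "z_CR \<Omega> \<T> g = (SOME z. z \<in> crouzeix_raviart \<Omega> \<T> \<and>
     (\<forall>v \<in> crouzeix_raviart \<Omega> \<T>.
        l2_inner \<Omega> (broken_grad \<T> z) (broken_grad \<T> v) = l2_inner \<Omega> g v))"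

definition marini_flux ::
    "'a::euclidean_space set \<Rightarrow> 'a set set \<Rightarrow> ('a \<Rightarrow> real) \<Rightarrow> 'a \<Rightarrow> 'a" where
  "marini_flux \<Omega> \<T> g x = broken_grad \<T> (z_CR \<Omega> \<T> g) x
     - (\<Sum>T \<in> \<T>. indicator (interior T) x *\<^sub>R ((g x / real DIM('a)) *\<^sub>R (x - barycentre T)))"

definition kappa_M :: "'a::euclidean_space set \<Rightarrow> 'a set set \<Rightarrow> real" where
  "kappa_M \<Omega> \<T> =
     Sup {l2_norm \<Omega> (\<lambda>x. marini_flux \<Omega> \<T> g x - weak_grad \<Omega> (z_c \<Omega> \<T> g) x) / l2_norm \<Omega> g | g.
            g \<in> piecewise_constant \<T> \<and> l2_norm \<Omega> g \<noteq> 0}"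

definition poincare_const :: "'a::euclidean_space set \<Rightarrow> real" where
  "poincare_const T =
     Sup {l2_norm (interior T) v / l2_norm (interior T) (weak_grad (interior T) v) | v.
            v \<in> H1 (interior T) \<and> l2_norm (interior T) v \<noteq> 0 \<and>
            (LINT x|lebesgue_on (interior T). v x) = 0}"

definition max_poincare_const :: "'a::euclidean_space set set \<Rightarrow> real" where
  "max_poincare_const \<T> = Max (poincare_const ` \<T>)"

definition error_bound :: "'a::euclidean_space set \<Rightarrow> 'a set set \<Rightarrow> ('a \<Rightarrow> real) \<Rightarrow> real" where
  "error_bound \<Omega> \<T> f =
     max_poincare_const \<T> * l2_norm \<Omega> (\<lambda>x. f x - l2_proj \<Omega> \<T> f x)
     + kappa_M \<Omega> \<T> * l2_norm \<Omega> (l2_proj \<Omega> \<T> f)"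

definition error_const :: "'a::euclidean_space set \<Rightarrow> 'a set set \<Rightarrow> real" where
  "error_const \<Omega> \<T> = sqrt ((max_poincare_const \<T>)\<^sup>2 + (kappa_M \<Omega> \<T>)\<^sup>2)"

end

theory Submission
  imports Defs
begin

text \<open>Write \<open>p\<close> for the projection of \<open>f\<close>, \<open>z\<close> for the conforming solution with data \<open>p\<close>, \<open>\<sigma>\<close> for the
  Marini flux of \<open>p\<close>, and \<open>w = u - z\<close>. By Galerkin orthogonality \<open>|u - u\<^sub>h| \<le> |w|\<close>. Since \<open>div \<sigma> = - p\<close>,
  \<open>|w|\<^sup>2 = (f - p, w) + (\<sigma> - \<nabla>z, \<nabla>w)\<close>; in the first term \<open>w\<close> may be replaced by \<open>w\<close> minus its
  elementwise means, so that the two terms are bounded by means of the Poincare constants and of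
  \<open>kappa_M\<close>.

  These constants are real suprema, so their finiteness is part of the proof. The Poincare
  inequality on a convex set \<open>K\<close> follows by integrating over \<open>h\<close> the bound of
  \<open>v (x + h) - v x\<close> in \<open>L\<^sup>2(K \<inter> (K - h))\<close> by \<open>|h|\<close> times the norm of \<open>\<nabla>v\<close>, which is dual to the definition of
  the weak gradient. For \<open>kappa_M\<close> one uses that the data are combinations of finitely many
  indicator functions. The identity \<open>(\<sigma>, \<nabla>w) = (p, w)\<close> is obtained from the nonconforming
  interpolant of a test function \<open>w\<close>; its facet means are written as volume integrals over cones, so
  that the divergence theorem is needed only for cones, where it follows by scaling.\<close>

section \<open>Smooth functions and test functions\<close>

text \<open>Projection, discrete solutions and weak gradients are picked by \<open>SOME\<close>, so
  existence is needed before anything can be said of them. For the two discrete problems it amounts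
  to the load vanishing on the kernel of the energy form. In the conforming space Friedrichs'
  inequality shows this. For Crouzeix-Raviart functions a vanishing broken gradient leaves one
  constant per element, and the facet conditions make these constants zero only if every element is
  linked to the boundary through facets. This is why a geometric argument about arbitrary conforming
  triangulations appears. The Lipschitz condition enters by excluding slits: it keeps the open
  elements inside \<open>\<Omega>\<close>, so that weak gradients can be restricted to them.\<close>

lemma times_cont_diff_continuous: "times_cont_diff k f \<Longrightarrow> continuous_on UNIV f"
  by (cases k) (auto intro!: differentiable_imp_continuous_on simp: differentiable_on_def intro: differentiable_at_withinI)

lemma times_cont_diff_SucD: "times_cont_diff (Suc k) f \<Longrightarrow> times_cont_diff k f"
proof (induction k arbitrary: f)
  case 0
  then show ?case using times_cont_diff_continuous[OF 0] by simp
next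
  case (Suc k)
  then show ?case by (metis times_cont_diff.simps(2))
qed

text \<open>Frees the inductions on the order from \<open>frechet_derivative\<close>: any derivative
  found by the calculus rules will do.\<close>

lemma times_cont_diff_SucI:
  assumes "\<And>x. (f has_derivative f' x) (at x)" "\<And>i. i \<in> Basis \<Longrightarrow> times_cont_diff k (\<lambda>x. f' x i)"
  shows "times_cont_diff (Suc k) f"
proof -
  have "frechet_derivative f (at x) = f' x" for x
    using assms(1) frechet_derivative_at by metis
  then show ?thesis using assms by (auto simp: differentiable_def)
qed

lemma times_cont_diff_Suc_derivative:
  "times_cont_diff (Suc k) f \<Longrightarrow> (f has_derivative frechet_derivative f (at x)) (at x)"
  by (auto simp: frechet_derivative_works)

lemma times_cont_diff_const [simp]: "times_cont_diff k (\<lambda>x. c)"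
proof (induction k arbitrary: c)
  case (Suc k)
  show ?case by (rule times_cont_diff_SucI[where f'="\<lambda>x h. 0"]) (auto simp: Suc)
qed auto

lemma times_cont_diff_add:
  "times_cont_diff k f \<Longrightarrow> times_cont_diff k g \<Longrightarrow> times_cont_diff k (\<lambda>x. f x + g x)"
proof (induction k arbitrary: f g)
  case 0 then show ?case by (auto intro: continuous_intros)
next
  case (Suc k)
  show ?case
    by (rule times_cont_diff_SucI[where f'="\<lambda>x h. frechet_derivative f (at x) h + frechet_derivative g (at x) h"])
       (use Suc in \<open>auto intro!: has_derivative_add simp: frechet_derivative_works[symmetric]\<close>)
qed

lemma times_cont_diff_mult:
  "times_cont_diff k f \<Longrightarrow> times_cont_diff k g \<Longrightarrow> times_cont_diff k (\<lambda>x. f x * g x)"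
proof (induction k arbitrary: f g)
  case 0 then show ?case by (auto intro: continuous_intros)
next
  case (Suc k)
  show ?case
    by (rule times_cont_diff_SucI[where f'="\<lambda>x h. f x * frechet_derivative g (at x) h + frechet_derivative f (at x) h * g x"])
       (use Suc Suc(2,3)[THEN times_cont_diff_SucD] in
        \<open>auto intro!: has_derivative_mult times_cont_diff_add simp: frechet_derivative_works[symmetric]\<close>)
qed

lemma times_cont_diff_cmult: "times_cont_diff k f \<Longrightarrow> times_cont_diff k (\<lambda>x. c * f x)"
  by (intro times_cont_diff_mult) auto

lemma times_cont_diff_diff:
  "times_cont_diff k f \<Longrightarrow> times_cont_diff k g \<Longrightarrow> times_cont_diff k (\<lambda>x. f x - g x)"
  using times_cont_diff_add[of k f "\<lambda>x. -1 * g x"] times_cont_diff_cmult[of k g "-1"] by simp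

lemma times_cont_diff_sum:
  "(\<And>i. i \<in> I \<Longrightarrow> times_cont_diff k (f i)) \<Longrightarrow> times_cont_diff k (\<lambda>x. \<Sum>i\<in>I. f i x)"
  by (induction I rule: infinite_finite_induct) (auto intro: times_cont_diff_add)

lemma times_cont_diff_prod:
  "(\<And>i. i \<in> I \<Longrightarrow> times_cont_diff k (f i)) \<Longrightarrow> times_cont_diff k (\<lambda>x. \<Prod>i\<in>I. f i x)"
  by (induction I rule: infinite_finite_induct) (auto intro: times_cont_diff_mult)

lemma times_cont_diff_bounded_linear: "bounded_linear f \<Longrightarrow> times_cont_diff k f"
proof (cases k)
  case 0 then show "bounded_linear f \<Longrightarrow> ?thesis" by (simp add: linear_continuous_on)
next
  case (Suc n)
  assume "bounded_linear f"
  then have "times_cont_diff (Suc n) f"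
    by (intro times_cont_diff_SucI[where f'="\<lambda>x. f"]) (auto intro: bounded_linear_imp_has_derivative)
  then show ?thesis by (simp add: Suc)
qed

text \<open>The outer function comes with all its derivatives as a sequence \<open>h\<close>, and
  the claim is made for every \<open>n\<close>. The chain rule then leads from \<open>h n\<close> to
  \<open>h (Suc n)\<close>, where the induction hypothesis applies.\<close>

lemma times_cont_diff_real_compose:
  assumes "\<And>n t. (h n has_real_derivative h (Suc n) t) (at t)" "times_cont_diff k f"
  shows "times_cont_diff k (\<lambda>x. h n (f x))"
  using assms(2)
proof (induction k arbitrary: f n)
  case 0
  have "continuous_on UNIV (h n)"
    using assms(1) by (meson DERIV_continuous continuous_at_imp_continuous_on)
  with 0 show ?case using continuous_on_compose2[of UNIV "h n" UNIV f] by auto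
next
  case (Suc k)
  show ?case
  proof (rule times_cont_diff_SucI)
    fix x
    show "((\<lambda>x. h n (f x)) has_derivative (\<lambda>v. h (Suc n) (f x) * frechet_derivative f (at x) v)) (at x)"
      using has_derivative_compose[OF times_cont_diff_Suc_derivative[OF Suc.prems] assms(1)[unfolded has_field_derivative_def]]
      by simp
  next
    fix i :: 'a assume "i \<in> Basis"
    then show "times_cont_diff k (\<lambda>x. h (Suc n) (f x) * frechet_derivative f (at x) i)"
      using Suc.prems by (intro times_cont_diff_mult Suc.IH times_cont_diff_SucD[OF Suc.prems]) auto
  qed
qed

lemma times_cont_diff_affine_compose:
  assumes L: "linear L" and f: "times_cont_diff k f"
  shows "times_cont_diff k (\<lambda>x. f (L x + b))"
  using f
proof (induction k arbitrary: f)
  case 0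
  have "continuous_on UNIV (\<lambda>x. L x + b)"
    using L by (intro continuous_intros linear_continuous_on) (simp add: linear_conv_bounded_linear)
  with 0 show ?case using continuous_on_compose2[of UNIV f UNIV] by auto
next
  case (Suc k)
  let ?D = "\<lambda>x. frechet_derivative f (at x)"
  have D: "(f has_derivative ?D x) (at x)" for x
    by (rule times_cont_diff_Suc_derivative[OF Suc.prems])
  have lin: "linear (?D x)" for x using D has_derivative_linear by blast
  show ?case
  proof (rule times_cont_diff_SucI)
    fix x
    have "((\<lambda>x. L x + b) has_derivative L) (at x)"
      using L by (auto intro!: derivative_eq_intros bounded_linear_imp_has_derivative simp: linear_conv_bounded_linear)
    from has_derivative_compose[OF this D]
    show "((\<lambda>x. f (L x + b)) has_derivative (\<lambda>v. ?D (L x + b) (L v))) (at x)" .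
  next
    fix i :: 'a assume "i \<in> Basis"
    \<comment> \<open>The induction hypothesis covers derivatives in basis directions only, so the
      direction \<open>L i\<close> is expanded in the basis.\<close>
    have "?D (L x + b) (L i) = (\<Sum>j\<in>Basis. (L i \<bullet> j) * ?D (L x + b) j)" for x
    proof -
      have "?D (L x + b) (L i) = ?D (L x + b) (\<Sum>j\<in>Basis. (L i \<bullet> j) *\<^sub>R j)"
        by (simp add: euclidean_representation)
      then show ?thesis by (simp add: linear_sum[OF lin] linear_scale[OF lin])
    qed
    moreover have "times_cont_diff k (\<lambda>x. \<Sum>j\<in>Basis. (L i \<bullet> j) * ?D (L x + b) j)"
      using Suc.prems by (intro times_cont_diff_sum times_cont_diff_cmult Suc.IH) auto
    ultimately show "times_cont_diff k (\<lambda>x. ?D (L x + b) (L i))" by simp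
  qed
qed

text \<open>The functions \<open>t \<mapsto> p (1/t) exp (-1/t)\<close>, \<open>p\<close> a polynomial, extended by zero to \<open>t \<le> 0\<close>,
  are closed under differentiation.\<close>

definition flat_exp :: "real poly \<Rightarrow> real \<Rightarrow> real" where
  "flat_exp p t = (if t > 0 then poly p (1/t) * exp (- (1/t)) else 0)"

lemma poly_exp_tendsto_0: "((\<lambda>y::real. poly q y * exp (- y)) \<longlongrightarrow> 0) at_top"
proof -
  have "((\<lambda>y::real. \<Sum>i\<le>degree q. coeff q i * (y ^ i / exp y)) \<longlongrightarrow> (\<Sum>i\<le>degree q. coeff q i * 0)) at_top"
    by (intro tendsto_sum tendsto_mult tendsto_const tendsto_power_div_exp_0)
  then show ?thesis
    by (simp add: poly_altdef sum_distrib_right exp_minus divide_inverse mult.assoc)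
qed

text \<open>With s = 1/t the derivative of p(s) exp(-s) is s^2 (p(s) - p'(s)) exp(-s), which is
  where the factor \<open>[:0,0,1:]\<close> comes from. At t = 0 the exponential decay beats every
  polynomial.\<close>

lemma flat_exp_deriv:
  "(flat_exp p has_real_derivative flat_exp ([:0,0,1:] * (p - pderiv p)) t) (at t)"
proof (cases t "0::real" rule: linorder_cases)
  case greater
  have i: "((\<lambda>t. 1/t) has_real_derivative - (1 / t\<^sup>2)) (at t)"
    using greater by (auto intro!: derivative_eq_intros simp: power2_eq_square)
  have "((\<lambda>t. poly p (1/t)) has_real_derivative poly (pderiv p) (1/t) * - (1 / t\<^sup>2)) (at t)"
    by (rule DERIV_chain2[OF poly_DERIV i])
  moreover have "((\<lambda>t. exp (- (1/t))) has_real_derivative exp (- (1/t)) * - (- (1 / t\<^sup>2))) (at t)"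
    by (rule DERIV_chain2[OF DERIV_exp DERIV_minus[OF i]])
  ultimately have "((\<lambda>t. poly p (1/t) * exp (- (1/t))) has_real_derivative
      poly (pderiv p) (1/t) * - (1 / t\<^sup>2) * exp (- (1/t)) + exp (- (1/t)) * - (- (1 / t\<^sup>2)) * poly p (1/t)) (at t)"
    by (rule DERIV_mult)
  also have "poly (pderiv p) (1/t) * - (1 / t\<^sup>2) * exp (- (1/t)) + exp (- (1/t)) * - (- (1 / t\<^sup>2)) * poly p (1/t)
      = flat_exp ([:0,0,1:] * (p - pderiv p)) t"
    using greater by (simp add: flat_exp_def algebra_simps power2_eq_square)
  finally show ?thesis
    by (rule has_field_derivative_transform_within_open[of _ _ _ "{0<..}"]) (use greater in \<open>auto simp: flat_exp_def\<close>)
next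
  case less
  have "((\<lambda>t. 0) has_real_derivative 0) (at t)" by simp
  then have "(flat_exp p has_real_derivative 0) (at t)"
    by (rule has_field_derivative_transform_within_open[of _ _ _ "{..<0}"]) (use less in \<open>auto simp: flat_exp_def\<close>)
  with less show ?thesis by (simp add: flat_exp_def)
next
  case equal
  have right: "((\<lambda>h. flat_exp p h / h) \<longlongrightarrow> 0) (at_right 0)"
  proof -
    \<comment> \<open>Dividing by h multiplies the polynomial by its variable 1/h, hence
      \<open>pCons 0 p\<close>.\<close>
    have "((\<lambda>h::real. poly (pCons 0 p) (inverse h) * exp (- inverse h)) \<longlongrightarrow> 0) (at_right 0)"
      by (rule filterlim_compose[OF poly_exp_tendsto_0 filterlim_inverse_at_top_right])
    then show ?thesis
      by (rule Lim_transform_eventually) (auto simp: eventually_at_filter flat_exp_def field_simps)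
  qed
  have left: "((\<lambda>h. flat_exp p h / h) \<longlongrightarrow> 0) (at_left 0)"
    by (rule Lim_transform_eventually[OF tendsto_const]) (auto simp: eventually_at_filter flat_exp_def)
  have "((\<lambda>h. flat_exp p h / h) \<longlongrightarrow> 0) (at 0)" using left right by (simp add: filterlim_split_at)
  then have "(flat_exp p has_real_derivative 0) (at 0)"
    by (simp add: DERIV_def flat_exp_def)
  with equal show ?thesis by (simp add: flat_exp_def)
qed

text \<open>This is exp(-1/t) for t > 0 and 0 otherwise: smooth, between 0 and 1, and tending to 1
  only at infinity.\<close>

definition smooth_step :: "real \<Rightarrow> real" where "smooth_step = flat_exp 1"

lemma smooth_step_bounds: "0 \<le> smooth_step t" "smooth_step t \<le> 1"
  and smooth_step_eq_0: "t \<le> 0 \<Longrightarrow> smooth_step t = 0"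
  by (auto simp: smooth_step_def flat_exp_def)

lemma smooth_step_tendsto_1: "(smooth_step \<longlongrightarrow> 1) at_top"
proof -
  have "((\<lambda>t::real. exp (- inverse t)) \<longlongrightarrow> exp (- 0)) at_top"
    by (intro tendsto_intros tendsto_inverse_0_at_top filterlim_ident)
  then have "((\<lambda>t::real. exp (- inverse t)) \<longlongrightarrow> 1) at_top" by simp
  then show ?thesis
    by (rule Lim_transform_eventually)
       (rule eventually_mono[OF eventually_gt_at_top[of "0::real"]], simp add: smooth_step_def flat_exp_def divide_inverse)
qed

lemma times_cont_diff_smooth_step:
  assumes "times_cont_diff k f" shows "times_cont_diff k (\<lambda>x. smooth_step (f x))"
proof -
  define h where "h n = flat_exp (((\<lambda>p. [:0,0,1:] * (p - pderiv p)) ^^ n) 1)" for n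
  have "(h n has_real_derivative h (Suc n) t) (at t)" for n t
    unfolding h_def funpow.simps comp_def by (rule flat_exp_deriv)
  then have "times_cont_diff k (\<lambda>x. h 0 (f x))"
    by (rule times_cont_diff_real_compose[OF _ assms])
  then show ?thesis by (simp add: h_def smooth_step_def)
qed

section \<open>Closure properties of test functions\<close>

lemma test_functionI:
  assumes "\<And>k. times_cont_diff k f" "compact K" "K \<subseteq> U" "\<And>x. f x \<noteq> 0 \<Longrightarrow> x \<in> K"
  shows "f \<in> test_functions U"
proof -
  have "closure {x. f x \<noteq> 0} \<subseteq> K"
    using assms by (intro closure_minimal) (auto intro: compact_imp_closed)
  moreover from this have "compact (closure {x. f x \<noteq> 0})"
    using assms(2) by (metis closed_closure compact_Int_closed inf.absorb_iff2 inf.commute)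
  ultimately show ?thesis using assms by (auto simp: test_functions_def)
qed

lemma test_function_smooth: "f \<in> test_functions U \<Longrightarrow> times_cont_diff k f"
  by (simp add: test_functions_def)

lemma test_function_support:
  assumes "f \<in> test_functions U"
  obtains K where "compact K" "K \<subseteq> U" "\<And>x. x \<notin> K \<Longrightarrow> f x = 0"
proof (rule that)
  show "compact (closure {x. f x \<noteq> 0})" "closure {x. f x \<noteq> 0} \<subseteq> U"
    using assms by (auto simp: test_functions_def)
  show "f x = 0" if "x \<notin> closure {x. f x \<noteq> 0}" for x
    using that closure_subset[of "{x. f x \<noteq> 0}"] by blast
qed

lemma test_function_zero_outside: "f \<in> test_functions U \<Longrightarrow> x \<notin> U \<Longrightarrow> f x = 0"
  by (meson subsetD test_function_support)

lemma test_function_mono: "f \<in> test_functions U \<Longrightarrow> U \<subseteq> V \<Longrightarrow> f \<in> test_functions V"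
  by (auto simp: test_functions_def)

lemma test_function_zero [simp]: "(\<lambda>x. 0) \<in> test_functions U"
  by (rule test_functionI[of _ "{}"]) auto

lemma test_function_add:
  assumes "f \<in> test_functions U" "g \<in> test_functions U"
  shows "(\<lambda>x. f x + g x) \<in> test_functions U"
proof -
  obtain K where K: "compact K" "K \<subseteq> U" "\<And>x. x \<notin> K \<Longrightarrow> f x = 0"
    using test_function_support[OF assms(1)] by blast
  obtain K' where K': "compact K'" "K' \<subseteq> U" "\<And>x. x \<notin> K' \<Longrightarrow> g x = 0"
    using test_function_support[OF assms(2)] by blast
  show ?thesis
  proof (rule test_functionI[of _ "K \<union> K'"])
    show "x \<in> K \<union> K'" if "f x + g x \<noteq> 0" for x using that K(3)[of x] K'(3)[of x] by (cases "x \<in> K") auto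
  qed (use K K' in \<open>auto intro!: times_cont_diff_add assms[THEN test_function_smooth]\<close>)
qed

lemma test_function_mult_smooth:
  assumes "f \<in> test_functions U" "\<And>k. times_cont_diff k g"
  shows "(\<lambda>x. g x * f x) \<in> test_functions U"
proof -
  obtain K where K: "compact K" "K \<subseteq> U" "\<And>x. x \<notin> K \<Longrightarrow> f x = 0"
    using test_function_support[OF assms(1)] by blast
  show ?thesis
  proof (rule test_functionI[of _ K])
    show "x \<in> K" if "g x * f x \<noteq> 0" for x using that K(3)[of x] by auto
  qed (use K in \<open>auto intro!: times_cont_diff_mult assms(2) assms(1)[THEN test_function_smooth]\<close>)
qed

lemma test_function_cmult: "f \<in> test_functions U \<Longrightarrow> (\<lambda>x. c * f x) \<in> test_functions U"
  by (intro test_function_mult_smooth) auto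

lemma test_function_diff:
  "f \<in> test_functions U \<Longrightarrow> g \<in> test_functions U \<Longrightarrow> (\<lambda>x. f x - g x) \<in> test_functions U"
  using test_function_add[of f U "\<lambda>x. -1 * g x"] test_function_cmult[of g U "-1"] by simp

lemma test_function_translate:
  assumes "f \<in> test_functions U" "(\<lambda>x. x + h) ` U \<subseteq> V"
  shows "(\<lambda>x. f (x - h)) \<in> test_functions V"
proof -
  obtain K where K: "compact K" "K \<subseteq> U" "\<And>x. x \<notin> K \<Longrightarrow> f x = 0"
    using test_function_support[OF assms(1)] by blast
  have sm: "times_cont_diff k (\<lambda>x. f (x - h))" for k
    using times_cont_diff_affine_compose[of "\<lambda>x. x" k f "-h"] test_function_smooth[OF assms(1)]
    by (simp add: linear_id[unfolded id_def])
  show ?thesis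
  proof (rule test_functionI[OF sm])
    show "compact ((\<lambda>x. x + h) ` K)"
      using K(1) by (intro compact_continuous_image continuous_intros)
    show "(\<lambda>x. x + h) ` K \<subseteq> V" using K(2) assms(2) by blast
    show "x \<in> (\<lambda>x. x + h) ` K" if "f (x - h) \<noteq> 0" for x
      using K(3)[of "x - h"] that by (intro image_eqI[of _ _ "x - h"]) auto
  qed
qed

text \<open>The shift by 1 keeps the support in the closed box shrunk by 1/n on every side, hence
  compact in the open box. The factor n sends the arguments of \<open>smooth_step\<close> to
  infinity at every interior point.\<close>

definition box_bump :: "'a::euclidean_space \<Rightarrow> 'a \<Rightarrow> nat \<Rightarrow> 'a \<Rightarrow> real" where
  "box_bump a b n x = (\<Prod>i\<in>Basis. smooth_step (real n * (x \<bullet> i - a \<bullet> i) - 1) * smooth_step (real n * (b \<bullet> i - x \<bullet> i) - 1))"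

lemma box_bump_bounds: "0 \<le> box_bump a b n x" "box_bump a b n x \<le> 1"
  unfolding box_bump_def
  by (auto intro!: prod_nonneg prod_le_1 mult_nonneg_nonneg mult_le_one smooth_step_bounds)

lemma box_bump_test:
  assumes "box a b \<subseteq> U" shows "box_bump a b n \<in> test_functions U"
proof (rule test_functionI)
  define e where "e = (1 / real n) *\<^sub>R (\<Sum>i\<in>Basis. i :: 'a)"
  have e: "e \<bullet> i = 1 / real n" if "i \<in> Basis" for i
    using that by (simp add: e_def inner_sum_left inner_Basis if_distrib sum.delta cong: if_cong)
  \<comment> \<open>For n = 0 the quotient 1/n is 0 and the shrunk box would not be shrunk at all;
    there the bump vanishes identically, so the empty set serves as support.\<close>
  let ?K = "if n = 0 then {} else cbox (a + e) (b - e)"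
  show "compact ?K" by auto
  have "cbox (a + e) (b - e) \<subseteq> box a b" if "n \<noteq> 0"
  proof
    fix x assume x: "x \<in> cbox (a + e) (b - e)"
    have "0 < 1 / real n" using that by simp
    have "a \<bullet> i < x \<bullet> i \<and> x \<bullet> i < b \<bullet> i" if "i \<in> Basis" for i
    proof -
      have "a \<bullet> i + 1 / n \<le> x \<bullet> i \<and> x \<bullet> i \<le> b \<bullet> i - 1 / n"
        using x that e[OF that] unfolding mem_box inner_simps by metis
      with \<open>0 < 1 / real n\<close> show ?thesis by linarith
    qed
    then show "x \<in> box a b" by (auto simp: mem_box)
  qed
  then show "?K \<subseteq> U" using assms by auto
  show "times_cont_diff k (box_bump a b n)" for k
    unfolding box_bump_def
    by (intro times_cont_diff_prod times_cont_diff_mult times_cont_diff_smooth_step times_cont_diff_diff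
        times_cont_diff_cmult times_cont_diff_const times_cont_diff_bounded_linear bounded_linear_inner_left)
  fix x assume "box_bump a b n x \<noteq> 0"
  then have nz: "real n * (x \<bullet> i - a \<bullet> i) - 1 > 0 \<and> real n * (b \<bullet> i - x \<bullet> i) - 1 > 0" if "i \<in> Basis" for i
    using that smooth_step_eq_0 unfolding box_bump_def by (fastforce simp: not_le[symmetric])
  from nz[OF SOME_Basis] have "n \<noteq> 0" by (cases "n = 0") auto
  with nz have "x \<bullet> i \<ge> a \<bullet> i + 1 / n \<and> x \<bullet> i \<le> b \<bullet> i - 1 / n" if "i \<in> Basis" for i
    using nz[OF that] by (auto simp: field_simps)
  then show "x \<in> ?K" using \<open>n \<noteq> 0\<close> e by (auto simp: mem_box inner_simps)
qed

lemma box_bump_tendsto: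
  assumes "x \<in> box a b" shows "(\<lambda>n. box_bump a b n x) \<longlonglongrightarrow> 1"
proof -
  have *: "(\<lambda>n. smooth_step (real n * c - 1)) \<longlonglongrightarrow> 1" if "c > 0" for c
  proof (rule filterlim_compose[OF smooth_step_tendsto_1])
    have "filterlim (\<lambda>n. c * real n) at_top sequentially"
      by (rule filterlim_tendsto_pos_mult_at_top[OF tendsto_const that filterlim_real_sequentially])
    from filterlim_tendsto_add_at_top[OF tendsto_const[of "-1"] this]
    show "filterlim (\<lambda>n. real n * c - 1) at_top sequentially" by (simp add: mult.commute)
  qed
  have "(\<lambda>n. box_bump a b n x) \<longlonglongrightarrow> (\<Prod>i\<in>(Basis::'a set). 1 * 1)"
    unfolding box_bump_def using assms by (intro tendsto_prod tendsto_mult *) (auto simp: mem_box)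
  then show ?thesis by simp
qed

text \<open>An open set is a countable union of open boxes, and 1 minus the product of the first n
  factors 1 - bump is a smooth substitute for the indicator function of the union of the first n
  boxes.\<close>

lemma test_cutoff:
  fixes U :: "'a::euclidean_space set"
  assumes "open U"
  obtains \<psi> where "\<And>n. \<psi> n \<in> test_functions U" "\<And>n x. 0 \<le> \<psi> n x" "\<And>n x. \<psi> n x \<le> (1::real)"
    "\<And>x. x \<in> U \<Longrightarrow> (\<lambda>n::nat. \<psi> n x) \<longlonglongrightarrow> 1"
proof -
  obtain D where D: "countable D" "D \<subseteq> Pow U" "\<And>X. X \<in> D \<Longrightarrow> \<exists>a b. X = box a b" "\<Union>D = U"
    by (rule open_countable_Union_open_box[OF assms]) blast
  \<comment> \<open>The empty box makes the family nonempty even if \<open>U\<close> is empty, so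
    that it can be enumerated.\<close>
  define D' where "D' = insert (box 0 (0::'a)) D"
  have D': "countable D'" "D' \<noteq> {}" "D' \<subseteq> Pow U" "\<Union>D' = U"
    using D by (auto simp: D'_def)
  have D'_box: "\<exists>a b. X = box a b" if "X \<in> D'" for X
  proof (cases "X \<in> D")
    case True then show ?thesis by (rule D(3))
  next
    case False
    then have "X = box 0 0" using that by (simp add: D'_def)
    then show ?thesis by (intro exI)
  qed
  define B where "B = from_nat_into D'"
  have B: "range B = D'" unfolding B_def by (rule range_from_nat_into[OF D'(2,1)])
  have "\<forall>j. \<exists>ab. B j = box (fst ab) (snd ab)"
  proof
    fix j
    have "B j \<in> D'" using B by blast
    from D'_box[OF this] obtain a b where "B j = box a b" by (elim exE)
    then show "\<exists>ab. B j = box (fst ab) (snd ab)" by (intro exI[of _ "(a, b)"]) simp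
  qed
  from choice[OF this] obtain ab where ab': "\<forall>j. B j = box (fst (ab j)) (snd (ab j))" by (elim exE)
  define a b where "a j = fst (ab j)" and "b j = snd (ab j)" for j
  have ab: "B j = box (a j) (b j)" for j using ab' by (simp add: a_def b_def)
  have sub: "box (a j) (b j) \<subseteq> U" for j using B D'(3) ab by blast
  define p where "p m n x = (\<Prod>j<m. 1 - box_bump (a j) (b j) n x)" for m n :: nat and x
  have p_bounds: "0 \<le> p m n x" "p m n x \<le> 1" for m n x
    unfolding p_def by (auto intro!: prod_nonneg prod_le_1 simp: box_bump_bounds)
  have p_test: "(\<lambda>x. 1 - p m n x) \<in> test_functions U" for m n
  proof (induction m)
    case 0 then show ?case by (simp add: p_def)
  next
    case (Suc m)
    let ?c = "box_bump (a m) (b m) n"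
    \<comment> \<open>Appending a factor 1 - c to p uses 1 - p (1 - c) = (1 - p) + (c - (1 - p) c),
      in which every term is a test function.\<close>
    have "(\<lambda>x. (1 - p m n x) + (?c x - (1 - p m n x) * ?c x)) \<in> test_functions U"
      by (intro test_function_add test_function_diff test_function_mult_smooth Suc box_bump_test[OF sub]
          test_function_smooth[OF Suc])
    then show ?case by (simp add: p_def algebra_simps)
  qed
  have lim: "(\<lambda>n. 1 - p n n x) \<longlonglongrightarrow> 1" if "x \<in> U" for x
  proof -
    have "x \<in> (\<Union>j. B j)" using that D'(4) B by simp
    then obtain j where j: "x \<in> box (a j) (b j)" unfolding ab by (elim UN_E)
    \<comment> \<open>One box containing \<open>x\<close> suffices: all other factors of the product
      are at most 1.\<close>
    have "box_bump (a j) (b j) n x \<le> 1 - p n n x" if "n > j" for n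
    proof -
      have "p n n x = (1 - box_bump (a j) (b j) n x) * (\<Prod>j\<in>{..<n}-{j}. 1 - box_bump (a j) (b j) n x)"
        unfolding p_def using that by (subst prod.remove[of _ j]) auto
      also have "\<dots> \<le> (1 - box_bump (a j) (b j) n x) * 1"
        by (intro mult_left_mono prod_le_1) (auto simp: box_bump_bounds)
      finally show ?thesis by simp
    qed
    then show ?thesis
      by (intro tendsto_sandwich[OF _ _ box_bump_tendsto[OF j] tendsto_const])
         (auto intro!: eventually_mono[OF eventually_gt_at_top[of j]] simp: p_bounds)
  qed
  show ?thesis
  proof (rule that[of "\<lambda>n x. 1 - p n n x"])
    show "(\<lambda>x. 1 - p n n x) \<in> test_functions U" for n by (rule p_test)
    show "0 \<le> 1 - p n n x" "1 - p n n x \<le> 1" for n x using p_bounds[of n n x] by auto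
    show "(\<lambda>n. 1 - p n n x) \<longlonglongrightarrow> 1" if "x \<in> U" for x by (rule lim[OF that])
  qed
qed

section \<open>Square-integrable functions\<close>

lemma L2_measurable: "f \<in> L2 S \<Longrightarrow> f \<in> borel_measurable (lebesgue_on S)"
  and L2_integrable: "f \<in> L2 S \<Longrightarrow> integrable (lebesgue_on S) (\<lambda>x. (norm (f x))\<^sup>2)"
  by (auto simp: L2_def)

lemma L2_norms_integrable:
  assumes "f \<in> L2 S" "g \<in> L2 S"
  shows "integrable (lebesgue_on S) (\<lambda>x. norm (f x) * norm (g x))"
proof (rule Bochner_Integration.integrable_bound)
  show "integrable (lebesgue_on S) (\<lambda>x. (norm (f x))\<^sup>2 + (norm (g x))\<^sup>2)"
    using assms by (intro Bochner_Integration.integrable_add L2_integrable)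
  show "(\<lambda>x. norm (f x) * norm (g x)) \<in> borel_measurable (lebesgue_on S)"
    using assms[THEN L2_measurable] by measurable
  have "a * b \<le> a\<^sup>2 + b\<^sup>2" if "0 \<le> a" "0 \<le> b" for a b :: real
  proof -
    have "0 \<le> (a - b)\<^sup>2" "0 \<le> a * b" using that by auto
    then show ?thesis unfolding power2_diff by linarith
  qed
  then show "AE x in lebesgue_on S. norm (norm (f x) * norm (g x)) \<le> norm ((norm (f x))\<^sup>2 + (norm (g x))\<^sup>2)"
    by (intro AE_I2) simp
qed

lemma L2_inner_integrable:
  assumes "f \<in> L2 S" "g \<in> L2 S"
  shows "integrable (lebesgue_on S) (\<lambda>x. f x \<bullet> g x)"
proof (rule Bochner_Integration.integrable_bound[OF L2_norms_integrable[OF assms]])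
  show "(\<lambda>x. f x \<bullet> g x) \<in> borel_measurable (lebesgue_on S)"
    using assms[THEN L2_measurable] by measurable
qed (simp add: Cauchy_Schwarz_ineq2 abs_mult)

lemma L2_mult_integrable:
  fixes f g :: "'a::euclidean_space \<Rightarrow> real"
  assumes "f \<in> L2 S" "g \<in> L2 S"
  shows "integrable (lebesgue_on S) (\<lambda>x. f x * g x)"
  using L2_inner_integrable[OF assms] by simp

lemma L2_scaleR_integrable:
  fixes f :: "'a::euclidean_space \<Rightarrow> real" and G :: "'a \<Rightarrow> 'b::euclidean_space"
  assumes "f \<in> L2 S" "G \<in> L2 S"
  shows "integrable (lebesgue_on S) (\<lambda>x. f x *\<^sub>R G x)"
proof (rule Bochner_Integration.integrable_bound[OF L2_norms_integrable[OF assms]])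
  show "(\<lambda>x. f x *\<^sub>R G x) \<in> borel_measurable (lebesgue_on S)"
    using assms[THEN L2_measurable] by measurable
qed simp

lemma L2_iff_inner:
  "f \<in> L2 S \<longleftrightarrow> f \<in> borel_measurable (lebesgue_on S) \<and> integrable (lebesgue_on S) (\<lambda>x. f x \<bullet> f x)"
  by (simp add: L2_def power2_norm_eq_inner)

lemma L2_add [intro]:
  assumes "f \<in> L2 S" "g \<in> L2 S" shows "(\<lambda>x. f x + g x) \<in> L2 S"
  unfolding L2_iff_inner
proof
  show "(\<lambda>x. f x + g x) \<in> borel_measurable (lebesgue_on S)"
    using assms[THEN L2_measurable] by measurable
  show "integrable (lebesgue_on S) (\<lambda>x. (f x + g x) \<bullet> (f x + g x))"
    unfolding inner_add_left inner_add_right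
    using assms by (intro Bochner_Integration.integrable_add L2_inner_integrable)
qed

lemma L2_scaleR [intro]:
  assumes "f \<in> L2 S" shows "(\<lambda>x. c *\<^sub>R f x) \<in> L2 S"
  unfolding L2_iff_inner inner_scaleR_left inner_scaleR_right mult.assoc[symmetric]
  using L2_measurable[OF assms] L2_inner_integrable[OF assms assms]
  by (auto intro: Bochner_Integration.integrable_mult_right)

lemma L2_cmult [intro]:
  fixes f :: "'a::euclidean_space \<Rightarrow> real"
  shows "f \<in> L2 S \<Longrightarrow> (\<lambda>x. c * f x) \<in> L2 S"
  using L2_scaleR[of f S c] by simp

lemma L2_diff [intro]:
  assumes "f \<in> L2 S" "g \<in> L2 S" shows "(\<lambda>x. f x - g x) \<in> L2 S"
  using L2_add[OF assms(1) L2_scaleR[OF assms(2), of "-1"]] by simp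

lemma L2_zero [simp]: "(\<lambda>x. 0) \<in> L2 S"
  by (simp add: L2_def)

lemma L2_sum: "(\<And>i. i \<in> I \<Longrightarrow> f i \<in> L2 S) \<Longrightarrow> (\<lambda>x. \<Sum>i\<in>I. f i x) \<in> L2 S"
  by (induction I rule: infinite_finite_induct) auto

lemma L2_inner_const:
  assumes "f \<in> L2 S" shows "(\<lambda>x. f x \<bullet> a) \<in> L2 S"
proof -
  have "integrable (lebesgue_on S) (\<lambda>x. (f x \<bullet> a)\<^sup>2)"
  proof (rule Bochner_Integration.integrable_bound[OF Bochner_Integration.integrable_mult_right[OF L2_integrable[OF assms], of "(norm a)\<^sup>2"]])
    show "(\<lambda>x. (f x \<bullet> a)\<^sup>2) \<in> borel_measurable (lebesgue_on S)"
      using L2_measurable[OF assms] by measurable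
    have "(f x \<bullet> a)\<^sup>2 \<le> (norm a)\<^sup>2 * (norm (f x))\<^sup>2" for x
      using Cauchy_Schwarz_ineq[of "f x" a] by (simp add: power2_norm_eq_inner mult.commute)
    then show "AE x in lebesgue_on S. norm ((f x \<bullet> a)\<^sup>2) \<le> norm ((norm a)\<^sup>2 * (norm (f x))\<^sup>2)"
      by (intro AE_I2) simp
  qed
  then show ?thesis using L2_measurable[OF assms] by (auto simp: L2_def)
qed

lemma L2_mono:
  assumes "f \<in> L2 S" "T \<subseteq> S" "S \<in> sets lebesgue" "T \<in> sets lebesgue"
  shows "f \<in> L2 T"
proof -
  have "integrable lebesgue (\<lambda>x. indicator S x *\<^sub>R (norm (f x))\<^sup>2)"
    using L2_integrable[OF assms(1)] assms(3) by (simp add: integrable_restrict_space)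
  then have "integrable lebesgue (\<lambda>x. indicator T x *\<^sub>R (indicator S x *\<^sub>R (norm (f x))\<^sup>2))"
    by (rule integrable_mult_indicator[OF assms(4)])
  moreover have "indicator T x *\<^sub>R (indicator S x *\<^sub>R (norm (f x))\<^sup>2) = indicator T x *\<^sub>R (norm (f x))\<^sup>2" for x
    using assms(2) by (auto simp: indicator_def)
  ultimately have "integrable lebesgue (\<lambda>x. indicator T x *\<^sub>R (norm (f x))\<^sup>2)" by (simp only:)
  then have "integrable (lebesgue_on T) (\<lambda>x. (norm (f x))\<^sup>2)"
    using assms(4) by (simp add: integrable_restrict_space)
  moreover have "f \<in> borel_measurable (lebesgue_on T)"
    using measurable_restrict_mono[OF L2_measurable[OF assms(1)] assms(2)] .
  ultimately show ?thesis by (simp add: L2_def)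
qed

lemma L2_bounded:
  assumes "S \<in> lmeasurable" "f \<in> borel_measurable (lebesgue_on S)" "\<And>x. x \<in> S \<Longrightarrow> norm (f x) \<le> B"
  shows "f \<in> L2 S"
proof -
  interpret finite_measure "lebesgue_on S" by (rule finite_measure_lebesgue_on[OF assms(1)])
  have "integrable (lebesgue_on S) (\<lambda>x. (norm (f x))\<^sup>2)"
  proof (rule integrable_const_bound[where B="B\<^sup>2"])
    show "AE x in lebesgue_on S. norm ((norm (f x))\<^sup>2) \<le> B\<^sup>2"
      using assms(3) by (intro AE_I2) (auto intro: power_mono)
    show "(\<lambda>x. (norm (f x))\<^sup>2) \<in> borel_measurable (lebesgue_on S)"
      using assms(2) by measurable
  qed
  then show ?thesis using assms by (simp add: L2_def)
qed

lemma continuous_measurable_lebesgue_on: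
  "continuous_on UNIV f \<Longrightarrow> f \<in> borel_measurable (lebesgue_on S)"
  by (intro measurable_restrict_space1 measurable_completion) (auto intro: borel_measurable_continuous_onI)

lemma L2_const: "S \<in> lmeasurable \<Longrightarrow> (\<lambda>x. c) \<in> L2 S"
  by (rule L2_bounded) auto

lemma continuous_compact_support_integrable:
  fixes f :: "'a::euclidean_space \<Rightarrow> 'b::euclidean_space"
  assumes "continuous_on UNIV f" "compact K" "\<And>x. x \<notin> K \<Longrightarrow> f x = 0"
  shows "integrable lborel f" "integrable lebesgue f"
proof -
  have "integrable lborel (\<lambda>x. indicator K x *\<^sub>R f x)"
    by (rule borel_integrable_compact[OF assms(2)]) (use assms(1) continuous_on_subset in blast)
  moreover have "(\<lambda>x. indicator K x *\<^sub>R f x) = f"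
    using assms(3) by (auto simp: indicator_def fun_eq_iff)
  ultimately show *: "integrable lborel f" by simp
  then show "integrable lebesgue f"
    by (subst integrable_completion) auto
qed

lemma continuous_compact_support_L2:
  fixes f :: "'a::euclidean_space \<Rightarrow> 'b::euclidean_space"
  assumes "continuous_on UNIV f" "compact K" "\<And>x. x \<notin> K \<Longrightarrow> f x = 0" "S \<in> sets lebesgue"
  shows "f \<in> L2 S"
proof -
  have "integrable lebesgue (\<lambda>x. (norm (f x))\<^sup>2)"
    using assms by (intro continuous_compact_support_integrable(2)[of _ K] continuous_intros) auto
  then have "f \<in> L2 UNIV"
    using continuous_measurable_lebesgue_on[OF assms(1), of UNIV] by (simp add: L2_def lebesgue_on_UNIV_eq)
  then show ?thesis by (rule L2_mono) (use assms in auto)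
qed

section \<open>Inner product and norm of square-integrable functions\<close>

lemma l2_inner_commute: "l2_inner S f g = l2_inner S g f"
  by (simp add: l2_inner_def inner_commute)

lemma l2_inner_add_left:
  assumes "f \<in> L2 S" "g \<in> L2 S" "h \<in> L2 S"
  shows "l2_inner S (\<lambda>x. f x + g x) h = l2_inner S f h + l2_inner S g h"
  using assms unfolding l2_inner_def inner_add_left
  by (intro Bochner_Integration.integral_add L2_inner_integrable)

lemma l2_inner_scaleR_left: "l2_inner S (\<lambda>x. c *\<^sub>R f x) h = c * l2_inner S f h"
  by (simp add: l2_inner_def)

lemma l2_inner_cmult_left:
  fixes f :: "'a::euclidean_space \<Rightarrow> real"
  shows "l2_inner S (\<lambda>x. c * f x) h = c * l2_inner S f h"
  using l2_inner_scaleR_left[of S c f h] by simp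

lemma l2_inner_diff_left:
  assumes "f \<in> L2 S" "g \<in> L2 S" "h \<in> L2 S"
  shows "l2_inner S (\<lambda>x. f x - g x) h = l2_inner S f h - l2_inner S g h"
  using assms unfolding l2_inner_def inner_diff_left
  by (intro Bochner_Integration.integral_diff L2_inner_integrable)

lemma l2_inner_diff_right:
  "f \<in> L2 S \<Longrightarrow> g \<in> L2 S \<Longrightarrow> h \<in> L2 S \<Longrightarrow>
    l2_inner S h (\<lambda>x. f x - g x) = l2_inner S h f - l2_inner S h g"
  using l2_inner_diff_left by (simp add: l2_inner_commute[of S h])

lemma l2_inner_lincomb_left:
  assumes "f \<in> L2 S" "g \<in> L2 S" "h \<in> L2 S"
  shows "l2_inner S (\<lambda>x. f x + c *\<^sub>R g x) h = l2_inner S f h + c * l2_inner S g h"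
  using l2_inner_add_left[OF assms(1) L2_scaleR[OF assms(2)] assms(3)] by (simp add: l2_inner_scaleR_left)

lemma l2_inner_cong_AE:
  assumes "AE x in lebesgue_on S. f x = f' x" "AE x in lebesgue_on S. g x = g' x"
    "f \<in> L2 S" "f' \<in> L2 S" "g \<in> L2 S" "g' \<in> L2 S"
  shows "l2_inner S f g = l2_inner S f' g'"
  unfolding l2_inner_def
proof (rule integral_cong_AE)
  show "(\<lambda>x. f x \<bullet> g x) \<in> borel_measurable (lebesgue_on S)" "(\<lambda>x. f' x \<bullet> g' x) \<in> borel_measurable (lebesgue_on S)"
    using assms(3-6)[THEN L2_measurable] by measurable
  show "AE x in lebesgue_on S. f x \<bullet> g x = f' x \<bullet> g' x"
    using assms(1,2) by eventually_elim simp
qed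

lemma l2_inner_self_nonneg: "0 \<le> l2_inner S f f"
  by (auto simp: l2_inner_def)

lemma l2_norm_nonneg [simp]: "0 \<le> l2_norm S f"
  by (simp add: l2_norm_def l2_inner_self_nonneg)

lemma l2_norm_square: "(l2_norm S f)\<^sup>2 = l2_inner S f f"
  by (simp add: l2_norm_def l2_inner_self_nonneg)

lemma l2_norm_cong_AE:
  assumes "AE x in lebesgue_on S. f x = f' x" "f \<in> L2 S" "f' \<in> L2 S"
  shows "l2_norm S f = l2_norm S f'"
  unfolding l2_norm_def using l2_inner_cong_AE[OF assms(1,1,2,3,2,3)] by simp

lemma l2_norm_cmult: 
  fixes f :: "'a::euclidean_space \<Rightarrow> real"
  shows "l2_norm S (\<lambda>x. c * f x) = \<bar>c\<bar> * l2_norm S f"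
proof -
  have "l2_inner S (\<lambda>x. c * f x) (\<lambda>x. c * f x) = c\<^sup>2 * l2_inner S f f"
    unfolding l2_inner_cmult_left l2_inner_commute[of S f "\<lambda>x. c * f x"] by (simp add: power2_eq_square)
  then show ?thesis by (simp add: l2_norm_def real_sqrt_mult)
qed

text \<open>The square of the norm of f + t g is a nonnegative quadratic polynomial in t; it is
  evaluated at its minimiser. A function \<open>g\<close> of norm zero need not vanish everywhere,
  so that case is treated apart.\<close>

lemma l2_Cauchy_Schwarz:
  assumes "f \<in> L2 S" "g \<in> L2 S"
  shows "\<bar>l2_inner S f g\<bar> \<le> l2_norm S f * l2_norm S g"
proof -
  have q: "0 \<le> l2_inner S f f + 2 * t * l2_inner S f g + t\<^sup>2 * l2_inner S g g" for t
  proof -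
    let ?h = "\<lambda>x. f x + t *\<^sub>R g x"
    have h: "?h \<in> L2 S" using assms by auto
    have "l2_inner S ?h ?h = l2_inner S f ?h + t * l2_inner S g ?h"
      by (rule l2_inner_lincomb_left[OF assms h])
    also have "l2_inner S f ?h = l2_inner S f f + t * l2_inner S f g"
      using l2_inner_lincomb_left[OF assms assms(1), of t]
      unfolding l2_inner_commute[of S f ?h] l2_inner_commute[of S g f] .
    also have "l2_inner S g ?h = l2_inner S f g + t * l2_inner S g g"
      using l2_inner_lincomb_left[OF assms assms(2), of t]
      unfolding l2_inner_commute[of S g ?h] .
    finally show ?thesis using l2_inner_self_nonneg[of S ?h] by (simp add: algebra_simps power2_eq_square)
  qed
  have "(l2_inner S f g)\<^sup>2 \<le> l2_inner S f f * l2_inner S g g"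
  proof (cases "l2_inner S g g = 0")
    case True
    have "l2_inner S f g = 0"
    proof (rule ccontr)
      assume "l2_inner S f g \<noteq> 0"
      \<comment> \<open>With (g, g) = 0 the polynomial is affine in t, and at this t it equals
        -1.\<close>
      then show False
        using q[of "- (l2_inner S f f + 1) / (2 * l2_inner S f g)"] True by (simp add: field_simps)
    qed
    then show ?thesis using True by simp
  next
    case False
    then have "l2_inner S g g > 0" using l2_inner_self_nonneg[of S g] by simp
    then show ?thesis
      using q[of "- l2_inner S f g / l2_inner S g g"] by (simp add: field_simps power2_eq_square)
  qed
  then have "(l2_inner S f g)\<^sup>2 \<le> (l2_norm S f * l2_norm S g)\<^sup>2"
    by (simp add: power_mult_distrib l2_norm_square)
  then have "\<bar>l2_inner S f g\<bar>\<^sup>2 \<le> (l2_norm S f * l2_norm S g)\<^sup>2" by simp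
  then show ?thesis by (rule power2_le_imp_le) simp
qed

lemma l2_norm_triangle:
  assumes "f \<in> L2 S" "g \<in> L2 S"
  shows "l2_norm S (\<lambda>x. f x + g x) \<le> l2_norm S f + l2_norm S g"
proof (rule power2_le_imp_le)
  have "(l2_norm S (\<lambda>x. f x + g x))\<^sup>2 = l2_inner S f f + 2 * l2_inner S f g + l2_inner S g g"
    unfolding l2_norm_square l2_inner_add_left[OF assms L2_add[OF assms]]
      l2_inner_commute[of S f "\<lambda>x. f x + g x"] l2_inner_commute[of S g "\<lambda>x. f x + g x"]
      l2_inner_add_left[OF assms assms(1)] l2_inner_add_left[OF assms assms(2)] l2_inner_commute[of S g f] by simp
  also have "\<dots> \<le> (l2_norm S f + l2_norm S g)\<^sup>2"
    using l2_Cauchy_Schwarz[OF assms] by (simp add: power2_sum l2_norm_square)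
  finally show "(l2_norm S (\<lambda>x. f x + g x))\<^sup>2 \<le> (l2_norm S f + l2_norm S g)\<^sup>2" .
qed simp

lemma l2_norm_minus: "l2_norm S (\<lambda>x. f x - g x) = l2_norm S (\<lambda>x. g x - f x)"
  unfolding l2_norm_def l2_inner_def by (simp add: inner_diff_left inner_diff_right algebra_simps)

lemma l2_norm_eq_0_AE:
  assumes "f \<in> L2 S" "l2_norm S f = 0"
  shows "AE x in lebesgue_on S. f x = 0"
proof -
  have "(LINT x|lebesgue_on S. f x \<bullet> f x) = 0"
    using assms(2) l2_norm_square[of S f] by (simp add: l2_inner_def)
  then have "AE x in lebesgue_on S. f x \<bullet> f x = 0"
    by (subst (asm) integral_nonneg_eq_0_iff_AE[OF L2_inner_integrable[OF assms(1) assms(1)]]) auto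
  then show ?thesis by simp
qed

lemma l2_norm_AE_0: "AE x in lebesgue_on S. f x = 0 \<Longrightarrow> f \<in> L2 S \<Longrightarrow> l2_norm S f = 0"
  using l2_norm_cong_AE[where S=S and f=f and f'="\<lambda>x. 0"] by (simp add: l2_norm_def l2_inner_def)

section \<open>Density of test functions and weak gradients\<close>

lemma test_function_L2:
  assumes "\<phi> \<in> test_functions U" "S \<in> sets lebesgue" shows "\<phi> \<in> L2 S"
proof -
  obtain K where "compact K" "K \<subseteq> U" "\<And>x. x \<notin> K \<Longrightarrow> \<phi> x = 0"
    using test_function_support[OF assms(1)] by blast
  then show ?thesis
    using times_cont_diff_continuous[OF test_function_smooth[OF assms(1), of 0]] assms(2)
    by (intro continuous_compact_support_L2)
qed

lemma real_polynomial_function_smooth: "real_polynomial_function p \<Longrightarrow> times_cont_diff k p"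
  by (induction rule: real_polynomial_function.induct)
     (auto intro: times_cont_diff_bounded_linear times_cont_diff_add times_cont_diff_mult)

text \<open>Measurability gives continuous functions converging almost everywhere. Truncation keeps
  them bounded, Weierstrass replaces them by polynomials, which are smooth, and cutoffs give compact
  support in \<open>U\<close>. Boundedness then allows dominated convergence.\<close>

lemma test_function_dense_bounded:
  fixes f :: "'a::euclidean_space \<Rightarrow> real"
  assumes "open U" "bounded U" and f: "f \<in> borel_measurable (lebesgue_on U)"
    and M: "\<And>x. x \<in> U \<Longrightarrow> \<bar>f x\<bar> \<le> M"
  obtains \<phi> where "\<And>n::nat. \<phi> n \<in> test_functions U" "(\<lambda>n. l2_norm U (\<lambda>x. f x - \<phi> n x)) \<longlonglongrightarrow> 0"
proof -
  have U: "U \<in> lmeasurable" using assms(1,2) lmeasurable_open by blast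
  obtain \<psi> where \<psi>: "\<And>n. \<psi> n \<in> test_functions U" "\<And>n x. 0 \<le> \<psi> n x" "\<And>n x. \<psi> n x \<le> (1::real)"
    "\<And>x. x \<in> U \<Longrightarrow> (\<lambda>n::nat. \<psi> n x) \<longlonglongrightarrow> 1"
    using test_cutoff[OF assms(1)] by blast
  have "(\<lambda>x. indicator U x *\<^sub>R f x) \<in> borel_measurable lebesgue"
    using f U by (subst borel_measurable_restrict_space_iff[symmetric]) (auto simp: fmeasurableD)
  then have "(\<lambda>x. indicator U x *\<^sub>R f x) measurable_on U"
    using U by (intro lebesgue_measurable_imp_measurable_on_real) (auto simp: fmeasurableD)
  then obtain N g where N: "negligible N" and g: "\<And>n. continuous_on UNIV (g n)"
    and lim: "\<And>x. x \<notin> N \<Longrightarrow> (\<lambda>n. g n x) \<longlonglongrightarrow> (if x \<in> U then indicator U x *\<^sub>R f x else 0)"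
    unfolding measurable_on_def by blast
  \<comment> \<open>Truncating at the bound of \<open>f\<close> does not disturb the limit and
    provides the dominating constant.\<close>
  define h where "h n x = max (- M) (min M (g n x))" for n x
  have h: "continuous_on (closure U) (h n)" for n
    unfolding h_def by (intro continuous_intros continuous_on_subset[OF g]) auto
  have "\<exists>p. real_polynomial_function p \<and> (\<forall>x\<in>closure U. \<bar>h n x - p x\<bar> < 1 / Suc n)" for n
    using Stone_Weierstrass_real_polynomial_function[OF _ h, of "1 / Suc n"] assms(2)
    by (metis compact_closure divide_pos_pos of_nat_0_less_iff zero_less_Suc zero_less_one)
  then obtain p where p: "\<And>n. real_polynomial_function (p n)"
    and ph: "\<And>n x. x \<in> closure U \<Longrightarrow> \<bar>h n x - p n x\<bar> < 1 / Suc n" by metis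
  define \<phi> where "\<phi> n x = p n x * \<psi> n x" for n x
  have \<phi>: "\<phi> n \<in> test_functions U" for n
    unfolding \<phi>_def by (intro test_function_mult_smooth \<psi> real_polynomial_function_smooth p)
  have bound: "\<bar>\<phi> n x\<bar> \<le> M + 1" if "x \<in> U" for n x
  proof -
    have "M \<ge> 0" using M[OF that] by linarith
    then have "\<bar>h n x\<bar> \<le> M" by (auto simp: h_def)
    moreover have "1 / Suc n \<le> (1::real)" by simp
    moreover have "x \<in> closure U" using that closure_subset by blast
    ultimately have "\<bar>p n x\<bar> \<le> M + 1" using ph[of x n] by linarith
    then have "\<bar>p n x\<bar> * \<bar>\<psi> n x\<bar> \<le> (M + 1) * 1" using \<psi>(2,3)[of n x] \<open>M \<ge> 0\<close>
      by (intro mult_mono) auto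
    then show ?thesis by (simp add: \<phi>_def abs_mult)
  qed
  have conv: "(\<lambda>n. \<phi> n x) \<longlonglongrightarrow> f x" if "x \<in> U" "x \<notin> N" for x
  proof -
    have "(\<lambda>n. g n x) \<longlonglongrightarrow> f x" using lim[OF that(2)] that(1) by simp
    then have "(\<lambda>n. h n x) \<longlonglongrightarrow> max (- M) (min M (f x))"
      unfolding h_def by (intro tendsto_intros)
    moreover have "max (- M) (min M (f x)) = f x" using M[OF that(1)] by auto
    ultimately have hl: "(\<lambda>n. h n x) \<longlonglongrightarrow> f x" by simp
    have "(\<lambda>n. p n x - h n x) \<longlonglongrightarrow> 0"
    proof (rule Lim_null_comparison)
      have "norm (p n x - h n x) \<le> 1 / Suc n" for n
        using ph[of x n] that(1) closure_subset[of U] by (auto simp: abs_minus_commute)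
      then show "\<forall>\<^sub>F n in sequentially. norm (p n x - h n x) \<le> 1 / Suc n" by simp
      show "(\<lambda>n. 1 / real (Suc n)) \<longlonglongrightarrow> 0" using LIMSEQ_Suc[OF lim_1_over_n] by simp
    qed
    from tendsto_add[OF this hl] have "(\<lambda>n. p n x) \<longlonglongrightarrow> f x" by simp
    from tendsto_mult[OF this \<psi>(4)[OF that(1)]] show ?thesis by (simp add: \<phi>_def)
  qed
  have ae: "AE x in lebesgue_on U. x \<in> U \<and> x \<notin> N"
    using N U by (subst AE_restrict_space_iff) (auto simp: fmeasurableD negligible_iff_null_sets intro: AE_mp[OF AE_not_in])
  have "(\<lambda>n. LINT x|lebesgue_on U. (f x - \<phi> n x)\<^sup>2) \<longlonglongrightarrow> (LINT x|lebesgue_on U. 0)"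
  proof (rule integral_dominated_convergence[where w="\<lambda>x. (2 * M + 1)\<^sup>2"])
    show "(\<lambda>x. 0) \<in> borel_measurable (lebesgue_on U)" by simp
    show "(\<lambda>x. (f x - \<phi> n x)\<^sup>2) \<in> borel_measurable (lebesgue_on U)" for n
      using f continuous_measurable_lebesgue_on[OF times_cont_diff_continuous[OF test_function_smooth[OF \<phi>[of n]]], of U]
      by measurable
    show "integrable (lebesgue_on U) (\<lambda>x. (2 * M + 1)\<^sup>2)"
      using finite_measure.integrable_const[OF finite_measure_lebesgue_on[OF U]] .
    show "AE x in lebesgue_on U. (\<lambda>n. (f x - \<phi> n x)\<^sup>2) \<longlonglongrightarrow> 0"
      using ae
    proof eventually_elim
      case (elim x)
      then have "(\<lambda>n. (f x - \<phi> n x)\<^sup>2) \<longlonglongrightarrow> (f x - f x)\<^sup>2" by (intro tendsto_intros conv) auto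
      then show ?case by simp
    qed
    show "AE x in lebesgue_on U. norm ((f x - \<phi> n x)\<^sup>2) \<le> (2 * M + 1)\<^sup>2" for n
    proof (rule AE_I2)
      fix x assume "x \<in> space (lebesgue_on U)"
      then have "\<bar>f x - \<phi> n x\<bar> \<le> 2 * M + 1" using M[of x] bound[of x n] by auto
      then have "\<bar>f x - \<phi> n x\<bar>\<^sup>2 \<le> (2 * M + 1)\<^sup>2" by (intro power_mono) auto
      then show "norm ((f x - \<phi> n x)\<^sup>2) \<le> (2 * M + 1)\<^sup>2" by simp
    qed
  qed
  then have "(\<lambda>n. sqrt (LINT x|lebesgue_on U. (f x - \<phi> n x)\<^sup>2)) \<longlonglongrightarrow> sqrt 0"
    by (intro tendsto_intros) simp
  then show ?thesis
    by (intro that[of \<phi>] \<phi>) (simp add: l2_norm_def l2_inner_def power2_eq_square)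
qed

text \<open>Truncations of \<open>f\<close> at height n converge to \<open>f\<close> in the L2 norm,
  dominated by the square of \<open>f\<close>, and reduce the claim to bounded functions.\<close>

lemma test_function_dense:
  fixes f :: "'a::euclidean_space \<Rightarrow> real"
  assumes "open U" "bounded U" "f \<in> L2 U" "e > 0"
  obtains \<phi> where "\<phi> \<in> test_functions U" "l2_norm U (\<lambda>x. f x - \<phi> x) < e"
proof -
  have U: "U \<in> lmeasurable" using assms(1,2) lmeasurable_open by blast
  define t where "t n x = max (- real n) (min (real n) (f x))" for n :: nat and x
  have t_meas: "t n \<in> borel_measurable (lebesgue_on U)" for n
    unfolding t_def using L2_measurable[OF assms(3)] by measurable
  have t_bound: "\<bar>t n x\<bar> \<le> real n" for n x by (auto simp: t_def)
  have tL2: "t n \<in> L2 U" for n using L2_bounded[OF U t_meas] t_bound by auto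
  have "(\<lambda>n. LINT x|lebesgue_on U. (f x - t n x)\<^sup>2) \<longlonglongrightarrow> (LINT x|lebesgue_on U. 0)"
  proof (rule integral_dominated_convergence[where w="\<lambda>x. (norm (f x))\<^sup>2"])
    show "(\<lambda>x. (f x - t n x)\<^sup>2) \<in> borel_measurable (lebesgue_on U)" for n
      using L2_measurable[OF assms(3)] t_meas[of n] by measurable
    show "AE x in lebesgue_on U. (\<lambda>n. (f x - t n x)\<^sup>2) \<longlonglongrightarrow> 0"
    proof (rule AE_I2)
      fix x
      have "\<forall>\<^sub>F n in sequentially. (f x - t n x)\<^sup>2 = 0"
        using eventually_ge_at_top[of "nat \<lceil>\<bar>f x\<bar>\<rceil>"]
      proof eventually_elim
        case (elim n)
        then have "\<bar>f x\<bar> \<le> real n" by linarith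
        then show ?case by (auto simp: t_def)
      qed
      then show "(\<lambda>n. (f x - t n x)\<^sup>2) \<longlonglongrightarrow> 0" by (rule tendsto_eventually)
    qed
    show "AE x in lebesgue_on U. norm ((f x - t n x)\<^sup>2) \<le> (norm (f x))\<^sup>2" for n
    proof (rule AE_I2)
      fix x
      have "\<bar>f x - t n x\<bar> \<le> \<bar>f x\<bar>" by (auto simp: t_def)
      then have "\<bar>f x - t n x\<bar>\<^sup>2 \<le> \<bar>f x\<bar>\<^sup>2" by (intro power_mono) auto
      then show "norm ((f x - t n x)\<^sup>2) \<le> (norm (f x))\<^sup>2" by simp
    qed
  qed (use L2_integrable[OF assms(3)] in auto)
  then have "(\<lambda>n. sqrt (LINT x|lebesgue_on U. (f x - t n x)\<^sup>2)) \<longlonglongrightarrow> sqrt 0"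
    by (intro tendsto_intros) simp
  then have "(\<lambda>n. l2_norm U (\<lambda>x. f x - t n x)) \<longlonglongrightarrow> 0"
    by (simp add: l2_norm_def l2_inner_def power2_eq_square)
  then have "\<forall>\<^sub>F n in sequentially. l2_norm U (\<lambda>x. f x - t n x) < e / 2"
    by (rule order_tendstoD) (use assms(4) in simp)
  then obtain n where n: "l2_norm U (\<lambda>x. f x - t n x) < e / 2"
    using eventually_happens trivial_limit_sequentially by blast
  obtain \<phi> where \<phi>: "\<And>m::nat. \<phi> m \<in> test_functions U" "(\<lambda>m. l2_norm U (\<lambda>x. t n x - \<phi> m x)) \<longlonglongrightarrow> 0"
    using test_function_dense_bounded[OF assms(1,2) t_meas t_bound] by blast
  have "\<forall>\<^sub>F m in sequentially. l2_norm U (\<lambda>x. t n x - \<phi> m x) < e / 2"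
    by (rule order_tendstoD[OF \<phi>(2)]) (use assms(4) in simp)
  then obtain m where m: "l2_norm U (\<lambda>x. t n x - \<phi> m x) < e / 2"
    using eventually_happens trivial_limit_sequentially by blast
  have "l2_norm U (\<lambda>x. (f x - t n x) + (t n x - \<phi> m x)) \<le> l2_norm U (\<lambda>x. f x - t n x) + l2_norm U (\<lambda>x. t n x - \<phi> m x)"
    using assms(3) tL2[of n] test_function_L2[OF \<phi>(1)[of m]] U
    by (intro l2_norm_triangle L2_diff) (auto simp: fmeasurableD)
  then have "l2_norm U (\<lambda>x. f x - \<phi> m x) < e" using n m by simp
  then show ?thesis using that \<phi>(1) by blast
qed

text \<open>Testing with an approximation of \<open>f\<close> itself turns the dual bound into (f,
  f) at most C times the norm of \<open>f\<close>, up to an error proportional to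
  \<open>e\<close>.\<close>

lemma l2_norm_le_dual:
  fixes f :: "'a::euclidean_space \<Rightarrow> real"
  assumes U: "open U" "bounded U" and f: "f \<in> L2 U" and "0 \<le> C"
    and dual: "\<And>\<phi>. \<phi> \<in> test_functions U \<Longrightarrow> \<bar>l2_inner U f \<phi>\<bar> \<le> C * l2_norm U \<phi>"
  shows "l2_norm U f \<le> C"
proof (rule ccontr)
  let ?n = "l2_norm U f"
  assume "\<not> ?n \<le> C"
  then have "?n > C" by simp
  then have npos: "?n > 0" using \<open>0 \<le> C\<close> by simp
  \<comment> \<open>Chosen so that e (n + C) is half of the gap n^2 - C n; the approximation error
    then cannot close the gap.\<close>
  define e where "e = (?n - C) * ?n / (2 * (?n + C))"
  have "e > 0" using \<open>?n > C\<close> npos \<open>0 \<le> C\<close> by (simp add: e_def)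
  obtain \<phi> where \<phi>: "\<phi> \<in> test_functions U" "l2_norm U (\<lambda>x. f x - \<phi> x) < e"
    using test_function_dense[OF U f \<open>e > 0\<close>] by blast
  have \<phi>L: "\<phi> \<in> L2 U" using test_function_L2[OF \<phi>(1)] U(1) by (auto intro: lborelD)
  have d: "(\<lambda>x. f x - \<phi> x) \<in> L2 U" using f \<phi>L by auto
  have "l2_norm U \<phi> \<le> ?n + l2_norm U (\<lambda>x. \<phi> x - f x)"
    using l2_norm_triangle[OF f L2_diff[OF \<phi>L f]] by simp
  then have n\<phi>: "l2_norm U \<phi> \<le> ?n + e" using \<phi>(2) by (simp add: l2_norm_minus[of U \<phi>])
  have "?n\<^sup>2 = l2_inner U f (\<lambda>x. f x - \<phi> x) + l2_inner U f \<phi>"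
    using f \<phi>L by (simp add: l2_norm_square l2_inner_diff_right)
  also have "\<dots> \<le> ?n * e + C * (?n + e)"
  proof (intro add_mono)
    have "l2_inner U f (\<lambda>x. f x - \<phi> x) \<le> ?n * l2_norm U (\<lambda>x. f x - \<phi> x)"
      using l2_Cauchy_Schwarz[OF f d] by linarith
    also have "\<dots> \<le> ?n * e" using \<phi>(2) by (intro mult_left_mono) auto
    finally show "l2_inner U f (\<lambda>x. f x - \<phi> x) \<le> ?n * e" .
    have "l2_inner U f \<phi> \<le> C * l2_norm U \<phi>" using dual[OF \<phi>(1)] by linarith
    also have "\<dots> \<le> C * (?n + e)" using n\<phi> \<open>0 \<le> C\<close> by (intro mult_left_mono) auto
    finally show "l2_inner U f \<phi> \<le> C * (?n + e)" .
  qed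
  also have "\<dots> = e * (?n + C) + C * ?n" by (simp add: algebra_simps)
  also have "e * (?n + C) = (?n - C) * ?n / 2" proof -
    have "?n + C \<noteq> 0" using npos \<open>0 \<le> C\<close> by linarith
    then show ?thesis by (simp add: e_def divide_simps)
  qed
  finally have "?n * ?n \<le> (?n - C) * ?n / 2 + C * ?n" by (simp only: power2_eq_square)
  moreover have "(?n - C) * ?n = ?n * ?n - C * ?n" by (rule left_diff_distrib)
  ultimately have "(?n - C) * ?n \<le> (?n - C) * ?n / 2" by linarith
  moreover have "(?n - C) * ?n > 0" using \<open>?n > C\<close> npos by simp
  ultimately show False by linarith
qed

text \<open>The case C = 0 of the dual bound.\<close>

lemma fundamental_lemma_variations:
  fixes f :: "'a::euclidean_space \<Rightarrow> real"
  assumes "open U" "bounded U" "f \<in> L2 U" "\<And>\<phi>. \<phi> \<in> test_functions U \<Longrightarrow> l2_inner U f \<phi> = 0"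
  shows "AE x in lebesgue_on U. f x = 0"
  using l2_norm_le_dual[OF assms(1-3), of 0] assms(4) l2_norm_eq_0_AE[OF assms(3)] l2_norm_nonneg[of U f]
  by force

section \<open>Classical and weak gradients\<close>

lemma grad_inner:
  assumes "f differentiable (at x)" shows "grad f x \<bullet> h = frechet_derivative f (at x) h"
proof -
  have lin: "linear (frechet_derivative f (at x))" using linear_frechet_derivative[OF assms] .
  have "frechet_derivative f (at x) h = (\<Sum>i\<in>Basis. (h \<bullet> i) * frechet_derivative f (at x) i)"
    by (subst euclidean_representation[of h, symmetric]) (simp only: linear_sum[OF lin] linear_scale[OF lin] real_scaleR_def)
  moreover have "grad f x \<bullet> h = (\<Sum>i\<in>Basis. (h \<bullet> i) * frechet_derivative f (at x) i)"
    unfolding grad_def inner_sum_left inner_scaleR_left by (simp only: inner_commute mult.commute)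
  ultimately show ?thesis by simp
qed

lemma grad_eqI:
  assumes "(f has_derivative (\<lambda>h. a \<bullet> h)) (at x)" shows "grad f x = a"
proof -
  have "frechet_derivative f (at x) = (\<lambda>h. a \<bullet> h)" using frechet_derivative_at[OF assms] by simp
  then show ?thesis by (simp add: grad_def euclidean_representation)
qed

lemma has_derivative_grad:
  assumes "times_cont_diff (Suc k) f" shows "(f has_derivative (\<lambda>h. grad f x \<bullet> h)) (at x)"
  using assms grad_inner[of f x] by (auto simp: frechet_derivative_works)

lemma continuous_grad:
  assumes "times_cont_diff (Suc k) f" shows "continuous_on UNIV (grad f)"
  unfolding grad_def using assms by (intro continuous_intros) (auto dest: times_cont_diff_continuous)

lemma grad_zero_outside:
  assumes "closed K" "\<And>x. x \<notin> K \<Longrightarrow> f x = 0" "x \<notin> K" shows "grad f x = 0"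
proof (rule grad_eqI)
  have "((\<lambda>x. 0) has_derivative (\<lambda>h. 0 \<bullet> h)) (at x)" by simp
  then show "(f has_derivative (\<lambda>h. 0 \<bullet> h)) (at x)"
    by (rule has_derivative_transform_within_open[of _ _ _ _ "- K"]) (use assms in auto)
qed

lemma test_function_grad_support:
  assumes "\<phi> \<in> test_functions U"
  obtains K where "compact K" "K \<subseteq> U" "\<And>x. x \<notin> K \<Longrightarrow> \<phi> x = 0" "\<And>x. x \<notin> K \<Longrightarrow> grad \<phi> x = 0"
    "continuous_on UNIV \<phi>" "continuous_on UNIV (grad \<phi>)"
proof -
  obtain K where K: "compact K" "K \<subseteq> U" "\<And>x. x \<notin> K \<Longrightarrow> \<phi> x = 0"
    using test_function_support[OF assms] by blast
  show ?thesis
    by (rule that[OF K]) (use K grad_zero_outside[OF compact_imp_closed[OF K(1)], of \<phi>]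
        times_cont_diff_continuous[OF test_function_smooth[OF assms, of 0]]
        continuous_grad[OF test_function_smooth[OF assms, of "Suc 0"]] in auto)
qed

lemma test_function_grad_L2:
  assumes "\<phi> \<in> test_functions U" "S \<in> sets lebesgue" shows "grad \<phi> \<in> L2 S"
proof -
  obtain K where "compact K" "K \<subseteq> U" "\<And>x. x \<notin> K \<Longrightarrow> grad \<phi> x = 0" "continuous_on UNIV (grad \<phi>)"
    using test_function_grad_support[OF assms(1)] by metis
  then show ?thesis using assms(2) by (intro continuous_compact_support_L2)
qed

lemma is_weak_gradD:
  assumes "is_weak_grad U v G" 
  shows "G \<in> L2 U" "\<phi> \<in> test_functions U \<Longrightarrow>
     (LINT x|lebesgue_on U. v x *\<^sub>R grad \<phi> x) = - (LINT x|lebesgue_on U. \<phi> x *\<^sub>R G x)"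
  using assms by (auto simp: is_weak_grad_def)

lemma is_weak_grad_unique:
  assumes U: "open U" "bounded U" and "is_weak_grad U v G" "is_weak_grad U v G'"
  shows "AE x in lebesgue_on U. G x = G' x"
proof -
  have US: "U \<in> sets lebesgue" using U(1) by auto
  have L: "G \<in> L2 U" "G' \<in> L2 U" using assms by (auto simp: is_weak_grad_def)
  have "AE x in lebesgue_on U. \<forall>i\<in>Basis. (G x - G' x) \<bullet> i = 0"
  proof (rule AE_finite_allI)
    fix i :: 'a assume "i \<in> Basis"
    show "AE x in lebesgue_on U. (G x - G' x) \<bullet> i = 0"
    proof (rule fundamental_lemma_variations[OF U])
      show "(\<lambda>x. (G x - G' x) \<bullet> i) \<in> L2 U" using L by (intro L2_inner_const L2_diff)
      fix \<phi> assume \<phi>: "\<phi> \<in> test_functions U"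
      note int = L[THEN L2_scaleR_integrable[OF test_function_L2[OF \<phi> US]]]
      have "(LINT x|lebesgue_on U. \<phi> x *\<^sub>R G x) = (LINT x|lebesgue_on U. \<phi> x *\<^sub>R G' x)"
        using is_weak_gradD(2)[OF assms(3) \<phi>] is_weak_gradD(2)[OF assms(4) \<phi>] by simp
      then have "0 = (LINT x|lebesgue_on U. \<phi> x *\<^sub>R G x - \<phi> x *\<^sub>R G' x)"
        using int by simp
      then have "0 = (LINT x|lebesgue_on U. \<phi> x *\<^sub>R G x - \<phi> x *\<^sub>R G' x) \<bullet> i" by simp
      also have "\<dots> = (LINT x|lebesgue_on U. (\<phi> x *\<^sub>R G x - \<phi> x *\<^sub>R G' x) \<bullet> i)"
        by (rule integral_inner_left[symmetric]) (use int in auto)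
      finally show "l2_inner U (\<lambda>x. (G x - G' x) \<bullet> i) \<phi> = 0"
        by (simp add: l2_inner_def inner_diff_left algebra_simps)
    qed
  qed simp
  then show ?thesis
    by eventually_elim (metis eq_iff_diff_eq_0 euclidean_eq_iff inner_zero_left)
qed

lemma is_weak_grad_weak_grad: "v \<in> H1 U \<Longrightarrow> is_weak_grad U v (weak_grad U v)"
  unfolding weak_grad_def H1_def by (auto intro: someI_ex[of "is_weak_grad U v"])

lemma weak_grad_L2: "v \<in> H1 U \<Longrightarrow> weak_grad U v \<in> L2 U"
  using is_weak_grad_weak_grad is_weak_gradD(1) by blast

lemma H1_L2: "v \<in> H1 U \<Longrightarrow> v \<in> L2 U"
  by (simp add: H1_def)

lemma weak_grad_AE_eq:
  assumes "open U" "bounded U" "v \<in> L2 U" "is_weak_grad U v G"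
  shows "AE x in lebesgue_on U. weak_grad U v x = G x"
proof -
  have "v \<in> H1 U" using assms by (auto simp: H1_def)
  from is_weak_grad_unique[OF assms(1,2) is_weak_grad_weak_grad[OF this] assms(4)] show ?thesis .
qed

lemma is_weak_grad_lincomb:
  assumes "open U" "u \<in> L2 U" "v \<in> L2 U" and uv: "is_weak_grad U u G" "is_weak_grad U v H"
  shows "is_weak_grad U (\<lambda>x. u x + c * v x) (\<lambda>x. G x + c *\<^sub>R H x)"
  unfolding is_weak_grad_def
proof (intro conjI ballI)
  have US: "U \<in> sets lebesgue" using assms(1) by auto
  have L: "G \<in> L2 U" "H \<in> L2 U" using uv by (auto simp: is_weak_grad_def)
  then show "(\<lambda>x. G x + c *\<^sub>R H x) \<in> L2 U" by auto
  fix \<phi> assume \<phi>: "\<phi> \<in> test_functions U"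
  note i1 = assms(2,3)[THEN L2_scaleR_integrable[OF _ test_function_grad_L2[OF \<phi> US]]]
  note i2 = L[THEN L2_scaleR_integrable[OF test_function_L2[OF \<phi> US]]]
  have "(LINT x|lebesgue_on U. (u x + c * v x) *\<^sub>R grad \<phi> x)
      = (LINT x|lebesgue_on U. u x *\<^sub>R grad \<phi> x) + c *\<^sub>R (LINT x|lebesgue_on U. v x *\<^sub>R grad \<phi> x)"
    using i1 by (simp add: scaleR_add_left scaleR_scaleR[symmetric] del: scaleR_scaleR)
  also have "\<dots> = - ((LINT x|lebesgue_on U. \<phi> x *\<^sub>R G x) + c *\<^sub>R (LINT x|lebesgue_on U. \<phi> x *\<^sub>R H x))"
    by (simp add: uv[THEN is_weak_gradD(2), OF \<phi>])
  also have "\<dots> = - (LINT x|lebesgue_on U. \<phi> x *\<^sub>R (G x + c *\<^sub>R H x))"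
    using i2 by (simp add: scaleR_add_right scaleR_left_commute[of _ c] del: scaleR_scaleR)
  finally show "(LINT x|lebesgue_on U. (u x + c * v x) *\<^sub>R grad \<phi> x) = - (LINT x|lebesgue_on U. \<phi> x *\<^sub>R (G x + c *\<^sub>R H x))" .
qed

lemma H1_lincomb:
  assumes "open U" "u \<in> H1 U" "v \<in> H1 U" shows "(\<lambda>x. u x + c * v x) \<in> H1 U"
  using is_weak_grad_lincomb[OF assms(1) assms(2,3)[THEN H1_L2] assms(2,3)[THEN is_weak_grad_weak_grad], of c]
    L2_add[OF H1_L2[OF assms(2)] L2_cmult[OF H1_L2[OF assms(3)], of c]]
  by (auto simp: H1_def)

lemma weak_grad_lincomb:
  assumes "open U" "bounded U" "u \<in> H1 U" "v \<in> H1 U"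
  shows "AE x in lebesgue_on U. weak_grad U (\<lambda>x. u x + c * v x) x = weak_grad U u x + c *\<^sub>R weak_grad U v x"
  using assms by (intro weak_grad_AE_eq is_weak_grad_lincomb is_weak_grad_weak_grad L2_add L2_cmult H1_L2)

section \<open>Integration by parts and the space of functions vanishing on the boundary\<close>

text \<open>The mean value inequality bounds all difference quotients by \<open>g\<close>, so
  dominated convergence applies along every sequence. Derivatives within a convex set
  \<open>S\<close> include the one-sided derivative at an end point of an interval.\<close>

lemma has_real_derivative_integral_dominated:
  fixes f f' :: "real \<Rightarrow> 'x \<Rightarrow> real"
  assumes "convex S" "t0 \<in> S"
    and int: "\<And>t. t \<in> S \<Longrightarrow> integrable M (f t)"
    and der: "\<And>t x. t \<in> S \<Longrightarrow> x \<in> space M \<Longrightarrow> ((\<lambda>t. f t x) has_real_derivative f' t x) (at t within S)"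
    and bound: "\<And>t x. t \<in> S \<Longrightarrow> x \<in> space M \<Longrightarrow> \<bar>f' t x\<bar> \<le> g x"
    and "integrable M g" "f' t0 \<in> borel_measurable M"
  shows "((\<lambda>t. LINT x|M. f t x) has_real_derivative (LINT x|M. f' t0 x)) (at t0 within S)"
  unfolding has_field_derivative_iff
proof (subst tendsto_at_iff_sequentially, intro allI impI)
  fix X assume X: "\<forall>i. X i \<in> S - {t0}" "X \<longlonglongrightarrow> t0"
  let ?q = "\<lambda>n x. (f (X n) x - f t0 x) / (X n - t0)"
  have "(\<lambda>n. LINT x|M. ?q n x) \<longlonglongrightarrow> (LINT x|M. f' t0 x)"
  proof (rule integral_dominated_convergence[where w=g])
    show "?q n \<in> borel_measurable M" for n
      using int[of "X n"] int[OF assms(2)] X(1) by (intro borel_measurable_divide borel_measurable_diff) auto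
    show "AE x in M. (\<lambda>n. ?q n x) \<longlonglongrightarrow> f' t0 x"
    proof (rule AE_I2)
      fix x assume "x \<in> space M"
      from der[OF assms(2) this, unfolded has_field_derivative_iff]
      show "(\<lambda>n. ?q n x) \<longlonglongrightarrow> f' t0 x"
        by (subst (asm) tendsto_at_iff_sequentially) (use X in \<open>auto simp: comp_def\<close>)
    qed
    show "AE x in M. norm (?q n x) \<le> g x" for n
    proof (rule AE_I2)
      fix x assume x: "x \<in> space M"
      have "norm (f (X n) x - f t0 x) \<le> g x * norm (X n - t0)"
        by (rule field_differentiable_bound[OF assms(1) der[OF _ x]]) (use bound[OF _ x] X(1) assms(2) in auto)
      moreover have "X n \<noteq> t0" using X(1) by auto
      ultimately show "norm (?q n x) \<le> g x" by (simp add: norm_divide pos_divide_le_eq)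
    qed
  qed (use assms in auto)
  moreover have "(LINT x|M. ?q n x) = ((LINT x|M. f (X n) x) - (LINT x|M. f t0 x)) / (X n - t0)" for n
  proof -
    have "X n \<in> S" using X(1) by auto
    then show ?thesis
      unfolding integral_divide_zero using Bochner_Integration.integral_diff[OF int int[OF assms(2)]] by simp
  qed
  ultimately show "((\<lambda>y. ((LINT x|M. f y x) - (LINT x|M. f t0 x)) / (y - t0)) \<circ> X) \<longlonglongrightarrow> (LINT x|M. f' t0 x)"
    unfolding comp_def by (simp only:)
qed

lemma lborel_integral_translate:
  fixes f :: "'a::euclidean_space \<Rightarrow> 'b::{banach, second_countable_topology}"
  assumes "f \<in> borel_measurable borel"
  shows "(LINT x|lborel. f (x + c)) = (LINT x|lborel. f x)"
proof -
  have "(LINT x|lborel. f x) = (LINT x|distr lborel borel ((+) c). f x)"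
    by (simp add: lborel_distr_plus)
  also have "\<dots> = (LINT x|lborel. f (c + x))" using assms by (subst integral_distr) auto
  finally show ?thesis by (simp add: add.commute)
qed

lemma has_real_derivative_along_line:
  assumes "times_cont_diff (Suc k) f"
  shows "((\<lambda>t. f (x + t *\<^sub>R h)) has_real_derivative grad f (x + t *\<^sub>R h) \<bullet> h) (at t within S)"
proof -
  have "((\<lambda>t. x + t *\<^sub>R h) has_derivative (\<lambda>s. s *\<^sub>R h)) (at t within S)"
    by (auto intro!: derivative_eq_intros)
  from has_derivative_compose[OF this has_derivative_grad[OF assms]]
  have "((\<lambda>t. f (x + t *\<^sub>R h)) has_derivative (\<lambda>s. grad f (x + t *\<^sub>R h) \<bullet> (s *\<^sub>R h))) (at t within S)" .
  then show ?thesis by (simp add: has_field_derivative_def mult.commute[of _ "_ \<bullet> h"])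
qed

text \<open>The integral of a translate of \<open>\<psi>\<close> does not depend on the translation
  vector t h; differentiating it at t = 0 gives the integral of the derivative of
  \<open>\<psi>\<close> along h.\<close>

lemma integral_grad_compact_support:
  fixes \<psi> :: "'a::euclidean_space \<Rightarrow> real"
  assumes sm: "times_cont_diff (Suc k) \<psi>" and K: "compact K" "\<And>x. x \<notin> K \<Longrightarrow> \<psi> x = 0"
  shows "(LINT x|lborel. grad \<psi> x) = 0"
proof -
  have g0: "\<And>x. x \<notin> K \<Longrightarrow> grad \<psi> x = 0" by (rule grad_zero_outside[OF compact_imp_closed[OF K(1)] K(2)])
  have cont: "continuous_on UNIV \<psi>" "continuous_on UNIV (grad \<psi>)"
    by (rule times_cont_diff_continuous[OF sm], rule continuous_grad[OF sm])
  have int: "integrable lborel (grad \<psi>)"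
    by (rule continuous_compact_support_integrable[OF cont(2) K(1) g0])
  have "(LINT x|lborel. grad \<psi> x) \<bullet> h = 0" for h
  proof -
    have "compact ((\<lambda>x. grad \<psi> x \<bullet> h) ` K)"
      using K(1) cont(2) by (intro compact_continuous_image continuous_intros continuous_on_subset[OF cont(2)]) auto
    then obtain B where B: "\<And>x. x \<in> K \<Longrightarrow> \<bar>grad \<psi> x \<bullet> h\<bar> \<le> B"
      using compact_imp_bounded bounded_iff by (metis (no_types, lifting) image_eqI real_norm_def)
    \<comment> \<open>One compact set containing the supports of all translates with t between -1
      and 1, so that a single integrable function dominates.\<close>
    define K' where "K' = (\<lambda>(x, t). x - t *\<^sub>R h) ` (K \<times> {-1..1})"
    have K': "compact K'" unfolding K'_def
      by (intro compact_continuous_image compact_Times K continuous_intros) (auto simp: case_prod_unfold intro!: continuous_intros)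
    have in_K': "x \<in> K'" if "x + t *\<^sub>R h \<in> K" "t \<in> {-1..1}" for x t
      unfolding K'_def using that by (intro image_eqI[of _ _ "(x + t *\<^sub>R h, t)"]) auto
    have "((\<lambda>t. LINT x|lborel. \<psi> (x + t *\<^sub>R h)) has_real_derivative (LINT x|lborel. grad \<psi> (x + 0 *\<^sub>R h) \<bullet> h)) (at 0 within {-1..1})"
    proof (rule has_real_derivative_integral_dominated[where g="\<lambda>x. indicator K' x *\<^sub>R \<bar>B\<bar>"])
      show "integrable lborel (\<lambda>x. \<psi> (x + t *\<^sub>R h))" if "t \<in> {-1..1}" for t
        by (rule continuous_compact_support_integrable[OF _ K'])
          (use in_K' that K(2) in \<open>auto intro!: continuous_on_compose2[OF cont(1)] continuous_intros\<close>)
      show "((\<lambda>t. \<psi> (x + t *\<^sub>R h)) has_real_derivative grad \<psi> (x + t *\<^sub>R h) \<bullet> h) (at t within {-1..1})" for t x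
        by (rule has_real_derivative_along_line[OF sm])
      show "\<bar>grad \<psi> (x + t *\<^sub>R h) \<bullet> h\<bar> \<le> indicator K' x *\<^sub>R \<bar>B\<bar>" if "t \<in> {-1..1}" for t x
      proof (cases "x + t *\<^sub>R h \<in> K")
        case True
        then show ?thesis using B[OF True] in_K'[OF True that] by simp
      qed (simp add: g0)
      show "integrable lborel (\<lambda>x. indicator K' x *\<^sub>R \<bar>B\<bar>)"
        by (rule borel_integrable_compact[OF K']) auto
      show "(\<lambda>x. grad \<psi> (x + 0 *\<^sub>R h) \<bullet> h) \<in> borel_measurable lborel"
        using cont(2) by (auto intro!: borel_measurable_continuous_onI continuous_intros)
    qed auto
    moreover have "(LINT x|lborel. \<psi> (x + t *\<^sub>R h)) = (LINT x|lborel. \<psi> x)" for t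
      by (rule lborel_integral_translate) (use cont(1) in \<open>auto intro: borel_measurable_continuous_onI\<close>)
    ultimately have "((\<lambda>t. LINT x|lborel. \<psi> x) has_real_derivative (LINT x|lborel. grad \<psi> x \<bullet> h)) (at 0 within {-1..1})"
      by simp
    then have "((\<lambda>t. LINT x|lborel. \<psi> x) has_real_derivative (LINT x|lborel. grad \<psi> x \<bullet> h)) (at 0)"
      by (subst (asm) at_within_interior) auto
    then have "(LINT x|lborel. grad \<psi> x \<bullet> h) = 0"
      using DERIV_unique[OF _ DERIV_const] by blast
    then show ?thesis using int by simp
  qed
  then show ?thesis by (metis inner_eq_zero_iff)
qed

lemma integral_lebesgue_on_zero_outside:
  fixes g :: "'a::euclidean_space \<Rightarrow> 'b::euclidean_space"
  assumes "U \<in> sets lebesgue" "\<And>x. x \<notin> U \<Longrightarrow> g x = 0"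
  shows "(LINT x|lebesgue_on U. g x) = (LINT x|lebesgue. g x)"
proof -
  have "(\<lambda>x. indicator U x *\<^sub>R g x) = g" using assms(2) by (auto simp: indicator_def)
  then show ?thesis using assms(1) by (simp add: integral_restrict_space)
qed

lemma grad_mult:
  assumes "times_cont_diff (Suc k) f" "times_cont_diff (Suc k) g"
  shows "grad (\<lambda>x. f x * g x) x = f x *\<^sub>R grad g x + g x *\<^sub>R grad f x"
proof (rule grad_eqI)
  have "((\<lambda>x. f x * g x) has_derivative (\<lambda>h. f x * (grad g x \<bullet> h) + (grad f x \<bullet> h) * g x)) (at x)"
    by (intro has_derivative_mult has_derivative_grad[OF assms(1)] has_derivative_grad[OF assms(2)])
  then show "((\<lambda>x. f x * g x) has_derivative (\<lambda>h. (f x *\<^sub>R grad g x + g x *\<^sub>R grad f x) \<bullet> h)) (at x)"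
    by (simp add: inner_add_left mult.commute)
qed

text \<open>The product of \<open>f\<close> and \<open>\<phi>\<close> vanishes outside the support
  of \<open>\<phi>\<close>, so its gradient has integral zero; the rest is the product rule.\<close>

lemma integration_by_parts_test:
  fixes f :: "'a::euclidean_space \<Rightarrow> real"
  assumes f: "times_cont_diff (Suc 0) f" and \<phi>: "\<phi> \<in> test_functions U" and U: "U \<in> sets lebesgue"
  shows "(LINT x|lebesgue_on U. f x *\<^sub>R grad \<phi> x) = - (LINT x|lebesgue_on U. \<phi> x *\<^sub>R grad f x)"
proof -
  obtain K where K: "compact K" "K \<subseteq> U" "\<And>x. x \<notin> K \<Longrightarrow> \<phi> x = 0" "\<And>x. x \<notin> K \<Longrightarrow> grad \<phi> x = 0"
    "continuous_on UNIV \<phi>" "continuous_on UNIV (grad \<phi>)"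
    using test_function_grad_support[OF \<phi>] by metis
  have c: "continuous_on UNIV (\<lambda>x. f x *\<^sub>R grad \<phi> x)" "continuous_on UNIV (\<lambda>x. \<phi> x *\<^sub>R grad f x)"
    by (intro continuous_on_scaleR times_cont_diff_continuous[OF f] continuous_grad[OF f] K(5,6))+
  have i: "integrable lborel (\<lambda>x. f x *\<^sub>R grad \<phi> x)" "integrable lborel (\<lambda>x. \<phi> x *\<^sub>R grad f x)"
    using c K by (auto intro!: continuous_compact_support_integrable[of _ K])
  have eq: "(LINT x|lebesgue_on U. g x) = (LINT x|lborel. g x)"
    if "continuous_on UNIV g" "\<And>x. x \<notin> K \<Longrightarrow> g x = 0" for g :: "'a \<Rightarrow> 'a"
  proof -
    have "(LINT x|lebesgue_on U. g x) = (LINT x|lebesgue. g x)"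
      using that(2) K(2) U by (intro integral_lebesgue_on_zero_outside) auto
    then show ?thesis using that(1) by (simp add: integral_completion borel_measurable_continuous_onI)
  qed
  have "(LINT x|lborel. grad (\<lambda>x. f x * \<phi> x) x) = 0"
    by (rule integral_grad_compact_support[where K=K and k=0])
       (use K in \<open>auto intro: times_cont_diff_mult f test_function_smooth[OF \<phi>] simp del: times_cont_diff.simps\<close>)
  then have "(LINT x|lborel. f x *\<^sub>R grad \<phi> x + \<phi> x *\<^sub>R grad f x) = 0"
    by (simp add: grad_mult[OF f test_function_smooth[OF \<phi>]])
  then have "(LINT x|lborel. f x *\<^sub>R grad \<phi> x) + (LINT x|lborel. \<phi> x *\<^sub>R grad f x) = 0"
    using i by simp
  then show ?thesis using eq[OF c(1)] eq[OF c(2)] K by (simp add: eq_neg_iff_add_eq_0)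
qed

lemma is_weak_grad_grad:
  fixes f :: "'a::euclidean_space \<Rightarrow> real"
  assumes "times_cont_diff (Suc 0) f" "grad f \<in> L2 U" "U \<in> sets lebesgue"
  shows "is_weak_grad U f (grad f)"
  using integration_by_parts_test[OF assms(1) _ assms(3)] assms(2) by (auto simp: is_weak_grad_def)

lemma test_function_is_weak_grad:
  "\<phi> \<in> test_functions U \<Longrightarrow> open V \<Longrightarrow> is_weak_grad V \<phi> (grad \<phi>)"
  by (intro is_weak_grad_grad test_function_grad_L2 test_function_smooth) auto

lemma l2_norm_mono:
  assumes "f \<in> L2 S" "g \<in> L2 S" "0 \<le> c" "\<And>x. x \<in> S \<Longrightarrow> norm (f x) \<le> c * norm (g x)"
  shows "l2_norm S f \<le> c * l2_norm S g"
proof (rule power2_le_imp_le)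
  have "l2_inner S f f \<le> (LINT x|lebesgue_on S. c\<^sup>2 * (g x \<bullet> g x))"
    unfolding l2_inner_def
  proof (rule integral_mono)
    fix x assume "x \<in> space (lebesgue_on S)"
    then have "(norm (f x))\<^sup>2 \<le> (c * norm (g x))\<^sup>2" using assms(4) by (intro power_mono) auto
    then show "f x \<bullet> f x \<le> c\<^sup>2 * (g x \<bullet> g x)" by (simp add: power_mult_distrib power2_norm_eq_inner)
  qed (use assms(1,2) L2_inner_integrable in auto)
  then show "(l2_norm S f)\<^sup>2 \<le> (c * l2_norm S g)\<^sup>2"
    by (simp add: l2_norm_square power_mult_distrib l2_inner_def)
qed (use assms in simp)

text \<open>Integration by parts with the factor x_i, whose i-th derivative is 1, shows that the
  square of the norm of \<open>\<phi>\<close> is -2 times the inner product of x_i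
  \<open>\<phi>\<close> with the i-th derivative of \<open>\<phi>\<close>. As x_i is at most R on
  \<open>U\<close>, the constant is 2 R.\<close>

lemma Friedrichs_test:
  fixes U :: "'a::euclidean_space set"
  assumes "open U" "bounded U"
  obtains C where "0 \<le> C" "\<And>\<phi>. \<phi> \<in> test_functions U \<Longrightarrow> l2_norm U \<phi> \<le> C * l2_norm U (grad \<phi>)"
proof -
  obtain R where R: "R > 0" "\<And>x. x \<in> U \<Longrightarrow> norm x \<le> R" using assms(2) bounded_pos by blast
  obtain i :: 'a where i: "i \<in> Basis" using nonempty_Basis by blast
  have US: "U \<in> sets lebesgue" using assms(1) by auto
  have xi: "times_cont_diff k (\<lambda>x. x \<bullet> i)" for k
    by (intro times_cont_diff_bounded_linear bounded_linear_inner_left)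
  have gxi: "grad (\<lambda>x. x \<bullet> i) x = i" for x
    by (rule grad_eqI) (auto intro!: derivative_eq_intros simp: inner_commute)
  have "l2_norm U \<phi> \<le> 2 * R * l2_norm U (grad \<phi>)" if \<phi>: "\<phi> \<in> test_functions U" for \<phi>
  proof -
    let ?h = "\<lambda>x. (x \<bullet> i) * \<phi> x"
    let ?d = "\<lambda>x. grad \<phi> x \<bullet> i"
    have h: "?h \<in> test_functions U" by (intro test_function_mult_smooth \<phi> xi)
    have L: "?h \<in> L2 U" "\<phi> \<in> L2 U" "grad \<phi> \<in> L2 U" "?d \<in> L2 U"
      using test_function_L2[OF h US] test_function_L2[OF \<phi> US] test_function_grad_L2[OF \<phi> US] L2_inner_const by auto
    have gh: "grad ?h x = (x \<bullet> i) *\<^sub>R grad \<phi> x + \<phi> x *\<^sub>R i" for x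
      using grad_mult[OF xi test_function_smooth[OF \<phi>], where x=x] by (simp add: gxi)
    have "(LINT x|lebesgue_on U. ?h x *\<^sub>R grad \<phi> x) \<bullet> i = - (LINT x|lebesgue_on U. \<phi> x *\<^sub>R grad ?h x) \<bullet> i"
      using integration_by_parts_test[OF test_function_smooth[OF h] \<phi> US] by simp
    then have "(LINT x|lebesgue_on U. (?h x *\<^sub>R grad \<phi> x) \<bullet> i) = - (LINT x|lebesgue_on U. (\<phi> x *\<^sub>R grad ?h x) \<bullet> i)"
      by (subst (1 2) integral_inner_left)
        (use L2_scaleR_integrable[OF L(1,3)] L2_scaleR_integrable[OF L(2) test_function_grad_L2[OF h US]] in auto)
    then have "l2_inner U ?h ?d = - (LINT x|lebesgue_on U. ?h x * ?d x + \<phi> x * \<phi> x)"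
      using i unfolding l2_inner_def gh by (simp add: inner_add_left algebra_simps)
    also have "(LINT x|lebesgue_on U. ?h x * ?d x + \<phi> x * \<phi> x) = l2_inner U ?h ?d + l2_inner U \<phi> \<phi>"
      using L2_mult_integrable[OF L(1,4)] L2_mult_integrable[OF L(2,2)] by (simp add: l2_inner_def)
    finally have "(l2_norm U \<phi>)\<^sup>2 = - 2 * l2_inner U ?h ?d" by (simp add: l2_norm_square)
    also have "\<dots> \<le> 2 * (l2_norm U ?h * l2_norm U ?d)"
      using l2_Cauchy_Schwarz[OF L(1,4)] by linarith
    also have "l2_norm U ?h * l2_norm U ?d \<le> (R * l2_norm U \<phi>) * (1 * l2_norm U (grad \<phi>))"
    proof (intro mult_mono l2_norm_mono L)
      fix x assume x: "x \<in> U"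
      have "\<bar>x \<bullet> i\<bar> \<le> R" using R(2)[OF x] Basis_le_norm[OF i, of x] by linarith
      then show "norm (?h x) \<le> R * norm (\<phi> x)" by (simp add: abs_mult mult_right_mono)
      show "norm (?d x) \<le> 1 * norm (grad \<phi> x)" using Basis_le_norm[OF i] by simp
    qed (use R in auto)
    finally have "l2_norm U \<phi> * l2_norm U \<phi> \<le> 2 * R * l2_norm U (grad \<phi>) * l2_norm U \<phi>"
      by (simp add: power2_eq_square algebra_simps)
    then show ?thesis
    proof (cases "l2_norm U \<phi> = 0")
      case False
      then have "l2_norm U \<phi> > 0" using l2_norm_nonneg[of U \<phi>] by linarith
      with \<open>l2_norm U \<phi> * l2_norm U \<phi> \<le> _\<close> show ?thesis by (simp only: mult_le_cancel_right_pos)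
    qed (use R in simp)
  qed
  then show ?thesis using that[of "2 * R"] R by simp
qed

lemma weak_grad_diff_test:
  assumes "open U" "bounded U" "v \<in> H1 U" "\<phi> \<in> test_functions U"
  shows "(\<lambda>x. v x - \<phi> x) \<in> H1 U" "\<phi> \<in> H1 U"
    "AE x in lebesgue_on U. weak_grad U (\<lambda>x. v x - \<phi> x) x = weak_grad U v x - grad \<phi> x"
proof -
  have US: "U \<in> sets lebesgue" using assms(1) by auto
  have L: "\<phi> \<in> L2 U" "v \<in> L2 U" using test_function_L2[OF assms(4) US] assms(3) by (auto simp: H1_L2)
  have w: "is_weak_grad U \<phi> (grad \<phi>)" by (rule test_function_is_weak_grad[OF assms(4,1)])
  show "\<phi> \<in> H1 U" using L w by (auto simp: H1_def)
  have *: "is_weak_grad U (\<lambda>x. v x - \<phi> x) (\<lambda>x. weak_grad U v x - grad \<phi> x)"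
    using is_weak_grad_lincomb[OF assms(1) L(2,1) is_weak_grad_weak_grad[OF assms(3)] w, of "-1"] by simp
  have "(\<lambda>x. v x - \<phi> x) \<in> L2 U" using L by auto
  then show "(\<lambda>x. v x - \<phi> x) \<in> H1 U" "AE x in lebesgue_on U. weak_grad U (\<lambda>x. v x - \<phi> x) x = weak_grad U v x - grad \<phi> x"
    using * weak_grad_AE_eq[OF assms(1,2)] by (auto simp: H1_def)
qed

section \<open>The closure of the test functions\<close>

lemma H01_H1: "v \<in> H01 U \<Longrightarrow> v \<in> H1 U"
  by (simp add: H01_def)

lemma H1_norm_diff_test:
  assumes "open U" "bounded U" "v \<in> H1 U" "\<phi> \<in> test_functions U"
  shows "H1_norm U (\<lambda>x. v x - \<phi> x)
    = sqrt ((l2_norm U (\<lambda>x. v x - \<phi> x))\<^sup>2 + (l2_norm U (\<lambda>x. weak_grad U v x - grad \<phi> x))\<^sup>2)"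
proof -
  have "l2_norm U (weak_grad U (\<lambda>x. v x - \<phi> x)) = l2_norm U (\<lambda>x. weak_grad U v x - grad \<phi> x)"
    using weak_grad_diff_test[OF assms] assms
    by (intro l2_norm_cong_AE weak_grad_L2 L2_diff test_function_grad_L2) auto
  then show ?thesis by (simp add: H1_norm_def H1_seminorm_def)
qed

lemma H01_approx:
  assumes "open U" "bounded U" "v \<in> H01 U" "e > 0"
  obtains \<phi> where "\<phi> \<in> test_functions U" "l2_norm U (\<lambda>x. v x - \<phi> x) < e"
    "l2_norm U (\<lambda>x. weak_grad U v x - grad \<phi> x) < e"
proof -
  obtain \<phi> where \<phi>: "\<phi> \<in> test_functions U" "H1_norm U (\<lambda>x. v x - \<phi> x) < e"
    using assms by (auto simp: H01_def)
  note n = H1_norm_diff_test[OF assms(1,2) H01_H1[OF assms(3)] \<phi>(1)]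
  show ?thesis
  proof (rule that[OF \<phi>(1)])
    show "l2_norm U (\<lambda>x. v x - \<phi> x) < e"
      using \<phi>(2) n real_sqrt_sum_squares_ge1[of "l2_norm U (\<lambda>x. v x - \<phi> x)" "l2_norm U (\<lambda>x. weak_grad U v x - grad \<phi> x)"]
      by linarith
    show "l2_norm U (\<lambda>x. weak_grad U v x - grad \<phi> x) < e"
      using \<phi>(2) n real_sqrt_sum_squares_ge2[of "l2_norm U (\<lambda>x. weak_grad U v x - grad \<phi> x)" "l2_norm U (\<lambda>x. v x - \<phi> x)"]
      by linarith
  qed
qed

lemma H01I:
  assumes "open U" "bounded U" "v \<in> H1 U"
    and "\<And>e. e > 0 \<Longrightarrow> \<exists>\<phi>\<in>test_functions U. l2_norm U (\<lambda>x. v x - \<phi> x) < e \<and> l2_norm U (\<lambda>x. weak_grad U v x - grad \<phi> x) < e"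
  shows "v \<in> H01 U"
  unfolding H01_def
proof (intro CollectI conjI allI impI)
  fix e :: real assume "e > 0"
  then obtain \<phi> where \<phi>: "\<phi> \<in> test_functions U" "l2_norm U (\<lambda>x. v x - \<phi> x) < e / 2"
    "l2_norm U (\<lambda>x. weak_grad U v x - grad \<phi> x) < e / 2"
    using assms(4)[of "e / 2"] by auto
  have "H1_norm U (\<lambda>x. v x - \<phi> x) \<le> l2_norm U (\<lambda>x. v x - \<phi> x) + l2_norm U (\<lambda>x. weak_grad U v x - grad \<phi> x)"
    unfolding H1_norm_diff_test[OF assms(1-3) \<phi>(1)] by (rule sqrt_sum_squares_le_sum) auto
  then show "\<exists>\<phi>\<in>test_functions U. H1_norm U (\<lambda>x. v x - \<phi> x) < e" using \<phi> by force
qed (use assms in simp)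

lemma grad_lincomb:
  assumes "times_cont_diff (Suc k) f" "times_cont_diff (Suc k) g"
  shows "grad (\<lambda>x. f x + c * g x) x = grad f x + c *\<^sub>R grad g x"
proof (rule grad_eqI)
  have "((\<lambda>x. f x + c * g x) has_derivative (\<lambda>h. grad f x \<bullet> h + c * (grad g x \<bullet> h))) (at x)"
    by (intro has_derivative_add has_derivative_mult_right has_derivative_grad[OF assms(1)] has_derivative_grad[OF assms(2)])
  then show "((\<lambda>x. f x + c * g x) has_derivative (\<lambda>h. (grad f x + c *\<^sub>R grad g x) \<bullet> h)) (at x)"
    by (simp add: inner_add_left)
qed

lemma l2_norm_scaleR: "l2_norm S (\<lambda>x. c *\<^sub>R f x) = \<bar>c\<bar> * l2_norm S f"
proof -
  have "l2_inner S (\<lambda>x. c *\<^sub>R f x) (\<lambda>x. c *\<^sub>R f x) = c\<^sup>2 * l2_inner S f f"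
    unfolding l2_inner_scaleR_left l2_inner_commute[of S f "\<lambda>x. c *\<^sub>R f x"] by (simp add: power2_eq_square)
  then show ?thesis by (simp add: l2_norm_def real_sqrt_mult)
qed

lemma H01_lincomb:
  assumes U: "open U" "bounded U" and u: "u \<in> H01 U" and v: "v \<in> H01 U"
  shows "(\<lambda>x. u x + c * v x) \<in> H01 U"
proof (rule H01I[OF U H1_lincomb[OF U(1) u[THEN H01_H1] v[THEN H01_H1]]])
  fix e :: real assume e: "e > 0"
  have US: "U \<in> sets lebesgue" using U by auto
  \<comment> \<open>The errors of the two approximations enter with weights 1 and the modulus of
    \<open>c\<close>, so both are made smaller than this share of \<open>e\<close>.\<close>
  define d where "d = e / (1 + \<bar>c\<bar>)"
  have "(1 + \<bar>c\<bar>) * d = e" by (simp add: d_def add_nonneg_eq_0_iff)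
  then have d: "d > 0" "d + \<bar>c\<bar> * d = e" using e by (simp_all add: distrib_right) (simp add: d_def add_pos_nonneg)
  obtain \<phi> where \<phi>: "\<phi> \<in> test_functions U" "l2_norm U (\<lambda>x. u x - \<phi> x) < d"
    "l2_norm U (\<lambda>x. weak_grad U u x - grad \<phi> x) < d" using H01_approx[OF U u d(1)] by blast
  obtain \<eta> where \<eta>: "\<eta> \<in> test_functions U" "l2_norm U (\<lambda>x. v x - \<eta> x) < d"
    "l2_norm U (\<lambda>x. weak_grad U v x - grad \<eta> x) < d" using H01_approx[OF U v d(1)] by blast
  let ?\<phi> = "\<lambda>x. \<phi> x + c * \<eta> x"
  have t: "?\<phi> \<in> test_functions U" by (intro test_function_add test_function_cmult \<phi> \<eta>)
  note L = H1_L2[OF H01_H1[OF u]] H1_L2[OF H01_H1[OF v]] test_function_L2[OF \<phi>(1) US] test_function_L2[OF \<eta>(1) US]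
  note G = weak_grad_L2[OF H01_H1[OF u]] weak_grad_L2[OF H01_H1[OF v]] test_function_grad_L2[OF \<phi>(1) US] test_function_grad_L2[OF \<eta>(1) US]
  have le: "x < d \<Longrightarrow> y < d \<Longrightarrow> x + \<bar>c\<bar> * y < e" for x y
    using d mult_left_mono[of y d "\<bar>c\<bar>"] by linarith
  have "l2_norm U (\<lambda>x. (u x - \<phi> x) + c * (v x - \<eta> x)) \<le> l2_norm U (\<lambda>x. u x - \<phi> x) + l2_norm U (\<lambda>x. c * (v x - \<eta> x))"
    using L by (intro l2_norm_triangle L2_diff L2_cmult)
  then have 1: "l2_norm U (\<lambda>x. (u x + c * v x) - ?\<phi> x) < e"
    using le[OF \<phi>(2) \<eta>(2)] unfolding l2_norm_cmult by (simp add: algebra_simps)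
  have "l2_norm U (\<lambda>x. weak_grad U (\<lambda>x. u x + c * v x) x - grad ?\<phi> x)
      = l2_norm U (\<lambda>x. (weak_grad U u x - grad \<phi> x) + c *\<^sub>R (weak_grad U v x - grad \<eta> x))"
  proof (rule l2_norm_cong_AE)
    show "AE x in lebesgue_on U. weak_grad U (\<lambda>x. u x + c * v x) x - grad ?\<phi> x
        = (weak_grad U u x - grad \<phi> x) + c *\<^sub>R (weak_grad U v x - grad \<eta> x)"
      using weak_grad_lincomb[OF U H01_H1[OF u] H01_H1[OF v], of c]
      by eventually_elim
         (simp add: grad_lincomb[OF test_function_smooth[OF \<phi>(1)] test_function_smooth[OF \<eta>(1), of "Suc 0"]] algebra_simps)
    show "(\<lambda>x. weak_grad U (\<lambda>x. u x + c * v x) x - grad ?\<phi> x) \<in> L2 U"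
      by (intro L2_diff weak_grad_L2 H1_lincomb U H01_H1 u v test_function_grad_L2[OF t US])
    show "(\<lambda>x. (weak_grad U u x - grad \<phi> x) + c *\<^sub>R (weak_grad U v x - grad \<eta> x)) \<in> L2 U"
      using G by (intro L2_add L2_scaleR L2_diff)
  qed
  also have "\<dots> \<le> l2_norm U (\<lambda>x. weak_grad U u x - grad \<phi> x) + l2_norm U (\<lambda>x. c *\<^sub>R (weak_grad U v x - grad \<eta> x))"
    using G by (intro l2_norm_triangle L2_diff L2_scaleR)
  also have "\<dots> < e" using le[OF \<phi>(3) \<eta>(3)] by (simp add: l2_norm_scaleR)
  finally show "\<exists>\<phi>\<in>test_functions U. l2_norm U (\<lambda>x. (u x + c * v x) - \<phi> x) < e \<and>
      l2_norm U (\<lambda>x. weak_grad U (\<lambda>x. u x + c * v x) x - grad \<phi> x) < e"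
    using 1 t by (intro bexI[of _ ?\<phi>] conjI)
qed

lemma test_function_H01:
  assumes "open U" "bounded U" "\<phi> \<in> test_functions U" shows "\<phi> \<in> H01 U"
proof (rule H01I[OF assms(1,2)])
  have US: "U \<in> sets lebesgue" using assms by auto
  have L: "\<phi> \<in> L2 U" by (rule test_function_L2[OF assms(3) US])
  have w: "is_weak_grad U \<phi> (grad \<phi>)" by (rule test_function_is_weak_grad[OF assms(3,1)])
  show H: "\<phi> \<in> H1 U" using L w by (auto simp: H1_def)
  have "AE x in lebesgue_on U. weak_grad U \<phi> x - grad \<phi> x = 0"
    using weak_grad_AE_eq[OF assms(1,2) L w] by simp
  then have "l2_norm U (\<lambda>x. weak_grad U \<phi> x - grad \<phi> x) = 0"
    by (intro l2_norm_AE_0 L2_diff weak_grad_L2 H test_function_grad_L2[OF assms(3) US])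
  moreover have "l2_norm U (\<lambda>x. \<phi> x - \<phi> x) = 0" by (intro l2_norm_AE_0 L2_diff L) simp
  ultimately show "\<exists>\<phi>'\<in>test_functions U. l2_norm U (\<lambda>x. \<phi> x - \<phi>' x) < e \<and> l2_norm U (\<lambda>x. weak_grad U \<phi> x - grad \<phi>' x) < e"
    if "e > 0" for e using that assms(3) by force
qed

text \<open>Both sides are continuous in the H1 norm, so the inequality passes from test functions
  to their closure.\<close>

lemma Friedrichs:
  fixes U :: "'a::euclidean_space set"
  assumes U: "open U" "bounded U"
  obtains C where "0 \<le> C" "\<And>v. v \<in> H01 U \<Longrightarrow> l2_norm U v \<le> C * l2_norm U (weak_grad U v)"
proof -
  obtain C where C: "0 \<le> C" "\<And>\<phi>. \<phi> \<in> test_functions U \<Longrightarrow> l2_norm U \<phi> \<le> C * l2_norm U (grad \<phi>)"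
    using Friedrichs_test[OF U] by blast
  have US: "U \<in> sets lebesgue" using U by auto
  have "l2_norm U v \<le> C * l2_norm U (weak_grad U v)" if v: "v \<in> H01 U" for v
  proof (rule field_le_epsilon)
    fix e :: real assume e: "e > 0"
    define d where "d = e / (1 + C)"
    have "(1 + C) * d = e" using C(1) by (simp add: d_def)
    then have d: "d > 0" "d + C * d = e" using e C(1) by (simp_all add: distrib_right) (simp add: d_def)
    obtain \<phi> where \<phi>: "\<phi> \<in> test_functions U" "l2_norm U (\<lambda>x. v x - \<phi> x) < d"
      "l2_norm U (\<lambda>x. weak_grad U v x - grad \<phi> x) < d" using H01_approx[OF U v d(1)] by blast
    note L = H1_L2[OF H01_H1[OF v]] test_function_L2[OF \<phi>(1) US] weak_grad_L2[OF H01_H1[OF v]] test_function_grad_L2[OF \<phi>(1) US]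
    have "l2_norm U v \<le> l2_norm U (\<lambda>x. v x - \<phi> x) + l2_norm U \<phi>"
      using l2_norm_triangle[OF L2_diff[OF L(1,2)] L(2)] by simp
    moreover have "l2_norm U (grad \<phi>) \<le> l2_norm U (\<lambda>x. grad \<phi> x - weak_grad U v x) + l2_norm U (weak_grad U v)"
      using l2_norm_triangle[OF L2_diff[OF L(4,3)] L(3)] by simp
    then have "l2_norm U (grad \<phi>) \<le> d + l2_norm U (weak_grad U v)"
      using \<phi>(3) by (simp add: l2_norm_minus[of U "grad \<phi>"])
    then have "C * l2_norm U (grad \<phi>) \<le> C * (d + l2_norm U (weak_grad U v))" using C(1) by (intro mult_left_mono)
    ultimately have "l2_norm U v \<le> d + C * (d + l2_norm U (weak_grad U v))"
      using C(2)[OF \<phi>(1)] \<phi>(2) by linarith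
    then show "l2_norm U v \<le> C * l2_norm U (weak_grad U v) + e" using d(2) by (simp add: algebra_simps)
  qed
  then show ?thesis using that C(1) by blast
qed

section \<open>The Poincare inequality on bounded convex open sets\<close>

lemma lborel_integrable_translate:
  fixes f :: "'a::euclidean_space \<Rightarrow> 'b::{banach, second_countable_topology}"
  assumes "f \<in> borel_measurable borel"
  shows "integrable lborel (\<lambda>x. f (x + c)) \<longleftrightarrow> integrable lborel f"
proof -
  have "integrable lborel f \<longleftrightarrow> integrable (distr lborel borel ((+) c)) f"
    by (simp add: lborel_distr_plus)
  also have "\<dots> \<longleftrightarrow> integrable lborel (\<lambda>x. f (c + x))" using assms by (subst integrable_distr_eq) auto
  finally show ?thesis by (simp add: add.commute)
qed

lemma lborel_nn_integral_translate:
  fixes f :: "'a::euclidean_space \<Rightarrow> ennreal"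
  assumes "f \<in> borel_measurable borel"
  shows "(\<integral>\<^sup>+x. f (c + x) \<partial>lborel) = (\<integral>\<^sup>+x. f x \<partial>lborel)"
proof -
  have "(\<integral>\<^sup>+x. f x \<partial>lborel) = (\<integral>\<^sup>+x. f x \<partial>distr lborel borel ((+) c))"
    by (simp add: lborel_distr_plus)
  also have "\<dots> = (\<integral>\<^sup>+x. f (c + x) \<partial>lborel)" using assms by (subst nn_integral_distr) auto
  finally show ?thesis by simp
qed

lemma L2_lborelI:
  fixes f :: "'a::euclidean_space \<Rightarrow> 'b::euclidean_space"
  assumes "f \<in> borel_measurable borel" "integrable lborel (\<lambda>x. (norm (f x))\<^sup>2)" "S \<in> sets lebesgue"
  shows "f \<in> L2 S"
proof -
  have "f \<in> L2 UNIV"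
    using assms(1,2) by (simp add: L2_def lebesgue_on_UNIV_eq integrable_completion measurable_completion)
  then show ?thesis by (rule L2_mono) (use assms(3) in auto)
qed

lemma integral_lebesgue_on_eq_lborel:
  fixes g :: "'a::euclidean_space \<Rightarrow> 'b::euclidean_space"
  assumes "U \<in> sets lebesgue" "\<And>x. x \<notin> U \<Longrightarrow> g x = 0" "g \<in> borel_measurable borel"
  shows "(LINT x|lebesgue_on U. g x) = (LINT x|lborel. g x)"
  using integral_lebesgue_on_zero_outside[OF assms(1,2)] assms(3) by (simp add: integral_completion)

text \<open>Translations and Fubini are applied to Borel functions on the whole space. Changing
  \<open>v\<close> on a null set and extending it by zero makes them available.\<close>

lemma L2_borel_representative:
  fixes v :: "'a::euclidean_space \<Rightarrow> real"
  assumes "open K" "v \<in> L2 K"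
  obtains v' where "v' \<in> borel_measurable borel" "\<And>x. x \<notin> K \<Longrightarrow> v' x = 0"
    "integrable lborel (\<lambda>x. (v' x)\<^sup>2)" "AE x in lebesgue_on K. v x = v' x"
proof -
  have KS: "K \<in> sets lebesgue" using assms(1) by auto
  have "(\<lambda>x. indicator K x *\<^sub>R v x) \<in> borel_measurable lebesgue"
    using L2_measurable[OF assms(2)] KS by (subst borel_measurable_restrict_space_iff[symmetric]) auto
  then have "(\<lambda>x. indicator K x * v x) \<in> borel_measurable (completion lborel)" by simp
  from completion_ex_borel_measurable_real[OF this]
  obtain g where g: "g \<in> borel_measurable lborel" "AE x in lborel. indicator K x * v x = g x" by blast
  define v' where "v' x = indicator K x * g x" for x
  have m: "v' \<in> borel_measurable borel" 
    unfolding v'_def using g(1) borel_open[OF assms(1)] by (intro borel_measurable_times borel_measurable_indicator) auto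
  have "AE x in lebesgue. indicator K x * v x = g x" using g(2) by (rule AE_completion)
  then have ae: "AE x in lebesgue. x \<in> K \<longrightarrow> v x = v' x" by eventually_elim (auto simp: v'_def)
  then have ae': "AE x in lebesgue_on K. v x = v' x" using KS by (subst AE_restrict_space_iff) auto
  have "integrable lebesgue (\<lambda>x. indicator K x *\<^sub>R (norm (v x))\<^sup>2)"
    using L2_integrable[OF assms(2)] KS by (simp add: integrable_restrict_space)
  then have "integrable lebesgue (\<lambda>x. (v' x)\<^sup>2)"
  proof (rule integrable_cong_AE_imp)
    show "(\<lambda>x. (v' x)\<^sup>2) \<in> borel_measurable lebesgue"
      using m by (intro measurable_completion) simp
    show "AE x in lebesgue. indicator K x *\<^sub>R (norm (v x))\<^sup>2 = (v' x)\<^sup>2"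
      using ae by eventually_elim (auto simp: v'_def indicator_def)
  qed
  then have "integrable lborel (\<lambda>x. (v' x)\<^sup>2)" using m by (simp add: integrable_completion)
  then show ?thesis using that[of v'] m ae' by (auto simp: v'_def)
qed

lemma grad_translate:
  assumes "times_cont_diff (Suc k) f" shows "grad (\<lambda>x. f (x - c)) x = grad f (x - c)"
proof (rule grad_eqI)
  have "((\<lambda>x. x - c) has_derivative (\<lambda>h. h)) (at x)" by (auto intro!: derivative_eq_intros)
  from has_derivative_compose[OF this has_derivative_grad[OF assms]]
  show "((\<lambda>x. f (x - c)) has_derivative (\<lambda>h. grad f (x - c) \<bullet> h)) (at x)" .
qed

lemma continuous_compact_support_bounded:
  fixes f :: "'a::euclidean_space \<Rightarrow> 'b::euclidean_space"
  assumes "continuous_on UNIV f" "compact K" "\<And>x. x \<notin> K \<Longrightarrow> f x = 0"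
  obtains B where "B \<ge> 0" "\<And>x. norm (f x) \<le> B"
proof -
  have "compact (f ` K)" by (rule compact_continuous_image[OF continuous_on_subset[OF assms(1)] assms(2)]) simp
  then obtain B where "B > 0" "\<And>x. x \<in> K \<Longrightarrow> norm (f x) \<le> B"
    using compact_imp_bounded bounded_pos by (metis image_eqI)
  then have "B \<ge> 0" "\<And>x. norm (f x) \<le> B" using assms(3) by (auto, metis less_imp_le norm_zero)
  then show ?thesis using that by blast
qed

lemma convex_translation_segment:
  assumes "convex K" "x \<in> K" "x + h \<in> K" "t \<in> {0..1::real}" shows "x + t *\<^sub>R h \<in> K"
proof -
  have "(1 - t) *\<^sub>R x + t *\<^sub>R (x + h) \<in> K" using assms by (intro convexD) auto
  then show ?thesis by (simp add: algebra_simps)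
qed

text \<open>Paired with a test function \<open>\<psi>\<close>, the difference of \<open>v\<close>
  becomes F 1 - F 0, where F t is the pairing of \<open>v\<close> with \<open>\<psi>\<close>
  translated by t h. The derivative of F pairs \<open>v\<close> with a directional derivative of a
  test function on \<open>K\<close>, that is, \<open>G\<close> with the translated
  \<open>\<psi>\<close>. No approximation of \<open>v\<close> by smooth functions up to the boundary
  is required.\<close>

lemma translation_estimate:
  fixes K :: "'a::euclidean_space set" and v :: "'a \<Rightarrow> real"
  assumes K: "open K" "convex K" "bounded K"
    and v: "v \<in> borel_measurable borel" "\<And>x. x \<notin> K \<Longrightarrow> v x = 0" "integrable lborel (\<lambda>x. (v x)\<^sup>2)"
    and G: "is_weak_grad K v G"
  defines "Kh \<equiv> \<lambda>h. {x \<in> K. x + h \<in> K}"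
  shows "l2_norm (Kh h) (\<lambda>x. v (x + h) - v x) \<le> norm h * l2_norm K G"
proof -
  have KS: "K \<in> sets lebesgue" "K \<in> lmeasurable" using K by (auto intro: lmeasurable_open)
  have "Kh h = K \<inter> (\<lambda>x. x + h) -` K" by (auto simp: Kh_def)
  then have Kh: "open (Kh h)" "bounded (Kh h)" "Kh h \<subseteq> K"
    using K by (auto intro!: open_Int open_vimage continuous_intros intro: bounded_subset simp: Kh_def)
  have KhS: "Kh h \<in> sets lebesgue" using Kh by auto
  have "integrable lborel (\<lambda>x. (v (x + h))\<^sup>2)"
    using lborel_integrable_translate[of "\<lambda>x. (v x)\<^sup>2" h] v(1,3) by simp
  then have vh: "(\<lambda>x. v (x + h)) \<in> L2 S" if "S \<in> sets lebesgue" for S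
    using v(1) that by (intro L2_lborelI) auto
  have vL: "v \<in> L2 S" if "S \<in> sets lebesgue" for S using v that by (intro L2_lborelI) auto
  have GL: "G \<in> L2 K" using G by (auto simp: is_weak_grad_def)
  have vint: "integrable lborel v"
  proof -
    have "integrable (lebesgue_on K) (\<lambda>x. v x * 1)"
      by (rule L2_mult_integrable[OF vL[OF KS(1)] L2_const[OF KS(2)]])
    then have "integrable lebesgue (\<lambda>x. indicator K x *\<^sub>R v x)" using KS(1) by (simp add: integrable_restrict_space)
    moreover have "indicator K x *\<^sub>R v x = v x" for x using v(2)[of x] by (cases "x \<in> K") auto
    ultimately have "integrable lebesgue v" by (simp only:)
    then show ?thesis using v(1) by (simp add: integrable_completion)
  qed
  show ?thesis
  proof (rule l2_norm_le_dual[OF Kh(1,2)])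
    show "(\<lambda>x. v (x + h) - v x) \<in> L2 (Kh h)" using vh[OF KhS] vL[OF KhS] by auto
    fix \<psi> assume \<psi>: "\<psi> \<in> test_functions (Kh h)"
    obtain Q where Q: "compact Q" "Q \<subseteq> Kh h" "\<And>x. x \<notin> Q \<Longrightarrow> \<psi> x = 0" "\<And>x. x \<notin> Q \<Longrightarrow> grad \<psi> x = 0"
      "continuous_on UNIV \<psi>" "continuous_on UNIV (grad \<psi>)"
      using test_function_grad_support[OF \<psi>] by metis
    obtain B where B: "B \<ge> 0" "\<And>x. norm (\<psi> x) \<le> B" using continuous_compact_support_bounded[OF Q(5,1,3)] by blast
    obtain B' where B': "B' \<ge> 0" "\<And>x. norm (grad \<psi> x) \<le> B'" using continuous_compact_support_bounded[OF Q(6,1,4)] by blast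
    have \<psi>m: "\<psi> \<in> borel_measurable borel" "grad \<psi> \<in> borel_measurable borel"
      using Q(5,6) by (auto intro: borel_measurable_continuous_onI)
    define F where "F t = (LINT x|lborel. v x * \<psi> (x + t *\<^sub>R (- h)))" for t
    have F: "(F has_real_derivative (LINT x|lborel. v x * (grad \<psi> (x + t *\<^sub>R (- h)) \<bullet> (- h)))) (at t within {0..1})"
      if "t \<in> {0..1}" for t
      unfolding F_def
    proof (rule has_real_derivative_integral_dominated[where g="\<lambda>x. (B' * norm h) * \<bar>v x\<bar>"])
      show "integrable lborel (\<lambda>x. v x * \<psi> (x + t *\<^sub>R (- h)))" for t
      proof (rule Bochner_Integration.integrable_bound[OF Bochner_Integration.integrable_mult_right[OF vint, of B]])
        show "(\<lambda>x. v x * \<psi> (x + t *\<^sub>R (- h))) \<in> borel_measurable lborel" using v(1) \<psi>m(1) by measurable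
        show "AE x in lborel. norm (v x * \<psi> (x + t *\<^sub>R (- h))) \<le> norm (B * v x)"
          using B(1) by (intro AE_I2) (simp add: abs_mult mult.commute[of B] mult_left_mono[OF B(2)[unfolded real_norm_def]])
      qed
      show "((\<lambda>t. v x * \<psi> (x + t *\<^sub>R (- h))) has_real_derivative v x * (grad \<psi> (x + t *\<^sub>R (- h)) \<bullet> (- h))) (at t within {0..1})" for t x
        by (rule DERIV_cmult[OF has_real_derivative_along_line[OF test_function_smooth[OF \<psi>, of "Suc 0"]]])
      show "\<bar>v x * (grad \<psi> (x + t *\<^sub>R (- h)) \<bullet> (- h))\<bar> \<le> (B' * norm h) * \<bar>v x\<bar>" for t x
      proof -
        have "\<bar>grad \<psi> (x + t *\<^sub>R (- h)) \<bullet> (- h)\<bar> \<le> norm (grad \<psi> (x + t *\<^sub>R (- h))) * norm (- h)"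
          by (rule Cauchy_Schwarz_ineq2)
        also have "\<dots> \<le> B' * norm h" using B' by (intro mult_mono) auto
        finally show ?thesis by (simp only: abs_mult mult.commute[of "B' * norm h"] mult_left_mono abs_ge_zero)
      qed
      show "integrable lborel (\<lambda>x. (B' * norm h) * \<bar>v x\<bar>)" using vint by simp
      show "(\<lambda>x. v x * (grad \<psi> (x + t *\<^sub>R (- h)) \<bullet> (- h))) \<in> borel_measurable lborel" using v(1) \<psi>m(2) by measurable
    qed (use that in auto)
    have F': "norm (LINT x|lborel. v x * (grad \<psi> (x + t *\<^sub>R (- h)) \<bullet> (- h))) \<le> norm h * l2_norm K G * l2_norm (Kh h) \<psi>"
      if t: "t \<in> {0..1}" for t
    proof -
      \<comment> \<open>On the support of \<open>\<psi>\<close> both \<open>x\<close> and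
        \<open>x + h\<close> lie in \<open>K\<close>; by convexity so does \<open>x + t h\<close>,
        and the translate is a test function on \<open>K\<close>.\<close>
      define \<phi> where "\<phi> x = \<psi> (x - t *\<^sub>R h)" for x
      have \<phi>: "\<phi> \<in> test_functions K" unfolding \<phi>_def
        by (rule test_function_translate[OF \<psi>]) (use convex_translation_segment[OF K(2) _ _ t] in \<open>auto simp: Kh_def\<close>)
      have g\<phi>: "grad \<phi> x = grad \<psi> (x - t *\<^sub>R h)" for x
        unfolding \<phi>_def by (rule grad_translate[OF test_function_smooth[OF \<psi>, of "Suc 0"]])
      have L: "\<phi> \<in> L2 K" "grad \<phi> \<in> L2 K"
        using test_function_L2[OF \<phi> KS(1)] test_function_grad_L2[OF \<phi> KS(1)] by auto
      have "(LINT x|lborel. v x * (grad \<psi> (x + t *\<^sub>R (- h)) \<bullet> (- h))) = - (LINT x|lborel. v x * (grad \<phi> x \<bullet> h))"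
        by (simp add: g\<phi>)
      also have "(LINT x|lborel. v x * (grad \<phi> x \<bullet> h)) = (LINT x|lebesgue_on K. v x * (grad \<phi> x \<bullet> h))"
      proof (rule integral_lebesgue_on_eq_lborel[OF KS(1), symmetric])
        show "(\<lambda>x. v x * (grad \<phi> x \<bullet> h)) \<in> borel_measurable borel"
          unfolding g\<phi> using v(1) \<psi>m(2) by measurable
      qed (simp add: v)
      also have "\<dots> = (LINT x|lebesgue_on K. (v x *\<^sub>R grad \<phi> x) \<bullet> h)" by simp
      also have "\<dots> = (LINT x|lebesgue_on K. v x *\<^sub>R grad \<phi> x) \<bullet> h"
        by (rule integral_inner_left) (use L2_scaleR_integrable[OF vL[OF KS(1)] L(2)] in simp)
      also have "\<dots> = - ((LINT x|lebesgue_on K. \<phi> x *\<^sub>R G x) \<bullet> h)"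
        using is_weak_gradD(2)[OF G \<phi>] by simp
      also have "(LINT x|lebesgue_on K. \<phi> x *\<^sub>R G x) \<bullet> h = (LINT x|lebesgue_on K. (\<phi> x *\<^sub>R G x) \<bullet> h)"
        by (rule integral_inner_left[symmetric]) (use L2_scaleR_integrable[OF L(1) GL] in simp)
      also have "\<dots> = l2_inner K \<phi> (\<lambda>x. G x \<bullet> h)" by (simp add: l2_inner_def)
      finally have "norm (LINT x|lborel. v x * (grad \<psi> (x + t *\<^sub>R (- h)) \<bullet> (- h))) = \<bar>l2_inner K \<phi> (\<lambda>x. G x \<bullet> h)\<bar>" by simp
      also have "\<dots> \<le> l2_norm K \<phi> * l2_norm K (\<lambda>x. G x \<bullet> h)"
        by (rule l2_Cauchy_Schwarz[OF L(1) L2_inner_const[OF GL]])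
      also have "\<dots> \<le> l2_norm K \<phi> * (norm h * l2_norm K G)"
        by (intro mult_left_mono l2_norm_mono L2_inner_const GL)
           (auto simp: Cauchy_Schwarz_ineq2 mult.commute[of "norm h"])
      also have "l2_norm K \<phi> = l2_norm (Kh h) \<psi>"
      proof -
        have "l2_inner K \<phi> \<phi> = (LINT x|lborel. \<phi> x * \<phi> x)"
          unfolding l2_inner_def inner_real_def
          by (rule integral_lebesgue_on_eq_lborel[OF KS(1)])
             (use test_function_zero_outside[OF \<phi>] \<psi>m in \<open>auto simp: \<phi>_def\<close>)
        also have "\<dots> = (LINT x|lborel. \<psi> x * \<psi> x)"
          using lborel_integral_translate[of "\<lambda>x. \<psi> x * \<psi> x" "- (t *\<^sub>R h)"] \<psi>m(1) by (simp add: \<phi>_def)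
        also have "\<dots> = l2_inner (Kh h) \<psi> \<psi>"
          unfolding l2_inner_def inner_real_def
          by (rule integral_lebesgue_on_eq_lborel[OF KhS, symmetric]) (use test_function_zero_outside[OF \<psi>] \<psi>m in auto)
        finally show ?thesis by (simp add: l2_norm_def)
      qed
      finally show ?thesis by (simp add: mult_ac)
    qed
    have "norm (F 1 - F 0) \<le> norm h * l2_norm K G * l2_norm (Kh h) \<psi> * norm (1 - 0 :: real)"
      by (rule field_differentiable_bound[of "{0..1}", OF _ F F']) auto
    moreover have "F 1 - F 0 = l2_inner (Kh h) (\<lambda>x. v (x + h) - v x) \<psi>"
    proof -
      have i: "integrable lborel (\<lambda>x. f x * \<psi> x)" if "f \<in> borel_measurable borel" "integrable lborel f" for f :: "'a \<Rightarrow> real"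
      proof (rule Bochner_Integration.integrable_bound[OF Bochner_Integration.integrable_mult_right[OF that(2), of B]])
        show "(\<lambda>x. f x * \<psi> x) \<in> borel_measurable lborel" using that(1) \<psi>m(1) by measurable
        show "AE x in lborel. norm (f x * \<psi> x) \<le> norm (B * f x)"
          using B(1) by (intro AE_I2) (simp add: abs_mult mult.commute[of B] mult_left_mono[OF B(2)[unfolded real_norm_def]])
      qed
      have m: "(\<lambda>x. v (x + h)) \<in> borel_measurable borel" using v(1) by measurable
      have "F 1 = (LINT x|lborel. v (x + h) * \<psi> x)"
        using lborel_integral_translate[of "\<lambda>x. v (x + h) * \<psi> x" "- h"] m \<psi>m(1) by (simp add: F_def)
      then have "F 1 - F 0 = (LINT x|lborel. v (x + h) * \<psi> x - v x * \<psi> x)"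
        using i[OF m] i[OF v(1) vint] lborel_integrable_translate[OF v(1), of h] vint by (simp add: F_def)
      also have "\<dots> = (LINT x|lebesgue_on (Kh h). v (x + h) * \<psi> x - v x * \<psi> x)"
        by (rule integral_lebesgue_on_eq_lborel[OF KhS, symmetric])
           (use test_function_zero_outside[OF \<psi>] \<psi>m m v(1) in auto)
      finally show ?thesis by (simp add: l2_inner_def algebra_simps)
    qed
    ultimately show "\<bar>l2_inner (Kh h) (\<lambda>x. v (x + h) - v x) \<psi>\<bar> \<le> norm h * l2_norm K G * l2_norm (Kh h) \<psi>"
      by simp
  qed simp
qed

lemma nn_integral_indicator_square:
  fixes f :: "'a::euclidean_space \<Rightarrow> real"
  assumes "S \<in> sets borel" "f \<in> borel_measurable borel" "f \<in> L2 S"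
  shows "(\<integral>\<^sup>+x. ennreal (indicator S x * (f x)\<^sup>2) \<partial>lborel) = ennreal ((l2_norm S f)\<^sup>2)"
proof -
  have m: "(\<lambda>x. indicator S x * (f x)\<^sup>2) \<in> borel_measurable borel" using assms(1,2) by measurable
  have "integrable lebesgue (\<lambda>x. indicator S x * (f x)\<^sup>2)"
    using L2_integrable[OF assms(3)] assms(1) by (simp add: integrable_restrict_space)
  then have "integrable lborel (\<lambda>x. indicator S x * (f x)\<^sup>2)"
    using m by (simp add: integrable_completion)
  then have "(\<integral>\<^sup>+x. ennreal (indicator S x * (f x)\<^sup>2) \<partial>lborel) = ennreal (LINT x|lborel. indicator S x * (f x)\<^sup>2)"
    by (rule nn_integral_eq_integral) auto
  also have "(LINT x|lborel. indicator S x * (f x)\<^sup>2) = (LINT x|lebesgue_on S. (f x)\<^sup>2)"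
    using m assms(1) by (simp add: integral_restrict_space integral_completion)
  also have "\<dots> = (l2_norm S f)\<^sup>2"
    unfolding l2_norm_square l2_inner_def by (simp add: power2_eq_square)
  finally show ?thesis .
qed

text \<open>Both inequalities estimate the integral of (v y - v x)^2 over K times K. As the mean
  vanishes, the inner integral over y is the squared norm of \<open>v\<close> plus |K| (v x)^2; only
  the first term is kept. Above, y = x + h is substituted, and the integral over x is bounded by the
  translation estimate. It is zero unless h is a difference of two points of \<open>K\<close>, so h
  may be restricted to the ball of radius \<open>D\<close>. Nonnegative integrals make the exchange
  of order free of integrability questions.\<close>

lemma Poincare_borel:
  fixes K :: "'a::euclidean_space set" and v :: "'a \<Rightarrow> real"
  assumes K: "open K" "convex K" "bounded K"
    and v: "v \<in> borel_measurable borel" "\<And>x. x \<notin> K \<Longrightarrow> v x = 0" "integrable lborel (\<lambda>x. (v x)\<^sup>2)"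
    and G: "is_weak_grad K v G" and mean: "(LINT x|lebesgue_on K. v x) = 0"
    and D: "\<And>x y. x \<in> K \<Longrightarrow> y \<in> K \<Longrightarrow> norm (x - y) \<le> D"
  shows "measure lebesgue K * (l2_norm K v)\<^sup>2 \<le> measure lborel (cball (0::'a) D) * (D * l2_norm K G)\<^sup>2"
proof -
  let ?i = "\<lambda>x y. ennreal (indicator K x * indicator K y * (v y - v x)\<^sup>2)"
  have KS: "K \<in> sets lebesgue" "K \<in> lmeasurable" "K \<in> sets borel" using K by (auto intro: lmeasurable_open)
  interpret finite_measure "lebesgue_on K" by (rule finite_measure_lebesgue_on[OF KS(2)])
  have mK: "measure (lebesgue_on K) K = measure lebesgue K" using KS by (simp add: measure_restrict_space)
  have vL: "v \<in> L2 K" using v KS by (intro L2_lborelI) auto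
  have cK: "(\<lambda>x. c) \<in> L2 K" for c :: real by (rule L2_const[OF KS(2)])
  have lower: "ennreal (indicator K x * (l2_norm K v)\<^sup>2) \<le> (\<integral>\<^sup>+y. ?i x y \<partial>lborel)" for x
  proof (cases "x \<in> K")
    case True
    have "(\<integral>\<^sup>+y. ?i x y \<partial>lborel) = ennreal ((l2_norm K (\<lambda>y. v y - v x))\<^sup>2)"
      using True nn_integral_indicator_square[OF KS(3) _ L2_diff[OF vL cK]] v(1) by simp
    also have "(l2_norm K (\<lambda>y. v y - v x))\<^sup>2 = (LINT y|lebesgue_on K. v y * v y - 2 * v x * v y + (v x)\<^sup>2)"
      unfolding l2_norm_square l2_inner_def by (simp add: algebra_simps power2_eq_square)
    also have "\<dots> = (LINT y|lebesgue_on K. v y * v y) - 2 * v x * (LINT y|lebesgue_on K. v y) + measure lebesgue K * (v x)\<^sup>2"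
      using L2_mult_integrable[OF vL vL] L2_mult_integrable[OF vL cK[of 1]] by (simp add: mK)
    also have "\<dots> = (l2_norm K v)\<^sup>2 + measure lebesgue K * (v x)\<^sup>2"
      by (simp add: mean l2_norm_square l2_inner_def)
    finally show ?thesis using True by (simp add: ennreal_leI)
  qed simp
  have upper: "(\<integral>\<^sup>+x. ?i x (x + h) \<partial>lborel) \<le> ennreal ((D * l2_norm K G)\<^sup>2) * indicator (cball 0 D) h" for h
  proof -
    let ?Kh = "{x \<in> K. x + h \<in> K}"
    have "?Kh = K \<inter> (\<lambda>x. x + h) -` K" by auto
    then have Kh: "open ?Kh" using K by (auto intro!: open_Int open_vimage continuous_intros)
    show ?thesis
    proof (cases "?Kh = {}")
      case True
      then have "?i x (x + h) = 0" for x by (auto simp: indicator_def)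
      then have "(\<integral>\<^sup>+x. ?i x (x + h) \<partial>lborel) = 0" by (simp only: nn_integral_const mult_zero_left)
      then show ?thesis by simp
    next
      case False
      then obtain x where "x \<in> K" "x + h \<in> K" by auto
      then have h: "norm h \<le> D" using D[of "x + h" x] by simp
      have "integrable lborel (\<lambda>x. (v (x + h))\<^sup>2)"
        using lborel_integrable_translate[of "\<lambda>x. (v x)\<^sup>2" h] v(1,3) by simp
      then have L: "(\<lambda>x. v (x + h) - v x) \<in> L2 ?Kh"
        using Kh v by (intro L2_diff L2_lborelI) auto
      have "(\<integral>\<^sup>+x. ?i x (x + h) \<partial>lborel) = (\<integral>\<^sup>+x. ennreal (indicator ?Kh x * (v (x + h) - v x)\<^sup>2) \<partial>lborel)"
        by (rule nn_integral_cong) (auto simp: indicator_def)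
      also have "\<dots> = ennreal ((l2_norm ?Kh (\<lambda>x. v (x + h) - v x))\<^sup>2)"
        by (rule nn_integral_indicator_square) (use Kh v(1) L in auto)
      also have "\<dots> \<le> ennreal ((D * l2_norm K G)\<^sup>2)"
      proof (intro ennreal_leI power_mono)
        have "l2_norm ?Kh (\<lambda>x. v (x + h) - v x) \<le> norm h * l2_norm K G"
          by (rule translation_estimate[OF K v G])
        also have "\<dots> \<le> D * l2_norm K G" using h by (intro mult_right_mono) auto
        finally show "l2_norm ?Kh (\<lambda>x. v (x + h) - v x) \<le> D * l2_norm K G" .
      qed simp
      finally show ?thesis using h by simp
    qed
  qed
  have m: "(\<lambda>(x, h). ?i x (x + h)) \<in> borel_measurable (lborel \<Otimes>\<^sub>M lborel)"
    using v(1) KS(3) by measurable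
  have "ennreal (measure lebesgue K * (l2_norm K v)\<^sup>2) = (\<integral>\<^sup>+x. ennreal ((l2_norm K v)\<^sup>2) * indicator K x \<partial>lborel)"
  proof -
    have "emeasure lborel K = ennreal (measure lborel K)"
      by (rule emeasure_eq_ennreal_measure) (use emeasure_bounded_finite[OF K(3)] in \<open>auto simp: less_top\<close>)
    moreover have "measure lebesgue K = measure lborel K" using KS(3) by (simp add: measure_def)
    ultimately have "emeasure lborel K = ennreal (measure lebesgue K)" by simp
    moreover have "(\<integral>\<^sup>+x. ennreal ((l2_norm K v)\<^sup>2) * indicator K x \<partial>lborel) = ennreal ((l2_norm K v)\<^sup>2) * emeasure lborel K"
      by (rule nn_integral_cmult_indicator) (use KS(3) in simp)
    ultimately show ?thesis by (simp only: ennreal_mult' measure_nonneg mult.commute[of _ "ennreal (measure lebesgue K)"])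
  qed
  also have "\<dots> = (\<integral>\<^sup>+x. ennreal (indicator K x * (l2_norm K v)\<^sup>2) \<partial>lborel)"
    by (rule nn_integral_cong) (auto simp: indicator_def)
  also have "\<dots> \<le> (\<integral>\<^sup>+x. (\<integral>\<^sup>+y. ?i x y \<partial>lborel) \<partial>lborel)" by (intro nn_integral_mono lower)
  also have "\<dots> = (\<integral>\<^sup>+x. (\<integral>\<^sup>+h. ?i x (x + h) \<partial>lborel) \<partial>lborel)"
  proof (rule nn_integral_cong)
    fix x
    have "?i x \<in> borel_measurable borel" using v(1) KS(3) by measurable
    from lborel_nn_integral_translate[OF this, of x]
    show "(\<integral>\<^sup>+y. ?i x y \<partial>lborel) = (\<integral>\<^sup>+h. ?i x (x + h) \<partial>lborel)" by simp
  qed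
  also have "\<dots> = (\<integral>\<^sup>+h. (\<integral>\<^sup>+x. ?i x (x + h) \<partial>lborel) \<partial>lborel)"
    by (rule lborel_pair.Fubini'[OF m, symmetric])
  also have "\<dots> \<le> (\<integral>\<^sup>+h. ennreal ((D * l2_norm K G)\<^sup>2) * indicator (cball (0::'a) D) h \<partial>lborel)"
    by (rule nn_integral_mono) (rule upper)
  also have "\<dots> = ennreal ((D * l2_norm K G)\<^sup>2) * emeasure lborel (cball (0::'a) D)"
    by (rule nn_integral_cmult_indicator) auto
  also have "emeasure lborel (cball (0::'a) D) = ennreal (measure lborel (cball (0::'a) D))"
    by (rule emeasure_eq_ennreal_measure) (use emeasure_bounded_finite[of "cball (0::'a) D"] in \<open>auto simp: less_top\<close>)
  also have "ennreal ((D * l2_norm K G)\<^sup>2) * ennreal (measure lborel (cball (0::'a) D))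
      = ennreal (measure lborel (cball (0::'a) D) * (D * l2_norm K G)\<^sup>2)"
    by (simp add: ennreal_mult mult.commute)
  finally show ?thesis by (subst (asm) ennreal_le_iff) auto
qed

lemma is_weak_grad_cong_AE:
  assumes "open K" "v \<in> L2 K" "v' \<in> L2 K" "AE x in lebesgue_on K. v x = v' x" "is_weak_grad K v G"
  shows "is_weak_grad K v' G"
  unfolding is_weak_grad_def
proof (intro conjI ballI)
  fix \<phi> assume \<phi>: "\<phi> \<in> test_functions K"
  have gm: "grad \<phi> \<in> borel_measurable (lebesgue_on K)"
    using test_function_grad_L2[OF \<phi>, of K] assms(1) by (auto intro: L2_measurable)
  have "(LINT x|lebesgue_on K. v' x *\<^sub>R grad \<phi> x) = (LINT x|lebesgue_on K. v x *\<^sub>R grad \<phi> x)"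
  proof (rule integral_cong_AE)
    show "(\<lambda>x. v' x *\<^sub>R grad \<phi> x) \<in> borel_measurable (lebesgue_on K)" "(\<lambda>x. v x *\<^sub>R grad \<phi> x) \<in> borel_measurable (lebesgue_on K)"
      using assms(2,3)[THEN L2_measurable] gm by measurable
    show "AE x in lebesgue_on K. v' x *\<^sub>R grad \<phi> x = v x *\<^sub>R grad \<phi> x" using assms(4) by eventually_elim simp
  qed
  then show "(LINT x|lebesgue_on K. v' x *\<^sub>R grad \<phi> x) = - (LINT x|lebesgue_on K. \<phi> x *\<^sub>R G x)"
    using is_weak_gradD(2)[OF assms(5) \<phi>] by simp
qed (use assms(5) in \<open>auto simp: is_weak_grad_def\<close>)

lemma measure_open_pos:
  fixes K :: "'a::euclidean_space set"
  assumes "open K" "bounded K" "K \<noteq> {}" shows "0 < measure lebesgue K"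
proof -
  have "\<not> negligible K" using open_not_negligible[OF assms(1,3)] .
  moreover have "K \<in> lmeasurable" using assms(1,2) lmeasurable_open by blast
  ultimately have "measure lebesgue K \<noteq> 0" using negligible_iff_measure0 by blast
  then show ?thesis using measure_nonneg[of lebesgue K] by linarith
qed

lemma Poincare:
  fixes K :: "'a::euclidean_space set"
  assumes K: "open K" "convex K" "bounded K" "K \<noteq> {}"
  obtains C where "0 \<le> C"
    "\<And>v. v \<in> H1 K \<Longrightarrow> (LINT x|lebesgue_on K. v x) = 0 \<Longrightarrow> l2_norm K v \<le> C * l2_norm K (weak_grad K v)"
proof -
  obtain D where D: "0 < D" "\<And>x y. x \<in> K \<Longrightarrow> y \<in> K \<Longrightarrow> norm (x - y) \<le> D"
  proof -
    obtain R where "R > 0" "\<And>x. x \<in> K \<Longrightarrow> norm x \<le> R" using K(3) bounded_pos by blast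
    then show ?thesis
    proof (intro that[of "2 * R"])
      show "norm (x - y) \<le> 2 * R" if "x \<in> K" "y \<in> K" for x y
        using norm_triangle_ineq4[of x y] \<open>\<And>x. x \<in> K \<Longrightarrow> norm x \<le> R\<close>[OF that(1)]
          \<open>\<And>x. x \<in> K \<Longrightarrow> norm x \<le> R\<close>[OF that(2)] by linarith
    qed simp
  qed
  have KS: "K \<in> sets lebesgue" using K by auto
  define m b where "m = measure lebesgue K" and "b = measure lborel (cball (0::'a) D)"
  have m: "m > 0" unfolding m_def by (rule measure_open_pos[OF K(1,3,4)])
  have b: "b \<ge> 0" by (simp add: b_def)
  have main: "l2_norm K v \<le> (sqrt (b / m) * D) * l2_norm K (weak_grad K v)"
    if v: "v \<in> H1 K" and mean: "(LINT x|lebesgue_on K. v x) = 0" for v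
  proof -
    obtain v' where v': "v' \<in> borel_measurable borel" "\<And>x. x \<notin> K \<Longrightarrow> v' x = 0"
      "integrable lborel (\<lambda>x. (v' x)\<^sup>2)" "AE x in lebesgue_on K. v x = v' x"
      using L2_borel_representative[OF K(1) H1_L2[OF v]] by blast
    have L: "v' \<in> L2 K" using v' KS by (intro L2_lborelI) auto
    have w: "is_weak_grad K v' (weak_grad K v)"
      by (rule is_weak_grad_cong_AE[OF K(1) H1_L2[OF v] L v'(4) is_weak_grad_weak_grad[OF v]])
    have "(LINT x|lebesgue_on K. v' x) = 0"
      using mean integral_cong_AE[OF L2_measurable[OF H1_L2[OF v]] L2_measurable[OF L] v'(4)] by simp
    from Poincare_borel[OF K(1-3) v'(1-3) w this D(2)]
    have "m * (l2_norm K v')\<^sup>2 \<le> b * (D * l2_norm K (weak_grad K v))\<^sup>2" by (simp add: m_def b_def)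
    also have "l2_norm K v' = l2_norm K v" using l2_norm_cong_AE[OF v'(4) H1_L2[OF v] L] by simp
    finally have "(l2_norm K v)\<^sup>2 \<le> b / m * (D * l2_norm K (weak_grad K v))\<^sup>2"
      using m by (simp add: field_simps)
    also have "\<dots> = ((sqrt (b / m) * D) * l2_norm K (weak_grad K v))\<^sup>2"
      using m b by (simp add: power_mult_distrib)
    finally show ?thesis by (rule power2_le_imp_le) (use m b D in auto)
  qed
  show ?thesis by (rule that[OF _ main]) (use m b D in auto)
qed

lemma is_weak_grad_affine:
  fixes K :: "'a::euclidean_space set"
  assumes "open K" "bounded K"
  shows "(\<lambda>x. a \<bullet> x + b) \<in> L2 K" "is_weak_grad K (\<lambda>x. a \<bullet> x + b) (\<lambda>x. a)"
proof -
  have K: "K \<in> lmeasurable" using assms lmeasurable_open by blast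
  obtain R where R: "\<And>x. x \<in> K \<Longrightarrow> norm x \<le> R" using assms(2) bounded_iff by blast
  show "(\<lambda>x. a \<bullet> x + b) \<in> L2 K"
  proof (rule L2_bounded[OF K])
    show "(\<lambda>x. a \<bullet> x + b) \<in> borel_measurable (lebesgue_on K)"
      by (intro continuous_measurable_lebesgue_on continuous_intros)
    fix x assume "x \<in> K"
    then have "norm a * norm x \<le> norm a * R" using R by (intro mult_left_mono) auto
    moreover have "norm (a \<bullet> x + b) \<le> \<bar>a \<bullet> x\<bar> + \<bar>b\<bar>" by simp
    ultimately show "norm (a \<bullet> x + b) \<le> norm a * R + \<bar>b\<bar>" using Cauchy_Schwarz_ineq2[of a x] by linarith
  qed
  have g: "grad (\<lambda>x. a \<bullet> x + b) = (\<lambda>x. a)"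
    by (rule ext, rule grad_eqI) (auto intro!: derivative_eq_intros)
  have "times_cont_diff (Suc 0) (\<lambda>x. a \<bullet> x + b)"
    by (intro times_cont_diff_add times_cont_diff_const times_cont_diff_bounded_linear bounded_linear_inner_right)
  from is_weak_grad_grad[OF this, of K] show "is_weak_grad K (\<lambda>x. a \<bullet> x + b) (\<lambda>x. a)"
    using K unfolding g by (auto simp: L2_const fmeasurableD)
qed

section \<open>The optimal Poincare constants as finite suprema\<close>

lemma poincare_const_bdd:
  fixes T :: "'a::euclidean_space set"
  assumes "convex T" "bounded T" "interior T \<noteq> {}"
  shows "bdd_above {l2_norm (interior T) v / l2_norm (interior T) (weak_grad (interior T) v) | v.
            v \<in> H1 (interior T) \<and> l2_norm (interior T) v \<noteq> 0 \<and> (LINT x|lebesgue_on (interior T). v x) = 0}"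
proof -
  obtain C where C: "0 \<le> C" "\<And>v. v \<in> H1 (interior T) \<Longrightarrow> (LINT x|lebesgue_on (interior T). v x) = 0 \<Longrightarrow>
      l2_norm (interior T) v \<le> C * l2_norm (interior T) (weak_grad (interior T) v)"
    using Poincare[of "interior T"] assms by (metis bounded_interior convex_interior open_interior)
  \<comment> \<open>If the gradient has norm zero the quotient is 0, which is below \<open>C\<close>
    as well.\<close>
  have "l2_norm (interior T) v / l2_norm (interior T) (weak_grad (interior T) v) \<le> C"
    if "v \<in> H1 (interior T)" "(LINT x|lebesgue_on (interior T). v x) = 0" for v
    using C(2)[OF that] C(1) by (cases "l2_norm (interior T) (weak_grad (interior T) v) = 0")
      (auto simp: divide_le_eq order.strict_iff_order)
  then show ?thesis by (intro bdd_aboveI[of _ C]) auto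
qed

text \<open>The supremum of an empty set would be an unspecified number, so an admissible function
  has to be exhibited: a coordinate minus its mean. It is not zero almost everywhere because its
  zero set is a hyperplane.\<close>

lemma poincare_const_nonneg:
  fixes T :: "'a::euclidean_space set"
  assumes "convex T" "bounded T" "interior T \<noteq> {}"
  shows "0 \<le> poincare_const T"
proof -
  let ?K = "interior T"
  have K: "open ?K" "bounded ?K" "?K \<in> lmeasurable" using assms by (auto simp: bounded_interior lmeasurable_open)
  have m: "measure lebesgue ?K > 0" by (rule measure_open_pos[OF K(1,2) assms(3)])
  interpret finite_measure "lebesgue_on ?K" by (rule finite_measure_lebesgue_on[OF K(3)])
  obtain i :: 'a where i: "i \<in> Basis" using nonempty_Basis by blast
  define c where "c = (LINT x|lebesgue_on ?K. i \<bullet> x) / measure lebesgue ?K"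
  define v where "v = (\<lambda>x. i \<bullet> x + (- c))"
  note A = is_weak_grad_affine[OF K(1,2)]
  have v: "v \<in> H1 ?K" unfolding v_def H1_def using A by blast
  have int: "integrable (lebesgue_on ?K) (\<lambda>x. i \<bullet> x)"
    using L2_mult_integrable[OF A(1)[of i 0] L2_const[OF K(3), of 1]] by simp
  have "(LINT x|lebesgue_on ?K. v x) = (LINT x|lebesgue_on ?K. i \<bullet> x) - c * measure (lebesgue_on ?K) ?K"
    unfolding v_def using int by simp
  also have "\<dots> = 0" using m K by (simp add: c_def measure_restrict_space fmeasurableD)
  finally have mean: "(LINT x|lebesgue_on ?K. v x) = 0" .
  have "l2_norm ?K v \<noteq> 0"
  proof
    assume "l2_norm ?K v = 0"
    then have "AE x in lebesgue_on ?K. v x = 0" by (rule l2_norm_eq_0_AE[OF H1_L2[OF v]])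
    then have "AE x in lebesgue. x \<in> ?K \<longrightarrow> v x = 0" using K by (subst (asm) AE_restrict_space_iff) auto
    moreover have "negligible {x. i \<bullet> x = c}" using i by (intro negligible_hyperplane) auto
    then have "AE x in lebesgue. x \<notin> {x. i \<bullet> x = c}" by (intro AE_not_in) (simp add: negligible_iff_null_sets)
    ultimately have "AE x in lebesgue. x \<notin> ?K" by eventually_elim (auto simp: v_def)
    then have "negligible ?K"
      using K by (subst negligible_iff_null_sets) (simp add: AE_iff_null_sets fmeasurableD)
    then show False using open_not_negligible[OF K(1) assms(3)] by simp
  qed
  then have "l2_norm ?K v / l2_norm ?K (weak_grad ?K v) \<le> poincare_const T"
    unfolding poincare_const_def using v mean by (intro cSup_upper poincare_const_bdd[OF assms]) auto
  moreover have "0 \<le> l2_norm ?K v / l2_norm ?K (weak_grad ?K v)" by simp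
  ultimately show ?thesis by linarith
qed

lemma poincare_const_inequality:
  fixes T :: "'a::euclidean_space set"
  assumes T: "convex T" "bounded T" "interior T \<noteq> {}"
    and v: "v \<in> H1 (interior T)" "(LINT x|lebesgue_on (interior T). v x) = 0"
  shows "l2_norm (interior T) v \<le> poincare_const T * l2_norm (interior T) (weak_grad (interior T) v)"
proof (cases "l2_norm (interior T) v = 0")
  case True
  then show ?thesis using poincare_const_nonneg[OF T] by simp
next
  case False
  let ?n = "l2_norm (interior T) v" and ?g = "l2_norm (interior T) (weak_grad (interior T) v)"
  obtain C where C: "0 \<le> C" "\<And>v. v \<in> H1 (interior T) \<Longrightarrow> (LINT x|lebesgue_on (interior T). v x) = 0 \<Longrightarrow>
      l2_norm (interior T) v \<le> C * l2_norm (interior T) (weak_grad (interior T) v)"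
    using Poincare[of "interior T"] T by (metis bounded_interior convex_interior open_interior)
  \<comment> \<open>With a vanishing denominator the quotient would be 0 and carry no information
    about \<open>v\<close>; the Poincare inequality rules this out.\<close>
  have "?g \<noteq> 0"
  proof
    assume "?g = 0"
    then have "?n \<le> 0" using C(2)[OF v] by simp
    then show False using False l2_norm_nonneg[of "interior T" v] by linarith
  qed
  then have g: "?g > 0" using l2_norm_nonneg[of "interior T" "weak_grad (interior T) v"] by linarith
  have "?n / ?g \<le> poincare_const T"
    unfolding poincare_const_def using v False by (intro cSup_upper poincare_const_bdd[OF T]) auto
  then show ?thesis using g by (simp add: pos_divide_le_eq)
qed

section \<open>Affine maps and integrals over simplices\<close>

lemma lborel_nn_integral_reflect:
  fixes f :: "'a::euclidean_space \<Rightarrow> ennreal"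
  assumes "f \<in> borel_measurable borel"
  shows "(\<integral>\<^sup>+x. f (c - x) \<partial>lborel) = (\<integral>\<^sup>+x. f x \<partial>lborel)"
proof -
  have "lborel = density (distr lborel borel (\<lambda>x. c + (-1) *\<^sub>R x)) (\<lambda>_. ennreal (\<bar>-1\<bar> ^ DIM('a)))"
    by (rule lborel_affine) simp
  then have "(lborel :: 'a measure) = distr lborel borel (\<lambda>x. c + (-1) *\<^sub>R x)" by (simp add: density_1)
  then have "(\<integral>\<^sup>+x. f x \<partial>lborel) = (\<integral>\<^sup>+x. f x \<partial>distr lborel borel (\<lambda>x. c + (-1) *\<^sub>R x))" by simp
  also have "\<dots> = (\<integral>\<^sup>+x. f (c + (-1) *\<^sub>R x) \<partial>lborel)" using assms by (subst nn_integral_distr) auto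
  finally show ?thesis by simp
qed

text \<open>Uniqueness of translation invariant measures: integrating
  \<open>1\<^sub>E (L x) 1\<^sub>B (L x + y)\<close> in both orders gives \<open>\<mu> E * \<nu> B = \<mu> B * \<nu> E\<close> for the image measure \<open>\<mu>\<close>
  and Lebesgue measure \<open>\<nu>\<close>.\<close>

lemma lborel_distr_linear:
  fixes L :: "'a::euclidean_space \<Rightarrow> 'a"
  assumes L: "linear L" "inj L"
  obtains c where "c > 0" "distr lborel borel L = density lborel (\<lambda>_. ennreal c)"
proof -
  obtain M where M: "linear M" "M \<circ> L = id" using linear_injective_left_inverse[OF L] by blast
  have LM: "L (M y) = y" for y
    using linear_inverse_left[OF L(1) M(1)] M(2) by (metis comp_apply id_apply)
  have inv1: "M (L x) = x" for x using M(2) by (metis comp_apply id_apply)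
  have Lm: "L \<in> borel_measurable borel"
    using L(1) by (intro borel_measurable_continuous_onI linear_continuous_on) (simp add: linear_conv_bounded_linear)
  let ?\<mu> = "\<lambda>E. \<integral>\<^sup>+x. indicator E (L x) \<partial>lborel"
  let ?\<nu> = "\<lambda>E. \<integral>\<^sup>+x. indicator E x \<partial>(lborel :: 'a measure)"
  have key: "?\<mu> E * ?\<nu> B = ?\<mu> B * ?\<nu> E" if [measurable]: "E \<in> sets borel" "B \<in> sets borel" for E B
  proof -
    note Lm[measurable]
    have "?\<mu> E * ?\<nu> B = (\<integral>\<^sup>+x. (\<integral>\<^sup>+y. indicator E (L x) * indicator B (L x + y) \<partial>lborel) \<partial>lborel)"
      by (simp add: nn_integral_cmult lborel_nn_integral_translate nn_integral_multc)
    also have "\<dots> = (\<integral>\<^sup>+y. (\<integral>\<^sup>+x. indicator E (L x) * indicator B (L x + y) \<partial>lborel) \<partial>lborel)"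
      by (rule lborel_pair.Fubini'[symmetric]) measurable
    also have "\<dots> = (\<integral>\<^sup>+y. (\<integral>\<^sup>+x. indicator E (L x - y) * indicator B (L x) \<partial>lborel) \<partial>lborel)"
    proof (rule nn_integral_cong)
      fix y
      \<comment> \<open>Shifting \<open>x\<close> by \<open>- M y\<close> turns \<open>L x\<close>
        into \<open>L x - y\<close>, because \<open>M\<close> is a right inverse of \<open>L\<close>
        too.\<close>
      have "(\<lambda>x. indicator E (L x) * indicator B (L x + y) :: ennreal) \<in> borel_measurable borel" by measurable
      from lborel_nn_integral_translate[OF this, of "- M y"]
      show "(\<integral>\<^sup>+x. indicator E (L x) * indicator B (L x + y) \<partial>lborel) = (\<integral>\<^sup>+x. indicator E (L x - y) * indicator B (L x) \<partial>lborel)"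
        by (simp add: linear_add[OF L(1)] linear_diff[OF L(1)] linear_neg[OF L(1)] LM)
    qed
    also have "\<dots> = (\<integral>\<^sup>+x. (\<integral>\<^sup>+y. indicator E (L x - y) * indicator B (L x) \<partial>lborel) \<partial>lborel)"
      by (rule lborel_pair.Fubini') measurable
    also have "\<dots> = ?\<mu> B * ?\<nu> E"
      by (simp add: nn_integral_multc lborel_nn_integral_reflect nn_integral_cmult mult.commute)
    finally show ?thesis .
  qed
  \<comment> \<open>The ball determines the constant: it and its preimage are open, nonempty and
    bounded, so their measures are positive and finite and one may divide by them.\<close>
  let ?B = "ball (0::'a) 1"
  have \<mu>: "emeasure (distr lborel borel L) E = ?\<mu> E" if "E \<in> sets borel" for E
  proof -
    have "?\<mu> E = (\<integral>\<^sup>+x. indicator (L -` E) x \<partial>lborel)" by (rule nn_integral_cong) (simp add: indicator_def)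
    also have "\<dots> = emeasure lborel (L -` E)"
      using measurable_sets[OF Lm that] by (intro nn_integral_indicator) simp
    finally show ?thesis using that Lm by (simp add: emeasure_distr)
  qed
  have fin: "?\<nu> ?B < \<infinity>" using emeasure_bounded_finite[of ?B] by simp
  have pos: "?\<nu> S > 0" if S: "open S" "S \<noteq> {}" for S
  proof -
    have "\<not> negligible S" using open_not_negligible[OF S] .
    then have "emeasure lborel S \<noteq> 0" using S(1)
      by (auto simp: negligible_iff_null_sets null_sets_completion_iff null_sets_def)
    then show ?thesis using S(1) by (simp add: zero_less_iff_neq_zero)
  qed
  have "L -` ?B = M ` ?B" 
  proof (intro set_eqI iffI)
    fix x assume "x \<in> L -` ?B"
    then show "x \<in> M ` ?B" using inv1[of x] by (intro image_eqI[of _ _ "L x"]) auto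
  next
    fix x assume "x \<in> M ` ?B"
    then obtain y where "y \<in> ?B" "x = M y" by blast
    then show "x \<in> L -` ?B" by (simp add: LM)
  qed
  then have bdd: "bounded (L -` ?B)"
    using M(1) by (simp add: bounded_linear_image linear_conv_bounded_linear)
  have opn: "open (L -` ?B)"
    using L(1) by (intro open_vimage linear_continuous_on) (auto simp: linear_conv_bounded_linear)
  have "0 \<in> L -` ?B" using L(1) by (simp add: linear_0)
  then have ne: "L -` ?B \<noteq> {}" by blast
  have \<mu>B: "?\<mu> ?B = ?\<nu> (L -` ?B)" by (rule nn_integral_cong) (auto simp: indicator_def)
  have "?\<mu> ?B < \<infinity>" unfolding \<mu>B using emeasure_bounded_finite[OF bdd] opn by simp
  moreover have "?\<mu> ?B > 0" unfolding \<mu>B by (rule pos[OF opn ne])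
  ultimately obtain a where a: "?\<mu> ?B = ennreal a" "a > 0"
    by (cases "?\<mu> ?B") (auto simp: less_top[symmetric])
  have "?\<nu> ?B > 0" by (rule pos) auto
  with fin obtain b where b: "?\<nu> ?B = ennreal b" "b > 0"
    by (cases "?\<nu> ?B") (auto simp: less_top[symmetric])
  show ?thesis
  proof (rule that[of "a / b"])
    show "a / b > 0" using a b by simp
    show "distr lborel borel L = density lborel (\<lambda>_. ennreal (a / b))"
    proof (rule measure_eqI)
      fix E assume "E \<in> sets (distr lborel borel L)"
      then have E: "E \<in> sets borel" by simp
      have "?\<mu> E * ennreal b = ennreal a * emeasure lborel E"
        using key[OF E, of ?B] a b E by simp
      then have "?\<mu> E * ennreal b * ennreal (1 / b) = ennreal a * emeasure lborel E * ennreal (1 / b)" by simp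
      moreover have "ennreal b * ennreal (1 / b) = 1" using b(2) by (simp add: ennreal_mult[symmetric])
      moreover have "ennreal a * ennreal (1 / b) = ennreal (a / b)" using a(2) b(2) by (simp add: ennreal_mult[symmetric])
      ultimately have "?\<mu> E = ennreal (a / b) * emeasure lborel E"
        by (metis (no_types, lifting) mult.assoc mult.commute mult.right_neutral)
      then show "emeasure (distr lborel borel L) E = emeasure (density lborel (\<lambda>_. ennreal (a / b))) E"
        using \<mu>[OF E] E by (simp add: emeasure_density_const)
    qed simp
  qed
qed

lemma lborel_integral_affine:
  fixes L :: "'a::euclidean_space \<Rightarrow> 'a" and f :: "'a \<Rightarrow> 'b::euclidean_space"
  assumes L: "linear L" and c: "c > 0" "distr lborel borel L = density lborel (\<lambda>_. ennreal c)"
    and f: "f \<in> borel_measurable borel"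
  shows "(LINT x|lborel. f (L x + b)) = c *\<^sub>R (LINT x|lborel. f x)"
proof -
  have Lm: "L \<in> borel_measurable borel"
    using L(1) by (intro borel_measurable_continuous_onI linear_continuous_on) (simp add: linear_conv_bounded_linear)
  have fb: "(\<lambda>y. f (y + b)) \<in> borel_measurable borel" using f by measurable
  have "(LINT x|lborel. f (L x + b)) = (LINT y|distr lborel borel L. f (y + b))"
    using Lm fb by (subst integral_distr) auto
  also have "\<dots> = (LINT y|lborel. c *\<^sub>R f (y + b))"
    unfolding c(2) using fb c(1) by (subst integral_density) auto
  also have "\<dots> = c *\<^sub>R (LINT y|lborel. f (y + b))" by simp
  also have "(LINT y|lborel. f (y + b)) = (LINT y|lborel. f y)" by (rule lborel_integral_translate[OF f])
  finally show ?thesis .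
qed

lemma set_integrable_continuous_compact:
  fixes f :: "'a::euclidean_space \<Rightarrow> 'b::euclidean_space"
  assumes "compact T" "continuous_on UNIV f" shows "set_integrable lborel T f"
  unfolding set_integrable_def
  by (rule borel_integrable_compact[OF assms(1) continuous_on_subset[OF assms(2)]]) simp

lemma set_integral_affine_image:
  fixes L :: "'a::euclidean_space \<Rightarrow> 'a" and f :: "'a \<Rightarrow> 'b::euclidean_space"
  assumes L: "linear L" "inj L" and c: "c > 0" "distr lborel borel L = density lborel (\<lambda>_. ennreal c)"
    and "compact T" "f \<in> borel_measurable borel"
  shows "(LINT x:T|lborel. f (L x + b)) = c *\<^sub>R (LINT x:(\<lambda>x. L x + b) ` T|lborel. f x)"
proof -
  have cont: "continuous_on T (\<lambda>x. L x + b)"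
    using L(1) by (intro continuous_intros linear_continuous_on) (simp add: linear_conv_bounded_linear)
  have "(\<lambda>x. L x + b) ` T \<in> sets borel"
    using compact_continuous_image[OF cont assms(5)] by (auto intro: borel_closed compact_imp_closed)
  then have m: "(\<lambda>x. indicator ((\<lambda>x. L x + b) ` T) x *\<^sub>R f x) \<in> borel_measurable borel"
    using assms(6) by (intro borel_measurable_scaleR borel_measurable_indicator) auto
  have ind: "indicator T x = (indicator ((\<lambda>x. L x + b) ` T) (L x + b) :: real)" for x
  proof -
    have "inj (\<lambda>x. L x + b)" using L(2) by (simp add: inj_def)
    from inj_image_mem_iff[OF this, of x T] show ?thesis by (simp add: indicator_def)
  qed
  show ?thesis
    using lborel_integral_affine[OF L(1) c m, of b] unfolding set_lebesgue_integral_def ind .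
qed

lemma set_integral_scale:
  fixes f :: "'a::euclidean_space \<Rightarrow> real"
  assumes "compact T" "f \<in> borel_measurable borel" "0 < t"
  shows "(LINT x:T|lborel. t ^ DIM('a) * f (p + t *\<^sub>R (x - p))) = (LINT x:(\<lambda>x. p + t *\<^sub>R (x - p)) ` T|lborel. f x)"
proof -
  let ?A = "\<lambda>x. p + t *\<^sub>R (x - p)"
  have "compact (?A ` T)" by (intro compact_continuous_image continuous_intros assms)
  then have m: "(\<lambda>x. indicator (?A ` T) x * f x) \<in> borel_measurable borel"
    using assms(2) by (intro borel_measurable_times borel_measurable_indicator) (auto intro: borel_closed compact_imp_closed)
  have A: "(\<lambda>x. (p - t *\<^sub>R p) + t *\<^sub>R x) = ?A" by (auto simp: algebra_simps)
  have ind: "indicator T x = (indicator (?A ` T) (?A x) :: real)" for x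
    using assms(3) by (auto simp: indicator_def)
  have "lborel = density (distr lborel borel ?A) (\<lambda>_. ennreal (t ^ DIM('a)))"
    using lborel_affine[of t "p - t *\<^sub>R p"] assms(3) unfolding A by simp
  then have "(LINT x|lborel. indicator (?A ` T) x * f x)
      = (LINT x|density (distr lborel borel ?A) (\<lambda>_. ennreal (t ^ DIM('a))). indicator (?A ` T) x * f x)" by simp
  also have "\<dots> = (LINT x|distr lborel borel ?A. t ^ DIM('a) * (indicator (?A ` T) x * f x))"
    using m assms(3) by (subst integral_density) auto
  also have "\<dots> = (LINT x|lborel. t ^ DIM('a) * (indicator (?A ` T) (?A x) * f (?A x)))"
    using m by (subst integral_distr) auto
  finally show ?thesis
    unfolding set_lebesgue_integral_def ind by (simp add: algebra_simps)
qed

lemma one_minus_power_le: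
  fixes t :: real
  assumes "0 \<le> t" "t \<le> 1" shows "1 - t ^ n \<le> real n * (1 - t)"
proof -
  have "1 + real n * (t - 1) \<le> (1 + (t - 1)) ^ n" by (rule Bernoulli_inequality) (use assms in simp)
  then show ?thesis by (simp add: algebra_simps)
qed

text \<open>The divergence theorem for the field \<open>v x (x - p)\<close> on a cone with apex \<open>p\<close>, when \<open>v\<close>
  vanishes on the base. It is the derivative at \<open>t = 1\<close> of the integral of \<open>v\<close> over the cone shrunk
  by the factor \<open>t\<close>; that integral changes by \<open>O((1 - t)\<^sup>2)\<close> only, as \<open>v\<close> is small near the base.\<close>

lemma cone_integral_zero:
  fixes T :: "'a::euclidean_space set"
  assumes T: "compact T" "convex T" "p \<in> T" "F \<subseteq> T"
    and cone: "\<And>x. x \<in> T \<Longrightarrow> \<exists>y\<in>F. \<exists>s\<in>{0..1}. x = p + s *\<^sub>R (y - p)"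
    and v: "times_cont_diff (Suc 0) v" "\<And>y. y \<in> F \<Longrightarrow> v y = 0"
  shows "real DIM('a) * (LINT x:T|lborel. v x) + (LINT x:T|lborel. grad v x \<bullet> (x - p)) = 0"
proof -
  let ?d = "DIM('a)"
  let ?A = "\<lambda>t x. p + t *\<^sub>R (x - p)"
  have cv: "continuous_on UNIV v" "continuous_on UNIV (grad v)"
    by (rule times_cont_diff_continuous[OF v(1)], rule continuous_grad[OF v(1)])
  have vm: "v \<in> borel_measurable borel" using cv by (intro borel_measurable_continuous_onI)
  have AT: "?A t x \<in> T" if "x \<in> T" "t \<in> {0..1}" for t x
    using convex_translation_segment[OF T(2,3), of "x - p" t] that by simp
  obtain R where R: "R > 0" "\<And>x. x \<in> T \<Longrightarrow> norm (x - p) \<le> R"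
  proof -
    have "compact ((\<lambda>x. x - p) ` T)" by (intro compact_continuous_image continuous_intros T)
    then obtain R where "R > 0" "\<forall>y\<in>(\<lambda>x. x - p) ` T. norm y \<le> R" using compact_imp_bounded bounded_pos by blast
    then show ?thesis using that by auto
  qed
  obtain V where V: "V > 0" "\<And>x. x \<in> T \<Longrightarrow> \<bar>v x\<bar> \<le> V"
  proof -
    have "compact (v ` T)" by (intro compact_continuous_image continuous_on_subset[OF cv(1)] T) auto
    then obtain R where "R > 0" "\<forall>y\<in>v ` T. norm y \<le> R" using compact_imp_bounded bounded_pos by blast
    then show ?thesis using that by auto
  qed
  obtain B where B: "B > 0" "\<And>x. x \<in> T \<Longrightarrow> norm (grad v x) \<le> B"
  proof -
    have "compact (grad v ` T)" by (intro compact_continuous_image continuous_on_subset[OF cv(2)] T) auto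
    then obtain R where "R > 0" "\<forall>y\<in>grad v ` T. norm y \<le> R" using compact_imp_bounded bounded_pos by blast
    then show ?thesis using that by auto
  qed
  have gb: "\<bar>grad v (?A t x) \<bullet> (y - p)\<bar> \<le> B * R" if "x \<in> T" "t \<in> {0..1}" "y \<in> T" for t x y
  proof -
    have "\<bar>grad v (?A t x) \<bullet> (y - p)\<bar> \<le> norm (grad v (?A t x)) * norm (y - p)" by (rule Cauchy_Schwarz_ineq2)
    also have "\<dots> \<le> B * R" using B R AT that by (intro mult_mono) auto
    finally show ?thesis .
  qed
  \<comment> \<open>The integral over the shrunken cone is pulled back to \<open>T\<close>, so that
    the domain stays fixed and t moves into the integrand, where it can be differentiated.\<close>
  define \<Phi> where "\<Phi> t = (LINT x|lborel. indicator T x * (t ^ ?d * v (?A t x)))" for t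
  define D where "D = (LINT x|lborel. indicator T x * (real ?d * v x + grad v x \<bullet> (x - p)))"
  have cA: "continuous_on UNIV (\<lambda>x. v (?A t x))" "continuous_on UNIV (\<lambda>x. grad v (?A t x))" for t
    by (auto intro!: continuous_on_compose2[OF cv(1)] continuous_on_compose2[OF cv(2)] continuous_intros)
  have ci: "integrable lborel (\<lambda>x. indicator T x * f x)" if "continuous_on UNIV f" for f :: "'a \<Rightarrow> real"
    using set_integrable_continuous_compact[OF T(1) that] by (simp add: set_integrable_def)
  have der: "(\<Phi> has_real_derivative D) (at 1 within {0..1})"
  proof -
    have "((\<lambda>t. LINT x|lborel. indicator T x * (t ^ ?d * v (?A t x))) has_real_derivative
       (LINT x|lborel. indicator T x * (real ?d * 1 ^ (?d - 1) * v (?A 1 x) + 1 ^ ?d * (grad v (?A 1 x) \<bullet> (x - p))))) (at 1 within {0..1})"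
    proof (rule has_real_derivative_integral_dominated[where g="\<lambda>x. indicator T x * (real ?d * V + B * R)"])
      show "integrable lborel (\<lambda>x. indicator T x * (t ^ ?d * v (?A t x)))" for t
        by (intro ci continuous_intros cA)
      show "integrable lborel (\<lambda>x. indicator T x * (real ?d * V + B * R))"
        by (intro ci continuous_intros)
      show "(\<lambda>x. indicator T x * (real ?d * 1 ^ (?d - 1) * v (?A 1 x) + 1 ^ ?d * (grad v (?A 1 x) \<bullet> (x - p)))) \<in> borel_measurable lborel"
        by (intro borel_measurable_integrable ci continuous_intros cA)
      fix t x assume t: "t \<in> {0..1::real}"
      show "((\<lambda>t. indicator T x * (t ^ ?d * v (?A t x))) has_real_derivative
          indicator T x * (real ?d * t ^ (?d - 1) * v (?A t x) + t ^ ?d * (grad v (?A t x) \<bullet> (x - p)))) (at t within {0..1})"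
        using has_real_derivative_along_line[OF v(1), of p "x - p" t "{0..1}"]
        by (auto intro!: derivative_eq_intros)
      show "\<bar>indicator T x * (real ?d * t ^ (?d - 1) * v (?A t x) + t ^ ?d * (grad v (?A t x) \<bullet> (x - p)))\<bar>
          \<le> indicator T x * (real ?d * V + B * R)"
      proof (cases "x \<in> T")
        case True
        have p1: "0 \<le> t ^ n" "t ^ n \<le> 1" for n using t by (auto simp: power_le_one)
        have "\<bar>real ?d * t ^ (?d - 1) * v (?A t x)\<bar> \<le> real ?d * 1 * V"
          unfolding abs_mult using p1 V AT[OF True t] by (intro mult_mono) auto
        moreover have "\<bar>t ^ ?d * (grad v (?A t x) \<bullet> (x - p))\<bar> \<le> 1 * (B * R)"
          unfolding abs_mult using p1 gb[OF True t True] by (intro mult_mono) auto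
        ultimately show ?thesis using True by (simp add: abs_triangle_ineq[THEN order_trans])
      qed simp
    qed auto
    then show ?thesis by (simp add: \<Phi>_def[abs_def] D_def)
  qed
  define m where "m = (LINT x|lborel. indicator T x * (1::real))"
  have m: "m \<ge> 0" unfolding m_def by (rule integral_nonneg_AE) simp
  have est: "\<bar>\<Phi> 1 - \<Phi> t\<bar> \<le> (B * R * m * real ?d) * (1 - t)\<^sup>2" if t: "0 < t" "t < 1" for t
  proof -
    let ?Tt = "?A t ` T"
    have sub: "?Tt \<subseteq> T" using AT t by auto
    have Tt: "compact ?Tt" by (intro compact_continuous_image continuous_intros T)
    have cit: "integrable lborel (\<lambda>x. indicator ?Tt x * f x)" if "continuous_on UNIV f" for f :: "'a \<Rightarrow> real"
      using set_integrable_continuous_compact[OF Tt that] by (simp add: set_integrable_def)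
    have \<Phi>t: "\<Phi> t = (LINT x|lborel. indicator ?Tt x * v x)"
      using set_integral_scale[OF T(1) vm t(1), of p]
      unfolding \<Phi>_def set_lebesgue_integral_def real_scaleR_def .
    have mt: "(LINT x|lborel. indicator ?Tt x * 1) = t ^ ?d * m"
      using set_integral_scale[OF T(1) _ t(1), of "\<lambda>x. 1" p] by (simp add: m_def set_lebesgue_integral_def mult.commute)
    \<comment> \<open>A point outside the shrunken cone lies at parameter s > t on its ray, so less
      than 1 - t away from the base, where \<open>v\<close> vanishes.\<close>
    have near: "\<bar>v x\<bar> \<le> B * R * (1 - t)" if x: "x \<in> T" "x \<notin> ?Tt" for x
    proof -
      obtain y s where ys: "y \<in> F" "s \<in> {0..1}" "x = ?A s y" using cone[OF x(1)] by blast
      then have yT: "y \<in> T" using T(4) by auto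
      have "s > t"
      proof (rule ccontr)
        assume "\<not> s > t"
        then have "s / t \<in> {0..1}" using t ys(2) by auto
        then have "?A (s / t) y \<in> T" by (rule AT[OF yT])
        moreover have "x = ?A t (?A (s / t) y)" using ys(3) t by simp
        ultimately show False using x(2) by blast
      qed
      have "norm (v (p + s *\<^sub>R (y - p)) - v (p + 1 *\<^sub>R (y - p))) \<le> B * R * norm (s - 1)"
        by (rule field_differentiable_bound[of "{0..1}", OF _ has_real_derivative_along_line[OF v(1)]])
           (use gb[OF yT _ yT] ys in auto)
      then have "\<bar>v x\<bar> \<le> B * R * (1 - s)" using v(2)[OF ys(1)] ys by simp
      also have "\<dots> \<le> B * R * (1 - t)" using \<open>s > t\<close> B(1) R(1) by (intro mult_left_mono) auto
      finally show ?thesis .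
    qed
    have "\<Phi> 1 - \<Phi> t = (LINT x|lborel. indicator T x * v x - indicator ?Tt x * v x)"
      unfolding \<Phi>t using ci[OF cv(1)] cit[OF cv(1)] by (simp add: \<Phi>_def)
    \<comment> \<open>There are two factors of order 1 - t: the size of \<open>v\<close> on the
      shell and the volume of the shell.\<close>
    also have "\<bar>\<dots>\<bar> \<le> (LINT x|lborel. B * R * (1 - t) * (indicator T x * 1 - indicator ?Tt x * 1))"
    proof (rule integral_abs_bound_integral)
      show "integrable lborel (\<lambda>x. indicator T x * v x - indicator ?Tt x * v x)" using ci[OF cv(1)] cit[OF cv(1)] by simp
      show "integrable lborel (\<lambda>x. B * R * (1 - t) * (indicator T x * 1 - indicator ?Tt x * 1))"
        using ci[of "\<lambda>x. 1"] cit[of "\<lambda>x. 1"] by (intro integrable_mult_right Bochner_Integration.integrable_diff) auto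
      fix x
      show "\<bar>indicator T x * v x - indicator ?Tt x * v x\<bar> \<le> B * R * (1 - t) * (indicator T x * 1 - indicator ?Tt x * 1)"
        using near[of x] sub by (cases "x \<in> ?Tt"; cases "x \<in> T") (auto simp del: image_iff simp: indicator_def)
    qed
    also have "\<dots> = B * R * (1 - t) * (m - t ^ ?d * m)"
      using ci[of "\<lambda>x. 1"] cit[of "\<lambda>x. 1"] mt by (simp add: m_def)
    also have "\<dots> = (B * R * (1 - t) * m) * (1 - t ^ ?d)" by (simp add: algebra_simps)
    also have "\<dots> \<le> (B * R * (1 - t) * m) * (real ?d * (1 - t))"
      using one_minus_power_le[of t ?d] t B(1) R(1) m by (intro mult_left_mono) auto
    finally show ?thesis by (simp add: power2_eq_square algebra_simps)
  qed
  have "((\<lambda>t. (\<Phi> t - \<Phi> 1) / (t - 1)) \<longlongrightarrow> 0) (at 1 within {0..1})"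
  proof (rule Lim_null_comparison)
    show "\<forall>\<^sub>F t in at 1 within {0..1}. norm ((\<Phi> t - \<Phi> 1) / (t - 1)) \<le> (B * R * m * real ?d) * (1 - t)"
      unfolding eventually_at
    proof (intro exI[of _ 1] conjI ballI impI)
      fix t assume "t \<in> {0..1::real}" "t \<noteq> 1 \<and> dist t 1 < 1"
      then have t: "0 < t" "t < 1" by (auto simp: dist_real_def)
      have "\<bar>\<Phi> t - \<Phi> 1\<bar> \<le> (B * R * m * real ?d) * (1 - t) * (1 - t)"
        using est[OF t] by (simp add: power2_eq_square abs_minus_commute mult.assoc)
      then show "norm ((\<Phi> t - \<Phi> 1) / (t - 1)) \<le> (B * R * m * real ?d) * (1 - t)"
        using t by (simp add: abs_divide pos_divide_le_eq abs_of_neg)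
    qed simp
    have "((\<lambda>t::real. (B * R * m * real ?d) * (1 - t)) \<longlongrightarrow> (B * R * m * real ?d) * (1 - 1)) (at 1 within {0..1})"
      by (intro tendsto_intros)
    then show "((\<lambda>t::real. (B * R * m * real ?d) * (1 - t)) \<longlongrightarrow> 0) (at 1 within {0..1})" by simp
  qed
  moreover have "((\<lambda>t. (\<Phi> t - \<Phi> 1) / (t - 1)) \<longlongrightarrow> D) (at 1 within {0..1})"
    using der by (simp add: has_field_derivative_iff)
  moreover have "at (1::real) within {0..1} \<noteq> bot"
    by (simp add: trivial_limit_within islimpt_Icc)
  ultimately have "D = 0" using tendsto_unique by blast
  moreover have "D = real ?d * (LINT x:T|lborel. v x) + (LINT x:T|lborel. grad v x \<bullet> (x - p))"
  proof -
    have "D = (LINT x|lborel. indicator T x * (real ?d * v x) + indicator T x * (grad v x \<bullet> (x - p)))"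
      by (simp add: D_def distrib_left)
    also have "\<dots> = (LINT x|lborel. indicator T x * (real ?d * v x)) + (LINT x|lborel. indicator T x * (grad v x \<bullet> (x - p)))"
      by (intro Bochner_Integration.integral_add ci continuous_intros cv)
    also have "(LINT x|lborel. indicator T x * (real ?d * v x)) = real ?d * (LINT x|lborel. indicator T x * v x)"
      by (subst integral_mult_right_zero[symmetric]) (simp only: mult.left_commute)
    finally show ?thesis by (simp only: set_lebesgue_integral_def real_scaleR_def)
  qed
  ultimately show ?thesis by simp
qed

section \<open>Affine maps between simplices\<close>

lemma affine_extension:
  fixes C :: "'a::euclidean_space set" and f :: "'a \<Rightarrow> 'a"
  assumes "\<not> affine_dependent C"
  obtains L b where "linear L" "\<And>c. c \<in> C \<Longrightarrow> L c + b = f c"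
proof (cases "C = {}")
  case True
  then show ?thesis using that[of "\<lambda>x. x" 0] linear_id by (simp add: id_def)
next
  case False
  then obtain c0 where c0: "c0 \<in> C" by blast
  have "independent ((\<lambda>x. - c0 + x) ` (C - {c0}))"
    using assms affine_dependent_iff_dependent2[OF c0] by simp
  from linear_independent_extend[OF this, of "\<lambda>y. f (c0 + y) - f c0"]
  obtain L where L: "linear L" "\<forall>y\<in>(\<lambda>x. - c0 + x) ` (C - {c0}). L y = f (c0 + y) - f c0" by blast
  show ?thesis
  proof (rule that[OF L(1)])
    fix c assume c: "c \<in> C"
    have "L (- c0 + c) = f c - f c0"
      using L c by (cases "c = c0") (auto simp: linear_0)
    moreover have "L (- c0 + c) = - L c0 + L c" by (simp only: linear_add[OF L(1)] linear_neg[OF L(1)])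
    ultimately have "- L c0 + L c = f c - f c0" by (simp only:)
    then show "L c + (f c0 - L c0) = f c" by (simp add: algebra_simps)
  qed
qed

lemma affine_map_fixes_hull:
  assumes "linear L" "\<And>c. c \<in> C \<Longrightarrow> L c + b = c" "x \<in> affine hull C"
  shows "L x + b = x"
proof -
  have "affine {x. L x + b = x}"
    unfolding affine_def
  proof (intro ballI allI impI CollectI)
    fix x y and u v :: real assume "x \<in> {x. L x + b = x}" "y \<in> {x. L x + b = x}" and uv: "u + v = 1"
    then have x: "L x = x - b" and y: "L y = y - b" by (auto simp: eq_diff_eq)
    have "L (u *\<^sub>R x + v *\<^sub>R y) + b = u *\<^sub>R x + v *\<^sub>R y - (u + v) *\<^sub>R b + b"
      by (simp add: linear_add[OF assms(1)] linear_scale[OF assms(1)] x y algebra_simps)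
    then show "L (u *\<^sub>R x + v *\<^sub>R y) + b = u *\<^sub>R x + v *\<^sub>R y" by (simp add: uv)
  qed
  then have "affine hull C \<subseteq> {x. L x + b = x}" using assms(2) by (intro hull_minimal) auto
  then show ?thesis using assms(3) by auto
qed

lemma affine_image_convex_hull:
  assumes "linear L" shows "(\<lambda>x. L x + b) ` (convex hull S) = convex hull ((\<lambda>x. L x + b) ` S)"
proof -
  have "(\<lambda>x. L x + b) ` X = (\<lambda>x. b + x) ` L ` X" for X by (auto simp: add.commute)
  then show ?thesis by (simp add: convex_hull_linear_image[OF assms] convex_hull_translation)
qed

definition simplex_vertices :: "'a::euclidean_space set \<Rightarrow> bool" where
  "simplex_vertices C \<longleftrightarrow> \<not> affine_dependent C \<and> card C = DIM('a) + 1"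

lemma simplex_verticesD:
  fixes C :: "'a::euclidean_space set"
  assumes "simplex_vertices C"
  shows "finite C" "affine hull C = UNIV" "compact (convex hull C)" "interior (convex hull C) \<noteq> {}"
    "0 < measure lborel (convex hull C)"
proof -
  show fin: "finite C" using assms aff_independent_finite by (auto simp: simplex_vertices_def)
  have "aff_dim C = DIM('a)"
    using aff_dim_affine_independent[of C] assms by (simp add: simplex_vertices_def)
  then show UN: "affine hull C = UNIV" by (simp add: aff_dim_eq_full)
  show cp: "compact (convex hull C)" by (rule finite_imp_compact_convex_hull[OF fin])
  have "C \<noteq> {}" using assms by (auto simp: simplex_vertices_def)
  then show int: "interior (convex hull C) \<noteq> {}"
    using rel_interior_interior[of "convex hull C"] rel_interior_eq_empty[of "convex hull C"] UN
    by (simp add: affine_hull_convex_hull)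
  have "bounded (interior (convex hull C))" using cp by (simp add: bounded_interior compact_imp_bounded)
  then have "0 < measure lebesgue (interior (convex hull C))" by (intro measure_open_pos) (use int in auto)
  also have "\<dots> \<le> measure lebesgue (convex hull C)"
    using cp by (intro measure_mono_fmeasurable lmeasurable_compact interior_subset) auto
  also have "\<dots> = measure lborel (convex hull C)"
    using cp by (simp add: measure_def borel_closed compact_imp_closed)
  finally show "0 < measure lborel (convex hull C)" .
qed

text \<open>The affine extension of the inverse bijection of the vertices is a left inverse: the
  composition fixes all vertices, hence their affine hull, which is the whole space.\<close>

lemma simplex_map:
  fixes C C' :: "'a::euclidean_space set"
  assumes C: "simplex_vertices C" "simplex_vertices C'" and f: "bij_betw f C C'"
  obtains L b where "linear L" "inj L" "\<And>c. c \<in> C \<Longrightarrow> L c + b = f c"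
proof -
  obtain L b where L: "linear L" "\<And>c. c \<in> C \<Longrightarrow> L c + b = f c"
    using affine_extension[of C f] C(1) by (auto simp: simplex_vertices_def)
  obtain M a where M: "linear M" "\<And>c. c \<in> C' \<Longrightarrow> M c + a = inv_into C f c"
    using affine_extension[of C' "inv_into C f"] C(2) by (auto simp: simplex_vertices_def)
  have "(M \<circ> L) x + (M b + a) = x" for x
  proof (rule affine_map_fixes_hull[OF linear_compose[OF L(1) M(1)]])
    show "x \<in> affine hull C" using simplex_verticesD(2)[OF C(1)] by simp
    fix c assume c: "c \<in> C"
    then have "M (L c + b) + a = c"
      using L(2) M(2) f by (simp add: bij_betw_def inv_into_f_f image_iff) (metis image_eqI inv_into_f_f)
    then show "(M \<circ> L) c + (M b + a) = c" by (simp add: linear_add[OF M(1)] add.assoc)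
  qed
  then have "inj L" by (intro inj_on_inverseI[of _ "\<lambda>y. M y + (M b + a)"]) auto
  then show ?thesis using that L by blast
qed

lemma cone_convex_hull:
  assumes "C - {p} \<noteq> {}" "p \<in> C" "x \<in> convex hull C"
  shows "\<exists>y\<in>convex hull (C - {p}). \<exists>s\<in>{0..1::real}. x = p + s *\<^sub>R (y - p)"
proof -
  have "x \<in> convex hull (insert p (C - {p}))" using assms by (simp add: insert_absorb)
  then obtain u v y where "0 \<le> u" "0 \<le> v" "u + v = 1" "y \<in> convex hull (C - {p})" "x = u *\<^sub>R p + v *\<^sub>R y"
    unfolding convex_hull_insert[OF assms(1)] by blast
  then have "u = 1 - v" "v \<in> {0..1}" by auto
  with \<open>x = _\<close> have "x = p + v *\<^sub>R (y - p)" by (simp add: algebra_simps)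
  then show ?thesis using \<open>y \<in> _\<close> \<open>v \<in> _\<close> by blast
qed

text \<open>By the divergence theorem for \<open>w x (x - p)\<close> this is the mean of \<open>w\<close> over the facet of \<open>T\<close>
  opposite to \<open>p\<close>; no surface measure is needed to see that it depends on the facet only.\<close>

definition facet_mean :: "'a::euclidean_space set \<Rightarrow> 'a \<Rightarrow> ('a \<Rightarrow> real) \<Rightarrow> real" where
  "facet_mean T p w =
     (LINT x:T|lborel. w x + (grad w x \<bullet> (x - p)) / real DIM('a)) / measure lborel T"

lemma measure_eq_set_integral:
  "compact T \<Longrightarrow> (LINT x:T|lborel. (1::real)) = measure lborel (T::'a::euclidean_space set)"
  by (simp add: set_lebesgue_integral_def)

lemma continuous_grad_inner:
  assumes "times_cont_diff (Suc k) w"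
  shows "continuous_on UNIV (\<lambda>x. w x + (grad w x \<bullet> (x - p)) / c)"
  unfolding divide_inverse
  by (intro continuous_intros continuous_grad[OF assms] times_cont_diff_continuous[OF assms])

text \<open>A simplex is a cone with apex \<open>p\<close> over the opposite facet, so this is
  \<open>cone_integral_zero\<close> divided by the dimension and the volume.\<close>

lemma facet_mean_zero:
  fixes C :: "'a::euclidean_space set"
  assumes C: "simplex_vertices C" "p \<in> C" and w: "times_cont_diff (Suc 0) w"
    and "\<And>y. y \<in> convex hull (C - {p}) \<Longrightarrow> w y = 0"
  shows "facet_mean (convex hull C) p w = 0"
proof -
  let ?T = "convex hull C"
  have "card (C - {p}) > 0" using C by (simp add: simplex_vertices_def)
  then have ne: "C - {p} \<noteq> {}" by (metis card.empty less_irrefl)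
  have z: "real DIM('a) * (LINT x:?T|lborel. w x) + (LINT x:?T|lborel. grad w x \<bullet> (x - p)) = 0"
    by (rule cone_integral_zero[where F="convex hull (C - {p})"])
       (use assms simplex_verticesD[OF C(1)] cone_convex_hull[OF ne C(2)] in
        \<open>auto simp: hull_inc hull_mono simp del: times_cont_diff.simps intro: subsetD[OF hull_mono]\<close>)
  have cont: "continuous_on UNIV w" "continuous_on UNIV (\<lambda>x. (grad w x \<bullet> (x - p)) / real DIM('a))"
    using times_cont_diff_continuous[OF w] continuous_grad[OF w] by (auto intro!: continuous_intros)
  have "(LINT x:?T|lborel. w x + (grad w x \<bullet> (x - p)) / real DIM('a))
      = (LINT x:?T|lborel. w x) + (LINT x:?T|lborel. grad w x \<bullet> (x - p)) / real DIM('a)"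
    using set_integral_add(2)[OF set_integrable_continuous_compact[OF simplex_verticesD(3)[OF C(1)] cont(1)]
        set_integrable_continuous_compact[OF simplex_verticesD(3)[OF C(1)] cont(2)]] by simp
  also have "\<dots> = 0" using z by (simp add: field_simps)
  finally show ?thesis by (simp add: facet_mean_def)
qed

lemma facet_mean_lincomb:
  fixes T :: "'a::euclidean_space set"
  assumes "compact T" and w: "times_cont_diff (Suc 0) w" "times_cont_diff (Suc 0) w'"
  shows "facet_mean T p (\<lambda>x. w x + c * w' x) = facet_mean T p w + c * facet_mean T p w'"
proof -
  let ?g = "\<lambda>w x. w x + (grad w x \<bullet> (x - p)) / real DIM('a)"
  have "(LINT x:T|lborel. ?g (\<lambda>x. w x + c * w' x) x) = (LINT x:T|lborel. ?g w x + c * ?g w' x)"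
    using assms by (simp add: grad_lincomb[OF w] inner_add_left add_divide_distrib distrib_left add.assoc add.left_commute del: times_cont_diff.simps)
  also have "\<dots> = (LINT x:T|lborel. ?g w x) + (LINT x:T|lborel. c * ?g w' x)"
    by (intro set_integral_add set_integrable_continuous_compact assms(1) continuous_intros
        continuous_grad_inner[OF w(1)] continuous_grad_inner[OF w(2)])
  also have "(LINT x:T|lborel. c * ?g w' x) = c * (LINT x:T|lborel. ?g w' x)" by simp
  finally show ?thesis by (simp add: facet_mean_def add_divide_distrib)
qed

text \<open>An affine map that fixes the common facet and sends \<open>p\<close> to
  \<open>p'\<close> carries one simplex onto the other, and the facet mean of \<open>w\<close> on
  the second is that of the pulled back \<open>w\<close> on the first. The pullback agrees with
  \<open>w\<close> on the common facet, so their difference has facet mean zero.\<close>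

lemma facet_mean_shared:
  fixes C C' :: "'a::euclidean_space set"
  assumes C: "simplex_vertices C" "p \<in> C" and C': "simplex_vertices C'" "p' \<in> C'"
    and eq: "C - {p} = C' - {p'}" and w: "times_cont_diff (Suc 0) w"
  shows "facet_mean (convex hull C) p w = facet_mean (convex hull C') p' w"
proof -
  let ?T = "convex hull C" and ?T' = "convex hull C'"
  define f where "f c = (if c = p then p' else c)" for c
  have "bij_betw f (insert p (C - {p})) (insert p' (C' - {p'}))"
    unfolding eq[symmetric] using eq by (intro bij_betw_byWitness[where f'="\<lambda>c. if c = p' then p else c"]) (auto simp: f_def)
  then have f: "bij_betw f C C'" using C(2) C'(2) by (simp add: insert_absorb)
  obtain L b where L: "linear L" "inj L" "\<And>c. c \<in> C \<Longrightarrow> L c + b = f c"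
    using simplex_map[OF C(1) C'(1) f] by blast
  let ?A = "\<lambda>x. L x + b"
  have "?A ` C = C'" using L(3) f by (simp add: bij_betw_def)
  then have img: "?A ` ?T = ?T'" using affine_image_convex_hull[OF L(1)] by simp
  obtain c where c: "c > 0" "distr lborel borel L = density lborel (\<lambda>_. ennreal c)"
    using lborel_distr_linear[OF L(1,2)] by blast
  have int: "(LINT x:?T|lborel. g (?A x)) = c * (LINT x:?T'|lborel. g x)" if "continuous_on UNIV g" for g :: "'a \<Rightarrow> real"
    using set_integral_affine_image[OF L(1,2) c simplex_verticesD(3)[OF C(1)], of g b] that
    by (simp add: borel_measurable_continuous_onI img)
  have m: "measure lborel ?T = c * measure lborel ?T'"
    using int[of "\<lambda>x. 1"] simplex_verticesD(3)[OF C(1)] simplex_verticesD(3)[OF C'(1)]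
    by (simp add: measure_eq_set_integral)
  let ?w = "\<lambda>x. w (?A x)"
  have w': "times_cont_diff (Suc 0) ?w" by (rule times_cont_diff_affine_compose[OF L(1) w])
  have Ap: "?A p = p'" using L(3)[OF C(2)] by (simp add: f_def)
  have g: "grad ?w x \<bullet> (x - p) = grad w (?A x) \<bullet> (?A x - p')" for x
  proof -
    have "(?A has_derivative L) (at x)"
      using L(1) by (auto intro!: derivative_eq_intros bounded_linear_imp_has_derivative simp: linear_conv_bounded_linear)
    from has_derivative_compose[OF this has_derivative_grad[OF w]]
    have "(?w has_derivative (\<lambda>h. grad w (?A x) \<bullet> L h)) (at x)" .
    from has_derivative_unique[OF this has_derivative_grad[OF w']]
    have "grad ?w x \<bullet> (x - p) = grad w (?A x) \<bullet> L (x - p)" by metis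
    also have "L (x - p) = ?A x - p'" using Ap by (simp add: linear_diff[OF L(1)] algebra_simps)
    finally show ?thesis .
  qed
  have "facet_mean ?T' p' w = facet_mean ?T p ?w"
    using int[OF continuous_grad_inner[OF w, of p' "real DIM('a)"]] c(1) simplex_verticesD(5)[OF C(1)]
    unfolding facet_mean_def g m by simp
  moreover have "facet_mean ?T p (\<lambda>x. ?w x + (-1) * w x) = 0"
  proof (rule facet_mean_zero[OF C])
    show "times_cont_diff (Suc 0) (\<lambda>x. ?w x + (-1) * w x)"
      by (intro times_cont_diff_add times_cont_diff_cmult w w')
    fix y assume y: "y \<in> convex hull (C - {p})"
    have "?A y = y"
      by (rule affine_map_fixes_hull[OF L(1), of "C - {p}"]) (use L(3) y convex_hull_subset_affine_hull in \<open>auto simp: f_def\<close>)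
    then show "?w y + (-1) * w y = 0" by simp
  qed
  moreover have "facet_mean ?T p (\<lambda>x. ?w x + (-1) * w x) = facet_mean ?T p ?w + (-1) * facet_mean ?T p w"
    by (rule facet_mean_lincomb[OF simplex_verticesD(3)[OF C(1)] w' w])
  ultimately show ?thesis by simp
qed

text \<open>A point fixed by the affine maps exchanging two vertices has equal barycentric coordinates.\<close>

lemma swap_invariant_mean:
  fixes C :: "'a::euclidean_space set"
  assumes C: "\<not> affine_dependent C" "X \<in> affine hull C"
    and swap: "\<And>p q. p \<in> C \<Longrightarrow> q \<in> C \<Longrightarrow> p \<noteq> q \<Longrightarrow> \<exists>L b. linear L \<and> L X + b = X \<and>
      (\<forall>c\<in>C. L c + b = (if c = p then q else if c = q then p else c))"
  shows "X = (\<Sum>C) /\<^sub>R real (card C)"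
proof -
  have fin: "finite C" using C(1) aff_independent_finite by blast
  obtain u where u: "sum u C = 1" "(\<Sum>c\<in>C. u c *\<^sub>R c) = X" using C(2) affine_hull_finite[OF fin] by auto
  have eq: "u p = u q" if pq: "p \<in> C" "q \<in> C" "p \<noteq> q" for p q
  proof -
    let ?s = "\<lambda>c. if c = p then q else if c = q then p else c"
    obtain L b where L: "linear L" "L X + b = X" "\<forall>c\<in>C. L c + b = ?s c" using swap[OF pq] by blast
    have bij: "bij_betw ?s C C" using pq by (intro bij_betw_byWitness[where f'="?s"]) auto
    have ss: "?s (?s c) = c" for c using pq by auto
    have s1: "(\<Sum>c\<in>C. u (?s c)) = 1"
      using sum.reindex_bij_betw[OF bij, of u] u(1) by simp
    have "X = (\<Sum>c\<in>C. u c *\<^sub>R L c) + (\<Sum>c\<in>C. u c) *\<^sub>R b"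
    proof -
      have "L X = (\<Sum>c\<in>C. u c *\<^sub>R L c)" by (simp add: u(2)[symmetric] linear_sum[OF L(1)] linear_scale[OF L(1)])
      then show ?thesis using L(2) u(1) by simp
    qed
    also have "\<dots> = (\<Sum>c\<in>C. u c *\<^sub>R (L c + b))" by (simp add: scaleR_add_right sum.distrib scaleR_sum_left)
    also have "\<dots> = (\<Sum>c\<in>C. u c *\<^sub>R ?s c)" using L(3) by (intro sum.cong) auto
    also have "\<dots> = (\<Sum>c\<in>C. u (?s c) *\<^sub>R c)"
      using sum.reindex_bij_betw[OF bij, of "\<lambda>c. u (?s c) *\<^sub>R c"] by (simp only: ss)
    finally have s2: "X = (\<Sum>c\<in>C. u (?s c) *\<^sub>R c)" .
    \<comment> \<open>Both \<open>u\<close> and \<open>u\<close> with two entries exchanged are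
      barycentric coordinates of \<open>X\<close>; affine independence makes them equal.\<close>
    have "sum (\<lambda>c. u c - u (?s c)) C = 0" using u(1) s1 by (simp add: sum_subtractf)
    moreover have "(\<Sum>c\<in>C. (u c - u (?s c)) *\<^sub>R c) = 0"
      using u(2) s2 by (simp add: scaleR_diff_left sum_subtractf)
    ultimately have "\<forall>c\<in>C. u c - u (?s c) = 0"
      using C(1) unfolding affine_dependent_explicit_finite[OF fin] by blast
    then have "u p - u (?s p) = 0" using pq(1) by (rule bspec)
    then show ?thesis by simp
  qed
  have "C \<noteq> {}" using u(1) by auto
  then obtain p where p: "p \<in> C" by blast
  have up: "u c = u p" if "c \<in> C" for c using eq[OF that p] by (cases "c = p") auto
  have "sum u C = real (card C) * u p" using sum.cong[OF refl up] by simp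
  then have "real (card C) * u p = 1" using u(1) by simp
  then have "u p = 1 / real (card C)" by (metis divide_self_if mult_cancel_left1 nonzero_mult_div_cancel_left zero_neq_one mult_zero_left)
  then have "u c = 1 / real (card C)" if "c \<in> C" for c using up[OF that] by simp
  then have "X = (\<Sum>c\<in>C. (1 / real (card C)) *\<^sub>R c)"
    unfolding u(2)[symmetric] by (intro sum.cong refl) simp
  then show ?thesis by (simp add: scaleR_sum_right divide_inverse)
qed

section \<open>Centroids of simplices and facets by symmetry\<close>

lemma set_integral_bounded_linear_affine:
  fixes g :: "'a::euclidean_space \<Rightarrow> 'a"
  assumes "compact T" "continuous_on UNIV g" "linear L"
  shows "(LINT x:T|lborel. L (g x) + (b::'a)) = L (LINT x:T|lborel. g x) + measure lborel T *\<^sub>R b"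
proof -
  have i: "integrable lborel (\<lambda>x. indicator T x *\<^sub>R g x)"
    using set_integrable_continuous_compact[OF assms(1,2)] by (simp add: set_integrable_def)
  have bl: "bounded_linear L" using assms(3) by (simp add: linear_conv_bounded_linear)
  have ib: "integrable lborel (\<lambda>x. indicator T x *\<^sub>R b)"
    using set_integrable_continuous_compact[OF assms(1), of "\<lambda>x. b"] by (simp add: set_integrable_def)
  have "(LINT x:T|lborel. L (g x) + b) = (LINT x|lborel. L (indicator T x *\<^sub>R g x) + indicator T x *\<^sub>R b)"
    unfolding set_lebesgue_integral_def by (simp add: scaleR_add_right linear_scale[OF assms(3)])
  also have "\<dots> = (LINT x|lborel. L (indicator T x *\<^sub>R g x)) + (LINT x|lborel. indicator T x *\<^sub>R b)"
    using integrable_bounded_linear[OF bl i] ib by simp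
  also have "(LINT x|lborel. L (indicator T x *\<^sub>R g x)) = L (LINT x|lborel. indicator T x *\<^sub>R g x)"
    by (rule integral_bounded_linear[OF bl i])
  also have "(LINT x|lborel. indicator T x *\<^sub>R b) = measure lborel T *\<^sub>R b"
    using set_integrable_continuous_compact[OF assms(1), of "\<lambda>x. 1::real"] measure_eq_set_integral[OF assms(1)]
    by (subst integral_scaleR_left) (simp_all add: set_integrable_def set_lebesgue_integral_def)
  finally show ?thesis by (simp add: set_lebesgue_integral_def)
qed

text \<open>A map of \<open>T\<close> onto itself has volume factor 1, so substituting it does not
  change the integral of \<open>g\<close>; and taking means commutes with affine maps. Applied to
  the identity on a simplex and to the projection of a prism onto its base.\<close>

lemma mean_fixed_by_symmetry:
  fixes g :: "'a::euclidean_space \<Rightarrow> 'a"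
  assumes T: "compact T" "measure lborel T > 0" and g: "continuous_on UNIV g"
    and L: "linear L" "inj L" "(\<lambda>x. L x + b) ` T = T" "\<And>x. x \<in> T \<Longrightarrow> g (L x + b) = L (g x) + b"
  defines "X \<equiv> (LINT x:T|lborel. g x) /\<^sub>R measure lborel T"
  shows "L X + b = X"
proof -
  obtain c where c: "c > 0" "distr lborel borel L = density lborel (\<lambda>_. ennreal c)"
    using lborel_distr_linear[OF L(1,2)] by blast
  have "measure lborel T = c * measure lborel T"
    using set_integral_affine_image[OF L(1,2) c T(1), of "\<lambda>x. 1::real" b] T(1)
    by (simp add: L(3) measure_eq_set_integral)
  then have "c = 1" using T(2) by simp
  then have "(LINT x:T|lborel. g (L x + b)) = (LINT x:T|lborel. g x)"
    using set_integral_affine_image[OF L(1,2) c T(1), of g b] g by (simp add: L(3) borel_measurable_continuous_onI)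
  also have "(LINT x:T|lborel. g (L x + b)) = (LINT x:T|lborel. L (g x) + b)"
    unfolding set_lebesgue_integral_def
    by (rule Bochner_Integration.integral_cong) (auto simp: L(4) indicator_def)
  also have "\<dots> = L (LINT x:T|lborel. g x) + measure lborel T *\<^sub>R b"
    by (rule set_integral_bounded_linear_affine[OF T(1) g L(1)])
  finally have eq: "L (LINT x:T|lborel. g x) + measure lborel T *\<^sub>R b = (LINT x:T|lborel. g x)" .
  have "L X + b = (L (LINT x:T|lborel. g x) + measure lborel T *\<^sub>R b) /\<^sub>R measure lborel T"
    using T(2) by (simp add: X_def linear_scale[OF L(1)] scaleR_add_right)
  then show ?thesis unfolding eq by (simp add: X_def)
qed

lemma swap_bij:
  "p \<in> C \<Longrightarrow> q \<in> C \<Longrightarrow> bij_betw (\<lambda>c. if c = p then q else if c = q then p else c) C C"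
  by (intro bij_betw_byWitness[where f'="\<lambda>c. if c = p then q else if c = q then p else c"]) auto

text \<open>The affine maps that exchange two vertices preserve the simplex, hence fix its centroid,
  and \<open>swap_invariant_mean\<close> identifies the fixed point.\<close>

lemma simplex_centroid:
  fixes C :: "'a::euclidean_space set"
  assumes C: "simplex_vertices C"
  shows "(LINT x:convex hull C|lborel. x) = measure lborel (convex hull C) *\<^sub>R ((\<Sum>C) /\<^sub>R real (DIM('a) + 1))"
proof -
  let ?T = "convex hull C"
  note S = simplex_verticesD[OF C]
  have "(LINT x:?T|lborel. x) /\<^sub>R measure lborel ?T = (\<Sum>C) /\<^sub>R real (card C)"
  proof (rule swap_invariant_mean)
    fix p q assume pq: "p \<in> C" "q \<in> C" "p \<noteq> q"
    let ?s = "\<lambda>c. if c = p then q else if c = q then p else c"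
    obtain L b where L: "linear L" "inj L" "\<And>c. c \<in> C \<Longrightarrow> L c + b = ?s c"
      using simplex_map[OF C C swap_bij[OF pq(1,2)]] by metis
    have "(\<lambda>x. L x + b) ` C = ?s ` C" using L(3) by (intro image_cong) auto
    also have "\<dots> = C" using swap_bij[OF pq(1,2)] by (simp add: bij_betw_def)
    finally have img: "(\<lambda>x. L x + b) ` ?T = ?T" using affine_image_convex_hull[OF L(1)] by simp
    have "L ((LINT x:?T|lborel. x) /\<^sub>R measure lborel ?T) + b = (LINT x:?T|lborel. x) /\<^sub>R measure lborel ?T"
      by (rule mean_fixed_by_symmetry[OF S(3,5) _ L(1,2) img]) auto
    then show "\<exists>L b. linear L \<and> L ((LINT x:?T|lborel. x) /\<^sub>R measure lborel ?T) + b = (LINT x:?T|lborel. x) /\<^sub>R measure lborel ?T \<and>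
      (\<forall>c\<in>C. L c + b = ?s c)" using L by blast
  qed (use C S in \<open>auto simp: simplex_vertices_def\<close>)
  moreover have "(LINT x:?T|lborel. x) = measure lborel ?T *\<^sub>R ((LINT x:?T|lborel. x) /\<^sub>R measure lborel ?T)"
    using S(5) by simp
  ultimately show ?thesis using C by (simp add: simplex_vertices_def)
qed

text \<open>The facet spans a hyperplane, so a unit normal exists and the choice in
  \<open>unit_normal\<close> is meaningful. Conversely a chosen normal describes that hyperplane,
  because the two hyperplanes have equal dimension.\<close>

lemma facet_unit_normal:
  fixes C :: "'a::euclidean_space set"
  assumes C: "simplex_vertices C" "p \<in> C"
  defines "F \<equiv> convex hull (C - {p})"
  shows "norm (unit_normal F) = 1" "\<And>x y. x \<in> affine hull F \<Longrightarrow> y \<in> F \<Longrightarrow> unit_normal F \<bullet> (x - y) = 0"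
    "\<And>x y. y \<in> F \<Longrightarrow> unit_normal F \<bullet> (x - y) = 0 \<Longrightarrow> x \<in> affine hull F"
    "\<And>x. x \<in> F \<Longrightarrow> x + unit_normal F \<notin> affine hull F"
proof -
  let ?n = "unit_normal F"
  have ind: "\<not> affine_dependent (C - {p})"
    using C affine_independent_Diff by (auto simp: simplex_vertices_def)
  have "card (C - {p}) = DIM('a)" using C simplex_verticesD(1)[OF C(1)] by (simp add: simplex_vertices_def)
  then have "aff_dim F = DIM('a) - 1"
    using aff_dim_affine_independent[OF ind] by (simp add: F_def aff_dim_convex_hull)
  then obtain a b where a: "a \<noteq> 0" "affine hull F = {x. a \<bullet> x = b}"
    using aff_dim_eq_hyperplane[of F] by auto
  have F: "F \<subseteq> affine hull F" by (rule hull_subset)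
  have "\<exists>n. norm n = 1 \<and> (\<forall>x\<in>F. \<forall>y\<in>F. n \<bullet> (x - y) = 0)"
    using a F by (intro exI[of _ "a /\<^sub>R norm a"]) (auto simp: inner_diff_right subset_iff)
  from someI_ex[OF this] have n: "norm ?n = 1" "\<forall>x\<in>F. \<forall>y\<in>F. ?n \<bullet> (x - y) = 0"
    by (auto simp: unit_normal_def)
  then show "norm ?n = 1" by simp
  have aff: "?n \<bullet> (x - y) = 0" if "x \<in> affine hull F" "y \<in> F" for x y
  proof -
    have "affine {x. ?n \<bullet> x = ?n \<bullet> y}" by (rule affine_hyperplane)
    moreover have "F \<subseteq> {x. ?n \<bullet> x = ?n \<bullet> y}"
    proof
      fix x assume "x \<in> F"
      then have "?n \<bullet> (x - y) = 0" using n(2) that(2) by blast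
      then show "x \<in> {x. ?n \<bullet> x = ?n \<bullet> y}" by (simp add: inner_diff_right)
    qed
    ultimately have "affine hull F \<subseteq> {x. ?n \<bullet> x = ?n \<bullet> y}" by (rule hull_minimal[rotated])
    then have "?n \<bullet> x = ?n \<bullet> y" using that(1) by blast
    then show ?thesis by (simp add: inner_diff_right)
  qed
  then show "\<And>x y. x \<in> affine hull F \<Longrightarrow> y \<in> F \<Longrightarrow> ?n \<bullet> (x - y) = 0" .
  have nn: "?n \<bullet> ?n = 1" using n(1) by (simp add: norm_eq_1)
  show "x + ?n \<notin> affine hull F" if "x \<in> F" for x
  proof
    assume "x + ?n \<in> affine hull F"
    from aff[OF this that] show False using nn by simp
  qed
  show "x \<in> affine hull F" if y: "y \<in> F" and x: "?n \<bullet> (x - y) = 0" for x y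
  proof -
    have "affine hull F = {x. ?n \<bullet> x = ?n \<bullet> y}"
    proof (rule affine_dim_equal)
      show "affine hull F \<noteq> {}" using y F by auto
      show "affine hull F \<subseteq> {x. ?n \<bullet> x = ?n \<bullet> y}"
      proof
        fix x assume "x \<in> affine hull F"
        from aff[OF this y] show "x \<in> {x. ?n \<bullet> x = ?n \<bullet> y}" by (simp add: inner_diff_right)
      qed
      have "?n \<noteq> 0" using n(1) by auto
      then show "aff_dim (affine hull F) = aff_dim {x. ?n \<bullet> x = ?n \<bullet> y}"
        using \<open>aff_dim F = _\<close> by (simp add: aff_dim_hyperplane)
    qed (auto intro: affine_hyperplane)
    then show ?thesis using x by (simp add: inner_diff_right)
  qed
qed

text \<open>The constant \<open>m\<close> is the volume of the prism, that is, the area of the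
  facet. Facet integrals are prism integrals of a function composed with the projection
  \<open>\<pi>\<close>, so for affine functions only the mean \<open>Y\<close> of
  \<open>\<pi>\<close> matters. Affine maps that exchange two vertices of the facet and preserve the
  normal map the prism to itself and commute with \<open>\<pi>\<close>; hence \<open>Y\<close> is
  the centroid of the vertices.\<close>

lemma facet_integral_affine:
  fixes C :: "'a::euclidean_space set"
  assumes C: "simplex_vertices C" "p \<in> C"
  defines "F \<equiv> convex hull (C - {p})"
  obtains m where "m > 0" "\<And>v a \<beta>. (\<And>x. x \<in> F \<Longrightarrow> v x = a \<bullet> x + \<beta>) \<Longrightarrow>
    (LINT x:F|facet_measure F. v x) = m * (a \<bullet> ((\<Sum>(C - {p})) /\<^sub>R real DIM('a)) + \<beta>)"
proof -
  let ?n = "unit_normal F" and ?S = "C - {p}" and ?P = "prism F"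
  define \<pi> where "\<pi> = closest_point (affine hull F)"
  note n = facet_unit_normal[OF C, folded F_def]
  have finS: "finite ?S" using simplex_verticesD(1)[OF C(1)] by simp
  have cardS: "card ?S = DIM('a)" using C simplex_verticesD(1)[OF C(1)] by (simp add: simplex_vertices_def)
  then have "?S \<noteq> {}" by (metis DIM_positive card.empty less_irrefl)
  then obtain s0 where s0: "s0 \<in> ?S" by blast
  have indS: "\<not> affine_dependent ?S" using C affine_independent_Diff by (auto simp: simplex_vertices_def)
  have SF: "?S \<subseteq> F" unfolding F_def by (rule hull_subset)
  have F: "compact F" "F \<subseteq> affine hull F"
    using finite_imp_compact_convex_hull[OF finS] hull_subset[of F affine] by (auto simp: F_def)
  have affS: "affine hull F = affine hull ?S" by (simp add: F_def affine_hull_convex_hull)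
  have Fb: "F \<in> sets borel" using F(1) by (auto intro: borel_closed compact_imp_closed)
  have aff: "convex (affine hull F)" "closed (affine hull F)" "affine hull F \<noteq> {}"
    using F SF s0 by (auto simp: affine_imp_convex)
  have \<pi>_cont: "continuous_on S \<pi>" for S unfolding \<pi>_def by (rule continuous_on_closest_point[OF aff])
  have \<pi>_eq: "\<pi> (x + t *\<^sub>R ?n) = x" if "x \<in> F" for x t
    unfolding \<pi>_def
  proof (rule closest_point_unique[OF aff(1,2), symmetric])
    show "x \<in> affine hull F" using that F by blast
    show "\<forall>z\<in>affine hull F. dist (x + t *\<^sub>R ?n) x \<le> dist (x + t *\<^sub>R ?n) z"
    proof
      fix z assume z: "z \<in> affine hull F"
      have o: "?n \<bullet> (x - z) = 0" using n(2)[OF z that] by (simp add: inner_diff_right)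
      have "(norm (t *\<^sub>R ?n))\<^sup>2 \<le> (norm ((x - z) + t *\<^sub>R ?n))\<^sup>2"
      proof -
        have "(norm ((x - z) + t *\<^sub>R ?n))\<^sup>2 = (norm (x - z))\<^sup>2 + (norm (t *\<^sub>R ?n))\<^sup>2"
          by (rule norm_add_Pythagorean) (use o in \<open>simp add: orthogonal_def inner_commute\<close>)
        then show ?thesis by simp
      qed
      then have "norm (t *\<^sub>R ?n) \<le> norm ((x - z) + t *\<^sub>R ?n)" by (rule power2_le_imp_le) simp
      then show "dist (x + t *\<^sub>R ?n) x \<le> dist (x + t *\<^sub>R ?n) z" by (simp add: dist_norm algebra_simps)
    qed
  qed
  have P_eq: "?P = (\<lambda>(x, t). x + t *\<^sub>R ?n) ` (F \<times> {0..1})"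
    unfolding prism_def by (auto simp: image_iff) blast+
  have P: "compact ?P" unfolding P_eq case_prod_unfold
    by (intro compact_continuous_image compact_Times F continuous_intros) auto
  have \<pi>P: "\<pi> x \<in> F" if "x \<in> ?P" for x using that \<pi>_eq by (auto simp: prism_def)
  \<comment> \<open>A full-dimensional simplex inside the prism. It shows that the prism has
    positive volume, and its vertices determine the affine maps used below.\<close>
  let ?C2 = "insert (s0 + ?n) ?S"
  have new: "s0 + ?n \<notin> affine hull ?S" using n(4)[of s0] SF s0 affS by auto
  then have newS: "s0 + ?n \<notin> ?S" by (meson hull_inc)
  have C2: "simplex_vertices ?C2"
    using affine_independent_insert[OF indS new] newS cardS finS by (simp add: simplex_vertices_def)
  have convexP: "convex ?P"
    unfolding convex_def
  proof (intro ballI allI impI)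
    fix x y and u v :: real assume xy: "x \<in> ?P" "y \<in> ?P" and uv: "0 \<le> u" "0 \<le> v" "u + v = 1"
    obtain x0 s where x: "x = x0 + s *\<^sub>R ?n" "x0 \<in> F" "s \<in> {0..1}" using xy by (auto simp: prism_def)
    obtain y0 t where y: "y = y0 + t *\<^sub>R ?n" "y0 \<in> F" "t \<in> {0..1}" using xy by (auto simp: prism_def)
    have "u *\<^sub>R x + v *\<^sub>R y = (u *\<^sub>R x0 + v *\<^sub>R y0) + (u * s + v * t) *\<^sub>R ?n" by (simp add: x y algebra_simps)
    moreover have "u *\<^sub>R x0 + v *\<^sub>R y0 \<in> F" using x y uv unfolding F_def by (intro convexD[OF convex_convex_hull]) auto
    moreover have "u * s + v * t \<in> {0..1}" using convexD[of "{0..1::real}" s t u v] x y uv by simp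
    ultimately show "u *\<^sub>R x + v *\<^sub>R y \<in> ?P" unfolding prism_def by blast
  qed
  have "s0 + 1 *\<^sub>R ?n \<in> ?P" using SF s0 unfolding prism_def by (intro CollectI exI[of _ s0] exI[of _ 1]) auto
  moreover have "x + 0 *\<^sub>R ?n \<in> ?P" if "x \<in> ?S" for x using SF that unfolding prism_def by (intro CollectI exI[of _ x] exI[of _ 0]) auto
  ultimately have "?C2 \<subseteq> ?P" by auto
  then have "convex hull ?C2 \<subseteq> ?P" using convexP by (intro hull_minimal) auto
  then have "measure lborel (convex hull ?C2) \<le> measure lborel ?P"
    using P simplex_verticesD(3)[OF C2] emeasure_bounded_finite[OF compact_imp_bounded[OF P]]
    by (intro measure_mono_fmeasurable) (auto simp: fmeasurable_def borel_closed compact_imp_closed)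
  then have mP: "measure lborel ?P > 0" using simplex_verticesD(5)[OF C2] by linarith
  define Y where "Y = (LINT x:?P|lborel. \<pi> x) /\<^sub>R measure lborel ?P"
  have int\<pi>: "integrable lborel (\<lambda>x. indicator ?P x *\<^sub>R \<pi> x)"
    using set_integrable_continuous_compact[OF P \<pi>_cont] by (simp add: set_integrable_def)
  have affint: "(LINT x:?P|lborel. a \<bullet> \<pi> x + \<beta>) = measure lborel ?P * (a \<bullet> Y + \<beta>)" for a \<beta>
  proof -
    have i1: "integrable lborel (\<lambda>x. indicator ?P x * \<beta>)"
      using set_integrable_continuous_compact[OF P, of "\<lambda>x. \<beta>"] by (simp add: set_integrable_def)
    have "(LINT x:?P|lborel. a \<bullet> \<pi> x + \<beta>) = (LINT x|lborel. a \<bullet> (indicator ?P x *\<^sub>R \<pi> x) + indicator ?P x * \<beta>)"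
      by (simp add: set_lebesgue_integral_def distrib_left)
    also have "\<dots> = (LINT x|lborel. a \<bullet> (indicator ?P x *\<^sub>R \<pi> x)) + (LINT x|lborel. indicator ?P x * \<beta>)"
      by (rule Bochner_Integration.integral_add[OF integrable_inner_right[OF int\<pi>] i1])
    also have "(LINT x|lborel. a \<bullet> (indicator ?P x *\<^sub>R \<pi> x)) = a \<bullet> (LINT x:?P|lborel. \<pi> x)"
      unfolding set_lebesgue_integral_def by (rule integral_inner_right[OF int\<pi>])
    also have "(LINT x|lborel. indicator ?P x * \<beta>) = measure lborel ?P * \<beta>"
      using P by (simp add: borel_closed compact_imp_closed emeasure_compact_finite)
    finally show ?thesis using mP by (simp add: Y_def algebra_simps)
  qed
  have "Y = (\<Sum>?S) /\<^sub>R real (card ?S)"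
  proof (rule swap_invariant_mean[OF indS])
    \<comment> \<open>The normal component of \<open>\<pi>\<close> is constant on the prism, so its
      mean \<open>Y\<close> lies in the hyperplane spanned by the facet, as
      \<open>swap_invariant_mean\<close> requires.\<close>
    have "(LINT x:?P|lborel. ?n \<bullet> \<pi> x + 0) = (LINT x:?P|lborel. (?n \<bullet> s0) * 1)"
      unfolding set_lebesgue_integral_def
    proof (rule Bochner_Integration.integral_cong)
      fix x
      show "indicator ?P x *\<^sub>R (?n \<bullet> \<pi> x + 0) = indicator ?P x *\<^sub>R ((?n \<bullet> s0) * 1)"
        using n(2)[of "\<pi> x" s0] \<pi>P[of x] F SF s0 by (cases "x \<in> ?P") (auto simp: inner_diff_right)
    qed simp
    also have "\<dots> = (?n \<bullet> s0) * measure lborel ?P" by (subst set_integral_mult_right) (simp add: measure_eq_set_integral[OF P] del: mult_1_right)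
    finally have "?n \<bullet> Y = ?n \<bullet> s0" using affint[of ?n 0] mP by simp
    then show "Y \<in> affine hull ?S" using n(3)[of s0 Y] SF s0 unfolding affS by (auto simp: inner_diff_right)
    fix p q assume pq: "p \<in> ?S" "q \<in> ?S" "p \<noteq> q"
    let ?s = "\<lambda>c. if c = p then q else if c = q then p else c"
    \<comment> \<open>The extra vertex follows its foot \<open>s0\<close>, which forces the linear
      part to fix the normal.\<close>
    let ?f = "\<lambda>c. if c = s0 + ?n then ?s s0 + ?n else ?s c"
    have sS: "?s ` ?S = ?S" using swap_bij[OF pq(1,2)] by (simp add: bij_betw_def)
    obtain L b where L: "linear L" "\<And>c. c \<in> ?C2 \<Longrightarrow> L c + b = ?f c"
      using affine_extension[of ?C2 ?f] C2 unfolding simplex_vertices_def by metis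
    have LS: "L c + b = ?s c" if "c \<in> ?S" for c using L(2)[of c] that newS by auto
    have "L (s0 + ?n) + b = ?s s0 + ?n" using L(2)[of "s0 + ?n"] by simp
    then have "(L s0 + b) + L ?n = ?s s0 + ?n" by (simp only: linear_add[OF L(1)] add_ac)
    then have Ln: "L ?n = ?n" unfolding LS[OF s0] by (simp only: add_left_cancel)
    have "(\<lambda>x. L x + b) ` ?S = ?s ` ?S" by (rule image_cong[OF refl]) (rule LS)
    then have AS: "(\<lambda>x. L x + b) ` ?S = ?S" using sS by (simp only:)
    have AF: "(\<lambda>x. L x + b) ` F = F"
      unfolding F_def affine_image_convex_hull[OF L(1)] AS ..
    have LLn: "L (x + t *\<^sub>R ?n) + b = (L x + b) + t *\<^sub>R ?n" for x t
      by (simp add: linear_add[OF L(1)] linear_scale[OF L(1)] Ln)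
    have AP: "(\<lambda>x. L x + b) ` ?P = ?P"
    proof -
      have FF: "F \<times> {0..1} = (\<lambda>(x, t). (L x + b, t)) ` (F \<times> {0..1::real})"
        by (subst image_paired_Times) (simp add: AF)
      have "?P = (\<lambda>(x, t). x + t *\<^sub>R ?n) ` (\<lambda>(x, t). (L x + b, t)) ` (F \<times> {0..1})"
        unfolding P_eq by (subst FF) (rule refl)
      moreover have "(\<lambda>x. L x + b) ` ?P = (\<lambda>(x, t). x + t *\<^sub>R ?n) ` (\<lambda>(x, t). (L x + b, t)) ` (F \<times> {0..1})"
        unfolding P_eq by (simp only: image_image case_prod_unfold fst_conv snd_conv LLn)
      ultimately show ?thesis by simp
    qed
    \<comment> \<open>The map is an involution on the vertices of \<open>?C2\<close>, hence
      everywhere, and therefore injective.\<close>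
    have "(L \<circ> L) x + (L b + b) = x" for x
    proof (rule affine_map_fixes_hull[OF linear_compose[OF L(1) L(1)]])
      show "x \<in> affine hull ?C2" using simplex_verticesD(2)[OF C2] by simp
      fix c assume c: "c \<in> ?C2"
      have LL: "L (L c + b) + b = c" if "c \<in> ?S" for c
      proof -
        have "?s c \<in> ?S" using that pq by auto
        from LS[OF this] have "L (L c + b) + b = ?s (?s c)" unfolding LS[OF that] .
        then show ?thesis using pq by simp
      qed
      have "L (L (s0 + ?n) + b) + b = s0 + ?n"
        using LLn[of s0 1] LLn[of "L s0 + b" 1] LL[OF s0] by (simp add: add_ac)
      then have "L (L c + b) + b = c" using c LL by auto
      then show "(L \<circ> L) c + (L b + b) = c" by (simp add: linear_add[OF L(1)] add.assoc)
    qed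
    then have inj: "inj L" by (intro inj_on_inverseI[of _ "\<lambda>y. L y + (L b + b)"]) auto
    have "L Y + b = Y" unfolding Y_def
    proof (rule mean_fixed_by_symmetry[OF P mP \<pi>_cont L(1) inj AP])
      fix x assume "x \<in> ?P"
      then obtain y t where y: "x = y + t *\<^sub>R ?n" "y \<in> F" by (auto simp: prism_def)
      have "L y + b \<in> F" using AF y(2) by blast
      then show "\<pi> (L x + b) = L (\<pi> x) + b" using y by (simp add: LLn \<pi>_eq)
    qed
    then show "\<exists>L b. linear L \<and> L Y + b = Y \<and> (\<forall>c\<in>?S. L c + b = ?s c)"
      using L(1) LS by (intro exI[of _ L] exI[of _ b] conjI ballI)
  qed
  then have Y: "Y = (\<Sum>?S) /\<^sub>R real DIM('a)" by (simp add: cardS)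
  show ?thesis
  proof (rule that[OF mP])
    fix v a \<beta> assume v: "\<And>x. x \<in> F \<Longrightarrow> v x = a \<bullet> x + \<beta>"
    have vi: "indicator F x *\<^sub>R v x = indicator F x *\<^sub>R (a \<bullet> x + \<beta>)" for x using v by (auto simp: indicator_def)
    have mF: "(\<lambda>x. indicator F x *\<^sub>R (a \<bullet> x + \<beta>)) \<in> borel_measurable borel"
      using Fb by (intro borel_measurable_scaleR borel_measurable_indicator) auto
    have Pb: "?P \<in> sets borel" using P by (auto intro: borel_closed compact_imp_closed)
    have "(LINT x:F|facet_measure F. v x) = (LINT x|facet_measure F. indicator F x *\<^sub>R (a \<bullet> x + \<beta>))"
      unfolding set_lebesgue_integral_def vi ..
    also have "\<dots> = (LINT x|lebesgue_on ?P. indicator F (\<pi> x) *\<^sub>R (a \<bullet> \<pi> x + \<beta>))"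
      unfolding facet_measure_def \<pi>_def[symmetric] using mF continuous_measurable_lebesgue_on[OF \<pi>_cont]
      by (subst integral_distr) auto
    also have "\<dots> = (LINT x|lebesgue_on ?P. a \<bullet> \<pi> x + \<beta>)"
      using \<pi>P by (intro Bochner_Integration.integral_cong) auto
    also have "\<dots> = (LINT x|lebesgue. indicator ?P x *\<^sub>R (a \<bullet> \<pi> x + \<beta>))"
      using Pb by (simp add: integral_restrict_space)
    also have "\<dots> = (LINT x|lborel. indicator ?P x *\<^sub>R (a \<bullet> \<pi> x + \<beta>))"
    proof (rule integral_completion)
      have "(\<lambda>x. a \<bullet> \<pi> x + \<beta>) \<in> borel_measurable borel"
        by (intro borel_measurable_continuous_onI continuous_intros \<pi>_cont)
      then show "(\<lambda>x. indicator ?P x *\<^sub>R (a \<bullet> \<pi> x + \<beta>)) \<in> borel_measurable lborel"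
        using Pb by (intro borel_measurable_scaleR borel_measurable_indicator) auto
    qed
    also have "\<dots> = measure lborel ?P * (a \<bullet> Y + \<beta>)" using affint by (simp add: set_lebesgue_integral_def)
    finally show "(LINT x:F|facet_measure F. v x) = measure lborel ?P * (a \<bullet> ((\<Sum>?S) /\<^sub>R real DIM('a)) + \<beta>)"
      by (simp add: Y)
  qed
qed

section \<open>Triangulated Lipschitz domains\<close>

text \<open>Close to a boundary point, the points strictly below the graph form an open set disjoint
  from \<open>\<Omega>\<close>, hence from its closure. Moving slightly downwards from the boundary
  point thus leaves the closure.\<close>

lemma lipschitz_interior_closure:
  fixes \<Omega> :: "'a::euclidean_space set"
  assumes "open \<Omega>" "lipschitz_boundary \<Omega>"
  shows "interior (closure \<Omega>) \<subseteq> \<Omega>"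
proof (rule subsetI, rule ccontr)
  fix x assume x: "x \<in> interior (closure \<Omega>)" "x \<notin> \<Omega>"
  then have "x \<in> frontier \<Omega>" using assms(1) interior_subset by (auto simp: frontier_def interior_open)
  then obtain r n \<gamma> L where r: "r > 0" and n: "norm n = 1" and \<gamma>: "L-lipschitz_on UNIV (\<gamma> :: 'a \<Rightarrow> real)"
    and iff: "\<And>y. y \<in> ball x r \<Longrightarrow> y \<in> \<Omega> \<longleftrightarrow> y \<bullet> n > \<gamma> (y - (y \<bullet> n) *\<^sub>R n)"
    using assms(2) unfolding lipschitz_boundary_def by metis
  have nn: "n \<bullet> n = 1" using n by (simp add: norm_eq_1)
  define h where "h y = y \<bullet> n - \<gamma> (y - (y \<bullet> n) *\<^sub>R n)" for y
  have \<gamma>c: "continuous_on UNIV \<gamma>" using \<gamma> by (rule lipschitz_on_continuous_on)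
  have "continuous_on UNIV (\<lambda>y. y - (y \<bullet> n) *\<^sub>R n)" by (intro continuous_intros)
  then have "continuous_on UNIV (\<lambda>y. \<gamma> (y - (y \<bullet> n) *\<^sub>R n))"
    by (rule continuous_on_compose2[OF \<gamma>c]) simp
  then have h: "continuous_on UNIV h"
    unfolding h_def by (intro continuous_on_diff continuous_on_inner continuous_on_id continuous_on_const)
  obtain e where e: "e > 0" "ball x e \<subseteq> closure \<Omega>"
    using x(1) by (meson mem_interior)
  define s where "s = min e r / 2"
  have s: "s > 0" "s < e" "s < r" using e r by (auto simp: s_def min_def)
  define y where "y = x - s *\<^sub>R n"
  have yb: "y \<in> ball x e" "y \<in> ball x r" using s n by (auto simp: y_def dist_norm)
  have "h x \<le> 0" using iff[of x] x(2) r by (auto simp: h_def)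
  moreover have "h y = h x - s" by (simp add: h_def y_def inner_diff_left nn algebra_simps)
  ultimately have hy: "h y < 0" using s by simp
  define W where "W = ball x r \<inter> h -` {..<0}"
  have "open W" unfolding W_def using h by (intro open_Int open_vimage) auto
  moreover have "W \<inter> \<Omega> = {}" using iff by (force simp: W_def h_def)
  ultimately have "W \<inter> closure \<Omega> = {}" by (simp add: open_Int_closure_eq_empty)
  moreover have "y \<in> W" using yb hy by (simp add: W_def)
  ultimately show False using yb(1) e(2) by blast
qed

text \<open>A direction that does not point away from \<open>T\<close> is split into a part
  \<open>f\<close> parallel to the hyperplane of \<open>F\<close> and a nonnegative multiple k of t
  - y. For small s the point y + s e is then a convex combination of \<open>t\<close> and of a point
  of \<open>F\<close> near \<open>y\<close>.\<close>

lemma simplex_contains_ray_start: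
  fixes T :: "'a::euclidean_space set"
  assumes y: "y \<in> rel_interior F" and F: "F \<subseteq> T" "affine hull F = {x. a \<bullet> x = b}" and T: "convex T"
    and t: "t \<in> T" "a \<bullet> t < b" and e: "a \<bullet> e \<le> 0"
  obtains d where "d > 0" "\<And>s. 0 \<le> s \<Longrightarrow> s \<le> d \<Longrightarrow> y + s *\<^sub>R e \<in> T"
proof -
  obtain r where r: "r > 0" "ball y r \<inter> affine hull F \<subseteq> F" and yF: "y \<in> F"
    using y by (auto simp: mem_rel_interior_ball)
  have ay: "a \<bullet> y = b" using yF F(2) hull_subset[of F affine] by auto
  \<comment> \<open>The value of k for which e - k (t - y) is parallel to the hyperplane; it is
    nonnegative since numerator and denominator are not positive.\<close>
  define k where "k = (a \<bullet> e) / (a \<bullet> (t - y))"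
  have at: "a \<bullet> (t - y) < 0" using t ay by (simp add: inner_diff_right)
  then have k: "k \<ge> 0" using e by (simp add: k_def divide_nonpos_neg)
  define f where "f = e - k *\<^sub>R (t - y)"
  have af: "a \<bullet> f = 0" using at by (simp add: f_def k_def inner_diff_right)
  \<comment> \<open>The first bound gives s k at most 1/2, so that the weight 1 - s k stays away
    from 0; the second then keeps the point \<open>z\<close> within distance r of
    \<open>y\<close>.\<close>
  define d where "d = min (1 / (2 * (k + 1))) (r / (2 * (norm f + 1)))"
  show ?thesis
  proof (rule that[of d])
    show "d > 0" using k r by (simp add: d_def add_nonneg_pos)
    fix s assume s: "0 \<le> s" "s \<le> d"
    have "s * (2 * (k + 1)) \<le> 1" using s(2) k by (simp add: d_def le_divide_eq)
    then have "2 * (s * k) + 2 * s \<le> 1" by (simp add: algebra_simps)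
    then have sk: "s * k \<le> 1 / 2" using s by linarith
    have "s * (2 * (norm f + 1)) \<le> r" using s(2) by (simp add: d_def le_divide_eq add_nonneg_pos)
    then have "2 * (s * norm f) + 2 * s \<le> r" by (simp add: algebra_simps)
    then have sf: "2 * (s * norm f) < r" using s r by (cases "s = 0") auto
    have pos: "1 - s * k \<ge> 1 / 2" using sk by simp
    define z where "z = y + (s / (1 - s * k)) *\<^sub>R f"
    have "z \<in> F"
    proof -
      have "s / (1 - s * k) \<le> s / (1 / 2)" using pos s by (intro divide_left_mono) auto
      then have "s / (1 - s * k) * norm f \<le> 2 * s * norm f" by (intro mult_right_mono) auto
      then have "dist y z < r" using sf pos s by (simp add: z_def dist_norm mult.assoc)
      moreover have "z \<in> affine hull F" using ay af by (simp add: F(2) z_def inner_add_right)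
      ultimately show ?thesis using r(2) by auto
    qed
    then have zT: "z \<in> T" using F(1) by blast
    have "y + s *\<^sub>R e = (1 - s * k) *\<^sub>R z + (s * k) *\<^sub>R t"
    proof -
      have "(1 - s * k) *\<^sub>R z = (1 - s * k) *\<^sub>R y + s *\<^sub>R f" using pos by (simp add: z_def scaleR_add_right)
      then show ?thesis by (simp add: f_def algebra_simps)
    qed
    also have "\<dots> \<in> T" using pos sk s k by (intro convexD[OF T zT t(1)]) auto
    finally show "y + s *\<^sub>R e \<in> T" .
  qed
qed

lemma affine_hull_negligible:
  fixes S :: "'a::euclidean_space set"
  assumes "aff_dim S < DIM('a)" shows "negligible (affine hull S)"
proof -
  have "interior (affine hull S) = {}"
    using aff_dim_nonempty_interior[of "affine hull S"] assms by (auto simp: aff_dim_affine_hull)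
  then show ?thesis by (simp add: negligible_convex_interior affine_imp_convex)
qed

section \<open>Geometry of a conforming triangulation\<close>

locale triangulated_domain =
  fixes \<Omega> :: "'a::euclidean_space set" and \<T> :: "'a set set"
  assumes domain: "polyhedral_lipschitz_domain \<Omega>" and conforming: "conforming_triangulation \<Omega> \<T>"
begin

definition vertices :: "'a set \<Rightarrow> 'a set" where "vertices T = {p. p extreme_point_of T}"

lemma \<Omega>: "open \<Omega>" "bounded \<Omega>" "\<Omega> \<noteq> {}" "\<Omega> \<in> sets lebesgue" "\<Omega> \<in> lmeasurable"
  using domain by (auto simp: polyhedral_lipschitz_domain_def intro: lmeasurable_open)

lemma finite_\<T>: "finite \<T>"
  using conforming by (simp add: conforming_triangulation_def triangulation_def)

lemma Union_\<T>: "\<Union>\<T> = closure \<Omega>"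
  using conforming by (simp add: conforming_triangulation_def)

lemma simplex_T:
  assumes "T \<in> \<T>" shows "simplex_vertices (vertices T)" "T = convex hull (vertices T)"
proof -
  obtain C where C: "\<not> affine_dependent C" "int (card C) = int DIM('a) + 1" "T = convex hull C"
    using conforming assms by (auto simp: conforming_triangulation_def simplex_def)
  then have "vertices T = C" by (auto simp: vertices_def extreme_point_of_convex_hull_affine_independent)
  then show "simplex_vertices (vertices T)" "T = convex hull (vertices T)"
    using C by (auto simp: simplex_vertices_def)
qed

lemma T_basic:
  assumes "T \<in> \<T>"
  shows "compact T" "convex T" "closed T" "bounded T" "interior T \<noteq> {}" "0 < measure lborel T" "finite (vertices T)"
    "affine hull T = UNIV" "aff_dim T = DIM('a)" "rel_interior T = interior T" "polytope T" "T \<in> sets borel"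
proof -
  note S = simplex_T[OF assms] and D = simplex_verticesD[OF simplex_T(1)[OF assms], folded simplex_T(2)[OF assms]]
  show c: "compact T" "interior T \<noteq> {}" "0 < measure lborel T" "finite (vertices T)" by (rule D)+
  show "convex T" by (subst S(2)) (rule convex_convex_hull)
  show "closed T" "bounded T" "T \<in> sets borel" using c by (auto intro: compact_imp_closed compact_imp_bounded borel_closed)
  show u: "affine hull T = UNIV" by (subst S(2)) (simp add: affine_hull_convex_hull D(2))
  show "aff_dim T = DIM('a)" using u by (simp add: aff_dim_eq_full)
  show "rel_interior T = interior T" by (rule rel_interior_interior[OF u])
  show "polytope T" unfolding polytope_def using S(2) c(4) by blast
qed

lemma face_Int: "T \<in> \<T> \<Longrightarrow> T' \<in> \<T> \<Longrightarrow> (T \<inter> T') face_of T"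
  using conforming by (simp add: conforming_triangulation_def triangulation_def)

text \<open>A proper face has smaller dimension, while all elements have full dimension, so no
  element is a face of another.\<close>

lemma face_full_dim:
  assumes "T \<in> \<T>" "T' \<in> \<T>" "T \<noteq> T'" shows "T \<inter> T' \<noteq> T"
proof
  assume eq: "T \<inter> T' = T"
  then have "T face_of T'" using face_Int[OF assms(2,1)] by (simp add: Int_commute)
  then have "aff_dim T < aff_dim T'" using face_of_aff_dim_lt[OF T_basic(2)[OF assms(2)]] assms(3) by blast
  then show False using T_basic(9)[OF assms(1)] T_basic(9)[OF assms(2)] by simp
qed

lemma interiors_disjoint:
  assumes "T \<in> \<T>" "T' \<in> \<T>" "T \<noteq> T'" shows "interior T \<inter> interior T' = {}"
proof (rule ccontr)
  assume "interior T \<inter> interior T' \<noteq> {}"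
  then have "interior (T \<inter> T') \<noteq> {}" by simp
  then have "aff_dim (T \<inter> T') = DIM('a)" by (rule aff_dim_nonempty_interior)
  moreover have "aff_dim (T \<inter> T') < aff_dim T"
    using face_of_aff_dim_lt[OF T_basic(2)[OF assms(1)] face_Int[OF assms(1,2)] face_full_dim[OF assms]] .
  ultimately show False using T_basic(9)[OF assms(1)] by simp
qed

text \<open>In a domain with a slit an open element could be crossed by the boundary; the Lipschitz
  condition excludes this.\<close>

lemma interior_subset_\<Omega>: "T \<in> \<T> \<Longrightarrow> interior T \<subseteq> \<Omega>"
proof -
  assume "T \<in> \<T>"
  then have "interior T \<subseteq> interior (closure \<Omega>)" using Union_\<T> by (intro interior_mono) blast
  also have "\<dots> \<subseteq> \<Omega>"
    using domain by (intro lipschitz_interior_closure) (auto simp: polyhedral_lipschitz_domain_def)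
  finally show ?thesis .
qed

lemma skeleton_negligible: "negligible (\<Omega> - (\<Union>T\<in>\<T>. interior T))"
proof (rule negligible_subset)
  show "negligible (\<Union>T\<in>\<T>. frontier T)"
    using finite_\<T> T_basic(2) by (intro negligible_Union finite_imageI) (auto intro: negligible_convex_frontier)
  show "\<Omega> - (\<Union>T\<in>\<T>. interior T) \<subseteq> (\<Union>T\<in>\<T>. frontier T)"
  proof
    fix x assume x: "x \<in> \<Omega> - (\<Union>T\<in>\<T>. interior T)"
    then have "x \<in> \<Union>\<T>" using Union_\<T> closure_subset by blast
    then obtain T where T: "T \<in> \<T>" "x \<in> T" by blast
    then have "x \<in> frontier T" using x closure_subset[of T] by (auto simp: frontier_def)
    then show "x \<in> (\<Union>T\<in>\<T>. frontier T)" using T by blast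
  qed
qed

lemma facetE:
  assumes "T \<in> \<T>" "F facet_of T"
  obtains p where "p \<in> vertices T" "F = convex hull (vertices T - {p})"
proof -
  have "F facet_of (convex hull (vertices T))" using assms(2) simplex_T(2)[OF assms(1)] by simp
  then show ?thesis
    using that facet_of_convex_hull_affine_independent[of "vertices T" F] simplex_T(1)[OF assms(1)]
    by (auto simp: simplex_vertices_def)
qed

text \<open>A point of \<open>T\<close> where \<open>c T \<noteq> 0\<close> is joined by a segment to a point outside the union of all such
  elements with the same value, chosen so that the segment meets no face of codimension two. At
  the last point of the union the segment crosses a facet, whose other side belongs to the union.\<close>

lemma facet_connected_zero:
  fixes c :: "'a set \<Rightarrow> real"
  assumes shared: "\<And>T T' F. T \<in> \<T> \<Longrightarrow> T' \<in> \<T> \<Longrightarrow> T \<noteq> T' \<Longrightarrow> F facet_of T \<Longrightarrow> F facet_of T' \<Longrightarrow> c T = c T'"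
    and boundary: "\<And>T F. T \<in> \<T> \<Longrightarrow> F facet_of T \<Longrightarrow> F \<subseteq> frontier \<Omega> \<Longrightarrow> c T = 0"
    and T0: "T0 \<in> \<T>"
  shows "c T0 = 0"
proof (rule ccontr)
  assume nz: "c T0 \<noteq> 0"
  define S where "S = {T \<in> \<T>. c T = c T0}"
  define U where "U = \<Union>S"
  have "finite S" using finite_\<T> by (simp add: S_def)
  then have U: "compact U" unfolding U_def using T_basic(1) by (intro compact_Union) (auto simp: S_def)
  define \<G> where "\<G> = (\<Union>T\<in>\<T>. {G. G face_of T \<and> aff_dim G \<le> int DIM('a) - 2})"
  have fin\<G>: "finite \<G>"
    unfolding \<G>_def using finite_\<T> finite_polytope_faces[OF T_basic(11)]
    by (intro finite_UN_I) (auto intro: finite_subset[rotated])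
  obtain x where x: "x \<in> interior T0" using T_basic(5)[OF T0] by blast
  have xU: "interior T0 \<subseteq> U" using T0 interior_subset by (force simp: U_def S_def)
  \<comment> \<open>The end points to be avoided: if the line through \<open>x\<close> and
    \<open>q\<close> meets \<open>G\<close> away from \<open>x\<close>, then \<open>q\<close> lies
    in the affine hull of \<open>x\<close> and \<open>G\<close>. Its dimension is at most one less
    than that of the space, so it is a null set.\<close>
  define B where "B = (\<Union>G\<in>\<G>. affine hull (insert x G))"
  have "negligible B"
    unfolding B_def
  proof (intro negligible_Union finite_imageI fin\<G>, clarify)
    fix G assume "G \<in> \<G>"
    then have "aff_dim G \<le> int DIM('a) - 2" by (auto simp: \<G>_def)
    then have "aff_dim (insert x G) < DIM('a)" by (simp add: aff_dim_insert)
    then show "negligible (affine hull (insert x G))" by (rule affine_hull_negligible)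
  qed
  moreover have "open (- U)" using U by (simp add: compact_imp_closed open_Compl)
  moreover have "- U \<noteq> {}" using U not_compact_UNIV by (metis Compl_UNIV_eq double_complement)
  ultimately have "\<not> - U \<subseteq> B" using open_not_negligible negligible_subset by blast
  then obtain q where q: "q \<notin> U" "q \<notin> B" by blast
  define e where "e = q - x"
  define K where "K = {t \<in> {0..1::real}. x + t *\<^sub>R e \<in> U}"
  have "K = {0..1} \<inter> (\<lambda>t. x + t *\<^sub>R e) -` U" by (auto simp: K_def)
  then have "compact K"
    using U by (auto intro!: compact_Int_closed closed_vimage continuous_intros simp: compact_imp_closed)
  moreover have "0 \<in> K" using x xU by (auto simp: K_def)
  ultimately obtain t where t: "t \<in> K" "\<And>s. s \<in> K \<Longrightarrow> s \<le> t" using compact_attains_sup[of K] by blast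
  define y where "y = x + t *\<^sub>R e"
  have yU: "y \<in> U" using t by (simp add: K_def y_def)
  have "t \<noteq> 1" using t q by (auto simp: K_def e_def)
  then have t01: "0 \<le> t" "t < 1" using t by (auto simp: K_def)
  have after: "\<exists>s>0. s \<le> d \<and> y + s *\<^sub>R e \<notin> U" if "d > 0" for d
  proof (intro exI conjI)
    let ?s = "min d (1 - t)"
    show "?s > 0" "?s \<le> d" using that t01 by auto
    show "y + ?s *\<^sub>R e \<notin> U"
    proof
      assume "y + ?s *\<^sub>R e \<in> U"
      then have "t + ?s \<in> K" using t01 that by (simp add: K_def y_def algebra_simps)
      then show False using t(2)[of "t + ?s"] that t01 by auto
    qed
  qed
  have not_int: "y \<notin> interior T" if "T \<in> S" for T
  proof
    assume "y \<in> interior T"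
    then obtain r where r: "r > 0" "ball y r \<subseteq> T" by (meson mem_interior)
    define d where "d = r / (2 * (norm e + 1))"
    have "d > 0" using r by (simp add: d_def add_nonneg_pos)
    then obtain s where s: "s > 0" "s \<le> d" "y + s *\<^sub>R e \<notin> U" using after by blast
    have "s * norm e \<le> d * (norm e + 1)" using s by (intro mult_mono) auto
    also have "\<dots> = r / 2"
    proof -
      have "norm e + 1 \<noteq> 0" using norm_ge_zero[of e] by linarith
      then show ?thesis unfolding d_def by (simp add: divide_simps)
    qed
    finally have "y + s *\<^sub>R e \<in> ball y r" using r s by (simp add: dist_norm)
    then show False using r s(3) that by (auto simp: U_def)
  qed
  have "T0 \<in> S" using T0 by (simp add: S_def)
  then have "t \<noteq> 0" using not_int x by (auto simp: y_def)
  have not_low: "y \<notin> G" if "G \<in> \<G>" for G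
  proof
    assume "y \<in> G"
    then have "y \<in> affine hull (insert x G)" "x \<in> affine hull (insert x G)" by (auto intro: hull_inc)
    then have "(1 - 1 / t) *\<^sub>R x + (1 / t) *\<^sub>R y \<in> affine hull (insert x G)"
      by (intro mem_affine[OF affine_affine_hull]) auto
    moreover have "(1 - 1 / t) *\<^sub>R x + (1 / t) *\<^sub>R y = q"
      using \<open>t \<noteq> 0\<close> by (simp add: y_def e_def algebra_simps)
    ultimately show False using q(2) that by (auto simp: B_def)
  qed
  obtain T where T: "T \<in> S" "y \<in> T" using yU by (auto simp: U_def)
  then have TT: "T \<in> \<T>" "c T = c T0" by (auto simp: S_def)
  note Tb = T_basic[OF TT(1)]
  have "y \<in> T - rel_interior T" using T not_int Tb(10) by auto
  then obtain F where F: "F facet_of T" "y \<in> F"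
    using rel_boundary_of_polyhedron[OF polytope_imp_polyhedron[OF Tb(11)]] by auto
  have Ff: "F face_of T" "F \<subseteq> T" "aff_dim F = int DIM('a) - 1"
    using F Tb(9) by (auto simp: facet_of_def dest: face_of_imp_subset)
  have Fc: "convex F" using Ff(1) face_of_imp_convex by blast
  have Fp: "polytope F" using face_of_polytope_polytope[OF Tb(11) Ff(1)] .
  have yF: "y \<in> rel_interior F"
  proof (rule ccontr)
    assume "y \<notin> rel_interior F"
    then obtain G where G: "G facet_of F" "y \<in> G"
      using rel_boundary_of_polyhedron[OF polytope_imp_polyhedron[OF Fp]] F(2) by auto
    then have "G face_of T" using Ff(1) face_of_trans facet_of_imp_face_of by blast
    moreover have "aff_dim G \<le> int DIM('a) - 2" using G Ff(3) by (simp add: facet_of_def)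
    ultimately have "G \<in> \<G>" using TT by (auto simp: \<G>_def)
    then show False using not_low G(2) by blast
  qed
  \<comment> \<open>As \<open>c T\<close> is nonzero, \<open>F\<close> is not a boundary facet. It
    therefore contains a point of \<open>\<Omega>\<close>, and by openness of
    \<open>\<Omega>\<close> there is one in its relative interior.\<close>
  have "\<not> F \<subseteq> frontier \<Omega>" using boundary[OF TT(1) F(1)] TT nz by auto
  moreover have "F \<subseteq> closure \<Omega>" using Ff(2) TT(1) Union_\<T> by blast
  ultimately obtain z0 where "z0 \<in> F" "z0 \<in> \<Omega>" using \<Omega>(1) by (auto simp: frontier_def interior_open)
  then have "\<Omega> \<inter> closure (rel_interior F) \<noteq> {}"
    using convex_closure_rel_interior[OF Fc] closure_subset[of F] by blast
  then have "\<Omega> \<inter> rel_interior F \<noteq> {}" using \<Omega>(1) by (simp add: open_Int_closure_eq_empty)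
  then obtain z where z: "z \<in> \<Omega>" "z \<in> rel_interior F" by blast
  have zF: "z \<in> F" using z rel_interior_subset by blast
  obtain p where p: "p \<in> vertices T" "F = convex hull (vertices T - {p})" using facetE[OF TT(1) F(1)] by blast
  have pT: "p \<in> T" using simplex_T(2)[OF TT(1)] p(1) by (metis hull_inc)
  have "p \<notin> affine hull (vertices T - {p})"
    using simplex_T(1)[OF TT(1)] p(1) unfolding simplex_vertices_def affine_dependent_def by blast
  then have p_aff: "p \<notin> affine hull F" by (simp add: p(2) affine_hull_convex_hull)
  obtain a b where ab: "a \<noteq> 0" "affine hull F = {x. a \<bullet> x = b}" "a \<bullet> p < b"
  proof -
    have "aff_dim F = DIM('a) - 1" using Ff(3) by (simp add: of_nat_diff)
    then obtain a b where ab: "a \<noteq> 0" "affine hull F = {x. a \<bullet> x = b}" using aff_dim_eq_hyperplane[of F] by blast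
    show ?thesis
    proof (cases "a \<bullet> p < b")
      case True then show ?thesis using that ab by blast
    next
      case False
      then have "- a \<bullet> p < - b" using p_aff ab(2) by auto
      moreover have "affine hull F = {x. - a \<bullet> x = - b}" using ab(2) by auto
      ultimately show ?thesis using that[of "- a" "- b"] ab(1) by simp
    qed
  qed
  have T_le: "a \<bullet> w \<le> b" if "w \<in> T" for w
  proof -
    have "vertices T \<subseteq> {x. a \<bullet> x \<le> b}"
    proof
      fix v assume v: "v \<in> vertices T"
      show "v \<in> {x. a \<bullet> x \<le> b}"
      proof (cases "v = p")
        case False
        then have "v \<in> F" using v p(2) by (auto intro: hull_inc)
        then have "v \<in> affine hull F" by (rule hull_inc)
        then show ?thesis using ab(2) by simp
      qed (use ab(3) in simp)
    qed
    then have "convex hull (vertices T) \<subseteq> {x. a \<bullet> x \<le> b}" by (rule hull_minimal) (rule convex_halfspace_le)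
    then show ?thesis using that simplex_T(2)[OF TT(1)] by blast
  qed
  \<comment> \<open>Close to \<open>z\<close> there are only elements containing \<open>z\<close>. A
    short step from \<open>z\<close> across the hyperplane of \<open>F\<close> ends in such an
    element, and it cannot be \<open>T\<close>, which lies on the other side.\<close>
  define \<N> where "\<N> = {T' \<in> \<T>. z \<notin> T'}"
  have "closed (\<Union>\<N>)" using finite_\<T> T_basic(3) by (intro closed_Union) (auto simp: \<N>_def)
  then have "open (\<Omega> - \<Union>\<N>)" using \<Omega>(1) by (rule open_Diff[rotated])
  moreover have "z \<in> \<Omega> - \<Union>\<N>" using z by (auto simp: \<N>_def)
  ultimately obtain r where r: "r > 0" "ball z r \<subseteq> \<Omega> - \<Union>\<N>" by (meson open_contains_ball)
  define w where "w = z + (r / (2 * norm a)) *\<^sub>R a"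
  have "w \<in> ball z r" using r ab(1) by (simp add: w_def dist_norm)
  then have w: "w \<in> \<Omega>" "w \<notin> \<Union>\<N>" using r(2) by auto
  then have "w \<in> \<Union>\<T>" using Union_\<T> closure_subset by blast
  then obtain T' where T': "T' \<in> \<T>" "w \<in> T'" by blast
  then have zT': "z \<in> T'" using w(2) by (auto simp: \<N>_def)
  have "a \<bullet> z = b" using hull_inc[OF zF, of affine] ab(2) by simp
  then have aw: "a \<bullet> w > b" using r ab(1) by (simp add: w_def inner_add_right)
  then have ne: "T \<noteq> T'" using T_le T'(2) by force
  have face: "(T \<inter> T') face_of T" by (rule face_Int[OF TT(1) T'(1)])
  \<comment> \<open>A face of \<open>T\<close> that meets the relative interior of \<open>F\<close>
    contains \<open>F\<close>. By conformity the intersection is such a face, and counting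
    dimensions shows that it equals \<open>F\<close>.\<close>
  have "(T \<inter> T') \<inter> rel_interior F \<noteq> {}" using zT' zF Ff(2) z by blast
  then have sub: "F \<subseteq> T \<inter> T'" using subset_of_face_of[OF face Ff(2)] by blast
  have "aff_dim (T \<inter> T') < aff_dim T"
    by (rule face_of_aff_dim_lt[OF Tb(2) face face_full_dim[OF TT(1) T'(1) ne]])
  then have le: "aff_dim (T \<inter> T') \<le> aff_dim F" using Ff(3) Tb(9) by simp
  have "F face_of (T \<inter> T')" using face_of_subset[OF Ff(1) sub] by blast
  then have FI: "F = T \<inter> T'"
    using face_of_aff_dim_lt[of "T \<inter> T'" F] le Tb(2) T_basic(2)[OF T'(1)] by (auto simp: convex_Int)
  have "F facet_of T'"
    using face_Int[OF T'(1) TT(1)] F Ff(3) T_basic(9)[OF T'(1)] FI by (auto simp: facet_of_def Int_commute)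
  then have "T' \<in> S" using shared[OF TT(1) T'(1) ne F(1)] TT T'(1) by (simp add: S_def)
  \<comment> \<open>The direction \<open>e\<close> points to the side of \<open>T\<close> or to that
    of \<open>T'\<close>; either way the segment stays in the union beyond \<open>y\<close>, against
    the choice of \<open>t\<close>.\<close>
  have "\<exists>d>0. \<forall>s. 0 \<le> s \<longrightarrow> s \<le> d \<longrightarrow> y + s *\<^sub>R e \<in> U"
  proof (cases "a \<bullet> e \<le> 0")
    case True
    obtain d where "d > 0" "\<And>s. 0 \<le> s \<Longrightarrow> s \<le> d \<Longrightarrow> y + s *\<^sub>R e \<in> T"
      using simplex_contains_ray_start[OF yF Ff(2) ab(2) Tb(2) pT ab(3) True] by blast
    then show ?thesis using T(1) by (auto simp: U_def)
  next
    case False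
    have h: "affine hull F = {x. - a \<bullet> x = - b}" using ab(2) by auto
    have "F \<subseteq> T'" using sub by blast
    obtain d where "d > 0" "\<And>s. 0 \<le> s \<Longrightarrow> s \<le> d \<Longrightarrow> y + s *\<^sub>R e \<in> T'"
      using simplex_contains_ray_start[OF yF \<open>F \<subseteq> T'\<close> h T_basic(2)[OF T'(1)] T'(2), of e] aw False by auto
    then show ?thesis using \<open>T' \<in> S\<close> by (auto simp: U_def)
  qed
  then obtain d where d: "d > 0" "\<And>s. 0 \<le> s \<Longrightarrow> s \<le> d \<Longrightarrow> y + s *\<^sub>R e \<in> U" by blast
  then show False using after[OF d(1)] by force
qed

end

section \<open>Discrete problems\<close>

text \<open>Finite dimensionality enters through \<open>P\<close>: the members of \<open>V\<close> that vanish on \<open>P\<close> lie in the kernel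
  of the form. Removing points from \<open>P\<close> one at a time is a Gram--Schmidt process.\<close>

lemma finite_dimensional_riesz:
  fixes V :: "('a \<Rightarrow> real) set" and A :: "('a \<Rightarrow> real) \<Rightarrow> ('a \<Rightarrow> real) \<Rightarrow> real"
  assumes "finite P"
    and "(\<lambda>x. 0) \<in> V" "\<And>u v c. u \<in> V \<Longrightarrow> v \<in> V \<Longrightarrow> (\<lambda>x. u x + c * v x) \<in> V"
    and "\<And>u v w c. u \<in> V \<Longrightarrow> v \<in> V \<Longrightarrow> w \<in> V \<Longrightarrow> A (\<lambda>x. u x + c * v x) w = A u w + c * A v w"
    and "\<And>u v. u \<in> V \<Longrightarrow> v \<in> V \<Longrightarrow> A u v = A v u" "\<And>v. v \<in> V \<Longrightarrow> 0 \<le> A v v"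
    and "\<And>u v c. u \<in> V \<Longrightarrow> v \<in> V \<Longrightarrow> l (\<lambda>x. u x + c * v x) = l u + c * l v"
    and "\<And>v. v \<in> V \<Longrightarrow> (\<And>p. p \<in> P \<Longrightarrow> v p = 0) \<Longrightarrow> A v v = 0"
    and "\<And>v. v \<in> V \<Longrightarrow> A v v = 0 \<Longrightarrow> l v = 0"
  shows "\<exists>z\<in>V. \<forall>v\<in>V. A z v = l v"
  using assms
proof (induction P arbitrary: V l rule: finite_induct)
  case (empty V l)
  have "l v = 0" if "v \<in> V" for v using empty.prems(7,8) that by blast
  moreover have "A (\<lambda>x. 0) v = 0" if "v \<in> V" for v
    using empty.prems(3)[OF empty.prems(1,1) that, of "-1"] by simp
  ultimately show ?case using empty.prems(1) by (intro bexI[of _ "\<lambda>x. 0"]) auto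
next
  case (insert p P V l)
  note V0 = insert.prems(1) and lin = insert.prems(2) and Al = insert.prems(3) and sym = insert.prems(4)
    and pos = insert.prems(5) and ll = insert.prems(6) and null = insert.prems(7) and lnull = insert.prems(8)
  \<comment> \<open>The form is only semidefinite; its null vectors are orthogonal to
    everything.\<close>
  have CS: "A u v = 0" if "u \<in> V" "v \<in> V" "A v v = 0" for u v
  proof (rule ccontr)
    assume nz: "A u v \<noteq> 0"
    \<comment> \<open>With this t the form would take the value -1 at u + t v.\<close>
    define t where "t = - (A u u + 1) / (2 * A u v)"
    have uv: "(\<lambda>x. u x + t * v x) \<in> V" using lin that by blast
    have "A (\<lambda>x. u x + t * v x) (\<lambda>x. u x + t * v x) = A u (\<lambda>x. u x + t * v x) + t * A v (\<lambda>x. u x + t * v x)"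
      by (rule Al[OF that(1,2) uv])
    also have "A u (\<lambda>x. u x + t * v x) = A u u + t * A u v"
      using Al[OF that(1,2,1), of t] sym[OF that(1) uv] sym[OF that(1,2)] by simp
    also have "A v (\<lambda>x. u x + t * v x) = A u v"
      using Al[OF that(1,2,2), of t] sym[OF that(2) uv] that(3) by simp
    finally have "0 \<le> A u u + 2 * (t * A u v)" using pos[OF uv] by simp
    moreover have "2 * (t * A u v) = - (A u u + 1)" using nz by (simp add: t_def)
    ultimately show False by simp
  qed
  define V' where "V' = {v \<in> V. v p = 0}"
  \<comment> \<open>Stated for a general functional because it is used twice: for \<open>l\<close>,
    and for \<open>A b\<close>, whose representative is the orthogonal projection of
    \<open>b\<close> to \<open>V'\<close>.\<close>
  have IH: "\<exists>z\<in>V'. \<forall>v\<in>V'. A z v = k v"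
    if k: "\<And>u v c. u \<in> V \<Longrightarrow> v \<in> V \<Longrightarrow> k (\<lambda>x. u x + c * v x) = k u + c * k v"
      "\<And>v. v \<in> V \<Longrightarrow> A v v = 0 \<Longrightarrow> k v = 0" for k
  proof (rule insert.IH)
    fix v assume "v \<in> V'" "\<And>q. q \<in> P \<Longrightarrow> v q = 0"
    then show "A v v = 0" by (intro null) (auto simp: V'_def)
  qed (use V0 lin Al sym pos k in \<open>auto simp: V'_def\<close>)
  have "\<exists>z\<in>V'. \<forall>v\<in>V'. A z v = l v" by (rule IH) (rule ll lnull; assumption)+
  then obtain z' where z': "z' \<in> V'" "\<And>v. v \<in> V' \<Longrightarrow> A z' v = l v" by blast
  show ?case
  proof (cases "V' = V")
    case True
    then show ?thesis using z' by blast
  next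
    case False
    then obtain b where b: "b \<in> V" "b p \<noteq> 0" by (auto simp: V'_def)
    have "\<exists>z\<in>V'. \<forall>v\<in>V'. A z v = A b v"
    proof (rule IH)
      fix u v c assume uv: "u \<in> V" "v \<in> V"
      have "A b (\<lambda>x. u x + c * v x) = A (\<lambda>x. u x + c * v x) b" by (rule sym[OF b(1) lin[OF uv]])
      also have "\<dots> = A b u + c * A b v" using Al[OF uv b(1)] sym[OF b(1) uv(1)] sym[OF b(1) uv(2)] by simp
      finally show "A b (\<lambda>x. u x + c * v x) = A b u + c * A b v" .
    qed (rule CS[OF b(1)])
    then obtain b' where b': "b' \<in> V'" "\<And>v. v \<in> V' \<Longrightarrow> A b' v = A b v" by blast
    have V'V: "v \<in> V' \<Longrightarrow> v \<in> V" for v by (simp add: V'_def)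
    \<comment> \<open>The part of \<open>b\<close> orthogonal to \<open>V'\<close>. Together with
      \<open>V'\<close> it spans \<open>V\<close>, since \<open>d p\<close> is nonzero.\<close>
    define d where "d = (\<lambda>x. b x + (-1) * b' x)"
    have d: "d \<in> V" "d p \<noteq> 0" using lin[OF b(1) V'V[OF b'(1)], of "-1"] b b' by (auto simp: d_def V'_def)
    have Ad: "A d v = 0" if "v \<in> V'" for v
      using Al[OF b(1) V'V[OF b'(1)] V'V[OF that], of "-1"] b'(2)[OF that] by (simp add: d_def)
    \<comment> \<open>If \<open>A d d = 0\<close> the quotient is 0 by convention, which is correct
      because then \<open>l d = 0\<close>.\<close>
    define z where "z = (\<lambda>x. z' x + (l d / A d d) * d x)"
    have z: "z \<in> V" unfolding z_def by (rule lin[OF V'V[OF z'(1)] d(1)])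
    have z'd: "A z' d = 0" using Ad[OF z'(1)] sym[OF d(1) V'V[OF z'(1)]] by simp
    have Azd: "A z d = l d"
      unfolding z_def Al[OF V'V[OF z'(1)] d(1) d(1)] z'd using lnull[OF d(1)] by simp
    have Az': "A z v = l v" if "v \<in> V'" for v
      unfolding z_def Al[OF V'V[OF z'(1)] d(1) V'V[OF that]] Ad[OF that] z'(2)[OF that] by simp
    have "A z v = l v" if v: "v \<in> V" for v
    proof -
      define k where "k = v p / d p"
      define v' where "v' = (\<lambda>x. v x + (- k) * d x)"
      have v'V: "v' \<in> V" unfolding v'_def by (rule lin[OF v d(1)])
      have v': "v' \<in> V'" using v'V d(2) by (simp add: V'_def v'_def k_def)
      have "A v' z = A v z + (- k) * A d z" unfolding v'_def by (rule Al[OF v d(1) z])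
      then have "A z v' = A z v - k * A z d" using sym[OF z v] sym[OF z d(1)] sym[OF z v'V] by simp
      moreover have "l v' = l v + (- k) * l d" unfolding v'_def by (rule ll[OF v d(1)])
      ultimately show ?thesis using Az'[OF v'] Azd by simp
    qed
    then show ?thesis using z by blast
  qed
qed

text \<open>A point and small steps from it in all basis directions determine the slope and then the
  constant. These points supply the set \<open>P\<close> for
  \<open>finite_dimensional_riesz\<close>.\<close>

lemma affine_unisolvent:
  fixes U :: "'a::euclidean_space set"
  assumes "open U" "U \<noteq> {}"
  obtains P where "finite P" "P \<subseteq> U" "\<And>a b. (\<And>p. p \<in> P \<Longrightarrow> a \<bullet> p + b = 0) \<Longrightarrow> a = 0 \<and> b = 0"
proof -
  obtain c where "c \<in> U" using assms(2) by blast
  then obtain r where r: "r > 0" "ball c r \<subseteq> U" using assms(1) open_contains_ball by blast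
  let ?P = "insert c ((\<lambda>i. c + (r / 2) *\<^sub>R i) ` Basis)"
  show ?thesis
  proof (rule that[of ?P])
    show "?P \<subseteq> U" using r by (auto intro!: subsetD[OF r(2)] simp: dist_norm)
    fix a :: 'a and b assume z: "\<And>p. p \<in> ?P \<Longrightarrow> a \<bullet> p + b = 0"
    have c: "a \<bullet> c + b = 0" using z by blast
    have "a \<bullet> i = 0" if "i \<in> Basis" for i
    proof -
      have "a \<bullet> (c + (r / 2) *\<^sub>R i) + b = 0" using z that by blast
      then have "a \<bullet> c + (r / 2) * (a \<bullet> i) + b = 0" unfolding inner_add_right inner_scaleR_right .
      then have "(r / 2) * (a \<bullet> i) = 0" using c by linarith
      then show ?thesis using r(1) by simp
    qed
    then have "a = 0" using euclidean_all_zero_iff[of a] by blast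
    then show "a = 0 \<and> b = 0" using c by simp
  qed simp
qed

text \<open>The centroid of a facet of a simplex, which has as many vertices as the dimension of the
  space.\<close>

definition facet_center :: "'a::euclidean_space set \<Rightarrow> 'a" where
  "facet_center F = (\<Sum>p | p extreme_point_of F. p) /\<^sub>R real DIM('a)"

context triangulated_domain
begin

section \<open>Piecewise defined functions on the triangulation\<close>

lemma AE_interior: "AE x in lebesgue_on \<Omega>. \<exists>T\<in>\<T>. x \<in> interior T"
proof -
  have "AE x in lebesgue. x \<notin> \<Omega> - (\<Union>T\<in>\<T>. interior T)"
    using skeleton_negligible by (intro AE_not_in) (simp add: negligible_iff_null_sets)
  then have "AE x in lebesgue. x \<in> \<Omega> \<longrightarrow> (\<exists>T\<in>\<T>. x \<in> interior T)" by eventually_elim auto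
  then show ?thesis using \<Omega>(4) by (subst AE_restrict_space_iff) auto
qed

lemma sum_interior:
  fixes h :: "'a set \<Rightarrow> 'b::real_vector"
  assumes "T \<in> \<T>" "x \<in> interior T"
  shows "(\<Sum>T'\<in>\<T>. indicator (interior T') x *\<^sub>R h T') = h T"
proof -
  have "(\<Sum>T'\<in>\<T> - {T}. indicator (interior T') x *\<^sub>R h T') = 0"
  proof (rule sum.neutral, rule ballI)
    fix T' assume "T' \<in> \<T> - {T}"
    then have "x \<notin> interior T'" using interiors_disjoint[of T T'] assms by auto
    then show "indicator (interior T') x *\<^sub>R h T' = 0" by simp
  qed
  then show ?thesis using assms by (subst sum.remove[OF finite_\<T> assms(1)]) simp
qed

lemma integral_split:
  fixes g :: "'a \<Rightarrow> 'b::euclidean_space"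
  assumes "integrable (lebesgue_on \<Omega>) g"
  shows "(LINT x|lebesgue_on \<Omega>. g x) = (\<Sum>T\<in>\<T>. LINT x|lebesgue_on (interior T). g x)"
proof -
  have I: "integrable lebesgue (\<lambda>x. indicator \<Omega> x *\<^sub>R g x)"
    using assms \<Omega>(4) by (simp add: integrable_restrict_space)
  have IT: "integrable lebesgue (\<lambda>x. indicator (interior T) x *\<^sub>R g x)" if "T \<in> \<T>" for T
  proof -
    have "integrable lebesgue (\<lambda>x. indicator (interior T) x *\<^sub>R (indicator \<Omega> x *\<^sub>R g x))"
      by (rule integrable_mult_indicator[OF _ I]) auto
    moreover have "indicator (interior T) x *\<^sub>R (indicator \<Omega> x *\<^sub>R g x) = indicator (interior T) x *\<^sub>R g x" for x
      using interior_subset_\<Omega>[OF that] by (auto simp: indicator_def)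
    ultimately show ?thesis by (simp only:)
  qed
  have "(LINT x|lebesgue_on \<Omega>. g x) = (LINT x|lebesgue. indicator \<Omega> x *\<^sub>R g x)"
    using \<Omega>(4) by (simp add: integral_restrict_space)
  also have "\<dots> = (LINT x|lebesgue. (\<Sum>T\<in>\<T>. indicator (interior T) x *\<^sub>R g x))"
  proof (rule integral_cong_AE)
    show "(\<lambda>x. indicator \<Omega> x *\<^sub>R g x) \<in> borel_measurable lebesgue" using I by (rule borel_measurable_integrable)
    show "(\<lambda>x. \<Sum>T\<in>\<T>. indicator (interior T) x *\<^sub>R g x) \<in> borel_measurable lebesgue"
      using IT by (intro borel_measurable_sum borel_measurable_integrable)
    have "AE x in lebesgue. x \<notin> \<Omega> - (\<Union>T\<in>\<T>. interior T)"
      using skeleton_negligible by (intro AE_not_in) (simp add: negligible_iff_null_sets)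
    then show "AE x in lebesgue. indicator \<Omega> x *\<^sub>R g x = (\<Sum>T\<in>\<T>. indicator (interior T) x *\<^sub>R g x)"
    proof eventually_elim
      case (elim x)
      show ?case
      proof (cases "x \<in> \<Omega>")
        case True
        then obtain T where T: "T \<in> \<T>" "x \<in> interior T" using elim by blast
        show ?thesis using sum_interior[OF T, of "\<lambda>_. g x"] True by simp
      next
        case False
        then have "x \<notin> interior T" if "T \<in> \<T>" for T using interior_subset_\<Omega>[OF that] by blast
        then show ?thesis using False by simp
      qed
    qed
  qed
  also have "\<dots> = (\<Sum>T\<in>\<T>. LINT x|lebesgue. indicator (interior T) x *\<^sub>R g x)"
    using IT by (rule Bochner_Integration.integral_sum)
  also have "\<dots> = (\<Sum>T\<in>\<T>. LINT x|lebesgue_on (interior T). g x)"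
    by (intro sum.cong refl) (simp add: integral_restrict_space)
  finally show ?thesis .
qed

lemma l2_inner_split:
  "f \<in> L2 \<Omega> \<Longrightarrow> g \<in> L2 \<Omega> \<Longrightarrow> l2_inner \<Omega> f g = (\<Sum>T\<in>\<T>. l2_inner (interior T) f g)"
  unfolding l2_inner_def by (intro integral_split L2_inner_integrable)

lemma L2_interior: "f \<in> L2 \<Omega> \<Longrightarrow> T \<in> \<T> \<Longrightarrow> f \<in> L2 (interior T)"
  by (rule L2_mono[OF _ interior_subset_\<Omega> \<Omega>(4)]) auto

text \<open>Links the elementwise spaces, which live on open elements, with the integral formulas
  for compact simplices: the boundary of a convex set is null.\<close>

lemma integral_interior_eq:
  fixes f :: "'a \<Rightarrow> 'b::euclidean_space"
  assumes "T \<in> \<T>" "continuous_on UNIV f"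
  shows "(LINT x|lebesgue_on (interior T). f x) = (LINT x:T|lborel. f x)"
proof -
  note Tb = T_basic[OF assms(1)]
  have fm: "f \<in> borel_measurable borel" using assms(2) by (rule borel_measurable_continuous_onI)
  have m: "(\<lambda>x. indicator T x *\<^sub>R f x) \<in> borel_measurable lborel" "(\<lambda>x. indicator (interior T) x *\<^sub>R f x) \<in> borel_measurable lborel"
    using fm Tb(12) by (auto intro!: borel_measurable_scaleR borel_measurable_indicator)
  have "(LINT x|lebesgue_on (interior T). f x) = (LINT x|lebesgue. indicator (interior T) x *\<^sub>R f x)"
    by (simp add: integral_restrict_space)
  also have "\<dots> = (LINT x|lebesgue. indicator T x *\<^sub>R f x)"
  proof (rule integral_cong_AE)
    have "AE x in lebesgue. x \<notin> frontier T"
      using negligible_convex_frontier[OF Tb(2)] by (intro AE_not_in) (simp add: negligible_iff_null_sets)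
    then show "AE x in lebesgue. indicator (interior T) x *\<^sub>R f x = indicator T x *\<^sub>R f x"
      by eventually_elim (use closure_subset[of T] interior_subset[of T] in \<open>auto simp: indicator_def frontier_def\<close>)
  qed (use m in \<open>auto intro: measurable_completion\<close>)
  also have "\<dots> = (LINT x|lborel. indicator T x *\<^sub>R f x)" by (rule integral_completion[OF m(1)])
  finally show ?thesis by (simp add: set_lebesgue_integral_def)
qed

lemma l2_inner_interior_eq:
  fixes f g f' g' :: "'a \<Rightarrow> 'b::euclidean_space"
  assumes "T \<in> \<T>" "continuous_on UNIV f'" "continuous_on UNIV g'"
    and "\<And>x. x \<in> interior T \<Longrightarrow> f x = f' x" "\<And>x. x \<in> interior T \<Longrightarrow> g x = g' x"
  shows "l2_inner (interior T) f g = (LINT x:T|lborel. f' x \<bullet> g' x)"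
proof -
  have "l2_inner (interior T) f g = (LINT x|lebesgue_on (interior T). f' x \<bullet> g' x)"
    unfolding l2_inner_def using assms(4,5) by (intro Bochner_Integration.integral_cong) auto
  also have "\<dots> = (LINT x:T|lborel. f' x \<bullet> g' x)"
    by (rule integral_interior_eq[OF assms(1)]) (intro continuous_intros assms)
  finally show ?thesis .
qed

text \<open>Nothing is known about \<open>f\<close> on the skeleton, where it may even fail to be
  Borel; as the skeleton is null, completeness of Lebesgue measure gives measurability.\<close>

lemma L2_piecewise:
  fixes f :: "'a \<Rightarrow> 'b::euclidean_space"
  assumes h: "\<And>T. T \<in> \<T> \<Longrightarrow> continuous_on UNIV (h T)" "\<And>T x. T \<in> \<T> \<Longrightarrow> x \<in> interior T \<Longrightarrow> f x = h T x"
  shows "f \<in> L2 \<Omega>"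
proof -
  define f' where "f' x = (\<Sum>T\<in>\<T>. indicator (interior T) x *\<^sub>R h T x)" for x
  have f'h: "f' x = h T x" if "T \<in> \<T>" "x \<in> interior T" for T x
    unfolding f'_def using sum_interior[OF that, of "\<lambda>T. h T x"] .
  have "f' \<in> L2 \<Omega>"
    unfolding f'_def
  proof (rule L2_sum)
    fix T assume T: "T \<in> \<T>"
    have "compact (h T ` T)"
      by (rule compact_continuous_image[OF continuous_on_subset[OF h(1)[OF T]] T_basic(1)[OF T]]) simp
    then obtain B where B: "\<And>x. x \<in> T \<Longrightarrow> norm (h T x) \<le> B"
      using compact_imp_bounded bounded_iff by (metis image_eqI)
    show "(\<lambda>x. indicator (interior T) x *\<^sub>R h T x) \<in> L2 \<Omega>"
    proof (rule L2_bounded[OF \<Omega>(5), where B="max B 0"])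
      have "(\<lambda>x. indicator (interior T) x *\<^sub>R h T x) \<in> borel_measurable borel"
        using borel_measurable_continuous_onI[OF h(1)[OF T]] by (intro borel_measurable_scaleR borel_measurable_indicator) auto
      then show "(\<lambda>x. indicator (interior T) x *\<^sub>R h T x) \<in> borel_measurable (lebesgue_on \<Omega>)"
        by (intro measurable_restrict_space1 measurable_completion) simp
      show "norm (indicator (interior T) x *\<^sub>R h T x) \<le> max B 0" for x
        using B[of x] interior_subset[of T] by (cases "x \<in> interior T") (auto intro: order_trans)
    qed
  qed
  have ae: "AE x in lebesgue_on \<Omega>. f' x = f x"
    using AE_interior by eventually_elim (use f'h h(2) in auto)
  have m': "(\<lambda>x. indicator \<Omega> x *\<^sub>R f' x) \<in> borel_measurable lebesgue"
    using L2_measurable[OF \<open>f' \<in> L2 \<Omega>\<close>] \<Omega>(4) by (subst borel_measurable_restrict_space_iff[symmetric]) auto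
  have "AE x in lebesgue. x \<in> \<Omega> \<longrightarrow> f' x = f x" using ae \<Omega>(4) by (subst (asm) AE_restrict_space_iff) auto
  then have "AE x in lebesgue. indicator \<Omega> x *\<^sub>R f' x = indicator \<Omega> x *\<^sub>R f x"
    by eventually_elim (auto simp: indicator_def)
  from borel_measurable_AE[OF m' this]
  have m: "f \<in> borel_measurable (lebesgue_on \<Omega>)"
    using \<Omega>(4) by (subst borel_measurable_restrict_space_iff) auto
  have "integrable (lebesgue_on \<Omega>) (\<lambda>x. (norm (f x))\<^sup>2)"
  proof (rule integrable_cong_AE_imp[OF L2_integrable[OF \<open>f' \<in> L2 \<Omega>\<close>]])
    show "(\<lambda>x. (norm (f x))\<^sup>2) \<in> borel_measurable (lebesgue_on \<Omega>)" using m by measurable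
    show "AE x in lebesgue_on \<Omega>. (norm (f' x))\<^sup>2 = (norm (f x))\<^sup>2" using ae by eventually_elim simp
  qed
  then show ?thesis using m by (simp add: L2_def)
qed

lemma piecewise_constant_L2:
  assumes "g \<in> piecewise_constant \<T>" shows "g \<in> L2 \<Omega>"
proof -
  have "\<forall>T\<in>\<T>. \<exists>c. \<forall>x\<in>interior T. g x = c"
    using assms by (simp add: piecewise_constant_def constant_on_def)
  then obtain c where "\<forall>T\<in>\<T>. \<forall>x\<in>interior T. g x = c T" by metis
  then show ?thesis by (intro L2_piecewise[where h="\<lambda>T x. c T"]) auto
qed

lemma affine_on_element:
  assumes T: "T \<in> \<T>" and ab: "\<And>x. x \<in> interior T \<Longrightarrow> v x = a \<bullet> x + b"
  shows "x \<in> interior T \<Longrightarrow> broken_grad \<T> v x = a" "x \<in> T \<Longrightarrow> trace T v x = a \<bullet> x + b"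
proof -
  assume x: "x \<in> interior T"
  have "grad v x = a"
  proof (rule grad_eqI)
    have "((\<lambda>x. a \<bullet> x + b) has_derivative (\<lambda>h. a \<bullet> h)) (at x)" by (auto intro!: derivative_eq_intros)
    then show "(v has_derivative (\<lambda>h. a \<bullet> h)) (at x)"
      by (rule has_derivative_transform_within_open[of _ _ _ _ "interior T"]) (use x ab in auto)
  qed
  then show "broken_grad \<T> v x = a" using T x by (auto simp: broken_grad_def)
next
  assume x: "x \<in> T"
  note Tb = T_basic[OF T]
  \<comment> \<open>The limit in \<open>trace\<close> is meaningful only at limit points of the open
    element; by convexity every point of \<open>T\<close> is one.\<close>
  have "x \<in> closure (interior T)" using convex_closure_interior[OF Tb(2,5)] x closure_subset by blast
  then have "x islimpt interior T"
    by (metis closure_def Un_iff interior_limit_point interior_interior mem_Collect_eq)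
  then have nt: "at x within interior T \<noteq> bot" by (simp add: trivial_limit_within)
  have "((\<lambda>x. a \<bullet> x + b) \<longlongrightarrow> a \<bullet> x + b) (at x within interior T)" by (intro tendsto_intros)
  then have "(v \<longlongrightarrow> a \<bullet> x + b) (at x within interior T)"
    by (rule Lim_transform_eventually) (use ab in \<open>auto simp: eventually_at_filter\<close>)
  then show "trace T v x = a \<bullet> x + b" unfolding trace_def by (rule tendsto_Lim[OF nt])
qed

lemma piecewise_affineE:
  assumes "v \<in> piecewise_affine \<T>"
  obtains a b where "\<And>T x. T \<in> \<T> \<Longrightarrow> x \<in> interior T \<Longrightarrow> v x = a T \<bullet> x + b T"
    "\<And>T x. T \<in> \<T> \<Longrightarrow> x \<in> interior T \<Longrightarrow> broken_grad \<T> v x = a T"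
    "\<And>T x. T \<in> \<T> \<Longrightarrow> x \<in> T \<Longrightarrow> trace T v x = a T \<bullet> x + b T"
proof -
  have "\<forall>T\<in>\<T>. \<exists>a b. \<forall>x\<in>interior T. v x = a \<bullet> x + b" using assms by (simp add: piecewise_affine_def)
  then obtain a b where ab: "\<And>T x. T \<in> \<T> \<Longrightarrow> x \<in> interior T \<Longrightarrow> v x = a T \<bullet> x + b T" by metis
  show ?thesis
    by (rule that[OF ab]) (assumption+, rule affine_on_element, assumption, rule ab, assumption+,
        rule affine_on_element, assumption, rule ab, assumption+)
qed

lemma piecewise_affine_L2:
  assumes "v \<in> piecewise_affine \<T>" shows "v \<in> L2 \<Omega>" "broken_grad \<T> v \<in> L2 \<Omega>"
proof -
  obtain a b where ab: "\<And>T x. T \<in> \<T> \<Longrightarrow> x \<in> interior T \<Longrightarrow> v x = a T \<bullet> x + b T"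
    "\<And>T x. T \<in> \<T> \<Longrightarrow> x \<in> interior T \<Longrightarrow> broken_grad \<T> v x = a T" by (rule piecewise_affineE[OF assms]) blast
  show "v \<in> L2 \<Omega>" by (rule L2_piecewise[where h="\<lambda>T x. a T \<bullet> x + b T"]) (auto intro!: continuous_intros simp: ab)
  show "broken_grad \<T> v \<in> L2 \<Omega>" by (rule L2_piecewise[where h="\<lambda>T x. a T"]) (auto simp: ab)
qed

lemma piecewise_affine_lincomb:
  assumes "u \<in> piecewise_affine \<T>" "v \<in> piecewise_affine \<T>"
  shows "(\<lambda>x. u x + c * v x) \<in> piecewise_affine \<T>"
    "T \<in> \<T> \<Longrightarrow> x \<in> T \<Longrightarrow> trace T (\<lambda>x. u x + c * v x) x = trace T u x + c * trace T v x"
    "broken_grad \<T> (\<lambda>x. u x + c * v x) = (\<lambda>x. broken_grad \<T> u x + c *\<^sub>R broken_grad \<T> v x)"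
proof -
  obtain a b where u: "\<And>T x. T \<in> \<T> \<Longrightarrow> x \<in> interior T \<Longrightarrow> u x = a T \<bullet> x + b T"
    "\<And>T x. T \<in> \<T> \<Longrightarrow> x \<in> interior T \<Longrightarrow> broken_grad \<T> u x = a T"
    "\<And>T x. T \<in> \<T> \<Longrightarrow> x \<in> T \<Longrightarrow> trace T u x = a T \<bullet> x + b T" by (rule piecewise_affineE[OF assms(1)]) blast
  obtain a' b' where v: "\<And>T x. T \<in> \<T> \<Longrightarrow> x \<in> interior T \<Longrightarrow> v x = a' T \<bullet> x + b' T"
    "\<And>T x. T \<in> \<T> \<Longrightarrow> x \<in> interior T \<Longrightarrow> broken_grad \<T> v x = a' T"
    "\<And>T x. T \<in> \<T> \<Longrightarrow> x \<in> T \<Longrightarrow> trace T v x = a' T \<bullet> x + b' T" by (rule piecewise_affineE[OF assms(2)]) blast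
  have w: "u x + c * v x = (a T + c *\<^sub>R a' T) \<bullet> x + (b T + c * b' T)" if "T \<in> \<T>" "x \<in> interior T" for T x
    by (simp add: u(1)[OF that] v(1)[OF that] inner_add_left algebra_simps)
  then show pa: "(\<lambda>x. u x + c * v x) \<in> piecewise_affine \<T>" unfolding piecewise_affine_def by blast
  show "trace T (\<lambda>x. u x + c * v x) x = trace T u x + c * trace T v x" if T: "T \<in> \<T>" "x \<in> T"
    using affine_on_element(2)[OF T(1) w[OF T(1)] T(2)] u(3)[OF T] v(3)[OF T] by (simp add: inner_add_left algebra_simps)
  show "broken_grad \<T> (\<lambda>x. u x + c * v x) = (\<lambda>x. broken_grad \<T> u x + c *\<^sub>R broken_grad \<T> v x)"
  proof
    fix x
    show "broken_grad \<T> (\<lambda>x. u x + c * v x) x = broken_grad \<T> u x + c *\<^sub>R broken_grad \<T> v x"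
    proof (cases "\<exists>T\<in>\<T>. x \<in> interior T")
      case True
      then obtain T where T: "T \<in> \<T>" "x \<in> interior T" by blast
      show ?thesis using affine_on_element(1)[OF T(1) w[OF T(1)] T(2)] u(2)[OF T] v(2)[OF T] by simp
    qed (auto simp: broken_grad_def)
  qed
qed

section \<open>The Crouzeix-Raviart space\<close>

lemma facet_center_vertices:
  assumes "T \<in> \<T>" "p \<in> vertices T" "F = convex hull (vertices T - {p})"
  shows "facet_center F = (\<Sum>(vertices T - {p})) /\<^sub>R real DIM('a)" "facet_center F \<in> F"
proof -
  have ind: "\<not> affine_dependent (vertices T - {p})"
    using simplex_T(1)[OF assms(1)] affine_independent_Diff by (auto simp: simplex_vertices_def)
  have "{q. q extreme_point_of F} = vertices T - {p}"
    using extreme_point_of_convex_hull_affine_independent[OF ind] by (auto simp: assms(3))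
  then show eq: "facet_center F = (\<Sum>(vertices T - {p})) /\<^sub>R real DIM('a)" by (simp add: facet_center_def)
  let ?S = "vertices T - {p}"
  have fin: "finite ?S" using T_basic(7)[OF assms(1)] by simp
  have card: "card ?S = DIM('a)"
    using simplex_T(1)[OF assms(1)] T_basic(7)[OF assms(1)] assms(2) by (simp add: simplex_vertices_def)
  have "(\<Sum>q\<in>?S. (1 / real DIM('a)) *\<^sub>R q) \<in> F"
    unfolding assms(3) by (rule convex_sum[OF fin convex_convex_hull]) (auto simp: card intro: hull_inc)
  then show "facet_center F \<in> F" unfolding eq by (simp add: scaleR_sum_right divide_inverse)
qed

lemma facet_integral_center:
  assumes "T \<in> \<T>" "F facet_of T"
  obtains m where "m > 0" "\<And>v a \<beta>. (\<And>x. x \<in> F \<Longrightarrow> v x = a \<bullet> x + \<beta>) \<Longrightarrow>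
    (LINT x:F|facet_measure F. v x) = m * (a \<bullet> facet_center F + \<beta>)"
proof -
  obtain p where p: "p \<in> vertices T" "F = convex hull (vertices T - {p})" using facetE[OF assms] by blast
  obtain m where m: "m > 0" "\<And>v a \<beta>. (\<And>x. x \<in> F \<Longrightarrow> v x = a \<bullet> x + \<beta>) \<Longrightarrow>
    (LINT x:F|facet_measure F. v x) = m * (a \<bullet> ((\<Sum>(vertices T - {p})) /\<^sub>R real DIM('a)) + \<beta>)"
    unfolding p(2) using facet_integral_affine[OF simplex_T(1)[OF assms(1)] p(1)] by blast
  show ?thesis by (rule that[OF m(1)]) (simp add: m(2) facet_center_vertices(1)[OF assms(1) p])
qed

text \<open>By exactness of the midpoint rule for affine functions, the degrees of freedom of the
  Crouzeix--Raviart space are the values at the centres of the facets.\<close>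

lemma crouzeix_raviart_iff:
  "v \<in> crouzeix_raviart \<Omega> \<T> \<longleftrightarrow> v \<in> piecewise_affine \<T> \<and>
    (\<forall>T\<in>\<T>. \<forall>T'\<in>\<T>. \<forall>F. T \<noteq> T' \<longrightarrow> F facet_of T \<longrightarrow> F facet_of T' \<longrightarrow> trace T v (facet_center F) = trace T' v (facet_center F)) \<and>
    (\<forall>T\<in>\<T>. \<forall>F. F facet_of T \<longrightarrow> F \<subseteq> frontier \<Omega> \<longrightarrow> trace T v (facet_center F) = 0)"
proof (cases "v \<in> piecewise_affine \<T>")
  case True
  obtain a b where ab: "\<And>T x. T \<in> \<T> \<Longrightarrow> x \<in> T \<Longrightarrow> trace T v x = a T \<bullet> x + b T" by (rule piecewise_affineE[OF True]) blast
  have sub: "x \<in> T" if "F facet_of T" "x \<in> F" for F T x using that facet_of_imp_subset by blast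
  have cen: "facet_center F \<in> F" if "T \<in> \<T>" "F facet_of T" for T F
    using facetE[OF that] facet_center_vertices(2)[OF that(1)] by metis
  have 1: "(LINT x:F|facet_measure F. trace T v x - trace T' v x) = 0 \<longleftrightarrow> trace T v (facet_center F) = trace T' v (facet_center F)"
    if T: "T \<in> \<T>" "T' \<in> \<T>" "F facet_of T" "F facet_of T'" for T T' F
  proof -
    obtain m where m: "m > 0" "\<And>v a \<beta>. (\<And>x. x \<in> F \<Longrightarrow> v x = a \<bullet> x + \<beta>) \<Longrightarrow>
      (LINT x:F|facet_measure F. v x) = m * (a \<bullet> facet_center F + \<beta>)" using facet_integral_center[OF T(1,3)] by blast
    have "(LINT x:F|facet_measure F. trace T v x - trace T' v x) = m * ((a T - a T') \<bullet> facet_center F + (b T - b T'))"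
    proof (rule m(2))
      fix x assume x: "x \<in> F"
      show "trace T v x - trace T' v x = (a T - a T') \<bullet> x + (b T - b T')"
        unfolding ab[OF T(1) sub[OF T(3) x]] ab[OF T(2) sub[OF T(4) x]] by (simp add: inner_diff_left)
    qed
    also have "\<dots> = m * (trace T v (facet_center F) - trace T' v (facet_center F))"
      using ab[OF T(1) sub[OF T(3) cen[OF T(1,3)]]] ab[OF T(2) sub[OF T(4) cen[OF T(1,3)]]] by (simp add: inner_diff_left)
    finally show ?thesis using m(1) by simp
  qed
  have 2: "(LINT x:F|facet_measure F. trace T v x) = 0 \<longleftrightarrow> trace T v (facet_center F) = 0"
    if T: "T \<in> \<T>" "F facet_of T" for T F
  proof -
    obtain m where m: "m > 0" "\<And>v a \<beta>. (\<And>x. x \<in> F \<Longrightarrow> v x = a \<bullet> x + \<beta>) \<Longrightarrow>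
      (LINT x:F|facet_measure F. v x) = m * (a \<bullet> facet_center F + \<beta>)" using facet_integral_center[OF T] by blast
    have "(LINT x:F|facet_measure F. trace T v x) = m * (a T \<bullet> facet_center F + b T)"
      by (rule m(2)) (rule ab[OF T(1) sub[OF T(2)]])
    then show ?thesis using m(1) ab[OF T(1) sub[OF T(2) cen[OF T]]] by simp
  qed
  show ?thesis
  proof
    assume "v \<in> crouzeix_raviart \<Omega> \<T>"
    note CR = this[unfolded crouzeix_raviart_def mem_Collect_eq]
    have A: "\<forall>T\<in>\<T>. \<forall>T'\<in>\<T>. \<forall>F. T \<noteq> T' \<and> F facet_of T \<and> F facet_of T' \<longrightarrow>
        (LINT x:F|facet_measure F. trace T v x - trace T' v x) = 0"
      by (rule CR[THEN conjunct2, THEN conjunct1])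
    have B: "\<forall>T\<in>\<T>. \<forall>F. F facet_of T \<and> F \<subseteq> frontier \<Omega> \<longrightarrow> (LINT x:F|facet_measure F. trace T v x) = 0"
      by (rule CR[THEN conjunct2, THEN conjunct2])
    show "v \<in> piecewise_affine \<T> \<and>
      (\<forall>T\<in>\<T>. \<forall>T'\<in>\<T>. \<forall>F. T \<noteq> T' \<longrightarrow> F facet_of T \<longrightarrow> F facet_of T' \<longrightarrow> trace T v (facet_center F) = trace T' v (facet_center F)) \<and>
      (\<forall>T\<in>\<T>. \<forall>F. F facet_of T \<longrightarrow> F \<subseteq> frontier \<Omega> \<longrightarrow> trace T v (facet_center F) = 0)"
    proof (intro conjI ballI allI impI True)
      fix T T' F assume T: "T \<in> \<T>" "T' \<in> \<T>" "T \<noteq> T'" "F facet_of T" "F facet_of T'"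
      then show "trace T v (facet_center F) = trace T' v (facet_center F)"
        using A 1[OF T(1,2,4,5)] by metis
    next
      fix T F assume T: "T \<in> \<T>" "F facet_of T" "F \<subseteq> frontier \<Omega>"
      then show "trace T v (facet_center F) = 0" using B 2[OF T(1,2)] by metis
    qed
  next
    assume R: "v \<in> piecewise_affine \<T> \<and>
      (\<forall>T\<in>\<T>. \<forall>T'\<in>\<T>. \<forall>F. T \<noteq> T' \<longrightarrow> F facet_of T \<longrightarrow> F facet_of T' \<longrightarrow> trace T v (facet_center F) = trace T' v (facet_center F)) \<and>
      (\<forall>T\<in>\<T>. \<forall>F. F facet_of T \<longrightarrow> F \<subseteq> frontier \<Omega> \<longrightarrow> trace T v (facet_center F) = 0)"
    show "v \<in> crouzeix_raviart \<Omega> \<T>"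
      unfolding crouzeix_raviart_def mem_Collect_eq
    proof (intro conjI ballI allI impI True)
      fix T T' F assume T: "T \<in> \<T>" "T' \<in> \<T>" "T \<noteq> T' \<and> F facet_of T \<and> F facet_of T'"
      then have F: "T \<noteq> T'" "F facet_of T" "F facet_of T'" by auto
      have "trace T v (facet_center F) = trace T' v (facet_center F)" using R T(1,2) F by metis
      then show "(LINT x:F|facet_measure F. trace T v x - trace T' v x) = 0" by (rule 1[OF T(1,2) F(2,3), THEN iffD2])
    next
      fix T F assume T: "T \<in> \<T>" "F facet_of T \<and> F \<subseteq> frontier \<Omega>"
      then have F: "F facet_of T" "F \<subseteq> frontier \<Omega>" by auto
      have "trace T v (facet_center F) = 0" using R T(1) F by metis
      then show "(LINT x:F|facet_measure F. trace T v x) = 0" by (rule 2[OF T(1) F(1), THEN iffD2])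
    qed
  qed
qed (simp add: crouzeix_raviart_def)

lemma crouzeix_raviart_piecewise_affine: "v \<in> crouzeix_raviart \<Omega> \<T> \<Longrightarrow> v \<in> piecewise_affine \<T>"
  by (simp add: crouzeix_raviart_iff)

lemma crouzeix_raviartD:
  assumes "v \<in> crouzeix_raviart \<Omega> \<T>" "T \<in> \<T>" "F facet_of T"
  shows "T' \<in> \<T> \<Longrightarrow> T \<noteq> T' \<Longrightarrow> F facet_of T' \<Longrightarrow> trace T v (facet_center F) = trace T' v (facet_center F)"
    "F \<subseteq> frontier \<Omega> \<Longrightarrow> trace T v (facet_center F) = 0"
  using assms(1)[unfolded crouzeix_raviart_iff, THEN conjunct2, THEN conjunct1, rule_format, OF assms(2) _ _ assms(3)]
    assms(1)[unfolded crouzeix_raviart_iff, THEN conjunct2, THEN conjunct2, rule_format, OF assms(2,3)]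
  by simp_all

lemma facet_center_in: "T \<in> \<T> \<Longrightarrow> F facet_of T \<Longrightarrow> facet_center F \<in> T"
  using facetE facet_center_vertices(2) facet_of_imp_subset by (metis subsetD)

lemma crouzeix_raviart_lincomb:
  assumes u: "u \<in> crouzeix_raviart \<Omega> \<T>" and v: "v \<in> crouzeix_raviart \<Omega> \<T>"
  shows "(\<lambda>x. u x + c * v x) \<in> crouzeix_raviart \<Omega> \<T>"
proof -
  note pa = u[THEN crouzeix_raviart_piecewise_affine] v[THEN crouzeix_raviart_piecewise_affine]
  note tr = piecewise_affine_lincomb(2)[OF pa, where c=c]
  show ?thesis
    unfolding crouzeix_raviart_iff
  proof (intro conjI ballI allI impI)
    show "(\<lambda>x. u x + c * v x) \<in> piecewise_affine \<T>" by (rule piecewise_affine_lincomb(1)[OF pa])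
  next
    fix T T' F assume T: "T \<in> \<T>" "T' \<in> \<T>" "T \<noteq> T'" "F facet_of T" "F facet_of T'"
    show "trace T (\<lambda>x. u x + c * v x) (facet_center F) = trace T' (\<lambda>x. u x + c * v x) (facet_center F)"
      using tr[OF T(1) facet_center_in[OF T(1,4)]] tr[OF T(2) facet_center_in[OF T(2,5)]]
        crouzeix_raviartD(1)[OF u T(1,4,2,3,5)] crouzeix_raviartD(1)[OF v T(1,4,2,3,5)] by simp
  next
    fix T F assume T: "T \<in> \<T>" "F facet_of T" "F \<subseteq> frontier \<Omega>"
    show "trace T (\<lambda>x. u x + c * v x) (facet_center F) = 0"
      using tr[OF T(1) facet_center_in[OF T(1,2)]] crouzeix_raviartD(2)[OF u T] crouzeix_raviartD(2)[OF v T] by simp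
  qed
qed

text \<open>Without gradient, \<open>v\<close> is a constant \<open>b T\<close> on each open
  element, and the conditions at the facet centres are exactly the hypotheses of
  \<open>facet_connected_zero\<close> for these constants.\<close>

lemma crouzeix_raviart_grad_zero:
  assumes v: "v \<in> crouzeix_raviart \<Omega> \<T>" and zero: "l2_inner \<Omega> (broken_grad \<T> v) (broken_grad \<T> v) = 0"
    and T: "T \<in> \<T>" "x \<in> interior T"
  shows "v x = 0"
proof -
  note pa = v[THEN crouzeix_raviart_piecewise_affine]
  obtain a b where ab: "\<And>T x. T \<in> \<T> \<Longrightarrow> x \<in> interior T \<Longrightarrow> v x = a T \<bullet> x + b T"
    "\<And>T x. T \<in> \<T> \<Longrightarrow> x \<in> interior T \<Longrightarrow> broken_grad \<T> v x = a T"
    "\<And>T x. T \<in> \<T> \<Longrightarrow> x \<in> T \<Longrightarrow> trace T v x = a T \<bullet> x + b T" by (rule piecewise_affineE[OF pa]) blast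
  have each: "l2_inner (interior T) (broken_grad \<T> v) (broken_grad \<T> v) = measure lborel T * (a T \<bullet> a T)" if T: "T \<in> \<T>" for T
  proof -
    have "l2_inner (interior T) (broken_grad \<T> v) (broken_grad \<T> v) = (LINT x:T|lborel. a T \<bullet> a T)"
      by (rule l2_inner_interior_eq[OF T]) (use ab(2)[OF T] in auto)
    also have "\<dots> = (LINT x:T|lborel. (a T \<bullet> a T) * 1)" by simp
    also have "\<dots> = (a T \<bullet> a T) * measure lborel T"
      unfolding measure_eq_set_integral[OF T_basic(1)[OF T], symmetric] by (rule set_integral_mult_right)
    finally show ?thesis by (simp add: mult.commute)
  qed
  have "(\<Sum>T\<in>\<T>. measure lborel T * (a T \<bullet> a T)) = 0"
    using zero each by (simp add: l2_inner_split piecewise_affine_L2(2)[OF pa])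
  then have "\<forall>T\<in>\<T>. measure lborel T * (a T \<bullet> a T) = 0"
    by (subst (asm) sum_nonneg_eq_0_iff[OF finite_\<T>]) auto
  then have a0: "a T = 0" if "T \<in> \<T>" for T using T_basic(6)[OF that] that by auto
  have tr: "trace T v (facet_center F) = b T" if "T \<in> \<T>" "F facet_of T" for T F
    using ab(3)[OF that(1) facet_center_in[OF that]] a0[OF that(1)] by simp
  have "b T = 0"
  proof (rule facet_connected_zero[OF _ _ T(1)])
    show "b T = b T'" if "T \<in> \<T>" "T' \<in> \<T>" "T \<noteq> T'" "F facet_of T" "F facet_of T'" for T T' F
      using crouzeix_raviartD(1)[OF v that(1,4,2,3,5)] tr[OF that(1,4)] tr[OF that(2,5)] by simp
    show "b T = 0" if "T \<in> \<T>" "F facet_of T" "F \<subseteq> frontier \<Omega>" for T F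
      using crouzeix_raviartD(2)[OF v that] tr[OF that(1,2)] by simp
  qed
  then show ?thesis using ab(1)[OF T] a0[OF T(1)] by simp
qed

section \<open>Solvability of the discrete problems\<close>

lemma unisolvent_points:
  obtains P where "finite P" "\<And>v T x. v \<in> piecewise_affine \<T> \<Longrightarrow> (\<And>p. p \<in> P \<Longrightarrow> v p = 0) \<Longrightarrow> T \<in> \<T> \<Longrightarrow> x \<in> interior T \<Longrightarrow> v x = 0"
proof -
  have "\<forall>T\<in>\<T>. \<exists>P. finite P \<and> P \<subseteq> interior T \<and> (\<forall>a b. (\<forall>p\<in>P. a \<bullet> p + b = 0) \<longrightarrow> a = 0 \<and> b = 0)"
  proof
    fix T assume "T \<in> \<T>"
    obtain P where P: "finite P" "P \<subseteq> interior T" "\<And>a b. (\<And>p. p \<in> P \<Longrightarrow> a \<bullet> p + b = 0) \<Longrightarrow> a = 0 \<and> b = 0"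
      using affine_unisolvent[OF open_interior T_basic(5)[OF \<open>T \<in> \<T>\<close>]] by metis
    show "\<exists>P. finite P \<and> P \<subseteq> interior T \<and> (\<forall>a b. (\<forall>p\<in>P. a \<bullet> p + b = 0) \<longrightarrow> a = 0 \<and> b = 0)"
    proof (rule exI[of _ P])
      show "finite P \<and> P \<subseteq> interior T \<and> (\<forall>a b. (\<forall>p\<in>P. a \<bullet> p + b = 0) \<longrightarrow> a = 0 \<and> b = 0)"
      proof (rule conjI[OF P(1) conjI[OF P(2)]], intro allI impI)
        fix a b assume "\<forall>p\<in>P. a \<bullet> p + b = 0"
        then show "a = 0 \<and> b = 0" by (intro P(3)) (rule bspec)
      qed
    qed
  qed
  from bchoice[OF this] obtain P where P': "\<forall>T\<in>\<T>. finite (P T) \<and> P T \<subseteq> interior T \<and>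
      (\<forall>a b. (\<forall>p\<in>P T. a \<bullet> p + b = 0) \<longrightarrow> a = 0 \<and> b = 0)" by (elim exE)
  note P = bspec[OF P']
  show ?thesis
  proof (rule that[of "\<Union>T\<in>\<T>. P T"])
    show "finite (\<Union>T\<in>\<T>. P T)" using finite_\<T> P by blast
    fix v T x assume v: "v \<in> piecewise_affine \<T>" "\<And>p. p \<in> (\<Union>T\<in>\<T>. P T) \<Longrightarrow> v p = 0" and T: "T \<in> \<T>" "x \<in> interior T"
    obtain a b where ab: "\<And>x. x \<in> interior T \<Longrightarrow> v x = a \<bullet> x + b"
      using v(1) T(1) unfolding piecewise_affine_def by blast
    have "\<forall>p\<in>P T. a \<bullet> p + b = 0"
    proof
      fix p assume p: "p \<in> P T"
      then have "p \<in> interior T" using P[OF T(1)] by blast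
      from ab[OF this] v(2)[of p] T(1) p show "a \<bullet> p + b = 0" by auto
    qed
    then have "a = 0 \<and> b = 0"
      by (rule P[OF T(1), THEN conjunct2, THEN conjunct2, THEN spec, THEN spec, THEN mp])
    then show "v x = 0" using ab[OF T(2)] by simp
  qed
qed

lemma z_CR_solution:
  assumes g: "g \<in> L2 \<Omega>"
  shows "z_CR \<Omega> \<T> g \<in> crouzeix_raviart \<Omega> \<T>"
    "v \<in> crouzeix_raviart \<Omega> \<T> \<Longrightarrow> l2_inner \<Omega> (broken_grad \<T> (z_CR \<Omega> \<T> g)) (broken_grad \<T> v) = l2_inner \<Omega> g v"
proof -
  let ?V = "crouzeix_raviart \<Omega> \<T>"
  let ?A = "\<lambda>u v. l2_inner \<Omega> (broken_grad \<T> u) (broken_grad \<T> v)"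
  obtain P where P: "finite P" "\<And>v T x. v \<in> piecewise_affine \<T> \<Longrightarrow> (\<And>p. p \<in> P \<Longrightarrow> v p = 0) \<Longrightarrow> T \<in> \<T> \<Longrightarrow> x \<in> interior T \<Longrightarrow> v x = 0"
    using unisolvent_points by metis
  note pa = crouzeix_raviart_piecewise_affine
  have zero_pa: "(\<lambda>x. 0) \<in> piecewise_affine \<T>"
    unfolding piecewise_affine_def by (intro CollectI ballI exI[of _ 0]) auto
  have tr0: "trace T (\<lambda>x. 0) x = 0" if "T \<in> \<T>" "x \<in> T" for T x
    using piecewise_affine_lincomb(2)[OF zero_pa zero_pa that, of "-1"] by simp
  have "\<exists>z\<in>?V. \<forall>v\<in>?V. ?A z v = l2_inner \<Omega> g v"
  proof (rule finite_dimensional_riesz[OF P(1)])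
    show "(\<lambda>x. 0) \<in> ?V" unfolding crouzeix_raviart_iff using zero_pa tr0 facet_center_in by simp
    show "(\<lambda>x. u x + c * v x) \<in> ?V" if "u \<in> ?V" "v \<in> ?V" for u v c by (rule crouzeix_raviart_lincomb[OF that])
    show "?A (\<lambda>x. u x + c * v x) w = ?A u w + c * ?A v w" if "u \<in> ?V" "v \<in> ?V" "w \<in> ?V" for u v w c
      unfolding piecewise_affine_lincomb(3)[OF pa[OF that(1)] pa[OF that(2)]]
      by (intro l2_inner_lincomb_left piecewise_affine_L2 pa that)
    show "?A u v = ?A v u" for u v by (rule l2_inner_commute)
    show "0 \<le> ?A v v" for v by (rule l2_inner_self_nonneg)
    show "l2_inner \<Omega> g (\<lambda>x. u x + c * v x) = l2_inner \<Omega> g u + c * l2_inner \<Omega> g v" if "u \<in> ?V" "v \<in> ?V" for u v c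
      using l2_inner_lincomb_left[OF piecewise_affine_L2(1)[OF pa[OF that(1)]] piecewise_affine_L2(1)[OF pa[OF that(2)]] g, of c]
      by (simp add: l2_inner_commute[of \<Omega> g])
    show "?A v v = 0" if v: "v \<in> ?V" "\<And>p. p \<in> P \<Longrightarrow> v p = 0" for v
    proof -
      have z: "v x = 0" if "T \<in> \<T>" "x \<in> interior T" for T x by (rule P(2)[OF pa[OF v(1)] v(2) that])
      have "broken_grad \<T> v x = 0" for x
      proof (cases "\<exists>T\<in>\<T>. x \<in> interior T")
        case True
        then obtain T where T: "T \<in> \<T>" "x \<in> interior T" by blast
        have "grad v x = 0"
        proof (rule grad_eqI)
          have "((\<lambda>x. 0) has_derivative (\<lambda>h. 0 \<bullet> h)) (at x)" by simp
          then show "(v has_derivative (\<lambda>h. 0 \<bullet> h)) (at x)"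
            by (rule has_derivative_transform_within_open[of _ _ _ _ "interior T"]) (use T z in auto)
        qed
        then show ?thesis by (simp add: broken_grad_def)
      qed (auto simp: broken_grad_def)
      then show ?thesis by (simp add: l2_inner_def)
    qed
    \<comment> \<open>Functions of zero energy may still take arbitrary values on the skeleton, so
      they vanish almost everywhere only, which is enough for the load.\<close>
    show "l2_inner \<Omega> g v = 0" if v: "v \<in> ?V" "?A v v = 0" for v
    proof -
      have "AE x in lebesgue_on \<Omega>. v x = 0"
        using AE_interior by eventually_elim (use crouzeix_raviart_grad_zero[OF v] in blast)
      then have "l2_inner \<Omega> g v = l2_inner \<Omega> g (\<lambda>x. 0)"
        using g piecewise_affine_L2(1)[OF pa[OF v(1)]] by (intro l2_inner_cong_AE) auto
      then show ?thesis by (simp add: l2_inner_def)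
    qed
  qed
  then have "\<exists>z. z \<in> ?V \<and> (\<forall>v\<in>?V. ?A z v = l2_inner \<Omega> g v)" by blast
  from someI_ex[OF this] show "z_CR \<Omega> \<T> g \<in> ?V" "v \<in> ?V \<Longrightarrow> ?A (z_CR \<Omega> \<T> g) v = l2_inner \<Omega> g v"
    by (auto simp: z_CR_def)
qed

lemma grad_inner_lincomb:
  assumes "u \<in> H1 \<Omega>" "v \<in> H1 \<Omega>" "w \<in> L2 \<Omega>"
  shows "l2_inner \<Omega> (weak_grad \<Omega> (\<lambda>x. u x + c * v x)) w = l2_inner \<Omega> (weak_grad \<Omega> u) w + c * l2_inner \<Omega> (weak_grad \<Omega> v) w"
proof -
  note G = assms(1,2)[THEN weak_grad_L2]
  have "l2_inner \<Omega> (weak_grad \<Omega> (\<lambda>x. u x + c * v x)) w = l2_inner \<Omega> (\<lambda>x. weak_grad \<Omega> u x + c *\<^sub>R weak_grad \<Omega> v x) w"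
    by (rule l2_inner_cong_AE[OF weak_grad_lincomb[OF \<Omega>(1,2) assms(1,2)]])
       (use G assms weak_grad_L2[OF H1_lincomb[OF \<Omega>(1) assms(1,2)]] in auto)
  also have "\<dots> = l2_inner \<Omega> (weak_grad \<Omega> u) w + c * l2_inner \<Omega> (weak_grad \<Omega> v) w"
    by (rule l2_inner_lincomb_left[OF G assms(3)])
  finally show ?thesis .
qed

lemma z_c_solution:
  assumes g: "g \<in> L2 \<Omega>" shows "poisson_solution \<Omega> (conforming_space \<Omega> \<T>) g (z_c \<Omega> \<T> g)"
proof -
  let ?V = "conforming_space \<Omega> \<T>"
  let ?A = "\<lambda>u v. l2_inner \<Omega> (weak_grad \<Omega> u) (weak_grad \<Omega> v)"
  obtain P where P: "finite P" "\<And>v T x. v \<in> piecewise_affine \<T> \<Longrightarrow> (\<And>p. p \<in> P \<Longrightarrow> v p = 0) \<Longrightarrow> T \<in> \<T> \<Longrightarrow> x \<in> interior T \<Longrightarrow> v x = 0"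
    using unisolvent_points by metis
  have V: "v \<in> H01 \<Omega>" "v \<in> H1 \<Omega>" "v \<in> L2 \<Omega>" "v \<in> piecewise_affine \<T>" if "v \<in> ?V" for v
    using that by (auto simp: conforming_space_def intro: H01_H1 H1_L2)
  have zero_pa: "(\<lambda>x. 0) \<in> piecewise_affine \<T>"
    unfolding piecewise_affine_def by (intro CollectI ballI exI[of _ 0]) auto
  have "\<exists>z\<in>?V. \<forall>v\<in>?V. ?A z v = l2_inner \<Omega> g v"
  proof (rule finite_dimensional_riesz[OF P(1)])
    show "(\<lambda>x. 0) \<in> ?V" using zero_pa test_function_H01[OF \<Omega>(1,2)] by (simp add: conforming_space_def)
    show "(\<lambda>x. u x + c * v x) \<in> ?V" if "u \<in> ?V" "v \<in> ?V" for u v c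
      using that by (auto simp: conforming_space_def intro: H01_lincomb[OF \<Omega>(1,2)] piecewise_affine_lincomb(1))
    show "?A (\<lambda>x. u x + c * v x) w = ?A u w + c * ?A v w" if "u \<in> ?V" "v \<in> ?V" "w \<in> ?V" for u v w c
      by (intro grad_inner_lincomb V that weak_grad_L2)
    show "?A u v = ?A v u" for u v by (rule l2_inner_commute)
    show "0 \<le> ?A v v" for v by (rule l2_inner_self_nonneg)
    show "l2_inner \<Omega> g (\<lambda>x. u x + c * v x) = l2_inner \<Omega> g u + c * l2_inner \<Omega> g v" if "u \<in> ?V" "v \<in> ?V" for u v c
      using l2_inner_lincomb_left[OF V(3)[OF that(1)] V(3)[OF that(2)] g, of c] by (simp add: l2_inner_commute[of \<Omega> g])
    show "?A v v = 0" if v: "v \<in> ?V" "\<And>p. p \<in> P \<Longrightarrow> v p = 0" for v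
    proof -
      have ae: "AE x in lebesgue_on \<Omega>. (\<lambda>x. 0) x = v x"
        using AE_interior by eventually_elim (use P(2)[OF V(4)[OF v(1)] v(2)] in force)
      have "is_weak_grad \<Omega> (\<lambda>x. 0) (\<lambda>x. 0)" by (simp add: is_weak_grad_def)
      from is_weak_grad_cong_AE[OF \<Omega>(1) L2_zero V(3)[OF v(1)] ae this]
      have "AE x in lebesgue_on \<Omega>. weak_grad \<Omega> v x = 0" by (rule weak_grad_AE_eq[OF \<Omega>(1,2) V(3)[OF v(1)]])
      then have "l2_norm \<Omega> (weak_grad \<Omega> v) = 0" by (rule l2_norm_AE_0[OF _ weak_grad_L2[OF V(2)[OF v(1)]]])
      then show ?thesis using l2_norm_square[of \<Omega> "weak_grad \<Omega> v"] by simp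
    qed
    \<comment> \<open>Here Friedrichs' inequality shows that zero energy implies norm zero.\<close>
    show "l2_inner \<Omega> g v = 0" if v: "v \<in> ?V" "?A v v = 0" for v
    proof -
      obtain C where C: "\<And>v. v \<in> H01 \<Omega> \<Longrightarrow> l2_norm \<Omega> v \<le> C * l2_norm \<Omega> (weak_grad \<Omega> v)"
        using Friedrichs[OF \<Omega>(1,2)] by blast
      have "l2_norm \<Omega> (weak_grad \<Omega> v) = 0" using v(2) by (simp add: l2_norm_def)
      then have "l2_norm \<Omega> v = 0" using C[OF V(1)[OF v(1)]] l2_norm_nonneg[of \<Omega> v] by simp
      then show ?thesis using l2_Cauchy_Schwarz[OF g V(3)[OF v(1)]] by simp
    qed
  qed
  then have "\<exists>z. poisson_solution \<Omega> ?V g z"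
    by (auto simp: poisson_solution_def)
  then show ?thesis unfolding z_c_def by (rule someI_ex)
qed

end

lemma set_integral_inner_left:
  fixes f :: "'a::euclidean_space \<Rightarrow> 'b::euclidean_space"
  assumes "compact T" "continuous_on UNIV f"
  shows "(LINT x:T|lborel. f x \<bullet> h) = (LINT x:T|lborel. f x) \<bullet> h"
proof -
  have i: "integrable lborel (\<lambda>x. indicator T x *\<^sub>R f x)"
    using set_integrable_continuous_compact[OF assms] by (simp add: set_integrable_def)
  have "(LINT x:T|lborel. f x \<bullet> h) = (LINT x|lborel. (indicator T x *\<^sub>R f x) \<bullet> h)"
    by (simp add: set_lebesgue_integral_def)
  also have "\<dots> = (LINT x|lborel. indicator T x *\<^sub>R f x) \<bullet> h" by (rule integral_inner_left) (use i in simp)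
  finally show ?thesis by (simp add: set_lebesgue_integral_def)
qed

lemma set_integral_add_continuous:
  fixes f g :: "'a::euclidean_space \<Rightarrow> real"
  assumes "compact T" "continuous_on UNIV f" "continuous_on UNIV g"
  shows "(LINT x:T|lborel. f x + g x) = (LINT x:T|lborel. f x) + (LINT x:T|lborel. g x)"
  by (intro set_integral_add set_integrable_continuous_compact assms)

lemma set_integral_const_compact:
  "compact T \<Longrightarrow> (LINT x:T|lborel. c) = measure lborel (T::'a::euclidean_space set) * (c::real)"
  using set_integral_mult_right[of lborel T c "\<lambda>x. 1"] by (simp add: measure_eq_set_integral mult.commute)

lemma l2_inner_sum_left:
  fixes f :: "'i \<Rightarrow> 'a::euclidean_space \<Rightarrow> real"
  assumes "\<And>i. i \<in> I \<Longrightarrow> f i \<in> L2 S" "h \<in> L2 S"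
  shows "l2_inner S (\<lambda>x. \<Sum>i\<in>I. c i * f i x) h = (\<Sum>i\<in>I. c i * l2_inner S (f i) h)"
proof -
  have "l2_inner S (\<lambda>x. \<Sum>i\<in>I. c i * f i x) h = (LINT x|lebesgue_on S. (\<Sum>i\<in>I. c i * (f i x * h x)))"
    by (simp add: l2_inner_def sum_distrib_right mult.assoc)
  also have "\<dots> = (\<Sum>i\<in>I. LINT x|lebesgue_on S. c i * (f i x * h x))"
    by (rule Bochner_Integration.integral_sum) (intro integrable_mult_right L2_mult_integrable assms)
  finally show ?thesis by (simp add: l2_inner_def)
qed

text \<open>Test functions of the smaller set are test functions of the larger one, and all
  integrands vanish outside the smaller set.\<close>

lemma is_weak_grad_restrict:
  assumes "is_weak_grad \<Omega> v G" "U \<subseteq> \<Omega>" "U \<in> sets lebesgue" "\<Omega> \<in> sets lebesgue"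
  shows "is_weak_grad U v G"
  unfolding is_weak_grad_def
proof (intro conjI ballI)
  show "G \<in> L2 U" using assms by (auto simp: is_weak_grad_def intro: L2_mono)
  fix \<phi> assume \<phi>: "\<phi> \<in> test_functions U"
  have \<phi>': "\<phi> \<in> test_functions \<Omega>" by (rule test_function_mono[OF \<phi> assms(2)])
  obtain Q where Q: "Q \<subseteq> U" "\<And>x. x \<notin> Q \<Longrightarrow> \<phi> x = 0" "\<And>x. x \<notin> Q \<Longrightarrow> grad \<phi> x = 0"
    using test_function_grad_support[OF \<phi>] by metis
  have z: "\<phi> x = 0" "grad \<phi> x = 0" if "x \<notin> U" for x using Q that by auto
  have z': "\<phi> x = 0" "grad \<phi> x = 0" if "x \<notin> \<Omega>" for x using z[of x] that assms(2) by auto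
  have "(LINT x|lebesgue_on U. v x *\<^sub>R grad \<phi> x) = (LINT x|lebesgue_on \<Omega>. v x *\<^sub>R grad \<phi> x)"
    using integral_lebesgue_on_zero_outside[OF assms(3), of "\<lambda>x. v x *\<^sub>R grad \<phi> x"]
      integral_lebesgue_on_zero_outside[OF assms(4), of "\<lambda>x. v x *\<^sub>R grad \<phi> x"] z z' by simp
  moreover have "(LINT x|lebesgue_on U. \<phi> x *\<^sub>R G x) = (LINT x|lebesgue_on \<Omega>. \<phi> x *\<^sub>R G x)"
    using integral_lebesgue_on_zero_outside[OF assms(3), of "\<lambda>x. \<phi> x *\<^sub>R G x"]
      integral_lebesgue_on_zero_outside[OF assms(4), of "\<lambda>x. \<phi> x *\<^sub>R G x"] z z' by simp
  ultimately show "(LINT x|lebesgue_on U. v x *\<^sub>R grad \<phi> x) = - (LINT x|lebesgue_on U. \<phi> x *\<^sub>R G x)"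
    using is_weak_gradD(2)[OF assms(1) \<phi>'] by simp
qed

section \<open>The Marini flux\<close>

context triangulated_domain
begin

lemma barycentre_vertices: "barycentre T = (\<Sum>(vertices T)) /\<^sub>R (real DIM('a) + 1)"
  by (simp add: barycentre_def vertices_def add.commute)

text \<open>The barycentre of the vertices is the centroid, so the linear part integrates to
  zero.\<close>

lemma integral_affine_element:
  assumes "T \<in> \<T>"
  shows "(LINT x:T|lborel. b + a \<bullet> (x - barycentre T)) = measure lborel T * b"
proof -
  note c = T_basic(1)[OF assms]
  have cen: "(LINT x:T|lborel. x) = measure lborel T *\<^sub>R barycentre T"
    using simplex_centroid[OF simplex_T(1)[OF assms]] unfolding simplex_T(2)[OF assms, symmetric]
    by (simp add: barycentre_vertices add.commute)
  have "(LINT x:T|lborel. b + a \<bullet> (x - barycentre T)) = (LINT x:T|lborel. (b - a \<bullet> barycentre T) + x \<bullet> a)"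
    by (simp add: inner_diff_right inner_commute algebra_simps)
  also have "\<dots> = measure lborel T * (b - a \<bullet> barycentre T) + (LINT x:T|lborel. x) \<bullet> a"
    unfolding set_integral_add_continuous[OF c continuous_on_const continuous_on_inner[OF continuous_on_id continuous_on_const]]
      set_integral_inner_left[OF c continuous_on_id] set_integral_const_compact[OF c] ..
  finally show ?thesis by (simp add: cen inner_commute algebra_simps)
qed

definition mean_grad :: "('a \<Rightarrow> real) \<Rightarrow> 'a set \<Rightarrow> 'a" where
  "mean_grad w T = (LINT x:T|lborel. grad w x) /\<^sub>R measure lborel T"

text \<open>The formula of \<open>facet_mean\<close> with the barycentre as apex. Since that formula
  is affine in the apex, this is the average of the facet means over all vertices of
  \<open>T\<close>.\<close>

definition mean_value :: "('a \<Rightarrow> real) \<Rightarrow> 'a set \<Rightarrow> real" where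
  "mean_value w T = (LINT x:T|lborel. w x + (grad w x \<bullet> (x - barycentre T)) / real DIM('a)) / measure lborel T"

text \<open>The value at the barycentre is chosen such that the values at the facet centres are the facet
  means of \<open>w\<close>.\<close>

definition CR_interpolant :: "('a \<Rightarrow> real) \<Rightarrow> 'a \<Rightarrow> real" where
  "CR_interpolant w x = (\<Sum>T\<in>\<T>. indicator (interior T) x *\<^sub>R (mean_value w T + mean_grad w T \<bullet> (x - barycentre T)))"

lemma CR_interpolant_eq:
  "T \<in> \<T> \<Longrightarrow> x \<in> interior T \<Longrightarrow> CR_interpolant w x = mean_grad w T \<bullet> x + (mean_value w T - mean_grad w T \<bullet> barycentre T)"
  unfolding CR_interpolant_def using sum_interior[of T x "\<lambda>T. mean_value w T + mean_grad w T \<bullet> (x - barycentre T)"]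
  by (simp add: inner_diff_right)

lemma facet_center_minus_barycentre:
  assumes "T \<in> \<T>" "p \<in> vertices T" "F = convex hull (vertices T - {p})"
  shows "facet_center F - barycentre T = (barycentre T - p) /\<^sub>R real DIM('a)"
proof -
  let ?d = "real DIM('a)"
  define s where "s = \<Sum>(vertices T)"
  have "\<Sum>(vertices T - {p}) = s - p"
    using sum.remove[OF T_basic(7)[OF assms(1)] assms(2), of "\<lambda>x. x"] by (simp add: s_def)
  then have fc: "facet_center F = (s - p) /\<^sub>R ?d" by (simp add: facet_center_vertices(1)[OF assms])
  have b: "s = (?d + 1) *\<^sub>R barycentre T" by (simp add: barycentre_vertices s_def add_nonneg_eq_0_iff)
  have "facet_center F = barycentre T + (barycentre T - p) /\<^sub>R ?d"
    unfolding fc b by (simp add: algebra_simps)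
  then show ?thesis by simp
qed

text \<open>Moving the apex from the barycentre to \<open>p\<close> changes the mean by
  \<open>mean_grad\<close> times (barycentre - p)/d. This is also the increment of the interpolant
  from the barycentre to the facet centre, by \<open>facet_center_minus_barycentre\<close>.\<close>

lemma CR_interpolant_facet:
  assumes T: "T \<in> \<T>" "p \<in> vertices T" "F = convex hull (vertices T - {p})" and w: "times_cont_diff (Suc 0) w"
  shows "trace T (CR_interpolant w) (facet_center F) = facet_mean T p w"
proof -
  let ?d = "real DIM('a)" and ?m = "measure lborel T"
  note c = T_basic(1)[OF T(1)] and m = T_basic(6)[OF T(1)]
  have cg: "continuous_on UNIV (grad w)" by (rule continuous_grad[OF w])
  have F: "F facet_of T"
  proof -
    have "\<not> affine_dependent (vertices T)" using simplex_T(1)[OF T(1)] by (simp add: simplex_vertices_def)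
    then have "F facet_of (convex hull (vertices T))"
      using facet_of_convex_hull_affine_independent[of "vertices T" F] T(2,3) facet_center_vertices(2)[OF T] by blast
    then show ?thesis using simplex_T(2)[OF T(1)] by simp
  qed
  have "(LINT x:T|lborel. w x + (grad w x \<bullet> (x - p)) / ?d)
      = (LINT x:T|lborel. (w x + (grad w x \<bullet> (x - barycentre T)) / ?d) + grad w x \<bullet> ((barycentre T - p) /\<^sub>R ?d))"
    by (simp add: inner_diff_right add_divide_distrib diff_divide_distrib divide_inverse algebra_simps)
  also have "\<dots> = (LINT x:T|lborel. w x + (grad w x \<bullet> (x - barycentre T)) / ?d) + (LINT x:T|lborel. grad w x) \<bullet> ((barycentre T - p) /\<^sub>R ?d)"
    unfolding set_integral_inner_left[OF c cg, symmetric]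
    by (rule set_integral_add_continuous[OF c continuous_grad_inner[OF w]]) (intro continuous_intros cg)
  finally have eq: "(LINT x:T|lborel. w x + (grad w x \<bullet> (x - p)) / ?d)
      = (LINT x:T|lborel. w x + (grad w x \<bullet> (x - barycentre T)) / ?d) + (LINT x:T|lborel. grad w x) \<bullet> ((barycentre T - p) /\<^sub>R ?d)" .
  have "facet_mean T p w = mean_value w T + mean_grad w T \<bullet> ((barycentre T - p) /\<^sub>R ?d)"
    unfolding facet_mean_def mean_value_def mean_grad_def eq
    by (simp only: add_divide_distrib inner_scaleR_left divide_inverse mult.commute distrib_left)
  also have "\<dots> = mean_value w T + mean_grad w T \<bullet> (facet_center F - barycentre T)"
    by (simp add: facet_center_minus_barycentre[OF T])
  also have "\<dots> = trace T (CR_interpolant w) (facet_center F)"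
    using affine_on_element(2)[OF T(1) CR_interpolant_eq[OF T(1)] facet_center_in[OF T(1) F]] by (simp add: inner_diff_right)
  finally show ?thesis by simp
qed

text \<open>On interior facets both neighbours see the same facet mean; on boundary facets the mean
  is zero because test functions vanish there.\<close>

lemma CR_interpolant_in:
  assumes w: "w \<in> test_functions \<Omega>" shows "CR_interpolant w \<in> crouzeix_raviart \<Omega> \<T>"
proof -
  have w1: "times_cont_diff (Suc 0) w" by (rule test_function_smooth[OF w])
  have cf: "trace T (CR_interpolant w) (facet_center F) = facet_mean T p w"
    if "T \<in> \<T>" "p \<in> vertices T" "F = convex hull (vertices T - {p})" for T p F
    by (rule CR_interpolant_facet[OF that w1])
  show ?thesis
    unfolding crouzeix_raviart_iff
  proof (intro conjI ballI allI impI)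
    show "CR_interpolant w \<in> piecewise_affine \<T>"
      unfolding piecewise_affine_def using CR_interpolant_eq by blast
  next
    fix T T' F assume T: "T \<in> \<T>" "T' \<in> \<T>" "T \<noteq> T'" "F facet_of T" "F facet_of T'"
    obtain p where p: "p \<in> vertices T" "F = convex hull (vertices T - {p})" using facetE[OF T(1,4)] by blast
    obtain p' where p': "p' \<in> vertices T'" "F = convex hull (vertices T' - {p'})" using facetE[OF T(2,5)] by blast
    have ext: "{q. q extreme_point_of (convex hull (vertices T - {p}))} = vertices T - {p}" if "T \<in> \<T>" for T p
    proof -
      have "\<not> affine_dependent (vertices T - {p})"
        using simplex_T(1)[OF that] affine_independent_Diff by (auto simp: simplex_vertices_def)
      then show ?thesis using extreme_point_of_convex_hull_affine_independent by blast
    qed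
    \<comment> \<open>Equal facets have equal vertex sets, since the vertices are recovered as the
      extreme points.\<close>
    have eq: "vertices T - {p} = vertices T' - {p'}"
      using ext[OF T(1), of p] ext[OF T(2), of p'] p(2) p'(2) by simp
    have "facet_mean T p w = facet_mean T' p' w"
      using facet_mean_shared[OF simplex_T(1)[OF T(1)] p(1) simplex_T(1)[OF T(2)] p'(1) eq w1]
      unfolding simplex_T(2)[OF T(1), symmetric] simplex_T(2)[OF T(2), symmetric] .
    then show "trace T (CR_interpolant w) (facet_center F) = trace T' (CR_interpolant w) (facet_center F)"
      using cf[OF T(1) p] cf[OF T(2) p'] by simp
  next
    fix T F assume T: "T \<in> \<T>" "F facet_of T" "F \<subseteq> frontier \<Omega>"
    obtain p where p: "p \<in> vertices T" "F = convex hull (vertices T - {p})" using facetE[OF T(1,2)] by blast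
    have "w y = 0" if "y \<in> convex hull (vertices T - {p})" for y
    proof -
      have "y \<notin> \<Omega>" using that p(2) T(3) \<Omega>(1) by (auto simp: frontier_def interior_open)
      then show ?thesis by (rule test_function_zero_outside[OF w])
    qed
    then have "facet_mean T p w = 0"
      using facet_mean_zero[OF simplex_T(1)[OF T(1)] p(1) w1] unfolding simplex_T(2)[OF T(1), symmetric] by blast
    then show "trace T (CR_interpolant w) (facet_center F) = 0" using cf[OF T(1) p] by simp
  qed
qed

section \<open>The divergence of the Marini flux in weak form\<close>

lemma marini_flux_eq:
  assumes T: "T \<in> \<T>" "x \<in> interior T"
  shows "marini_flux \<Omega> \<T> g x = broken_grad \<T> (z_CR \<Omega> \<T> g) x - (g x / real DIM('a)) *\<^sub>R (x - barycentre T)"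
  unfolding marini_flux_def
  using sum_interior[OF T, of "\<lambda>T. (g x / real DIM('a)) *\<^sub>R (x - barycentre T)"] by simp

lemma piecewise_constantE:
  assumes "g \<in> piecewise_constant \<T>"
  obtains c where "\<And>T x. T \<in> \<T> \<Longrightarrow> x \<in> interior T \<Longrightarrow> g x = c T"
proof -
  have "\<forall>T\<in>\<T>. \<exists>c. \<forall>x\<in>interior T. g x = c"
    using assms by (simp add: piecewise_constant_def constant_on_def)
  then show ?thesis using that by metis
qed

lemma marini_flux_L2:
  assumes g: "g \<in> piecewise_constant \<T>" shows "marini_flux \<Omega> \<T> g \<in> L2 \<Omega>"
proof -
  have z: "z_CR \<Omega> \<T> g \<in> piecewise_affine \<T>"
    using z_CR_solution(1)[OF piecewise_constant_L2[OF g]] by (rule crouzeix_raviart_piecewise_affine)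
  obtain a b where ab: "\<And>T x. T \<in> \<T> \<Longrightarrow> x \<in> interior T \<Longrightarrow> broken_grad \<T> (z_CR \<Omega> \<T> g) x = a T"
    by (rule piecewise_affineE[OF z]) blast
  obtain c where c: "\<And>T x. T \<in> \<T> \<Longrightarrow> x \<in> interior T \<Longrightarrow> g x = c T" by (rule piecewise_constantE[OF g]) blast
  show ?thesis
  proof (rule L2_piecewise[where h="\<lambda>T x. a T - (c T / real DIM('a)) *\<^sub>R (x - barycentre T)"])
    fix T x assume T: "T \<in> \<T>" "x \<in> interior T"
    show "marini_flux \<Omega> \<T> g x = a T - (c T / real DIM('a)) *\<^sub>R (x - barycentre T)"
      unfolding marini_flux_eq[OF T] ab[OF T] c[OF T] ..
  qed (intro continuous_intros)
qed

text \<open>The divergence of the Marini flux is \<open>- g\<close>: testing the nonconforming problem with the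
  interpolant of \<open>w\<close> replaces the broken gradients by that of \<open>w\<close>, and the divergence theorem on each
  element shows that the affine correction accounts for \<open>(g, I w - w)\<close>.\<close>

lemma marini_flux_test:
  assumes g: "g \<in> piecewise_constant \<T>" and w: "w \<in> test_functions \<Omega>"
  shows "l2_inner \<Omega> (marini_flux \<Omega> \<T> g) (grad w) = l2_inner \<Omega> g w"
proof -
  let ?d = "real DIM('a)" and ?z = "z_CR \<Omega> \<T> g" and ?I = "CR_interpolant w" and ?m = "measure lborel"
  have gL: "g \<in> L2 \<Omega>" by (rule piecewise_constant_L2[OF g])
  note zs = z_CR_solution[OF gL]
  have z: "?z \<in> piecewise_affine \<T>" using zs(1) by (rule crouzeix_raviart_piecewise_affine)
  have I: "?I \<in> crouzeix_raviart \<Omega> \<T>" by (rule CR_interpolant_in[OF w])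
  then have Ipa: "?I \<in> piecewise_affine \<T>" by (rule crouzeix_raviart_piecewise_affine)
  obtain a b where ab: "\<And>T x. T \<in> \<T> \<Longrightarrow> x \<in> interior T \<Longrightarrow> broken_grad \<T> ?z x = a T"
    by (rule piecewise_affineE[OF z]) blast
  obtain c where c: "\<And>T x. T \<in> \<T> \<Longrightarrow> x \<in> interior T \<Longrightarrow> g x = c T" by (rule piecewise_constantE[OF g]) blast
  have w1: "times_cont_diff (Suc 0) w" by (rule test_function_smooth[OF w])
  have cw: "continuous_on UNIV w" "continuous_on UNIV (grad w)"
    by (rule times_cont_diff_continuous[OF w1], rule continuous_grad[OF w1])
  have wL: "w \<in> L2 \<Omega>" "grad w \<in> L2 \<Omega>" using test_function_L2[OF w \<Omega>(4)] test_function_grad_L2[OF w \<Omega>(4)] .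
  \<comment> \<open>Elementwise contributions: \<open>A\<close> pairs the broken gradient with that
    of \<open>w\<close>, \<open>B\<close> pairs the affine correction with it, and \<open>W\<close>
    is the load.\<close>
  define A where "A T = a T \<bullet> (LINT x:T|lborel. grad w x)" for T
  define B where "B T = c T * (LINT x:T|lborel. (grad w x \<bullet> (x - barycentre T)) / ?d)" for T
  define W where "W T = c T * (LINT x:T|lborel. w x)" for T
  have "(\<Sum>T\<in>\<T>. A T) = l2_inner \<Omega> (broken_grad \<T> ?z) (broken_grad \<T> ?I)"
    unfolding l2_inner_split[OF piecewise_affine_L2(2)[OF z] piecewise_affine_L2(2)[OF Ipa]]
  proof (rule sum.cong[OF refl])
    fix T assume T: "T \<in> \<T>"
    have "l2_inner (interior T) (broken_grad \<T> ?z) (broken_grad \<T> ?I) = (LINT x:T|lborel. a T \<bullet> mean_grad w T)"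
      by (rule l2_inner_interior_eq[OF T]) (auto simp: ab[OF T] affine_on_element(1)[OF T CR_interpolant_eq[OF T]])
    also have "\<dots> = ?m T * (a T \<bullet> mean_grad w T)" by (rule set_integral_const_compact[OF T_basic(1)[OF T]])
    also have "\<dots> = A T" using T_basic(6)[OF T] by (simp add: A_def mean_grad_def)
    finally show "A T = l2_inner (interior T) (broken_grad \<T> ?z) (broken_grad \<T> ?I)" by simp
  qed
  also have "\<dots> = l2_inner \<Omega> g ?I" by (rule zs(2)[OF I])
  also have "\<dots> = (\<Sum>T\<in>\<T>. W T + B T)"
    unfolding l2_inner_split[OF gL piecewise_affine_L2(1)[OF Ipa]]
  proof (rule sum.cong[OF refl])
    fix T assume T: "T \<in> \<T>"
    note cT = T_basic(1)[OF T]
    have "l2_inner (interior T) g ?I = (LINT x:T|lborel. c T \<bullet> (mean_value w T + mean_grad w T \<bullet> (x - barycentre T)))"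
      by (rule l2_inner_interior_eq[OF T])
         (auto intro!: continuous_intros simp: c[OF T] CR_interpolant_eq[OF T] inner_diff_right)
    \<comment> \<open>The data are constant on the element, so only the value of the interpolant at
      the barycentre survives.\<close>
    also have "\<dots> = c T * (?m T * mean_value w T)" by (simp add: integral_affine_element[OF T])
    also have "?m T * mean_value w T = (LINT x:T|lborel. w x + (grad w x \<bullet> (x - barycentre T)) / ?d)"
      using T_basic(6)[OF T] by (simp add: mean_value_def)
    also have "\<dots> = (LINT x:T|lborel. w x) + (LINT x:T|lborel. (grad w x \<bullet> (x - barycentre T)) / ?d)"
      by (rule set_integral_add_continuous[OF cT cw(1)]) (intro continuous_intros cw, simp)
    finally show "l2_inner (interior T) g ?I = W T + B T" by (simp add: W_def B_def distrib_left)
  qed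
  finally have 1: "(\<Sum>T\<in>\<T>. A T) = (\<Sum>T\<in>\<T>. W T) + (\<Sum>T\<in>\<T>. B T)" by (simp add: sum.distrib)
  have "l2_inner \<Omega> (marini_flux \<Omega> \<T> g) (grad w) = (\<Sum>T\<in>\<T>. A T - B T)"
    unfolding l2_inner_split[OF marini_flux_L2[OF g] wL(2)]
  proof (rule sum.cong[OF refl])
    fix T assume T: "T \<in> \<T>"
    note cT = T_basic(1)[OF T]
    have cd: "continuous_on UNIV (\<lambda>x. (grad w x \<bullet> (x - barycentre T)) / ?d)" by (intro continuous_intros cw) simp
    have "l2_inner (interior T) (marini_flux \<Omega> \<T> g) (grad w)
        = (LINT x:T|lborel. (a T - (c T / ?d) *\<^sub>R (x - barycentre T)) \<bullet> grad w x)"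
      by (rule l2_inner_interior_eq[OF T])
         (auto intro!: continuous_intros cw simp: marini_flux_eq[OF T] ab[OF T] c[OF T])
    also have "\<dots> = (LINT x:T|lborel. grad w x \<bullet> a T + (- c T) * ((grad w x \<bullet> (x - barycentre T)) / ?d))"
    proof -
      have "(a T - (c T / ?d) *\<^sub>R y) \<bullet> G = G \<bullet> a T + (- c T) * ((G \<bullet> y) / ?d)" for G y
        by (simp add: inner_diff_left inner_commute[of G])
      then show ?thesis by (simp only:)
    qed
    also have "\<dots> = (LINT x:T|lborel. grad w x \<bullet> a T) + (LINT x:T|lborel. (- c T) * ((grad w x \<bullet> (x - barycentre T)) / ?d))"
      by (rule set_integral_add_continuous[OF cT]) (intro continuous_on_mult continuous_on_const cd continuous_intros cw)+
    also have "\<dots> = A T - B T"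
      unfolding set_integral_mult_right set_integral_inner_left[OF cT cw(2)] by (simp add: A_def B_def inner_commute)
    finally show "l2_inner (interior T) (marini_flux \<Omega> \<T> g) (grad w) = A T - B T" .
  qed
  also have "\<dots> = (\<Sum>T\<in>\<T>. W T)" using 1 by (simp add: sum_subtractf)
  also have "\<dots> = l2_inner \<Omega> g w"
    unfolding l2_inner_split[OF gL wL(1)]
  proof (rule sum.cong[OF refl])
    fix T assume T: "T \<in> \<T>"
    have "l2_inner (interior T) g w = (LINT x:T|lborel. c T \<bullet> w x)"
      by (rule l2_inner_interior_eq[OF T]) (auto intro: cw simp: c[OF T])
    then show "W T = l2_inner (interior T) g w" by (simp add: W_def)
  qed
  finally show ?thesis .
qed

text \<open>Both sides are continuous in the H1 norm, so the identity extends from test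
  functions.\<close>

lemma marini_flux_H01:
  assumes g: "g \<in> piecewise_constant \<T>" and w: "w \<in> H01 \<Omega>"
  shows "l2_inner \<Omega> (marini_flux \<Omega> \<T> g) (weak_grad \<Omega> w) = l2_inner \<Omega> g w"
proof -
  let ?\<sigma> = "marini_flux \<Omega> \<T> g"
  define D where "D = l2_inner \<Omega> ?\<sigma> (weak_grad \<Omega> w) - l2_inner \<Omega> g w"
  have L: "?\<sigma> \<in> L2 \<Omega>" "g \<in> L2 \<Omega>" "w \<in> L2 \<Omega>" "weak_grad \<Omega> w \<in> L2 \<Omega>"
    using marini_flux_L2[OF g] piecewise_constant_L2[OF g] H1_L2[OF H01_H1[OF w]] weak_grad_L2[OF H01_H1[OF w]] .
  have "\<bar>D\<bar> \<le> 0 + e" if e: "e > 0" for e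
  proof -
    \<comment> \<open>The summand 1 keeps N positive, so that one may divide by it even if flux and
      data vanish.\<close>
    define N where "N = l2_norm \<Omega> ?\<sigma> + l2_norm \<Omega> g + 1"
    have N: "N > 0" unfolding N_def using l2_norm_nonneg[of \<Omega> ?\<sigma>] l2_norm_nonneg[of \<Omega> g] by linarith
    obtain \<phi> where \<phi>: "\<phi> \<in> test_functions \<Omega>" "l2_norm \<Omega> (\<lambda>x. w x - \<phi> x) < e / N"
      "l2_norm \<Omega> (\<lambda>x. weak_grad \<Omega> w x - grad \<phi> x) < e / N"
      using H01_approx[OF \<Omega>(1,2) w, of "e / N"] e N by auto
    have \<phi>L: "\<phi> \<in> L2 \<Omega>" "grad \<phi> \<in> L2 \<Omega>" using test_function_L2[OF \<phi>(1) \<Omega>(4)] test_function_grad_L2[OF \<phi>(1) \<Omega>(4)] .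
    have "D = l2_inner \<Omega> ?\<sigma> (\<lambda>x. weak_grad \<Omega> w x - grad \<phi> x) - l2_inner \<Omega> g (\<lambda>x. w x - \<phi> x)"
      unfolding D_def l2_inner_diff_right[OF L(4) \<phi>L(2) L(1)] l2_inner_diff_right[OF L(3) \<phi>L(1) L(2)]
      using marini_flux_test[OF g \<phi>(1)] by simp
    then have "\<bar>D\<bar> \<le> \<bar>l2_inner \<Omega> ?\<sigma> (\<lambda>x. weak_grad \<Omega> w x - grad \<phi> x)\<bar> + \<bar>l2_inner \<Omega> g (\<lambda>x. w x - \<phi> x)\<bar>" by linarith
    also have "\<dots> \<le> l2_norm \<Omega> ?\<sigma> * (e / N) + l2_norm \<Omega> g * (e / N)"
    proof (rule add_mono)
      show "\<bar>l2_inner \<Omega> ?\<sigma> (\<lambda>x. weak_grad \<Omega> w x - grad \<phi> x)\<bar> \<le> l2_norm \<Omega> ?\<sigma> * (e / N)"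
        using l2_Cauchy_Schwarz[OF L(1) L2_diff[OF L(4) \<phi>L(2)]] mult_left_mono[OF less_imp_le[OF \<phi>(3)] l2_norm_nonneg[of \<Omega> ?\<sigma>]]
        by linarith
      show "\<bar>l2_inner \<Omega> g (\<lambda>x. w x - \<phi> x)\<bar> \<le> l2_norm \<Omega> g * (e / N)"
        using l2_Cauchy_Schwarz[OF L(2) L2_diff[OF L(3) \<phi>L(1)]] mult_left_mono[OF less_imp_le[OF \<phi>(2)] l2_norm_nonneg[of \<Omega> g]]
        by linarith
    qed
    also have "\<dots> = (N - 1) * (e / N)" by (simp only: N_def add_diff_cancel_right' distrib_right)
    also have "\<dots> \<le> N * (e / N)" using e N by (intro mult_right_mono) auto
    also have "\<dots> = e" using N by simp
    finally show ?thesis by simp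
  qed
  then have "\<bar>D\<bar> \<le> 0" by (rule field_le_epsilon)
  then show ?thesis by (simp add: D_def)
qed

section \<open>Finiteness of the flux constant\<close>

lemma coefficient_bound:
  assumes g: "g \<in> piecewise_constant \<T>" and T: "T \<in> \<T>" and c: "\<And>x. x \<in> interior T \<Longrightarrow> g x = c"
  shows "\<bar>c\<bar> \<le> l2_norm \<Omega> g / sqrt (measure lborel T)"
proof -
  have gL: "g \<in> L2 \<Omega>" by (rule piecewise_constant_L2[OF g])
  have "l2_inner (interior T) g g = (LINT x:T|lborel. c \<bullet> c)" by (rule l2_inner_interior_eq[OF T]) (auto simp: c)
  then have "l2_inner (interior T) g g = measure lborel T * c\<^sup>2"
    using set_integral_const_compact[OF T_basic(1)[OF T], of "c\<^sup>2"] by (simp add: power2_eq_square)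
  moreover have "l2_inner (interior T) g g \<le> (\<Sum>T\<in>\<T>. l2_inner (interior T) g g)"
    by (rule member_le_sum[OF T _ finite_\<T>]) (rule l2_inner_self_nonneg)
  ultimately have "measure lborel T * c\<^sup>2 \<le> (l2_norm \<Omega> g)\<^sup>2"
    by (simp add: l2_norm_square l2_inner_split[OF gL gL])
  then have "(sqrt (measure lborel T) * \<bar>c\<bar>)\<^sup>2 \<le> (l2_norm \<Omega> g)\<^sup>2"
    by (simp add: power_mult_distrib)
  then have "sqrt (measure lborel T) * \<bar>c\<bar> \<le> l2_norm \<Omega> g" by (rule power2_le_imp_le) simp
  then show ?thesis using T_basic(6)[OF T] by (simp add: pos_le_divide_eq mult.commute)
qed

text \<open>Replaces a Poincare inequality for broken gradients. The squared energy of the solution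
  z is (g, z), which is a sum of coefficients of \<open>g\<close> times (\<open>\<eta> T\<close>,
  z). Each of these equals the energy product of z with the solution for the data
  \<open>\<eta> T\<close>. Finitely many fixed energies thus bound everything, one energy norm of z
  cancels, and the dependence of \<open>K\<close> on the mesh does no harm.\<close>

lemma z_CR_bound:
  obtains K where "0 \<le> K"
    "\<And>g. g \<in> piecewise_constant \<T> \<Longrightarrow> l2_norm \<Omega> (broken_grad \<T> (z_CR \<Omega> \<T> g)) \<le> K * l2_norm \<Omega> g"
proof -
  define \<eta> :: "'a set \<Rightarrow> 'a \<Rightarrow> real" where "\<eta> T = indicator (interior T)" for T
  let ?b = "\<lambda>g. broken_grad \<T> (z_CR \<Omega> \<T> g)"
  define K where "K = (\<Sum>T\<in>\<T>. l2_norm \<Omega> (?b (\<eta> T)) / sqrt (measure lborel T))"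
  have \<eta>: "\<eta> T \<in> piecewise_constant \<T>" if "T \<in> \<T>" for T
    unfolding piecewise_constant_def constant_on_def
  proof (intro CollectI ballI)
    fix T' assume "T' \<in> \<T>"
    then show "\<exists>y. \<forall>x\<in>interior T'. \<eta> T x = y"
      using interiors_disjoint[OF that, of T'] by (cases "T' = T") (auto simp: \<eta>_def indicator_def intro: exI[of _ 1] exI[of _ 0])
  qed
  note bL = piecewise_affine_L2(2)[OF crouzeix_raviart_piecewise_affine[OF z_CR_solution(1)]]
  have "l2_norm \<Omega> (?b g) \<le> K * l2_norm \<Omega> g" if g: "g \<in> piecewise_constant \<T>" for g
  proof -
    have gL: "g \<in> L2 \<Omega>" by (rule piecewise_constant_L2[OF g])
    note zs = z_CR_solution[OF gL]
    have zL: "z_CR \<Omega> \<T> g \<in> L2 \<Omega>" by (rule piecewise_affine_L2(1)[OF crouzeix_raviart_piecewise_affine[OF zs(1)]])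
    obtain c where c: "\<And>T x. T \<in> \<T> \<Longrightarrow> x \<in> interior T \<Longrightarrow> g x = c T" by (rule piecewise_constantE[OF g]) blast
    have \<eta>L: "\<eta> T \<in> L2 \<Omega>" if "T \<in> \<T>" for T by (rule piecewise_constant_L2[OF \<eta>[OF that]])
    have "(l2_norm \<Omega> (?b g))\<^sup>2 = l2_inner \<Omega> g (z_CR \<Omega> \<T> g)" unfolding l2_norm_square by (rule zs(2)[OF zs(1)])
    also have "\<dots> = l2_inner \<Omega> (\<lambda>x. \<Sum>T\<in>\<T>. c T * \<eta> T x) (z_CR \<Omega> \<T> g)"
    proof (rule l2_inner_cong_AE)
      show "AE x in lebesgue_on \<Omega>. g x = (\<Sum>T\<in>\<T>. c T * \<eta> T x)"
        using AE_interior
      proof eventually_elim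
        case (elim x)
        then obtain T where T: "T \<in> \<T>" "x \<in> interior T" by blast
        show ?case using sum_interior[OF T, of c] c[OF T] by (simp add: \<eta>_def mult.commute)
      qed
      show "(\<lambda>x. \<Sum>T\<in>\<T>. c T * \<eta> T x) \<in> L2 \<Omega>" using \<eta>L by (intro L2_sum L2_cmult)
    qed (use gL zL in auto)
    also have "\<dots> = (\<Sum>T\<in>\<T>. c T * l2_inner \<Omega> (\<eta> T) (z_CR \<Omega> \<T> g))" by (rule l2_inner_sum_left[OF \<eta>L zL])
    also have "\<dots> \<le> (\<Sum>T\<in>\<T>. (l2_norm \<Omega> g / sqrt (measure lborel T)) * (l2_norm \<Omega> (?b (\<eta> T)) * l2_norm \<Omega> (?b g)))"
    proof (rule sum_mono)
      fix T assume T: "T \<in> \<T>"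
      have "l2_inner \<Omega> (\<eta> T) (z_CR \<Omega> \<T> g) = l2_inner \<Omega> (?b (\<eta> T)) (?b g)"
        by (rule z_CR_solution(2)[OF \<eta>L[OF T] zs(1), symmetric])
      then have i: "\<bar>l2_inner \<Omega> (\<eta> T) (z_CR \<Omega> \<T> g)\<bar> \<le> l2_norm \<Omega> (?b (\<eta> T)) * l2_norm \<Omega> (?b g)"
        using l2_Cauchy_Schwarz[OF bL[OF \<eta>L[OF T]] bL[OF gL]] by simp
      have "c T * l2_inner \<Omega> (\<eta> T) (z_CR \<Omega> \<T> g) \<le> \<bar>c T\<bar> * \<bar>l2_inner \<Omega> (\<eta> T) (z_CR \<Omega> \<T> g)\<bar>"
        by (metis abs_ge_self abs_mult)
      also have "\<dots> \<le> (l2_norm \<Omega> g / sqrt (measure lborel T)) * (l2_norm \<Omega> (?b (\<eta> T)) * l2_norm \<Omega> (?b g))"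
        using coefficient_bound[OF g T c[OF T]] i by (intro mult_mono) auto
      finally show "c T * l2_inner \<Omega> (\<eta> T) (z_CR \<Omega> \<T> g) \<le> (l2_norm \<Omega> g / sqrt (measure lborel T)) * (l2_norm \<Omega> (?b (\<eta> T)) * l2_norm \<Omega> (?b g))" .
    qed
    also have "\<dots> = (K * l2_norm \<Omega> g) * l2_norm \<Omega> (?b g)"
      unfolding K_def sum_distrib_right by (intro sum.cong) auto
    finally have le: "l2_norm \<Omega> (?b g) * l2_norm \<Omega> (?b g) \<le> (K * l2_norm \<Omega> g) * l2_norm \<Omega> (?b g)"
      by (simp add: power2_eq_square)
    show ?thesis
    proof (cases "l2_norm \<Omega> (?b g) = 0")
      case True
      then show ?thesis by (simp add: K_def sum_nonneg)
    next
      case False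
      then have "l2_norm \<Omega> (?b g) > 0" using l2_norm_nonneg[of \<Omega> "?b g"] by linarith
      with le show ?thesis by (simp only: mult_le_cancel_right_pos)
    qed
  qed
  moreover have "0 \<le> K" by (simp add: K_def sum_nonneg)
  ultimately show ?thesis using that by blast
qed

text \<open>The three constants belong to the broken gradient, to the affine correction, and to the
  conforming gradient. Only the existence of \<open>C\<close> matters, as an upper bound for the set
  in \<open>kappa_M\<close>.\<close>

lemma flux_error_bound:
  obtains C where "0 \<le> C" "\<And>g. g \<in> piecewise_constant \<T> \<Longrightarrow>
    l2_norm \<Omega> (\<lambda>x. marini_flux \<Omega> \<T> g x - weak_grad \<Omega> (z_c \<Omega> \<T> g) x) \<le> C * l2_norm \<Omega> g"
proof -
  obtain K where K: "0 \<le> K"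
    "\<And>g. g \<in> piecewise_constant \<T> \<Longrightarrow> l2_norm \<Omega> (broken_grad \<T> (z_CR \<Omega> \<T> g)) \<le> K * l2_norm \<Omega> g"
    using z_CR_bound by blast
  obtain CF where CF: "0 \<le> CF" "\<And>v. v \<in> H01 \<Omega> \<Longrightarrow> l2_norm \<Omega> v \<le> CF * l2_norm \<Omega> (weak_grad \<Omega> v)"
    using Friedrichs[OF \<Omega>(1,2)] by blast
  have "\<forall>T\<in>\<T>. \<exists>R\<ge>0. \<forall>x\<in>T. norm (x - barycentre T) \<le> R"
  proof
    fix T assume "T \<in> \<T>"
    then obtain B where B: "B > 0" "\<And>x. x \<in> T \<Longrightarrow> norm x \<le> B" using T_basic(4) bounded_pos by metis
    have "norm (x - barycentre T) \<le> B + norm (barycentre T)" if "x \<in> T" for x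
      using norm_triangle_ineq4[of x "barycentre T"] B(2)[OF that] by linarith
    then show "\<exists>R\<ge>0. \<forall>x\<in>T. norm (x - barycentre T) \<le> R"
      using B(1) by (intro exI[of _ "B + norm (barycentre T)"]) auto
  qed
  from bchoice[OF this] obtain R where R: "\<forall>T\<in>\<T>. 0 \<le> R T \<and> (\<forall>x\<in>T. norm (x - barycentre T) \<le> R T)" by (elim exE)
  define S where "S = (\<Sum>T\<in>\<T>. R T)"
  have S: "0 \<le> S" "norm (x - barycentre T) \<le> S" if "T \<in> \<T>" "x \<in> T" for x T
  proof -
    show "0 \<le> S" unfolding S_def using R by (intro sum_nonneg) auto
    have "R T \<le> S" unfolding S_def using R that(1) finite_\<T> by (intro member_le_sum) auto
    then show "norm (x - barycentre T) \<le> S" using R that by force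
  qed
  have S0: "0 \<le> S" unfolding S_def using R by (intro sum_nonneg) auto
  show ?thesis
  proof (rule that[of "K + S + CF"])
    show "0 \<le> K + S + CF" using K(1) S0 CF(1) by simp
    fix g assume g: "g \<in> piecewise_constant \<T>"
    have gL: "g \<in> L2 \<Omega>" by (rule piecewise_constant_L2[OF g])
    let ?b = "broken_grad \<T> (z_CR \<Omega> \<T> g)" and ?zc = "z_c \<Omega> \<T> g"
    have bL: "?b \<in> L2 \<Omega>" by (rule piecewise_affine_L2(2)[OF crouzeix_raviart_piecewise_affine[OF z_CR_solution(1)[OF gL]]])
    have \<sigma>L: "marini_flux \<Omega> \<T> g \<in> L2 \<Omega>" by (rule marini_flux_L2[OF g])
    \<comment> \<open>The affine correction, bounded pointwise by the distance to the barycentre, at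
      most \<open>S\<close>, times the data.\<close>
    define r where "r x = marini_flux \<Omega> \<T> g x - ?b x" for x
    have rL: "r \<in> L2 \<Omega>" unfolding r_def by (rule L2_diff[OF \<sigma>L bL])
    have "norm (r x) \<le> S * norm (g x)" for x
    proof (cases "\<exists>T\<in>\<T>. x \<in> interior T")
      case True
      then obtain T where T: "T \<in> \<T>" "x \<in> interior T" by blast
      then have "x \<in> T" using interior_subset by blast
      have "norm (r x) = \<bar>g x\<bar> / real DIM('a) * norm (x - barycentre T)"
        by (simp add: r_def marini_flux_eq[OF T])
      also have "\<dots> \<le> \<bar>g x\<bar> / 1 * S"
        using S(2)[OF T(1) \<open>x \<in> T\<close>] DIM_positive[where 'a='a] by (intro mult_mono divide_left_mono) auto
      finally show ?thesis by (simp add: mult.commute)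
    next
      case False
      then have "r x = 0" by (simp add: r_def marini_flux_def)
      then show ?thesis using S0 by simp
    qed
    then have rn: "l2_norm \<Omega> r \<le> S * l2_norm \<Omega> g" by (intro l2_norm_mono rL gL S0)
    have "marini_flux \<Omega> \<T> g = (\<lambda>x. ?b x + r x)" by (auto simp: r_def)
    then have \<sigma>n: "l2_norm \<Omega> (marini_flux \<Omega> \<T> g) \<le> K * l2_norm \<Omega> g + S * l2_norm \<Omega> g"
      using l2_norm_triangle[OF bL rL] K(2)[OF g] rn by simp
    have zs: "poisson_solution \<Omega> (conforming_space \<Omega> \<T>) g ?zc" by (rule z_c_solution[OF gL])
    then have zH: "?zc \<in> H01 \<Omega>" by (simp add: poisson_solution_def conforming_space_def)
    have zL: "?zc \<in> L2 \<Omega>" "weak_grad \<Omega> ?zc \<in> L2 \<Omega>" using H1_L2[OF H01_H1[OF zH]] weak_grad_L2[OF H01_H1[OF zH]] .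
    let ?n = "l2_norm \<Omega> (weak_grad \<Omega> ?zc)"
    have "?n\<^sup>2 = l2_inner \<Omega> g ?zc" using zs by (auto simp: poisson_solution_def l2_norm_square)
    also have "\<dots> \<le> l2_norm \<Omega> g * l2_norm \<Omega> ?zc" using l2_Cauchy_Schwarz[OF gL zL(1)] by linarith
    also have "\<dots> \<le> l2_norm \<Omega> g * (CF * ?n)" by (intro mult_left_mono CF(2)[OF zH]) simp
    finally have le: "?n * ?n \<le> (CF * l2_norm \<Omega> g) * ?n" by (simp add: power2_eq_square mult_ac)
    have zn: "?n \<le> CF * l2_norm \<Omega> g"
    proof (cases "?n = 0")
      case False
      then have "?n > 0" using l2_norm_nonneg[of \<Omega> "weak_grad \<Omega> ?zc"] by linarith
      with le show ?thesis by (simp only: mult_le_cancel_right_pos)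
    qed (use CF(1) in simp)
    have "l2_norm \<Omega> (\<lambda>x. marini_flux \<Omega> \<T> g x + (-1) *\<^sub>R weak_grad \<Omega> ?zc x)
        \<le> l2_norm \<Omega> (marini_flux \<Omega> \<T> g) + l2_norm \<Omega> (\<lambda>x. (-1) *\<^sub>R weak_grad \<Omega> ?zc x)"
      by (rule l2_norm_triangle[OF \<sigma>L L2_scaleR[OF zL(2)]])
    then show "l2_norm \<Omega> (\<lambda>x. marini_flux \<Omega> \<T> g x - weak_grad \<Omega> ?zc x) \<le> (K + S + CF) * l2_norm \<Omega> g"
      using \<sigma>n zn unfolding l2_norm_scaleR by (simp add: distrib_right)
  qed
qed

lemma kappa_M_bound:
  assumes g: "g \<in> piecewise_constant \<T>"
  shows "l2_norm \<Omega> (\<lambda>x. marini_flux \<Omega> \<T> g x - weak_grad \<Omega> (z_c \<Omega> \<T> g) x) \<le> kappa_M \<Omega> \<T> * l2_norm \<Omega> g"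
proof -
  let ?e = "\<lambda>g. l2_norm \<Omega> (\<lambda>x. marini_flux \<Omega> \<T> g x - weak_grad \<Omega> (z_c \<Omega> \<T> g) x)"
  obtain C where C: "0 \<le> C" "\<And>g. g \<in> piecewise_constant \<T> \<Longrightarrow> ?e g \<le> C * l2_norm \<Omega> g"
    using flux_error_bound by blast
  show ?thesis
  proof (cases "l2_norm \<Omega> g = 0")
    \<comment> \<open>Data of norm zero are excluded from the supremum, so the linear bound is used
      directly.\<close>
    case True
    then show ?thesis using C(2)[OF g] by simp
  next
    case False
    then have pos: "l2_norm \<Omega> g > 0" using l2_norm_nonneg[of \<Omega> g] by linarith
    have "?e g / l2_norm \<Omega> g \<le> kappa_M \<Omega> \<T>"
      unfolding kappa_M_def
    proof (rule cSup_upper)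
      show "?e g / l2_norm \<Omega> g \<in> {?e g / l2_norm \<Omega> g | g. g \<in> piecewise_constant \<T> \<and> l2_norm \<Omega> g \<noteq> 0}"
        using g False by blast
      show "bdd_above {?e g / l2_norm \<Omega> g | g. g \<in> piecewise_constant \<T> \<and> l2_norm \<Omega> g \<noteq> 0}"
      proof (rule bdd_aboveI[of _ C], elim CollectE exE conjE)
        fix q g assume q: "q = ?e g / l2_norm \<Omega> g" and g: "g \<in> piecewise_constant \<T>" "l2_norm \<Omega> g \<noteq> 0"
        then have "l2_norm \<Omega> g > 0" using l2_norm_nonneg[of \<Omega> g] by linarith
        then show "q \<le> C" using C(2)[OF g(1)] by (simp add: q pos_divide_le_eq)
      qed
    qed
    then show ?thesis using pos by (simp add: pos_divide_le_eq)
  qed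
qed

section \<open>The projection and the error estimate\<close>

lemma l2_proj_properties:
  assumes f: "f \<in> L2 \<Omega>"
  shows "l2_proj \<Omega> \<T> f \<in> piecewise_constant \<T>"
    "q \<in> piecewise_constant \<T> \<Longrightarrow> l2_inner \<Omega> (\<lambda>x. f x - l2_proj \<Omega> \<T> f x) q = 0"
proof -
  \<comment> \<open>The elementwise means witness the choice made in \<open>l2_proj\<close>.\<close>
  define m where "m T = (LINT x|lebesgue_on (interior T). f x) / measure lborel T" for T
  define p where "p x = (\<Sum>T\<in>\<T>. indicator (interior T) x *\<^sub>R m T)" for x
  have pm: "p x = m T" if "T \<in> \<T>" "x \<in> interior T" for T x unfolding p_def by (rule sum_interior[OF that])
  then have p: "p \<in> piecewise_constant \<T>" unfolding piecewise_constant_def constant_on_def by blast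
  have "l2_inner \<Omega> (\<lambda>x. f x - p x) q = 0" if q: "q \<in> piecewise_constant \<T>" for q
  proof -
    obtain c where c: "\<And>T x. T \<in> \<T> \<Longrightarrow> x \<in> interior T \<Longrightarrow> q x = c T" by (rule piecewise_constantE[OF q]) blast
    have L: "(\<lambda>x. f x - p x) \<in> L2 \<Omega>" "q \<in> L2 \<Omega>" using f piecewise_constant_L2[OF p] piecewise_constant_L2[OF q] by auto
    have "l2_inner (interior T) (\<lambda>x. f x - p x) q = 0" if T: "T \<in> \<T>" for T
    proof -
      have lm: "interior T \<in> lmeasurable" using T_basic(4)[OF T] by (simp add: bounded_interior lmeasurable_open)
      have fi: "integrable (lebesgue_on (interior T)) f"
        using L2_mult_integrable[OF L2_interior[OF f T] L2_const[OF lm, of 1]] by simp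
      have ci: "integrable (lebesgue_on (interior T)) (\<lambda>x. m T)"
        using finite_measure.integrable_const[OF finite_measure_lebesgue_on[OF lm]] .
      have "(LINT x|lebesgue_on (interior T). m T) = (LINT x:T|lborel. m T)" by (rule integral_interior_eq[OF T]) simp
      also have "\<dots> = measure lborel T * m T" by (rule set_integral_const_compact[OF T_basic(1)[OF T]])
      also have "\<dots> = (LINT x|lebesgue_on (interior T). f x)" using T_basic(6)[OF T] by (simp add: m_def)
      finally have "(LINT x|lebesgue_on (interior T). f x - m T) = 0" using fi ci by simp
      moreover have "l2_inner (interior T) (\<lambda>x. f x - p x) q = (LINT x|lebesgue_on (interior T). (f x - m T) * c T)"
        unfolding l2_inner_def by (rule Bochner_Integration.integral_cong) (auto simp: pm[OF T] c[OF T])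
      ultimately show ?thesis by simp
    qed
    then show ?thesis by (simp add: l2_inner_split[OF L])
  qed
  with p have "\<exists>p. p \<in> piecewise_constant \<T> \<and> (\<forall>q\<in>piecewise_constant \<T>. l2_inner \<Omega> (\<lambda>x. f x - p x) q = 0)" by blast
  from someI_ex[OF this] show "l2_proj \<Omega> \<T> f \<in> piecewise_constant \<T>"
    "q \<in> piecewise_constant \<T> \<Longrightarrow> l2_inner \<Omega> (\<lambda>x. f x - l2_proj \<Omega> \<T> f x) q = 0"
    by (auto simp: l2_proj_def)
qed

lemma max_poincare_const_ge: "T \<in> \<T> \<Longrightarrow> poincare_const T \<le> max_poincare_const \<T>"
  unfolding max_poincare_const_def using finite_\<T> by (intro Max_ge) auto

text \<open>Here m is the elementwise mean. The bound involves the gradient chosen on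
  \<open>\<Omega>\<close>, which on the open element agrees almost everywhere with the one chosen
  there.\<close>

lemma element_Poincare:
  assumes T: "T \<in> \<T>" and w: "w \<in> H1 \<Omega>"
  obtains m where "(\<lambda>x. w x - m) \<in> L2 (interior T)"
    "l2_norm (interior T) (\<lambda>x. w x - m) \<le> poincare_const T * l2_norm (interior T) (weak_grad \<Omega> w)"
proof -
  let ?K = "interior T"
  note Tb = T_basic[OF T]
  have K: "open ?K" "bounded ?K" "?K \<in> lmeasurable" using Tb(4) by (auto simp: bounded_interior lmeasurable_open)
  have wL: "w \<in> L2 ?K" by (rule L2_interior[OF H1_L2[OF w] T])
  define m where "m = (LINT x|lebesgue_on ?K. w x) / measure lborel T"
  have fi: "integrable (lebesgue_on ?K) w" using L2_mult_integrable[OF wL L2_const[OF K(3), of 1]] by simp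
  have ci: "integrable (lebesgue_on ?K) (\<lambda>x. m)"
    using finite_measure.integrable_const[OF finite_measure_lebesgue_on[OF K(3)]] .
  have "(LINT x|lebesgue_on ?K. m) = (LINT x:T|lborel. m)" by (rule integral_interior_eq[OF T]) simp
  also have "\<dots> = measure lborel T * m" by (rule set_integral_const_compact[OF Tb(1)])
  also have "\<dots> = (LINT x|lebesgue_on ?K. w x)" using Tb(6) by (simp add: m_def)
  finally have mean: "(LINT x|lebesgue_on ?K. w x - m) = 0" using fi ci by simp
  have L: "(\<lambda>x. w x - m) \<in> L2 ?K" by (rule L2_diff[OF wL L2_const[OF K(3)]])
  have wg: "is_weak_grad ?K w (weak_grad \<Omega> w)"
    by (rule is_weak_grad_restrict[OF is_weak_grad_weak_grad[OF w] interior_subset_\<Omega>[OF T] _ \<Omega>(4)]) auto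
  have "is_weak_grad ?K (\<lambda>x. m) (\<lambda>x. 0)" using is_weak_grad_affine(2)[OF K(1,2), of 0 m] by simp
  from is_weak_grad_lincomb[OF K(1) wL L2_const[OF K(3)] wg this, of "-1"]
  have g: "is_weak_grad ?K (\<lambda>x. w x - m) (weak_grad \<Omega> w)" by simp
  have H: "(\<lambda>x. w x - m) \<in> H1 ?K" using L g by (auto simp: H1_def)
  have "l2_norm ?K (\<lambda>x. w x - m) \<le> poincare_const T * l2_norm ?K (weak_grad ?K (\<lambda>x. w x - m))"
    by (rule poincare_const_inequality[OF Tb(2,4,5) H mean])
  also have "l2_norm ?K (weak_grad ?K (\<lambda>x. w x - m)) = l2_norm ?K (weak_grad \<Omega> w)"
    by (rule l2_norm_cong_AE[OF weak_grad_AE_eq[OF K(1,2) L g] weak_grad_L2[OF H] L2_interior[OF weak_grad_L2[OF w] T]])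
  finally show ?thesis using that L by blast
qed

text \<open>Orthogonality to piecewise constants allows subtracting the elementwise constants from
  \<open>w\<close>; the elementwise Poincare bounds are then collected by Cauchy-Schwarz for finite
  sums.\<close>

lemma orthogonal_residual_bound:
  assumes r: "r \<in> L2 \<Omega>" "\<And>q. q \<in> piecewise_constant \<T> \<Longrightarrow> l2_inner \<Omega> r q = 0" and w: "w \<in> H1 \<Omega>"
  shows "l2_inner \<Omega> r w \<le> max_poincare_const \<T> * l2_norm \<Omega> r * l2_norm \<Omega> (weak_grad \<Omega> w)"
proof -
  let ?C = "max_poincare_const \<T>" and ?G = "weak_grad \<Omega> w"
  have wL: "w \<in> L2 \<Omega>" by (rule H1_L2[OF w])
  have GL: "?G \<in> L2 \<Omega>" by (rule weak_grad_L2[OF w])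
  have "\<forall>T\<in>\<T>. \<exists>m. (\<lambda>x. w x - m) \<in> L2 (interior T) \<and>
      l2_norm (interior T) (\<lambda>x. w x - m) \<le> poincare_const T * l2_norm (interior T) ?G"
    using element_Poincare[OF _ w] by metis
  from bchoice[OF this] obtain m where m: "\<forall>T\<in>\<T>. (\<lambda>x. w x - m T) \<in> L2 (interior T) \<and>
      l2_norm (interior T) (\<lambda>x. w x - m T) \<le> poincare_const T * l2_norm (interior T) ?G" by (elim exE)
  define q where "q x = (\<Sum>T\<in>\<T>. indicator (interior T) x *\<^sub>R m T)" for x
  have qm: "q x = m T" if "T \<in> \<T>" "x \<in> interior T" for T x unfolding q_def by (rule sum_interior[OF that])
  then have q: "q \<in> piecewise_constant \<T>" unfolding piecewise_constant_def constant_on_def by blast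
  have qL: "q \<in> L2 \<Omega>" by (rule piecewise_constant_L2[OF q])
  have "l2_inner \<Omega> r w = l2_inner \<Omega> r (\<lambda>x. w x - q x)"
    unfolding l2_inner_diff_right[OF wL qL r(1)] r(2)[OF q] by simp
  also have "\<dots> = (\<Sum>T\<in>\<T>. l2_inner (interior T) r (\<lambda>x. w x - q x))"
    by (rule l2_inner_split[OF r(1) L2_diff[OF wL qL]])
  also have "\<dots> \<le> (\<Sum>T\<in>\<T>. ?C * (\<bar>l2_norm (interior T) r\<bar> * \<bar>l2_norm (interior T) ?G\<bar>))"
  proof (rule sum_mono)
    fix T assume T: "T \<in> \<T>"
    have mT: "(\<lambda>x. w x - m T) \<in> L2 (interior T)"
      "l2_norm (interior T) (\<lambda>x. w x - m T) \<le> poincare_const T * l2_norm (interior T) ?G" using m T by auto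
    have "l2_inner (interior T) r (\<lambda>x. w x - q x) = l2_inner (interior T) r (\<lambda>x. w x - m T)"
      unfolding l2_inner_def by (rule Bochner_Integration.integral_cong) (auto simp: qm[OF T])
    also have "\<dots> \<le> l2_norm (interior T) r * l2_norm (interior T) (\<lambda>x. w x - m T)"
      using l2_Cauchy_Schwarz[OF L2_interior[OF r(1) T] mT(1)] by linarith
    also have "\<dots> \<le> l2_norm (interior T) r * (?C * l2_norm (interior T) ?G)"
    proof (rule mult_left_mono)
      have "poincare_const T * l2_norm (interior T) ?G \<le> ?C * l2_norm (interior T) ?G"
        by (rule mult_right_mono[OF max_poincare_const_ge[OF T]]) simp
      then show "l2_norm (interior T) (\<lambda>x. w x - m T) \<le> ?C * l2_norm (interior T) ?G" using mT(2) by linarith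
    qed simp
    finally show "l2_inner (interior T) r (\<lambda>x. w x - q x) \<le> ?C * (\<bar>l2_norm (interior T) r\<bar> * \<bar>l2_norm (interior T) ?G\<bar>)"
      by (simp add: mult.left_commute)
  qed
  also have "\<dots> = ?C * (\<Sum>T\<in>\<T>. \<bar>l2_norm (interior T) r\<bar> * \<bar>l2_norm (interior T) ?G\<bar>)" by (rule sum_distrib_left[symmetric])
  also have "\<dots> \<le> ?C * (l2_norm \<Omega> r * l2_norm \<Omega> ?G)"
  proof (rule mult_left_mono)
    \<comment> \<open>Norms over \<open>\<Omega>\<close> are the Euclidean norms of the families of
      element norms, because the skeleton is null.\<close>
    have n': "L2_set (\<lambda>T. l2_norm (interior T) ?G) \<T> = l2_norm \<Omega> ?G"
      unfolding L2_set_def l2_norm_square unfolding l2_norm_def l2_inner_split[OF GL GL] ..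
    have n1: "L2_set (\<lambda>T. l2_norm (interior T) r) \<T> = l2_norm \<Omega> r"
      unfolding L2_set_def l2_norm_square unfolding l2_norm_def l2_inner_split[OF r(1) r(1)] ..
    show "(\<Sum>T\<in>\<T>. \<bar>l2_norm (interior T) r\<bar> * \<bar>l2_norm (interior T) ?G\<bar>) \<le> l2_norm \<Omega> r * l2_norm \<Omega> ?G"
      using L2_set_mult_ineq[of "\<lambda>T. l2_norm (interior T) r" "\<lambda>T. l2_norm (interior T) ?G" \<T>] unfolding n1 n' .
    have "\<Union>\<T> \<noteq> {}" using Union_\<T> \<Omega>(3) by simp
    then obtain T where "T \<in> \<T>" by blast
    then show "0 \<le> ?C"
      using poincare_const_nonneg[OF T_basic(2,4,5)] max_poincare_const_ge by (meson order_trans)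
  qed
  finally show ?thesis by (simp add: mult.assoc)
qed

theorem error_estimate:
  assumes f: "f \<in> L2 \<Omega>" and u: "poisson_solution \<Omega> (H01 \<Omega>) f u"
    and u\<^sub>h: "poisson_solution \<Omega> (conforming_space \<Omega> \<T>) f u\<^sub>h"
  shows "H1_seminorm \<Omega> (\<lambda>x. u x - u\<^sub>h x) \<le> error_bound \<Omega> \<T> f"
proof -
  let ?V = "conforming_space \<Omega> \<T>" and ?p = "l2_proj \<Omega> \<T> f"
  define z where "z = z_c \<Omega> \<T> ?p"
  define \<sigma> where "\<sigma> = marini_flux \<Omega> \<T> ?p"
  let ?G = "weak_grad \<Omega>"
  note pr = l2_proj_properties[OF f]
  have pL: "?p \<in> L2 \<Omega>" by (rule piecewise_constant_L2[OF pr(1)])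
  have z: "poisson_solution \<Omega> ?V ?p z" unfolding z_def by (rule z_c_solution[OF pL])
  have H01: "u \<in> H01 \<Omega>" "u\<^sub>h \<in> H01 \<Omega>" "z \<in> H01 \<Omega>"
    using u u\<^sub>h z by (auto simp: poisson_solution_def conforming_space_def)
  note H1 = H01[THEN H01_H1]
  note G = H1[THEN weak_grad_L2]
  have sub: "(\<lambda>x. a x - b x) \<in> H01 \<Omega>" if "a \<in> H01 \<Omega>" "b \<in> H01 \<Omega>" for a b
    using H01_lincomb[OF \<Omega>(1,2) that, of "-1"] by simp
  have diff: "l2_inner \<Omega> (?G (\<lambda>x. a x - b x)) v = l2_inner \<Omega> (?G a) v - l2_inner \<Omega> (?G b) v"
    if "a \<in> H1 \<Omega>" "b \<in> H1 \<Omega>" "v \<in> L2 \<Omega>" for a b v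
    using grad_inner_lincomb[OF that, of "-1"] by simp
  define e where "e = (\<lambda>x. u x - u\<^sub>h x)"
  define w where "w = (\<lambda>x. u x - z x)"
  have e: "e \<in> H01 \<Omega>" and w: "w \<in> H01 \<Omega>" using sub H01 by (auto simp: e_def w_def)
  note eG = weak_grad_L2[OF H01_H1[OF e]] and wG = weak_grad_L2[OF H01_H1[OF w]] and wL = H1_L2[OF H01_H1[OF w]]
  have \<sigma>L: "\<sigma> \<in> L2 \<Omega>" unfolding \<sigma>_def by (rule marini_flux_L2[OF pr(1)])
  have orth: "l2_inner \<Omega> (?G e) (?G v) = 0" if v: "v \<in> ?V" for v
  proof -
    have vH: "v \<in> H01 \<Omega>" using v by (simp add: conforming_space_def)
    have "l2_inner \<Omega> (?G e) (?G v) = l2_inner \<Omega> (?G u) (?G v) - l2_inner \<Omega> (?G u\<^sub>h) (?G v)"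
      unfolding e_def by (rule diff[OF H1(1,2) weak_grad_L2[OF H01_H1[OF vH]]])
    then show ?thesis using u u\<^sub>h v vH by (simp add: poisson_solution_def)
  qed
  have we: "w x = e x - (z x - u\<^sub>h x)" for x by (simp add: w_def e_def)
  \<comment> \<open>The functions \<open>w\<close> and \<open>e\<close> differ by a discrete
    function, to which \<open>e\<close> is orthogonal, so the inner product of their gradients is
    the squared seminorm of \<open>e\<close>.\<close>
  have "l2_inner \<Omega> (?G w) (?G e) = l2_inner \<Omega> (?G u) (?G e) - l2_inner \<Omega> (?G z) (?G e)"
    unfolding w_def by (rule diff[OF H1(1,3) eG])
  moreover have "l2_inner \<Omega> (?G e) (?G e) = l2_inner \<Omega> (?G u) (?G e) - l2_inner \<Omega> (?G u\<^sub>h) (?G e)"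
    using diff[OF H1(1,2) eG] by (simp add: e_def)
  moreover have "l2_inner \<Omega> (?G z) (?G e) = 0" "l2_inner \<Omega> (?G u\<^sub>h) (?G e) = 0"
    using orth z u\<^sub>h by (auto simp: poisson_solution_def l2_inner_commute[of \<Omega> _ "?G e"])
  ultimately have "(l2_norm \<Omega> (?G e))\<^sup>2 = l2_inner \<Omega> (?G w) (?G e)" by (simp add: l2_norm_square)
  also have "\<dots> \<le> l2_norm \<Omega> (?G w) * l2_norm \<Omega> (?G e)" using l2_Cauchy_Schwarz[OF wG eG] by linarith
  finally have best: "l2_norm \<Omega> (?G e) \<le> l2_norm \<Omega> (?G w)"
    using l2_norm_nonneg[of \<Omega> "?G e"] by (cases "l2_norm \<Omega> (?G e) = 0") (auto simp: power2_eq_square)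
  have rL: "(\<lambda>x. f x - ?p x) \<in> L2 \<Omega>" using f pL by auto
  have dL: "(\<lambda>x. \<sigma> x - ?G z x) \<in> L2 \<Omega>" using \<sigma>L G(3) by auto
  have "(l2_norm \<Omega> (?G w))\<^sup>2 = l2_inner \<Omega> (?G u) (?G w) - l2_inner \<Omega> (?G z) (?G w)"
    unfolding l2_norm_square using diff[OF H1(1,3) wG] by (simp add: w_def)
  also have "l2_inner \<Omega> (?G u) (?G w) = l2_inner \<Omega> f w" using u w by (simp add: poisson_solution_def)
  also have "l2_inner \<Omega> f w = l2_inner \<Omega> (\<lambda>x. f x - ?p x) w + l2_inner \<Omega> ?p w"
    by (simp add: l2_inner_diff_left[OF f pL wL])
  also have "l2_inner \<Omega> ?p w = l2_inner \<Omega> \<sigma> (?G w)"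
    unfolding \<sigma>_def by (rule marini_flux_H01[OF pr(1) w, symmetric])
  finally have "(l2_norm \<Omega> (?G w))\<^sup>2 = l2_inner \<Omega> (\<lambda>x. f x - ?p x) w + l2_inner \<Omega> (\<lambda>x. \<sigma> x - ?G z x) (?G w)"
    by (simp add: l2_inner_diff_left[OF \<sigma>L G(3) wG])
  also have "\<dots> \<le> max_poincare_const \<T> * l2_norm \<Omega> (\<lambda>x. f x - ?p x) * l2_norm \<Omega> (?G w)
      + (kappa_M \<Omega> \<T> * l2_norm \<Omega> ?p) * l2_norm \<Omega> (?G w)"
  proof (rule add_mono)
    show "l2_inner \<Omega> (\<lambda>x. f x - ?p x) w \<le> max_poincare_const \<T> * l2_norm \<Omega> (\<lambda>x. f x - ?p x) * l2_norm \<Omega> (?G w)"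
      by (rule orthogonal_residual_bound[OF rL pr(2) H01_H1[OF w]])
    have "l2_inner \<Omega> (\<lambda>x. \<sigma> x - ?G z x) (?G w) \<le> l2_norm \<Omega> (\<lambda>x. \<sigma> x - ?G z x) * l2_norm \<Omega> (?G w)"
      using l2_Cauchy_Schwarz[OF dL wG] by linarith
    also have "\<dots> \<le> (kappa_M \<Omega> \<T> * l2_norm \<Omega> ?p) * l2_norm \<Omega> (?G w)"
      using kappa_M_bound[OF pr(1)] by (intro mult_right_mono) (simp_all add: \<sigma>_def z_def)
    finally show "l2_inner \<Omega> (\<lambda>x. \<sigma> x - ?G z x) (?G w) \<le> (kappa_M \<Omega> \<T> * l2_norm \<Omega> ?p) * l2_norm \<Omega> (?G w)" .
  qed
  also have "\<dots> = error_bound \<Omega> \<T> f * l2_norm \<Omega> (?G w)" by (simp add: error_bound_def distrib_right)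
  finally have le: "l2_norm \<Omega> (?G w) * l2_norm \<Omega> (?G w) \<le> error_bound \<Omega> \<T> f * l2_norm \<Omega> (?G w)"
    by (simp add: power2_eq_square)
  have "l2_norm \<Omega> (?G w) \<le> error_bound \<Omega> \<T> f"
  proof (cases "l2_norm \<Omega> (?G w) = 0")
    case False
    then have "l2_norm \<Omega> (?G w) > 0" using l2_norm_nonneg[of \<Omega> "?G w"] by linarith
    with le show ?thesis by (simp only: mult_le_cancel_right_pos)
  next
    \<comment> \<open>Nothing can be cancelled here; what remains is that the bound is
      nonnegative.\<close>
    case True
    have "0 \<le> kappa_M \<Omega> \<T> * l2_norm \<Omega> ?p" using kappa_M_bound[OF pr(1)] l2_norm_nonneg by (rule order_trans[rotated])
    moreover have "0 \<le> max_poincare_const \<T> * l2_norm \<Omega> (\<lambda>x. f x - ?p x)"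
    proof -
      have "\<Union>\<T> \<noteq> {}" using Union_\<T> \<Omega>(3) by simp
      then obtain T where "T \<in> \<T>" by blast
      then have "0 \<le> max_poincare_const \<T>"
        using poincare_const_nonneg[OF T_basic(2,4,5)] max_poincare_const_ge by (meson order_trans)
      then show ?thesis by simp
    qed
    ultimately show ?thesis using True by (simp add: error_bound_def)
  qed
  then show ?thesis using best by (simp add: H1_seminorm_def e_def)
qed

text \<open>By Pythagoras x and y are the legs of a right triangle whose hypotenuse is the norm of
  \<open>f\<close>, and the bound is the inner product in the plane of the two constants with (x,
  y).\<close>

lemma error_bound_le:
  assumes f: "f \<in> L2 \<Omega>"
  shows "error_bound \<Omega> \<T> f \<le> error_const \<Omega> \<T> * l2_norm \<Omega> f"
proof -
  let ?p = "l2_proj \<Omega> \<T> f" and ?a = "max_poincare_const \<T>" and ?b = "kappa_M \<Omega> \<T>"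
  define x where "x = l2_norm \<Omega> (\<lambda>x. f x - ?p x)"
  define y where "y = l2_norm \<Omega> ?p"
  note pr = l2_proj_properties[OF f]
  have pL: "?p \<in> L2 \<Omega>" by (rule piecewise_constant_L2[OF pr(1)])
  have rL: "(\<lambda>x. f x - ?p x) \<in> L2 \<Omega>" using f pL by auto
  have o: "l2_inner \<Omega> (\<lambda>x. f x - ?p x) ?p = 0" by (rule pr(2)[OF pr(1)])
  have "l2_inner \<Omega> f f = l2_inner \<Omega> (\<lambda>x. f x - ?p x) f + l2_inner \<Omega> ?p f"
    by (simp add: l2_inner_diff_left[OF f pL f])
  moreover have "l2_inner \<Omega> (\<lambda>x. f x - ?p x) f = x\<^sup>2"
    using l2_inner_diff_right[OF f pL rL] o by (simp add: x_def l2_norm_square)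
  moreover have "l2_inner \<Omega> ?p f = y\<^sup>2"
    using l2_inner_diff_left[OF f pL pL] o by (simp add: y_def l2_norm_square l2_inner_commute[of \<Omega> ?p f])
  ultimately have n: "l2_norm \<Omega> f = sqrt (x\<^sup>2 + y\<^sup>2)" by (simp add: l2_norm_def)
  have "(?a * x + ?b * y)\<^sup>2 \<le> (?a\<^sup>2 + ?b\<^sup>2) * (x\<^sup>2 + y\<^sup>2)"
  proof -
    \<comment> \<open>Lagrange's identity; the second square is dropped.\<close>
    have "(?a\<^sup>2 + ?b\<^sup>2) * (x\<^sup>2 + y\<^sup>2) = (?a * x + ?b * y)\<^sup>2 + (?a * y - ?b * x)\<^sup>2"
      by (simp add: power2_eq_square algebra_simps)
    then show ?thesis by simp
  qed
  then have "\<bar>?a * x + ?b * y\<bar> \<le> sqrt ((?a\<^sup>2 + ?b\<^sup>2) * (x\<^sup>2 + y\<^sup>2))" by (rule real_le_rsqrt[of "\<bar>_\<bar>", simplified])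
  then show ?thesis by (simp add: error_bound_def error_const_def n real_sqrt_mult x_def[symmetric] y_def[symmetric])
qed

end

theorem theorem4p2:
  fixes \<Omega> :: "'a::euclidean_space set" and \<T> :: "'a set set" and f u u\<^sub>h :: "'a \<Rightarrow> real"
  assumes "DIM('a) = 2 \<or> DIM('a) = 3"
    and "polyhedral_lipschitz_domain \<Omega>"
    and "conforming_triangulation \<Omega> \<T>"
    and "f \<in> L2 \<Omega>"
    and "poisson_solution \<Omega> (H01 \<Omega>) f u"
    and "poisson_solution \<Omega> (conforming_space \<Omega> \<T>) f u\<^sub>h"
  shows "H1_seminorm \<Omega> (\<lambda>x. u x - u\<^sub>h x) \<le> error_bound \<Omega> \<T> f \<and>
         error_bound \<Omega> \<T> f \<le> error_const \<Omega> \<T> * l2_norm \<Omega> f"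
proof -
  interpret triangulated_domain \<Omega> \<T> using assms(2,3) by unfold_locales
  show ?thesis using error_estimate[OF assms(4-6)] error_bound_le[OF assms(4)] by blast
qed

end
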